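(* Let $R=V[[x_2,\dots,x_d]]$, $R_n$, $R_\infty$ be as in the context. Let $R_n\to S_n$ be a module-finite extension of domains with $p^{1/p}\in S_n$, and let $S_\infty$ be any semi-perfect algebra over $S_n$. Let $0<k<d$ and assume $H^{k-1}_{\mathfrak m}(S_n)=0$ and $\ell(H^k_{\mathfrak m}(S_n))<\infty$. Let $\Phi:H^k_{\mathfrak m}(S_n)\otimes_{R_n}R_\infty\to H^k_{\mathfrak m}(S_\infty)$ be given by $\Phi(a\otimes b)=\phi(a)b$, where $\phi:H^k_{\mathfrak m}(S_n)\to H^k_{\mathfrak m}(S_\infty)$ is induced by $S_n\to S_\infty$, and let $\Phi_{p^{1/p}}:H^k_{\mathfrak m}(S_n)_{p^{1/p}}\otimes_{R_n}R_\infty\to H^k_{\mathfrak m}(S_\infty)_{p^{1/p}}$ be the restriction of $\Phi$. Then $$\lambda_\infty(\mathrm{Im}(\Phi_{p^{1/p}}))\le\frac{1}{p^{d(n+1)-1}}\cdot\ell\big(H^k_{\mathfrak m}(S_n)_{p^{1/p}}\big).$$ In particular, $\Phi$ is not injective if $H^k_{\mathfrak m}(S_n)$ is non-zero.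
   Context: Let $p$ be a prime and $(V,pV)$ a complete discrete valuation ring of mixed characteristic $p>0$ with perfect residue field of characteristic $p$. Put $R=V[[x_2,\dots,x_d]]$, a complete regular local ring of dimension $d$ with maximal ideal $\mathfrak m$. For $e\ge 0$ put $R_e=V[p^{1/p^e}][[x_2^{1/p^e},\dots,x_d^{1/p^e}]]$ (compatible systems of $p$-power roots, so $R_e\subset R_{e+1}$) and $R_\infty=\bigcup_e R_e$. $\mathcal M$ is the category of $\mathfrak m$-torsion $R_\infty$-modules (every element is killed by a power of $\mathfrak m$). $\ell$ is length over $R_n$. Normalized length $\lambda_\infty$ on $\mathcal M$: (i) if $M\in\mathcal M$ is finitely presented, then $M\simeq R_\infty\otimes_{R_n}M_n$ for some $n$ and some finite $R_n$-module $M_n$ (of finite length), and $\lambda_\infty(M):=p^{-dn}\ell(M_n)$; (ii) if $M\in\mathcal M$ is finitely generated, $\lambda_\infty(M):=\inf\lambda_\infty(N)$ over finitely presented $N\in\mathcal M$ that surject onto $M$; (iii) for arbitrary $M\in\mathcal M$, $\lambda_\infty(M):=\sup\lambda_\infty(N)\in\mathbb R\cup\{\infty\}$ over finitely generated submodules $N\subset M$. Semi-perfect algebra: for an extension of domains $R_n\to S_n$ of mixed characteristic $p$, an $S_n$-algebra $S_\infty$ is semi-perfect if (1) there is a commutative square consisting of $R_n\to S_n\to S_\infty$ and $R_n\to R_\infty\to S_\infty$ in which every map is a ring extension (injective) of domains; (2) $S_\infty$ is integrally closed in its fraction field; (3) the Frobenius endomorphism of $S_\infty/pS_\infty$ is surjective.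 The element $p^{1/p}\in S_n$ is understood to have the same image in $S_\infty$ as $p^{1/p}\in R_\infty$. For a module $M$ over a ring $A$ and $a\in A$, $M_a:=\{m\in M\mid am=0\}$. *)

theory Defs
  imports "HOL-Library.Extended_Nonnegative_Real" "HOL-Algebra.Algebra"
begin

section \<open>Modules\<close>

text \<open>
  The record type of modules extends the one of rings; the multiplicative fields carry no
  information for modules and are left unspecified.
\<close>

definition mk_module ::
  "'m set \<Rightarrow> ('m \<Rightarrow> 'm \<Rightarrow> 'm) \<Rightarrow> 'm \<Rightarrow> ('a \<Rightarrow> 'm \<Rightarrow> 'm) \<Rightarrow> ('a, 'm) module"
  where "mk_module C pl z sm =
    \<lparr>carrier = C, monoid.mult = (\<lambda>_ _. undefined), one = undefined, ring.zero = z, add = pl, smult = sm\<rparr>"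

definition self_module :: "'a ring \<Rightarrow> ('a, 'a) module"
  where "self_module A = mk_module (carrier A) (add A) \<zero>\<^bsub>A\<^esub> (monoid.mult A)"

definition restrict_scalars :: "('a \<Rightarrow> 'b) \<Rightarrow> ('b, 'm) module \<Rightarrow> ('a, 'm) module"
  where "restrict_scalars f M = mk_module (carrier M) (add M) \<zero>\<^bsub>M\<^esub> (\<lambda>a x. f a \<odot>\<^bsub>M\<^esub> x)"

definition quotient_module :: "('a, 'm) module \<Rightarrow> 'm set \<Rightarrow> ('a, 'm set) module"
  where "quotient_module M N =
    mk_module (a_rcosets\<^bsub>M\<^esub> N) (set_add M) N (\<lambda>a Y. \<Union>x\<in>Y. N +>\<^bsub>M\<^esub> (a \<odot>\<^bsub>M\<^esub> x))"

definition direct_product :: "'i set \<Rightarrow> ('i \<Rightarrow> ('a, 'm) module) \<Rightarrow> ('a, 'i \<Rightarrow> 'm) module"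
  where "direct_product I M =
    mk_module (\<Pi>\<^sub>E i\<in>I. carrier (M i)) (\<lambda>f g. \<lambda>i\<in>I. f i \<oplus>\<^bsub>M i\<^esub> g i)
      (\<lambda>i\<in>I. \<zero>\<^bsub>M i\<^esub>) (\<lambda>a f. \<lambda>i\<in>I. a \<odot>\<^bsub>M i\<^esub> f i)"

definition free_module :: "'a ring \<Rightarrow> nat \<Rightarrow> ('a, nat \<Rightarrow> 'a) module"
  where "free_module A r = direct_product {..<r} (\<lambda>_. self_module A)"

text \<open>The submodule \<open>M\<^sub>a = {m. a m = 0}\<close>.\<close>

definition annihilated :: "('a, 'm) module \<Rightarrow> 'a \<Rightarrow> ('a, 'm) module"
  where "annihilated M a = M\<lparr>carrier := {x \<in> carrier M. a \<odot>\<^bsub>M\<^esub> x = \<zero>\<^bsub>M\<^esub>}\<rparr>"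

definition linear_maps :: "'a ring \<Rightarrow> ('a, 'm) module \<Rightarrow> ('a, 'n) module \<Rightarrow> ('m \<Rightarrow> 'n) set"
  where "linear_maps A M N = {f \<in> carrier M \<rightarrow> carrier N.
    (\<forall>x\<in>carrier M. \<forall>y\<in>carrier M. f (x \<oplus>\<^bsub>M\<^esub> y) = f x \<oplus>\<^bsub>N\<^esub> f y) \<and>
    (\<forall>a\<in>carrier A. \<forall>x\<in>carrier M. f (a \<odot>\<^bsub>M\<^esub> x) = a \<odot>\<^bsub>N\<^esub> f x)}"

definition isomorphic_modules :: "'a ring \<Rightarrow> ('a, 'm) module \<Rightarrow> ('a, 'n) module \<Rightarrow> bool"
  where "isomorphic_modules A M N \<longleftrightarrow>
    (\<exists>f\<in>linear_maps A M N. bij_betw f (carrier M) (carrier N))"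

definition module_span :: "'a ring \<Rightarrow> ('a, 'm) module \<Rightarrow> 'm set \<Rightarrow> 'm set"
  where "module_span A M Y = \<Inter>{N. submodule N A M \<and> Y \<subseteq> N}"

definition finitely_generated :: "'a ring \<Rightarrow> ('a, 'm) module \<Rightarrow> bool"
  where "finitely_generated A M \<longleftrightarrow>
    (\<exists>Y. finite Y \<and> Y \<subseteq> carrier M \<and> module_span A M Y = carrier M)"

definition finitely_presented :: "'a ring \<Rightarrow> ('a, 'm) module \<Rightarrow> bool"
  where "finitely_presented A M \<longleftrightarrow>
    (\<exists>r Y. finite Y \<and> Y \<subseteq> carrier (free_module A r) \<and>
      isomorphic_modules A M (quotient_module (free_module A r) (module_span A (free_module A r) Y)))"

definition module_length :: "'a ring \<Rightarrow> ('a, 'm) module \<Rightarrow> enat"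
  where "module_length A M = Sup {enat l | l. \<exists>N :: nat \<Rightarrow> 'm set.
    (\<forall>i\<le>l. submodule (N i) A M) \<and> (\<forall>i<l. N i \<subset> N (Suc i))}"

definition ideal_power :: "'a ring \<Rightarrow> 'a set \<Rightarrow> nat \<Rightarrow> 'a set"
  where "ideal_power A I t = I [^]\<^bsub>ideals_set A\<^esub> t"

text \<open>
  The ideal \<open>I\<close> of \<open>A\<close> acts on \<open>M\<close> through a ring containing \<open>A\<close>.
\<close>

definition torsion_module :: "'a ring \<Rightarrow> 'a set \<Rightarrow> ('a, 'm) module \<Rightarrow> bool"
  where "torsion_module A I M \<longleftrightarrow>
    (\<forall>x\<in>carrier M. \<exists>t. \<forall>a\<in>ideal_power A I t. a \<odot>\<^bsub>M\<^esub> x = \<zero>\<^bsub>M\<^esub>)"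


section \<open>Base change\<close>

text \<open>
  \<open>M \<otimes>\<^sub>A B\<close> for a ring homomorphism \<open>f\<close> from \<open>A\<close> to \<open>B\<close>: the free abelian group on the pairs
  \<open>(x, b)\<close> modulo the bilinearity relations, with \<open>B\<close> acting on the right factor.
\<close>

definition tensor_relations ::
  "'a ring \<Rightarrow> ('a, 'm) module \<Rightarrow> ('a, 'n) module \<Rightarrow> ('m \<times> 'n \<Rightarrow>\<^sub>0 int) set"
  where "tensor_relations A M N =
    {frag_of (x \<oplus>\<^bsub>M\<^esub> x', y) - frag_of (x, y) - frag_of (x', y) | x x' y.
       x \<in> carrier M \<and> x' \<in> carrier M \<and> y \<in> carrier N} \<union>
    {frag_of (x, y \<oplus>\<^bsub>N\<^esub> y') - frag_of (x, y) - frag_of (x, y') | x y y'.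
       x \<in> carrier M \<and> y \<in> carrier N \<and> y' \<in> carrier N} \<union>
    {frag_of (a \<odot>\<^bsub>M\<^esub> x, y) - frag_of (x, a \<odot>\<^bsub>N\<^esub> y) | a x y.
       a \<in> carrier A \<and> x \<in> carrier M \<and> y \<in> carrier N}"

definition base_change ::
  "'a ring \<Rightarrow> ('a \<Rightarrow> 'b) \<Rightarrow> 'b ring \<Rightarrow> ('a, 'm) module \<Rightarrow> ('b, ('m \<times> 'b \<Rightarrow>\<^sub>0 int) set) module"
  where "base_change A f B M =
    (let F = free_Abelian_group (carrier M \<times> carrier B);
         K = generate F (tensor_relations A M (restrict_scalars f (self_module B)))
     in mk_module (carrier (F Mod K)) (monoid.mult (F Mod K)) (monoid.one (F Mod K))
          (\<lambda>b Y. \<Union>c\<in>Y. K #>\<^bsub>F\<^esub> frag_extend (\<lambda>(x, y). frag_of (x, b \<otimes>\<^bsub>B\<^esub> y)) c))"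

text \<open>
  The map out of a base change determined by \<open>x \<otimes> b \<mapsto> g (x, b)\<close>; the value at a coset is the
  common value of the additive extension of \<open>g\<close> at the representatives of the coset.
\<close>

definition tensor_lift :: "('b, 'n) module \<Rightarrow> ('m \<times> 'b \<Rightarrow> 'n) \<Rightarrow> ('m \<times> 'b \<Rightarrow>\<^sub>0 int) set \<Rightarrow> 'n"
  where "tensor_lift P g Y =
    the_elem ((\<lambda>c. \<Oplus>\<^bsub>P\<^esub>z\<in>Poly_Mapping.keys c. add_pow P (Poly_Mapping.lookup c z) (g z)) ` Y)"


section \<open>Localization\<close>

definition localization_rel ::
  "'a ring \<Rightarrow> 'a set \<Rightarrow> ('a, 'm) module \<Rightarrow> (('m \<times> 'a) \<times> ('m \<times> 'a)) set"
  where "localization_rel A U M = {((x, s), (x', s')).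
    x \<in> carrier M \<and> x' \<in> carrier M \<and> s \<in> U \<and> s' \<in> U \<and>
    (\<exists>u\<in>U. u \<odot>\<^bsub>M\<^esub> (s' \<odot>\<^bsub>M\<^esub> x) = u \<odot>\<^bsub>M\<^esub> (s \<odot>\<^bsub>M\<^esub> x'))}"

definition fraction :: "'a ring \<Rightarrow> 'a set \<Rightarrow> ('a, 'm) module \<Rightarrow> 'm \<Rightarrow> 'a \<Rightarrow> ('m \<times> 'a) set"
  where "fraction A U M x s = localization_rel A U M `` {(x, s)}"

definition localization :: "'a ring \<Rightarrow> 'a set \<Rightarrow> ('a, 'm) module \<Rightarrow> ('a, ('m \<times> 'a) set) module"
  where "localization A U M =
    mk_module ((carrier M \<times> U) // localization_rel A U M)
      (\<lambda>Y Z. \<Union>(x, s)\<in>Y. \<Union>(y, t)\<in>Z. fraction A U M ((t \<odot>\<^bsub>M\<^esub> x) \<oplus>\<^bsub>M\<^esub> (s \<odot>\<^bsub>M\<^esub> y)) (s \<otimes>\<^bsub>A\<^esub> t))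
      (fraction A U M \<zero>\<^bsub>M\<^esub> \<one>\<^bsub>A\<^esub>)
      (\<lambda>a Y. \<Union>(x, s)\<in>Y. fraction A U M (a \<odot>\<^bsub>M\<^esub> x) s)"

text \<open>
  The canonical map between two localizations of \<open>M\<close>, when every element of \<open>U\<close> divides some
  element of \<open>U'\<close>: it sends \<open>x / s\<close> to \<open>r x / r s\<close> for any \<open>r\<close> with \<open>r s \<in> U'\<close>.
\<close>

definition localization_map ::
  "'a ring \<Rightarrow> 'a set \<Rightarrow> 'a set \<Rightarrow> ('a, 'm) module \<Rightarrow> ('m \<times> 'a) set \<Rightarrow> ('m \<times> 'a) set"
  where "localization_map A U U' M Y =
    (\<Union>(x, s)\<in>Y. \<Union>r\<in>{r \<in> carrier A. r \<otimes>\<^bsub>A\<^esub> s \<in> U'}. fraction A U' M (r \<odot>\<^bsub>M\<^esub> x) (r \<otimes>\<^bsub>A\<^esub> s))"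

definition fraction_field :: "'a ring \<Rightarrow> ('a \<times> 'a) set ring"
  where "fraction_field A =
    (let U = carrier A - {\<zero>\<^bsub>A\<^esub>}; L = localization A U (self_module A)
     in \<lparr>carrier = carrier L,
         monoid.mult = (\<lambda>Y Z. \<Union>(x, s)\<in>Y. \<Union>(y, t)\<in>Z.
           fraction A U (self_module A) (x \<otimes>\<^bsub>A\<^esub> y) (s \<otimes>\<^bsub>A\<^esub> t)),
         one = fraction A U (self_module A) \<one>\<^bsub>A\<^esub> \<one>\<^bsub>A\<^esub>,
         ring.zero = \<zero>\<^bsub>L\<^esub>, add = add L\<rparr>)"

definition to_fraction_field :: "'a ring \<Rightarrow> 'a \<Rightarrow> ('a \<times> 'a) set"
  where "to_fraction_field A a = fraction A (carrier A - {\<zero>\<^bsub>A\<^esub>}) (self_module A) a \<one>\<^bsub>A\<^esub>"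

text \<open>Polynomials are coefficient lists with the leading coefficient first.\<close>

definition integral_element :: "'k ring \<Rightarrow> 'k set \<Rightarrow> 'k \<Rightarrow> bool"
  where "integral_element K B z \<longleftrightarrow>
    (\<exists>q. q \<noteq> [] \<and> set q \<subseteq> B \<and> lead_coeff q = \<one>\<^bsub>K\<^esub> \<and> ring.eval K q z = \<zero>\<^bsub>K\<^esub>)"

definition integrally_closed_domain :: "'a ring \<Rightarrow> bool"
  where "integrally_closed_domain A \<longleftrightarrow>
    (\<forall>z\<in>carrier (fraction_field A).
      integral_element (fraction_field A) (to_fraction_field A ` carrier A) z \<longrightarrow>
      z \<in> to_fraction_field A ` carrier A)"


section \<open>Local cohomology\<close>

text \<open>
  For elements \<open>x 1, \<dots>, x d\<close> of \<open>A\<close> the local cohomology of an \<open>A\<close>-module \<open>M\<close> with support in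
  the ideal generated by them is the cohomology of the Cech complex, whose term in degree \<open>j\<close> is
  the direct sum of the localizations of \<open>M\<close> at \<open>x\<^sub>J = (\<Prod>i\<in>J. x i)\<close> over the \<open>J \<subseteq> {1..d}\<close> of
  size \<open>j\<close>. If \<open>\<mm>\<close> is an ideal of a ring \<open>R\<close> mapping to \<open>A\<close>, then \<open>H\<^sub>\<mm>(M)\<close> is obtained by taking
  for \<open>x\<close> the images in \<open>A\<close> of generators of \<open>\<mm>\<close>; it is then an \<open>A\<close>-module.
\<close>

definition cech_index :: "nat \<Rightarrow> nat \<Rightarrow> nat set set"
  where "cech_index d j = {J. J \<subseteq> {1..d} \<and> card J = j}"

definition cech_denominators :: "'a ring \<Rightarrow> (nat \<Rightarrow> 'a) \<Rightarrow> nat set \<Rightarrow> 'a set"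
  where "cech_denominators A x J = range (\<lambda>t::nat. (\<Otimes>\<^bsub>A\<^esub>i\<in>J. x i) [^]\<^bsub>A\<^esub> t)"

definition cech_localization ::
  "'a ring \<Rightarrow> (nat \<Rightarrow> 'a) \<Rightarrow> ('a, 'm) module \<Rightarrow> nat set \<Rightarrow> ('a, ('m \<times> 'a) set) module"
  where "cech_localization A x M J = localization A (cech_denominators A x J) M"

definition cech_cochains ::
  "'a ring \<Rightarrow> (nat \<Rightarrow> 'a) \<Rightarrow> nat \<Rightarrow> ('a, 'm) module \<Rightarrow> nat \<Rightarrow>
   ('a, nat set \<Rightarrow> ('m \<times> 'a) set) module"
  where "cech_cochains A x d M j = direct_product (cech_index d j) (cech_localization A x M)"

definition cech_differential ::
  "'a ring \<Rightarrow> (nat \<Rightarrow> 'a) \<Rightarrow> nat \<Rightarrow> ('a, 'm) module \<Rightarrow> nat \<Rightarrow>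
   (nat set \<Rightarrow> ('m \<times> 'a) set) \<Rightarrow> (nat set \<Rightarrow> ('m \<times> 'a) set)"
  where "cech_differential A x d M j c = (\<lambda>J\<in>cech_index d (Suc j).
    \<Oplus>\<^bsub>cech_localization A x M J\<^esub>i\<in>J.
      add_pow (cech_localization A x M J) ((- 1 :: int) ^ card {l \<in> J. l < i})
        (localization_map A (cech_denominators A x (J - {i})) (cech_denominators A x J) M
          (c (J - {i}))))"

definition cech_cocycles ::
  "'a ring \<Rightarrow> (nat \<Rightarrow> 'a) \<Rightarrow> nat \<Rightarrow> ('a, 'm) module \<Rightarrow> nat \<Rightarrow> (nat set \<Rightarrow> ('m \<times> 'a) set) set"
  where "cech_cocycles A x d M j = {c \<in> carrier (cech_cochains A x d M j).
    cech_differential A x d M j c = \<zero>\<^bsub>cech_cochains A x d M (Suc j)\<^esub>}"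

definition cech_coboundaries ::
  "'a ring \<Rightarrow> (nat \<Rightarrow> 'a) \<Rightarrow> nat \<Rightarrow> ('a, 'm) module \<Rightarrow> nat \<Rightarrow> (nat set \<Rightarrow> ('m \<times> 'a) set) set"
  where "cech_coboundaries A x d M j =
    (case j of 0 \<Rightarrow> {\<zero>\<^bsub>cech_cochains A x d M 0\<^esub>}
     | Suc i \<Rightarrow> cech_differential A x d M i ` carrier (cech_cochains A x d M i))"

definition local_cohomology ::
  "'a ring \<Rightarrow> (nat \<Rightarrow> 'a) \<Rightarrow> nat \<Rightarrow> ('a, 'm) module \<Rightarrow> nat \<Rightarrow>
   ('a, (nat set \<Rightarrow> ('m \<times> 'a) set) set) module"
  where "local_cohomology A x d M j =
    quotient_module ((cech_cochains A x d M j)\<lparr>carrier := cech_cocycles A x d M j\<rparr>)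
      (cech_coboundaries A x d M j)"

text \<open>
  The map on the local cohomology of the rings themselves induced by a ring homomorphism \<open>f\<close> from
  \<open>A\<close> to \<open>B\<close>, the elements of \<open>B\<close> being the images \<open>f (x i)\<close>.
\<close>

definition local_cohomology_map ::
  "'a ring \<Rightarrow> (nat \<Rightarrow> 'a) \<Rightarrow> nat \<Rightarrow> nat \<Rightarrow> ('a \<Rightarrow> 'b) \<Rightarrow> 'b ring \<Rightarrow>
   (nat set \<Rightarrow> ('a \<times> 'a) set) set \<Rightarrow> (nat set \<Rightarrow> ('b \<times> 'b) set) set"
  where "local_cohomology_map A x d j f B Y =
    (let y = f \<circ> x; N = self_module B
     in \<Union>c\<in>Y. cech_coboundaries B y d N j +>\<^bsub>cech_cochains B y d N j\<^esub>
          (\<lambda>J\<in>cech_index d j. \<Union>(a, s)\<in>c J. fraction B (cech_denominators B y J) N (f a) (f s)))"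


section \<open>Complete discrete valuation rings of mixed characteristic\<close>

definition discrete_valuation_ring :: "'a ring \<Rightarrow> bool"
  where "discrete_valuation_ring A \<longleftrightarrow>
    principal_domain A \<and> \<not> field A \<and> (\<exists>!I. maximalideal I A)"

text \<open>The canonical map from \<open>A\<close> to the inverse limit of the \<open>A / I^t\<close> is bijective.\<close>

definition adically_complete :: "'a ring \<Rightarrow> 'a set \<Rightarrow> bool"
  where "adically_complete A I \<longleftrightarrow>
    (\<Inter>t. ideal_power A I t) = {\<zero>\<^bsub>A\<^esub>} \<and>
    (\<forall>s. (\<forall>t. s t \<in> carrier A) \<and> (\<forall>t. s (Suc t) \<ominus>\<^bsub>A\<^esub> s t \<in> ideal_power A I t) \<longrightarrow>
      (\<exists>l\<in>carrier A. \<forall>t. l \<ominus>\<^bsub>A\<^esub> s t \<in> ideal_power A I t))"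

definition frobenius_surjective :: "nat \<Rightarrow> 'a ring \<Rightarrow> bool"
  where "frobenius_surjective p A \<longleftrightarrow> (\<forall>y\<in>carrier A. \<exists>x\<in>carrier A. x [^]\<^bsub>A\<^esub> p = y)"

definition ring_nat :: "'a ring \<Rightarrow> nat \<Rightarrow> 'a"
  where "ring_nat A m = add_pow A m \<one>\<^bsub>A\<^esub>"

definition mod_p :: "nat \<Rightarrow> 'a ring \<Rightarrow> 'a set ring"
  where "mod_p p A = A Quot (PIdl\<^bsub>A\<^esub> (ring_nat A p))"

text \<open>
  As \<open>A / p A\<close> is a field of characteristic \<open>p\<close> here, it is perfect iff its Frobenius
  endomorphism is surjective.
\<close>

definition complete_mixed_dvr :: "nat \<Rightarrow> 'a ring \<Rightarrow> bool"
  where "complete_mixed_dvr p A \<longleftrightarrow>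
    discrete_valuation_ring A \<and>
    (\<forall>m>0. ring_nat A m \<noteq> \<zero>\<^bsub>A\<^esub>) \<and>
    maximalideal (PIdl\<^bsub>A\<^esub> (ring_nat A p)) A \<and>
    adically_complete A (PIdl\<^bsub>A\<^esub> (ring_nat A p)) \<and>
    frobenius_surjective p (mod_p p A)"


section \<open>The tower of power series rings\<close>

text \<open>
  All the rings \<open>V[p^(1/p^e)]\<close> live in a common domain \<open>W\<close> containing \<open>V\<close> and a compatible system
  \<open>\<pi>\<close> of \<open>p\<close>-power roots of \<open>p\<close>, where \<open>\<pi> e\<close> plays the role of \<open>p^(1/p^e)\<close>.
\<close>

definition compatible_roots :: "nat \<Rightarrow> 'w ring \<Rightarrow> (nat \<Rightarrow> 'w) \<Rightarrow> bool"
  where "compatible_roots p W \<pi> \<longleftrightarrow>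
    (\<forall>e. \<pi> e \<in> carrier W) \<and> \<pi> 0 = ring_nat W p \<and> (\<forall>e. \<pi> (Suc e) [^]\<^bsub>W\<^esub> p = \<pi> e)"

text \<open>
  A formal power series is the function giving its coefficients; the monomial with exponent \<open>\<alpha>\<close> is
  the product of the \<open>x\<^sub>i^(\<alpha> i)\<close>. With exponents in the multiples of \<open>1 / p^e\<close>, the inclusions of
  the \<open>R_level e\<close> into each other are inclusions of sets, and the roots \<open>x\<^sub>i^(1/p^e)\<close> are compatible.
\<close>

type_synonym 'w series = "(nat \<Rightarrow> rat) \<Rightarrow> 'w"

definition exponents :: "nat \<Rightarrow> nat \<Rightarrow> nat \<Rightarrow> (nat \<Rightarrow> rat) set"
  where "exponents p d e = {\<alpha>. (\<forall>i. i \<notin> {2..d} \<longrightarrow> \<alpha> i = 0) \<and>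
    (\<forall>i\<in>{2..d}. \<exists>m::nat. \<alpha> i = of_nat m / of_nat (p ^ e))}"

definition series_carrier ::
  "nat \<Rightarrow> nat \<Rightarrow> 'w ring \<Rightarrow> 'w set \<Rightarrow> (nat \<Rightarrow> 'w) \<Rightarrow> nat \<Rightarrow> 'w series set"
  where "series_carrier p d W V \<pi> e = {f.
    (\<forall>\<alpha>\<in>exponents p d e. f \<alpha> \<in> ring.simple_extension W V (\<pi> e)) \<and>
    (\<forall>\<alpha>. \<alpha> \<notin> exponents p d e \<longrightarrow> f \<alpha> = \<zero>\<^bsub>W\<^esub>)}"

definition constant_series :: "'w ring \<Rightarrow> 'w \<Rightarrow> 'w series"
  where "constant_series W c = (\<lambda>\<alpha>. if \<alpha> = (\<lambda>_. 0) then c else \<zero>\<^bsub>W\<^esub>)"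

definition variable_series :: "'w ring \<Rightarrow> nat \<Rightarrow> 'w series"
  where "variable_series W i = (\<lambda>\<alpha>. if \<alpha> = (\<lambda>_. 0)(i := 1) then \<one>\<^bsub>W\<^esub> else \<zero>\<^bsub>W\<^esub>)"

definition series_ring :: "'w ring \<Rightarrow> 'w series set \<Rightarrow> 'w series ring"
  where "series_ring W C =
    \<lparr>carrier = C,
     monoid.mult = (\<lambda>f g \<gamma>. \<Oplus>\<^bsub>W\<^esub>\<alpha>\<in>{\<alpha>. f \<alpha> \<noteq> \<zero>\<^bsub>W\<^esub> \<and> g (\<lambda>i. \<gamma> i - \<alpha> i) \<noteq> \<zero>\<^bsub>W\<^esub>}.
       f \<alpha> \<otimes>\<^bsub>W\<^esub> g (\<lambda>i. \<gamma> i - \<alpha> i)),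
     one = constant_series W \<one>\<^bsub>W\<^esub>,
     ring.zero = constant_series W \<zero>\<^bsub>W\<^esub>,
     add = (\<lambda>f g \<alpha>. f \<alpha> \<oplus>\<^bsub>W\<^esub> g \<alpha>)\<rparr>"

definition R_level ::
  "nat \<Rightarrow> nat \<Rightarrow> 'w ring \<Rightarrow> 'w set \<Rightarrow> (nat \<Rightarrow> 'w) \<Rightarrow> nat \<Rightarrow> 'w series ring"
  where "R_level p d W V \<pi> e = series_ring W (series_carrier p d W V \<pi> e)"

definition R_infinity ::
  "nat \<Rightarrow> nat \<Rightarrow> 'w ring \<Rightarrow> 'w set \<Rightarrow> (nat \<Rightarrow> 'w) \<Rightarrow> 'w series ring"
  where "R_infinity p d W V \<pi> = series_ring W (\<Union>e. series_carrier p d W V \<pi> e)"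

text \<open>The regular system of parameters \<open>p, x\<^sub>2, \<dots>, x\<^sub>d\<close>, with \<open>p\<close> in position \<open>1\<close>.\<close>

definition parameters :: "nat \<Rightarrow> 'w ring \<Rightarrow> nat \<Rightarrow> 'w series"
  where "parameters p W i =
    (if i = 1 then constant_series W (ring_nat W p) else variable_series W i)"

text \<open>The maximal ideal \<open>\<mm> = (p, x\<^sub>2, \<dots>, x\<^sub>d)\<close> of the regular local ring \<open>R = R\<^sub>0\<close>.\<close>

definition max_ideal :: "nat \<Rightarrow> nat \<Rightarrow> 'w ring \<Rightarrow> 'w set \<Rightarrow> (nat \<Rightarrow> 'w) \<Rightarrow> 'w series set"
  where "max_ideal p d W V \<pi> = genideal (R_level p d W V \<pi> 0) (parameters p W ` {1..d})"


section \<open>Normalized length\<close>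

text \<open>
  Up to isomorphism, every finitely generated module over a ring with elements of type \<open>'r\<close> is a
  quotient of a free module of finite rank and hence has its elements in the type
  \<open>(nat \<Rightarrow> 'r) set\<close>; so the bound modules \<open>N\<close> below represent every isomorphism class.
  Here \<open>R\<close> is the sequence of the rings \<open>R\<^sub>n\<close>, with union \<open>Rinf\<close>, and \<open>mm\<close> the maximal ideal
  of \<open>R 0\<close>.
\<close>

definition normalized_length_fp ::
  "nat \<Rightarrow> nat \<Rightarrow> (nat \<Rightarrow> 'r ring) \<Rightarrow> 'r ring \<Rightarrow> ('r, 'm) module \<Rightarrow> ennreal"
  where "normalized_length_fp p d R Rinf M = (THE l.
    \<exists>n. \<exists>N :: ('r, (nat \<Rightarrow> 'r) set) module.
      module (R n) N \<and> finitely_generated (R n) N \<and> module_length (R n) N < \<infinity> \<and>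
      isomorphic_modules Rinf M (base_change (R n) (\<lambda>a. a) Rinf N) \<and>
      l = ennreal_of_enat (module_length (R n) N) / of_nat (p ^ (d * n)))"

definition normalized_length_fg ::
  "nat \<Rightarrow> nat \<Rightarrow> (nat \<Rightarrow> 'r ring) \<Rightarrow> 'r ring \<Rightarrow> 'r set \<Rightarrow> ('r, 'm) module \<Rightarrow> ennreal"
  where "normalized_length_fg p d R Rinf mm M =
    Inf {normalized_length_fp p d R Rinf N | N :: ('r, (nat \<Rightarrow> 'r) set) module.
      module Rinf N \<and> torsion_module (R 0) mm N \<and> finitely_presented Rinf N \<and>
      (\<exists>f\<in>linear_maps Rinf N M. f ` carrier N = carrier M)}"

definition normalized_length ::
  "nat \<Rightarrow> nat \<Rightarrow> (nat \<Rightarrow> 'r ring) \<Rightarrow> 'r ring \<Rightarrow> 'r set \<Rightarrow> ('r, 'm) module \<Rightarrow> ennreal"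
  where "normalized_length p d R Rinf mm M =
    (if finitely_presented Rinf M then normalized_length_fp p d R Rinf M
     else if finitely_generated Rinf M then normalized_length_fg p d R Rinf mm M
     else Sup {if finitely_presented Rinf (M\<lparr>carrier := N\<rparr>)
               then normalized_length_fp p d R Rinf (M\<lparr>carrier := N\<rparr>)
               else normalized_length_fg p d R Rinf mm (M\<lparr>carrier := N\<rparr>) | N.
             submodule N Rinf M \<and> finitely_generated Rinf (M\<lparr>carrier := N\<rparr>)})"


section \<open>Extensions and semi-perfect algebras\<close>

definition domain_extension :: "'a ring \<Rightarrow> 'b ring \<Rightarrow> ('a \<Rightarrow> 'b) \<Rightarrow> bool"
  where "domain_extension A B f \<longleftrightarrow>
    domain A \<and> domain B \<and> f \<in> ring_hom A B \<and> inj_on f (carrier A)"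

definition module_finite :: "'a ring \<Rightarrow> 'b ring \<Rightarrow> ('a \<Rightarrow> 'b) \<Rightarrow> bool"
  where "module_finite A B f \<longleftrightarrow>
    finitely_generated A (restrict_scalars f (self_module B))"

text \<open>
  The map \<open>\<tau>\<close>, whose existence is demanded of a semi-perfect algebra, is kept as an argument, since
  the action of \<open>Rinf\<close> on \<open>Sinf\<close> depends on it. The commutative square consists of \<open>\<rho>\<close> from \<open>Rn\<close> to \<open>Sn\<close>, \<open>\<sigma>\<close> from \<open>Sn\<close> to \<open>Sinf\<close>, the inclusion
  of \<open>Rn\<close> into \<open>Rinf\<close>, and \<open>\<tau>\<close> from \<open>Rinf\<close> to \<open>Sinf\<close>.
\<close>

definition semi_perfect ::
  "nat \<Rightarrow> 'r ring \<Rightarrow> 'r ring \<Rightarrow> 's ring \<Rightarrow> 't ring \<Rightarrow> ('r \<Rightarrow> 's) \<Rightarrow> ('s \<Rightarrow> 't) \<Rightarrow> ('r \<Rightarrow> 't) \<Rightarrow> bool"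
  where "semi_perfect p Rn Rinf Sn Sinf \<rho> \<sigma> \<tau> \<longleftrightarrow>
    domain_extension Rn Sn \<rho> \<and> domain_extension Sn Sinf \<sigma> \<and>
    domain_extension Rn Rinf (\<lambda>a. a) \<and> domain_extension Rinf Sinf \<tau> \<and>
    (\<forall>a\<in>carrier Rn. \<sigma> (\<rho> a) = \<tau> a) \<and>
    integrally_closed_domain Sinf \<and>
    frobenius_surjective p (mod_p p Sinf)"

text \<open>
  The formula \<open>a \<otimes> b \<mapsto> \<phi>(a) b\<close>, where \<open>\<phi>\<close> is induced by \<open>\<sigma>\<close> and \<open>Rinf\<close> acts on the local
  cohomology of \<open>Sinf\<close> through \<open>\<tau>\<close>. Applied to the base change of \<open>H\<close> it is \<open>\<Phi>\<close>, applied to the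
  base change of a submodule of \<open>H\<close> it is the restriction of \<open>\<Phi>\<close>.
\<close>

definition cohomology_comparison ::
  "'s ring \<Rightarrow> (nat \<Rightarrow> 's) \<Rightarrow> nat \<Rightarrow> nat \<Rightarrow> ('s \<Rightarrow> 't) \<Rightarrow> 't ring \<Rightarrow> ('r \<Rightarrow> 't) \<Rightarrow>
   ((nat set \<Rightarrow> ('s \<times> 's) set) set \<times> 'r \<Rightarrow>\<^sub>0 int) set \<Rightarrow> (nat set \<Rightarrow> ('t \<times> 't) set) set"
  where "cohomology_comparison Sn x d k \<sigma> Sinf \<tau> =
    (let P = restrict_scalars \<tau> (local_cohomology Sinf (\<sigma> \<circ> x) d (self_module Sinf) k)
     in tensor_lift P (\<lambda>(a, b). b \<odot>\<^bsub>P\<^esub> local_cohomology_map Sn x d k \<sigma> Sinf a))"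

end

theory Submission
  imports Defs
begin

text \<open>Lengths over \<open>Rinf\<close> are controlled by triangular filtrations: finite filtrations by cyclic
  extensions whose generators are killed, modulo the earlier terms, by the \<open>p^m\<close>-th roots of the
  parameters. Passing from level \<open>m\<close> to \<open>m + q\<close> multiplies the number of steps by \<open>p^(dq)\<close>.

  Write \<open>\<omega> = p^(1/p)\<close>. A class \<open>\<xi> = [z]\<close> of \<open>H^k(S\<^sub>n)\<close> killed by \<open>\<omega>\<close> is killed by \<open>p\<close>, so \<open>p z = d y\<close>.
  Since Frobenius is onto modulo \<open>p\<close> on the integrally closed \<open>S\<^sub>\<infinity>\<close>, one finds a cochain \<open>w\<close> with
  \<open>w^p \<equiv> y\<close> modulo \<open>p\<close>, and \<open>d w = \<omega> z'\<close>; send \<open>\<xi>\<close> to \<open>[z']\<close>. This is additive, \<open>p\<close>-semilinear, well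
  defined because \<open>H^(k-1)(S\<^sub>n) = 0\<close>, and its image contains \<open>\<phi>(H_\<omega>)\<close>. So a filtration of
  \<open>p \<ell>(H_\<omega>)\<close> steps at level \<open>n\<close> becomes one of \<open>Im \<Phi>\<close> at level \<open>n + 1\<close>, whence
  \<open>\<lambda> \<le> p \<ell>(H_\<omega>) / p^(d(n+1))\<close>. If \<open>\<Phi>\<close> were injective, \<open>\<lambda>\<close> would be \<open>\<ell>(H_\<omega>) / p^(dn)\<close>, which is larger
  as \<open>d > 1\<close>.\<close>

text \<open>The constant has two sources. The factor \<open>p\<close> arises because the classes
  killed by p = \<omega>^p form \<open>p\<close> layers, each embedded by a power of \<omega> into
  the classes killed by \<omega>. The level rises to \<open>n + 1\<close> because the construction
  turns multiplication by b^p, with \<open>b\<close> of level \<open>n + 1\<close>, into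
  multiplication by \<open>b\<close>. The obstacle is that this is known for p-th powers only, and
  that nothing places all values of the construction in the image of \<Phi>. One restricts to the
  classes whose value lies there; that they form a submodule over the ring of level \<open>n\<close>
  rests on the perfect residue field for constants and on torsion for the rest. All localizations
  are realised inside the fraction field of \<open>Sinf\<close>, so that cochains are families of
  field elements. Flatness of \<open>Rinf\<close> over a level enters through functionals dual to
  finitely many basis monomials. The inequality they yield between filtrations at different levels
  shows both that the normalized length of a finitely presented module is well defined and that the
  number of steps bounds it.\<close>

abbreviation (input) add_sub ("(_ +._ _)" [65, 1000, 66] 65) where "x +.M y \<equiv> x \<oplus>\<^bsub>M\<^esub> y"
abbreviation (input) mult_sub ("(_ *._ _)" [70, 1000, 71] 70) where "x *.M y \<equiv> x \<otimes>\<^bsub>M\<^esub> y"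
abbreviation (input) smult_sub ("(_ **._ _)" [70, 1000, 71] 70) where "a **.M x \<equiv> a \<odot>\<^bsub>M\<^esub> x"
abbreviation (input) pow_sub ("(_ ^._ _)" [76, 1000, 75] 75) where "x ^.M n \<equiv> x [^]\<^bsub>M\<^esub> n"
abbreviation (input) diff_sub ("(_ -._ _)" [65, 1000, 66] 65) where "x -.M y \<equiv> x \<ominus>\<^bsub>M\<^esub> y"
abbreviation (input) minus_sub ("(-._ _)" [1000, 81] 80) where "-.M x \<equiv> \<ominus>\<^bsub>M\<^esub> x"
abbreviation (input) zero_sub ("0'__" [1000] 1000) where "0_M \<equiv> \<zero>\<^bsub>M\<^esub>"
abbreviation (input) carrier_of ("($_)" [1000] 1000) where "$M \<equiv> carrier M"
abbreviation (input) one_sub ("1'__" [1000] 1000) where "1_M \<equiv> \<one>\<^bsub>M\<^esub>"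

section \<open>Triangular filtrations and rank functions\<close>

definition adjoin :: "('r, 'x) ring_scheme => ('r, 'm, 'y) module_scheme => 'm set => 'm => 'm set"
 where "adjoin R M P x = {u+.M r**.M x | u r. u : P & r : $R}"

text \<open>The index counts adjunctions, not simple factors: a generator may already lie in the
  previous term, so \<open>l\<close> bounds the length from above. \<open>E\<close> is a plain set
  of operators, which allows one element at a time to be exchanged for a root of it.\<close>

inductive triangular :: "('r, 'x) ring_scheme => ('r, 'm, 'y) module_scheme => 'r set => nat => 'm set => bool"
 for R M E where
 zero: "triangular R M E 0 {0_M}"
| step: "triangular R M E l P ==> x : $M ==> (!!a. a : E ==> a**.M x : P)
  ==> triangular R M E (Suc l) (adjoin R M P x)"

text \<open>A strictly increasing function with values up to \<open>l\<close> on the submodules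
  inside \<open>P\<close> certifies that chains in \<open>P\<close> have length at most
  \<open>l\<close>. Such certificates combine directly along extensions, kernels and images, which
  suprema of chains do not.\<close>

definition ranked :: "('r, 'x) ring_scheme => ('r, 'm, 'y) module_scheme => 'm set => nat => ('m set => nat) => bool"
 where "ranked R M P l f \<longleftrightarrow>
  (\<forall>N. submodule N R M & N \<subseteq> P \<longrightarrow> f N \<le> l) \<and>
  (\<forall>N N'. submodule N R M & submodule N' R M & N \<subset> N' & N' \<subseteq> P \<longrightarrow> f N < f N')"

lemma ranked_le: "ranked R M P l f ==> submodule N R M ==> N \<subseteq> P ==> f N \<le> l"
 unfolding ranked_def by blast

lemma ranked_less:
 "ranked R M P l f ==> submodule N R M ==> submodule N' R M ==> N \<subset> N' ==> N' \<subseteq> P ==> f N < f N'"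
 unfolding ranked_def by blast

lemma ranked_mono:
 "ranked R M P l f ==> submodule N R M ==> submodule N' R M ==> N \<subseteq> N' ==> N' \<subseteq> P ==> f N \<le> f N'"
 by(metis less_imp_le order.order_iff_strict ranked_less)

lemma ranked_subset: "ranked R M P l f ==> P' \<subseteq> P ==> ranked R M P' l f"
 unfolding ranked_def by blast

lemma ranked_chain:
 assumes f: "ranked R M P l f" and N: "!!i. i \<le> s ==> submodule (N i) R M" "!!i. i < s ==> N i \<subset> N (Suc i)"
  and P: "N s \<subseteq> P"
 shows "s \<le> l"
proof -
 have sub: "i \<le> s ==> N i \<subseteq> P" for i
 proof(induction "s - i" arbitrary: i)
  case 0 thus ?case using P by simp
 next
  case (Suc k)
  hence "N (Suc i) \<subseteq> P" by simp
  thus ?case using N(2)[of i] Suc.hyps(2) by fastforce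
 qed
 have "i \<le> s ==> i \<le> f (N i)" for i
 proof(induction i)
  case (Suc i)
  hence "f (N i) < f (N (Suc i))" using ranked_less[OF f, of "N i" "N (Suc i)"] N sub by simp
  thus ?case using Suc by simp
 qed simp
 hence "s \<le> f (N s)" by simp
 also have "\<dots> \<le> l" using ranked_le[OF f] N P by simp
 finally show ?thesis .
qed

lemma module_length_leI:
 assumes "ranked A M $M l f" "module A M"
 shows "module_length A M \<le> enat l"
 unfolding module_length_def
proof(rule Sup_least, clarify)
 fix s and N :: "nat => _"
 assume N: "\<forall>i\<le>s. submodule (N i) A M" "\<forall>i<s. N i \<subset> N (Suc i)"
 thus "enat s \<le> enat l"
  using ranked_chain[OF assms(1), of s N] module.submoduleE(1)[OF assms(2), of "N s"] by simp
qed

context module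
begin

lemma submodule_zero_mem: "submodule P R M ==> 0_M : P"
 using subgroup.one_closed[OF submodule.axioms(1), of P R M] by simp

lemma submodule_minus_closed:
 "submodule P R M ==> x : P ==> y : P ==> x-.M y : P"
 using submoduleE(3,5) by(simp add: a_minus_def)

lemma submodule_diffD:
 assumes "submodule P R M" "x-.M y : P" "y : P" "x : $M"
 shows "x : P"
proof -
 have y: "y : $M" using assms submoduleE(1) by blast
 have "(x-.M y)+.M y : P" using submoduleE(5) assms by blast
 also have "(x-.M y)+.M y = x" using y assms(4)
  by(simp add: a_minus_def M.a_assoc M.l_neg)
 finally show ?thesis .
qed

lemma submodule_singleton_zero: "submodule {0_M} R M"
 by(rule submoduleI) auto

lemma submodule_Int: "submodule P R M ==> submodule Q R M ==> submodule (P \<inter> Q) R M"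
 using submoduleE submodule_zero_mem by(intro submoduleI) auto

lemma mem_adjoinI: "u : P ==> r : $R ==> u+.M r**.M x : adjoin R M P x"
 unfolding adjoin_def by blast

lemma submodule_adjoin:
 assumes P: "submodule P R M" and x: "x : $M"
 shows "submodule (adjoin R M P x) R M"
proof(rule submoduleI)
 note PE = submoduleE[OF P]
 show "adjoin R M P x \<subseteq> $M" using PE(1) x by(auto simp: adjoin_def)
 show "0_M : adjoin R M P x"
  using mem_adjoinI[OF submodule_zero_mem[OF P] R.zero_closed, of x] x by simp
 fix a assume "a : adjoin R M P x"
 then obtain u r where a: "a = u+.M r**.M x" "u : P" "r : $R" by(auto simp: adjoin_def)
 hence u: "u : $M" using PE(1) by blast
 have "-.M a =-.M u+.M (\<ominus> r)**.M x"
  using a u x by(simp add: smult_l_minus M.minus_add)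
 thus "-.M a : adjoin R M P x" using mem_adjoinI a PE(3) by simp
 { fix b assume "b : adjoin R M P x"
  then obtain v s where b: "b = v+.M s**.M x" "v : P" "s : $R" by(auto simp: adjoin_def)
  hence v: "v : $M" using PE(1) by blast
  have "a+.M b = (u+.M v)+.M (r \<oplus> s)**.M x"
   using a b u v x by(simp add: smult_l_distr M.a_ac)
  thus "a+.M b : adjoin R M P x" using mem_adjoinI a b PE(5) by simp }
 fix c assume c: "c : $R"
 have "c**.M a = c**.M u+.M (c \<otimes> r)**.M x"
  using a u x c by(simp add: smult_r_distr smult_assoc1)
 thus "c**.M a : adjoin R M P x" using mem_adjoinI a PE(4) c by simp
qed

lemma subset_adjoin:
 assumes "P \<subseteq> $M" "x : $M" shows "P \<subseteq> adjoin R M P x"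
proof
 fix u assume "u : P"
 thus "u : adjoin R M P x" using mem_adjoinI[of u P \<zero> x] assms by auto
qed

lemma mem_adjoin:
 assumes "submodule P R M" "x : $M" shows "x : adjoin R M P x"
 using mem_adjoinI[OF submodule_zero_mem[OF assms(1)] R.one_closed, of x] assms by simp

lemma adjoin_subset: "submodule Q R M ==> P \<subseteq> Q ==> x : Q ==> adjoin R M P x \<subseteq> Q"
 unfolding adjoin_def using submoduleE(4,5) by blast

lemma triangular_submodule: "triangular R M E l P ==> submodule P R M"
 by(induction rule: triangular.induct) (auto intro: submodule_singleton_zero submodule_adjoin)

text \<open>If \<open>t^q\<close> kills the generator \<open>x\<close> modulo \<open>P\<close>, then \<open>t\<close> kills each of
 \<open>t^(q-1) x, \<dots>, t x, x\<close> modulo its predecessors.\<close>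

lemma triangular_adjoin_power:
 assumes "triangular R M (insert t E) l P" "x : $M" "!!a. a : E ==> a**.M x : P"
  "(t [^] q)**.M x : P" "t : $R" "E \<subseteq> $R"
 shows "triangular R M (insert t E) (q + l) (adjoin R M P x)"
 using assms(2,3,4)
proof(induction q arbitrary: x)
 case 0
 have P: "submodule P R M" using triangular_submodule[OF assms(1)] .
 have "adjoin R M P x = P"
  using adjoin_subset[OF P, of P x] subset_adjoin[OF submoduleE(1)[OF P], of x] 0 by auto
 thus ?case using assms(1) by simp
next
 case (Suc q)
 have P: "submodule P R M" using triangular_submodule[OF assms(1)] .
 let ?P' = "adjoin R M P (t**.M x)"
 have tx: "t**.M x : $M" using Suc.prems assms by simp
 have E: "a**.M (t**.M x) : P" if "a : E" for a
 proof -
  have "a**.M (t**.M x) = t**.M (a**.M x)"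
   using that assms Suc.prems by(metis R.m_comm smult_assoc1 subsetD)
  thus ?thesis using Suc.prems that submoduleE(4)[OF P] assms(5) by simp
 qed
 have "(t [^] q)**.M (t**.M x) : P"
  using Suc.prems assms(5) by(simp add: smult_assoc1[symmetric])
 hence T: "triangular R M (insert t E) (q + l) ?P'" using Suc.IH[OF tx E] by blast
 have P': "submodule ?P' R M" using triangular_submodule[OF T] .
 have PP': "P \<subseteq> ?P'" using subset_adjoin submoduleE(1)[OF P] tx by blast
 have "triangular R M (insert t E) (Suc (q + l)) (adjoin R M ?P' x)"
  using Suc.prems PP' mem_adjoin[OF P tx] by(intro triangular.step[OF T]) auto
 moreover have "adjoin R M ?P' x = adjoin R M P x"
 proof
  have Px: "submodule (adjoin R M P x) R M" using submodule_adjoin[OF P] Suc.prems by blast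
  have x: "x : adjoin R M P x" using mem_adjoin[OF P] Suc.prems by blast
  have "?P' \<subseteq> adjoin R M P x"
   using adjoin_subset[OF Px] subset_adjoin[OF submoduleE(1)[OF P]] submoduleE(4)[OF Px assms(5) x] Suc.prems by blast
  thus "adjoin R M ?P' x \<subseteq> adjoin R M P x" using adjoin_subset[OF Px] x by blast
  show "adjoin R M P x \<subseteq> adjoin R M ?P' x"
   using PP' unfolding adjoin_def by blast
 qed
 ultimately show ?case by simp
qed

text \<open>Each step whose generator is killed by t^q is subdivided into \<open>q\<close> steps
  whose generators are killed by \<open>t\<close>.\<close>

lemma triangular_refine:
 assumes "triangular R M (insert (t [^] q) E) l P" "t : $R" "E \<subseteq> $R"
 shows "triangular R M (insert t E) (q * l) P"
 using assms(1)
proof(induction rule: triangular.induct)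
 case zero thus ?case by(simp add: triangular.zero)
next
 case (step l P x)
 have "triangular R M (insert t E) (q + q * l) (adjoin R M P x)"
  using step assms by(intro triangular_adjoin_power) auto
 thus ?case by simp
qed

end

lemma enat_Sup_mem: "Sup S = enat l ==> S ~= {} ==> enat l : S"
 by(metis Max_in Sup_enat_def enat.simps(3))

lemma module_length_chain:
 assumes "module_length A M = enat l" "module A M"
 obtains N where "!!i. i \<le> l ==> submodule (N i) A M" "!!i. i < l ==> N i \<subset> N (Suc i)"
proof -
 have "enat l : {enat l | l. \<exists>N :: nat => _ set. (\<forall>i\<le>l. submodule (N i) A M) & (\<forall>i<l. N i \<subset> N (Suc i))}"
  using assms(1) module.submodule_singleton_zero[OF assms(2)]
  by(intro enat_Sup_mem) (auto simp: module_length_def)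
 thus ?thesis using that by auto
qed

lemma chain_le_module_length:
 assumes "!!i. i \<le> s ==> submodule (N i) A M" "!!i. i < s ==> N i \<subset> N (Suc i)"
 shows "enat s \<le> module_length A M"
 unfolding module_length_def using assms by(intro Sup_upper) blast

text \<open>The rank of a submodule is the greatest length of a strict chain ending at it. Finite
  length bounds these chains, and a chain ending at a submodule is prolonged by any strictly larger
  one.\<close>

lemma module_length_ranked:
 assumes len: "module_length A M = enat l" and M: "module A M"
 obtains f where "ranked A M $M l f"
proof -
 define S where "S K = {s. \<exists>N. (\<forall>i\<le>s. submodule (N i) A M) & (\<forall>i<s. N i \<subset> N (Suc i)) & N s = K}" for K
 have bound: "s \<le> l" if "s : S K" for s K
 proof -
  have "enat s \<le> module_length A M" using that chain_le_module_length unfolding S_def by blast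
  thus ?thesis using len by simp
 qed
 hence fin: "finite (S K)" for K by(meson finite_nat_set_iff_bounded_le)
 have ne: "0 : S K" if "submodule K A M" for K
  unfolding S_def using that by(auto intro!: exI[of _ "%_. K"])
 have "ranked A M $M l (%K. Max (S K))"
  unfolding ranked_def
 proof(intro conjI allI impI; (elim conjE)?)
  fix N assume "submodule N A M"
  thus "Max (S N) \<le> l" using ne bound Max_in[OF fin] by blast
 next
  fix K K' assume K: "submodule K A M" "submodule K' A M" "K \<subset> K'"
  have "Max (S K) : S K" using ne[OF K(1)] Max_in[OF fin] by blast
  then obtain N where N: "\<forall>i\<le>Max (S K). submodule (N i) A M"
   "\<forall>i<Max (S K). N i \<subset> N (Suc i)" "N (Max (S K)) = K" unfolding S_def by blast
  have "Suc (Max (S K)) : S K'"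
  proof -
   define m where "m = Max (S K)"
   let ?N = "N(Suc m := K')"
   have "submodule (?N i) A M" if "i \<le> Suc m" for i using that N(1) K m_def by(cases "i = Suc m") auto
   moreover have "?N i \<subset> ?N (Suc i)" if "i < Suc m" for i using that N K m_def by(cases "i = m") auto
   ultimately have "Suc m : S K'" unfolding S_def by(intro CollectI exI[of _ ?N]) simp
   thus ?thesis unfolding m_def .
  qed
  thus "Max (S K) < Max (S K')" using Max_ge[OF fin] by(simp add: Suc_le_lessD)
 qed
 thus thesis using that by blast
qed

lemma (in module) submodule_carrier_update:
 assumes "submodule K R M"
 shows "submodule N R (M\<lparr>carrier := K\<rparr>) \<longleftrightarrow> submodule N R M & N \<subseteq> K"
proof -
 interpret K: module R "M\<lparr>carrier := K\<rparr>" using submodule.submodule_is_module[OF assms] module_axioms by blast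
 show ?thesis
 proof
  assume N: "submodule N R (M\<lparr>carrier := K\<rparr>)"
  have NK: "N \<subseteq> K" using K.submoduleE(1)[OF N] by simp
  have "module R (M\<lparr>carrier := K\<rparr>\<lparr>carrier := N\<rparr>)"
   using submodule.submodule_is_module[OF N] K.module_axioms by blast
  thus "submodule N R M & N \<subseteq> K"
   using module_incl_imp_submodule[of N] NK submoduleE(1)[OF assms] by simp
 next
  assume N: "submodule N R M & N \<subseteq> K"
  hence "module R (M\<lparr>carrier := N\<rparr>)" using submodule.submodule_is_module module_axioms by blast
  thus "submodule N R (M\<lparr>carrier := K\<rparr>)"
   using K.module_incl_imp_submodule[of N] N by simp
 qed
qed

lemma (in module) ranked_carrier_update:
 assumes "submodule K R M"
 shows "ranked R (M\<lparr>carrier := K\<rparr>) K l f \<longleftrightarrow> ranked R M K l f"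
 unfolding ranked_def submodule_carrier_update[OF assms] by(meson psubset_imp_subset subset_trans)

text \<open>A common setting for the operator rings below: \<open>M\<close> is a module over \<open>R\<close> and, by the same
 action, over a smaller ring \<open>S\<close>. The assumption says that each step of a triangular filtration
 over \<open>R\<close> is trivial or simple as an \<open>S\<close>-module.\<close>

lemma triangular_ranked:
 assumes R: "module R M" and S: "module S M" and SR: "$S \<subseteq> $R"
  and simple: "!!P x r. submodule P R M ==> x : $M ==> (!!a. a : E ==> a**.M x : P) ==> r : $R ==>
   \<exists>v\<in>$S. r**.M x-.M v**.M x : P \<and>
   (v**.M x : P \<or> (\<exists>u\<in>$S. u**.M (v**.M x)-.M x : P))"
  and T: "triangular R M E l P"
 shows "\<exists>f. ranked S M P l f"
 using T
proof(induction rule: triangular.induct)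
 case zero
 interpret S: module S M by(rule S)
 have "ranked S M {0_M} 0 (%_. 0)"
  unfolding ranked_def using S.submodule_zero_mem by blast
 thus ?case by blast
next
 case (step l P x)
 interpret S: module S M by(rule S)
 interpret R: module R M by(rule R)
 from step obtain f where f: "ranked S M P l f" by blast
 have P: "submodule P R M" using R.triangular_submodule step by blast
 note PR = R.submoduleE[OF P]
 have PS: "submodule P S M" using PR SR R.submodule_zero_mem[OF P] by(intro S.submoduleI) auto
 let ?A = "adjoin R M P x"
 \<comment> \<open>One more is counted exactly when a submodule leaves \<open>P\<close>; the
   quotient of the adjoined term by \<open>P\<close> is zero or simple over
   \<open>S\<close>.\<close>
 let ?g = "%N. f (N \<inter> P) + (if N \<subseteq> P then 0 else 1)"
 have Ia: "submodule (N \<inter> P) S M" if "submodule N S M" for N using S.submodule_Int[OF that PS] .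
 have "ranked S M ?A (Suc l) ?g"
  unfolding ranked_def
 proof(intro conjI allI impI; elim conjE)
  fix N assume "submodule N S M" "N \<subseteq> ?A"
  thus "?g N \<le> Suc l" using ranked_le[OF f Ia, of N] by auto
 next
  fix N N' assume N: "submodule N S M" and N': "submodule N' S M" and NN: "N \<subset> N'" and N'A: "N' \<subseteq> ?A"
  have mono: "f (N \<inter> P) \<le> f (N' \<inter> P)" using ranked_mono[OF f Ia[OF N] Ia[OF N']] NN by blast
  show "?g N < ?g N'"
  proof(cases "N \<inter> P = N' \<inter> P")
   case False
   hence "f (N \<inter> P) < f (N' \<inter> P)" using ranked_less[OF f Ia[OF N] Ia[OF N']] NN by blast
   thus ?thesis using NN by auto
  next
   case eq: True
   show ?thesis
   proof(cases "N \<subseteq> P")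
   case True thus ?thesis using eq NN by auto
   next
   case False
   then obtain n where n: "n : N" "n \<notin> P" by blast
   hence "n : ?A" using NN N'A by blast
   then obtain u r where ur: "n = u+.M r**.M x" "u : P" "r : $R" unfolding adjoin_def by blast
   have x: "x : $M" using step by blast
   have uM: "u : $M" using ur PR by blast
   obtain v where v: "v : $S" "r**.M x-.M v**.M x : P"
   "v**.M x : P \<or> (\<exists>w\<in>$S. w**.M (v**.M x)-.M x : P)"
   using simple[OF P x step(3) ur(3)] by blast
   have "\<not> v**.M x : P"
   proof
   assume "v**.M x : P"
   hence "r**.M x : P" using R.submodule_diffD[OF P v(2)] ur x by simp
   thus False using n ur PR(5) by simp
   qed
   \<comment> \<open>As \<open>n\<close> lies outside \<open>P\<close>, its coefficient acts
     invertibly on \<open>x\<close> modulo \<open>P\<close>; the scalar \<open>w\<close> undoes it,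
     so \<open>w\<close> times \<open>n\<close> is congruent to \<open>x\<close>.\<close>
   then obtain w where w: "w : $S" "w**.M (v**.M x)-.M x : P" using v by blast
   have nM: "n : $M" using n S.submoduleE(1)[OF N] by blast
   define e1 where "e1 = r**.M x-.M v**.M x"
   have e1: "e1 : P" "e1 : $M" using v(2) PR(1) unfolding e1_def by auto
   have rx: "r**.M x = e1+.M v**.M x" unfolding e1_def using v ur x
   by(simp add: a_minus_def S.M.a_assoc S.M.l_neg)
   have "w**.M n-.M x = w**.M (u+.M e1)+.M (w**.M (v**.M x)-.M x)"
   using w v x e1 uM unfolding ur(1) rx by(simp add: a_minus_def S.smult_r_distr S.M.a_assoc)
   also have "\<dots> : P" using w PR(4,5) ur(2) e1(1) SR by(meson subsetD)
   finally have wn: "w**.M n-.M x : P" .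
   \<comment> \<open>Subtracting a multiple of the element congruent to \<open>x\<close> moves a
     given element of \<open>N'\<close> into \<open>P\<close>, where \<open>N\<close> and
     \<open>N'\<close> agree.\<close>
   have "N' \<subseteq> N"
   proof
   fix n' assume n': "n' : N'"
   have n'M: "n' : $M" using n' S.submoduleE(1)[OF N'] by blast
   obtain u' r' where ur': "n' = u'+.M r'**.M x" "u' : P" "r' : $R"
   using n' N'A unfolding adjoin_def by blast
   obtain v' where v': "v' : $S" "r'**.M x-.M v'**.M x : P"
   using simple[OF P x step(3) ur'(3)] by blast
   let ?d = "v'**.M (w**.M n)"
   have d: "?d : N" using S.submoduleE(4)[OF N] n w v' by blast
   have dM: "?d : $M" using w v' nM by simp
   define e2 where "e2 = r'**.M x-.M v'**.M x"
   have e2: "e2 : P" "e2 : $M" using v'(2) PR(1) unfolding e2_def by auto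
   define e3 where "e3 = w**.M n-.M x"
   have e3: "e3 : P" "e3 : $M" using wn PR(1) unfolding e3_def by auto
   have r'x: "r'**.M x = e2+.M v'**.M x" unfolding e2_def using v' ur' x
   by(simp add: a_minus_def S.M.a_assoc S.M.l_neg)
   have wn': "w**.M n = e3+.M x" unfolding e3_def using w nM x
   by(simp add: a_minus_def S.M.a_assoc S.M.l_neg)
   have u'M: "u' : $M" using ur' PR by blast
   have v'R: "v' : $R" using v' SR by blast
   have "n'-.M ?d = u'+.M e2-.M v'**.M e3"
   proof -
   have "v'**.M x-.M ?d =-.M (v'**.M e3)"
   unfolding wn' using v'(1) e3 x S.M.a_lcomm[of "v'**.M x" "-.M (v'**.M e3)" "-.M (v'**.M x)"]
   by(simp add: a_minus_def S.smult_r_distr S.M.minus_add S.M.r_neg)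
   thus ?thesis unfolding ur'(1) r'x using v' u'M e2 e3 x dM
   by(simp add: a_minus_def S.M.a_assoc)
   qed
   also have "\<dots> : P" using PR(4,5) R.submodule_minus_closed[OF P] ur' e2 e3 v'R by blast
   finally have "n'-.M ?d : P" .
   moreover have "n'-.M ?d : N'" using S.submodule_minus_closed[OF N'] n' d NN by blast
   ultimately have "n'-.M ?d : N" using eq by blast
   thus "n' : N" using S.submodule_diffD[OF N _ d] n'M by blast
   qed
   thus ?thesis using NN by blast
   qed
  qed
 qed
 thus ?case by blast
qed

context module
begin

text \<open>The operators are treated one after the other: the last multiple of \<open>y\<close> by
  a power of \<open>t\<close> outside \<open>P\<close> is killed by \<open>t\<close> modulo
  \<open>P\<close>, and commutativity preserves the relations already achieved for the other
  operators.\<close>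

lemma exists_socle_element:
 assumes E: "finite E" "E \<subseteq> $R" and P: "submodule P R M" and K: "submodule K R M"
  and tors: "!!a x. a : E ==> x : K ==> \<exists>t. (a [^] (t::nat))**.M x = 0_M" and x: "x : K - P"
 shows "\<exists>y\<in>K - P. \<forall>a\<in>E. a**.M y : P"
 using E tors
proof(induction E rule: finite_induct)
 case empty thus ?case using x by blast
next
 case (insert t E)
 have "\<exists>y\<in>K - P. \<forall>a\<in>E. a**.M y : P" using insert.prems by(intro insert.IH) auto
 then obtain y where y: "y : K - P" "!!a. a : E ==> a**.M y : P" by blast
 have yM: "y : $M" using y submoduleE(1)[OF K] by blast
 have t: "t : $R" using insert by blast
 let ?Q = "%s. (t [^] (s::nat))**.M y : P"
 obtain s0 where "(t [^] (s0::nat))**.M y = 0_M" using insert.prems(2)[of t y] y by blast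
 hence ex: "?Q s0" using submodule_zero_mem[OF P] by simp
 define s where "s = (LEAST s. ?Q s)"
 have Qs: "?Q s" unfolding s_def using ex by(rule LeastI)
 have "s ~= 0"
 proof
  assume "s = 0" thus False using Qs y yM by simp
 qed
 then obtain s' where s': "s = Suc s'" using not0_implies_Suc by blast
 have nQ: "\<not> ?Q s'" using not_less_Least[of s' ?Q] s' unfolding s_def by simp
 let ?z = "(t [^] s')**.M y"
 have "t**.M ?z = (t [^] s)**.M y" unfolding s' using t yM
  by(simp add: smult_assoc1[symmetric] R.m_comm)
 hence "t**.M ?z : P" using Qs by simp
 moreover have "a**.M ?z : P" if a: "a : E" for a
 proof -
  have "a : $R" using a insert by blast
  hence "a**.M ?z = (t [^] s')**.M (a**.M y)"
   using t yM by(simp add: smult_assoc1[symmetric] R.m_comm)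
  thus ?thesis using submoduleE(4)[OF P _ y(2)[OF a]] t by simp
 qed
 moreover have "?z : K - P" using nQ submoduleE(4)[OF K] y t by simp
 ultimately show ?case by blast
qed

text \<open>As long as the filtration has not reached \<open>K\<close>, an element killed by
  \<open>E\<close> modulo its last term can be adjoined. Each adjunction raises the rank, so
  \<open>K\<close> is reached after at most \<open>l\<close> of them.\<close>

lemma ranked_triangular:
 assumes E: "finite E" "E \<subseteq> $R" and K: "submodule K R M"
  and tors: "!!a x. a : E ==> x : K ==> \<exists>t. (a [^] (t::nat))**.M x = 0_M"
  and f: "ranked R M K l f"
 shows "\<exists>l'\<le>l. triangular R M E l' K"
proof -
 have "(\<exists>l'\<le>l. triangular R M E l' K) \<or> (\<exists>P. triangular R M E i P & P \<subseteq> K & i \<le> f P)" for i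
 proof(induction i)
  case 0 thus ?case using triangular.zero[of R M E] submodule_zero_mem[OF K] by blast
 next
  case (Suc i)
  show ?case
  proof(cases "\<exists>l'\<le>l. triangular R M E l' K")
   case False
   then obtain P where P: "triangular R M E i P" "P \<subseteq> K" "i \<le> f P" using Suc by blast
   have Ps: "submodule P R M" using triangular_submodule P by blast
   have "f P \<le> l" using ranked_le[OF f Ps] P by blast
   hence "P ~= K" using False P by(metis order_trans)
   then obtain x where "x : K - P" using P by blast
   then obtain y where y: "y : K - P" "\<forall>a\<in>E. a**.M y : P"
   using exists_socle_element[OF E Ps K tors] by blast
   have yM: "y : $M" using y submoduleE(1)[OF K] by blast
   have "triangular R M E (Suc i) (adjoin R M P y)"
   using triangular.step[OF P(1) yM] y by blast
   moreover have AK: "adjoin R M P y \<subseteq> K" using adjoin_subset[OF K P(2)] y by blast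
   moreover have "P \<subset> adjoin R M P y"
   using subset_adjoin[OF submoduleE(1)[OF Ps] yM] mem_adjoin[OF Ps yM] y by blast
   hence "f P < f (adjoin R M P y)" using ranked_less[OF f Ps submodule_adjoin[OF Ps yM] _ AK] by blast
   ultimately show ?thesis using P(3) by(metis Suc_leI le_less_trans)
  qed blast
 qed
 from this[of "Suc l"] show ?thesis
  using ranked_le[OF f triangular_submodule] by(metis Suc_n_not_le_n order_trans)
qed

text \<open>A submodule of the kernel of h^(j+1) is determined, among comparable ones, by its part
  in the kernel of h^j and its image under h^j, which lies in the kernel of \<open>h\<close>. Adding
  the two ranks costs one \<open>s\<close> per power of \<open>h\<close>. With \<open>h\<close>
  multiplication by \<omega> and \<open>j = p\<close> this produces the factor \<open>p\<close> of
  the theorem.\<close>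

lemma ranked_kernel_power:
 assumes h: "h : $M \<rightarrow> $M"
   "!!x y. x : $M ==> y : $M ==> h (x+.M y) = h x+.M h y"
   "!!r x. r : $R ==> x : $M ==> h (r**.M x) = r**.M h x"
  and f: "ranked R M {x : $M. h x = 0_M} s f"
 shows "\<exists>g. ranked R M {x : $M. (h ^^ j) x = 0_M} (j * s) g"
proof(induction j)
 case 0
 have "ranked R M {x : $M. (h ^^ 0) x = 0_M} 0 (%_. 0)"
  unfolding ranked_def funpow_0 using submodule_zero_mem by blast
 thus ?case by auto
next
 case (Suc j)
 let ?H = "%j. {x : $M. (h ^^ j) x = 0_M}"
 from Suc obtain g where g: "ranked R M (?H j) (j * s) g" by blast
 define k where "k = h ^^ j"
 have k: "k : $M \<rightarrow> $M"
   "!!x y. x : $M ==> y : $M ==> k (x+.M y) = k x+.M k y"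
   "!!r x. r : $R ==> x : $M ==> k (r**.M x) = r**.M k x"
 proof -
  have "(h ^^ j) : $M \<rightarrow> $M &
   (\<forall>x\<in>$M. \<forall>y\<in>$M. (h^^j) (x+.M y) = (h^^j) x+.M (h^^j) y) \<and>
   (\<forall>r\<in>$R. \<forall>x\<in>$M. (h^^j) (r**.M x) = r**.M (h^^j) x)" for j
   by(induction j) (use h in "auto simp: Pi_iff")
  thus "k : $M \<rightarrow> $M"
   "!!x y. x : $M ==> y : $M ==> k (x+.M y) = k x+.M k y"
   "!!r x. r : $R ==> x : $M ==> k (r**.M x) = r**.M k x" unfolding k_def by blast+
 qed
 have k0: "k 0_M = 0_M" using k(3)[of \<zero> "0_M"] k(1) by(simp add: Pi_iff)
 have kneg: "k (-.M x) =-.M k x" if "x : $M" for x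
  using k(3)[of "\<ominus> \<one>" x] that funcset_mem[OF k(1) that] by(simp add: smult_l_minus)
 have im: "submodule (k ` N) R M" if N: "submodule N R M" for N
 proof(rule submoduleI)
  note NE = submoduleE[OF N]
  show "k ` N \<subseteq> $M" using NE(1) k(1) by(auto simp: Pi_iff)
  show "0_M : k ` N" using imageI[OF submodule_zero_mem[OF N], of k] unfolding k0 .
  fix a assume "a : k ` N"
  then obtain x where x: "x : N" "a = k x" by blast
  have xM: "x : $M" using x NE(1) by blast
  show "-.M a : k ` N" using imageI[OF NE(3)[OF x(1)], of k] kneg[OF xM] x by simp
  show "a+.M b : k ` N" if b: "b : k ` N" for b
  proof -
   obtain y where y: "y : N" "b = k y" using b by blast
   hence "y : $M" using NE(1) by blast
   thus ?thesis using imageI[OF NE(5)[OF x(1) y(1)], of k] k(2)[OF xM] x y by simp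
  qed
  show "r**.M a : k ` N" if "r : $R" for r
   using imageI[OF NE(4)[OF that x(1)], of k] k(3)[OF that xM] x by simp
 qed
 have Hj: "submodule (?H j) R M"
  using k k0 kneg unfolding k_def[symmetric] by(intro submoduleI) auto
 have imH: "k ` N \<subseteq> {x : $M. h x = 0_M}" if "N \<subseteq> ?H (Suc j)" for N
  using that k(1) unfolding k_def by auto
 have "ranked R M (?H (Suc j)) (Suc j * s) (%N. g (N \<inter> ?H j) + f (k ` N))"
  unfolding ranked_def
 proof(intro conjI allI impI; elim conjE)
  fix N assume N: "submodule N R M" "N \<subseteq> ?H (Suc j)"
  show "g (N \<inter> ?H j) + f (k ` N) \<le> Suc j * s"
   using ranked_le[OF g submodule_Int[OF N(1) Hj]] ranked_le[OF f im[OF N(1)] imH[OF N(2)]] by simp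
 next
  fix N N' assume N: "submodule N R M" "submodule N' R M" "N \<subset> N'" "N' \<subseteq> ?H (Suc j)"
  have g1: "g (N \<inter> ?H j) \<le> g (N' \<inter> ?H j)"
   using ranked_mono[OF g submodule_Int[OF N(1) Hj] submodule_Int[OF N(2) Hj]] N by blast
  have f1: "f (k ` N) \<le> f (k ` N')"
   using ranked_mono[OF f im[OF N(1)] im[OF N(2)] _ imH[OF N(4)]] N by blast
  show "g (N \<inter> ?H j) + f (k ` N) < g (N' \<inter> ?H j) + f (k ` N')"
  proof(rule ccontr)
   assume "\<not> ?thesis"
   hence "g (N \<inter> ?H j) = g (N' \<inter> ?H j)" "f (k ` N) = f (k ` N')" using g1 f1 by auto
   hence "\<not> N \<inter> ?H j \<subset> N' \<inter> ?H j" "\<not> k ` N \<subset> k ` N'"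
   using ranked_less[OF g submodule_Int[OF N(1) Hj] submodule_Int[OF N(2) Hj]]
   ranked_less[OF f im[OF N(1)] im[OF N(2)] _ imH[OF N(4)]] by auto
   hence e1: "N \<inter> ?H j = N' \<inter> ?H j" and e2: "k ` N = k ` N'" using N(3) by blast+
   \<comment> \<open>An element of \<open>N'\<close> has the same image as some element of
     \<open>N\<close>, and their difference lies in the common part of the kernel.\<close>
   have "N' \<subseteq> N"
   proof
   fix y assume y: "y : N'"
   then obtain x where x: "x : N" "k y = k x" using e2 by(metis imageE imageI)
   have yM: "y : $M" "x : $M" using y x submoduleE(1) N by blast+
   have "k (y-.M x) = k y+.M-.M k x" unfolding a_minus_def using yM k kneg by simp
   also have "\<dots> = 0_M" using x(2) yM k(1) by(simp add: M.r_neg Pi_iff)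
   finally have "y-.M x : ?H j" using yM unfolding k_def by simp
   moreover have "y-.M x : N'" using submodule_minus_closed[OF N(2) y] x N(3) by blast
   ultimately have "y-.M x : N" using e1 by blast
   thus "y : N" using submodule_diffD[OF N(1)] x yM by blast
   qed
   thus False using N(3) by blast
  qed
 qed
 thus ?case by blast
qed

end

section \<open>Scaled copies of a chain, and descent along a tower of rings\<close>

text \<open>Once the summands are independent this is a direct sum of copies of \<open>N\<close>,
  standing in for the tensor product of \<open>N\<close> with a free module.\<close>

primrec scaled_sum :: "('r, 'm, 'y) module_scheme => (nat => 'r) => 'm set => nat => 'm set"
 where "scaled_sum M b N 0 = {0_M}"
 | "scaled_sum M b N (Suc j) = {u+.M b j**.M x | u x. u : scaled_sum M b N j & x : N}"

lemma submodule_add_scaled: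
 assumes R: "module R M" and S: "module S M" and SR: "$S \<subseteq> $R" and b: "b : $R"
  and T: "submodule T S M" and Q: "submodule Q S M"
 shows "submodule {u+.M b**.M x | u x. u : T & x : Q} S M"
proof -
 interpret S: module S M by(rule S)
 interpret R: module R M by(rule R)
 note TE = S.submoduleE[OF T] and QE = S.submoduleE[OF Q]
 let ?D = "{u+.M b**.M x | u x. u : T & x : Q}"
 have DI: "u+.M b**.M x : ?D" if "u : T" "x : Q" for u x using that by blast
 show ?thesis
 proof(rule S.submoduleI)
  show "?D \<subseteq> $M" using TE(1) QE(1) b by blast
  show "0_M : ?D"
   using DI[OF S.submodule_zero_mem[OF T] S.submodule_zero_mem[OF Q]] b by simp
  fix a assume "a : ?D"
  then obtain u x where a: "a = u+.M b**.M x" "u : T" "x : Q" by blast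
  hence ux: "u : $M" "x : $M" using TE(1) QE(1) by auto
  have "-.M a =-.M u+.M b**.M (-.M x)"
   using ux b a by(simp add: R.smult_r_minus S.M.minus_add)
  thus "-.M a : ?D" using DI[OF TE(3)[OF a(2)] QE(3)[OF a(3)]] by simp
  { fix a' assume "a' : ?D"
   then obtain u' x' where a': "a' = u'+.M b**.M x'" "u' : T" "x' : Q" by blast
   hence ux': "u' : $M" "x' : $M" using TE(1) QE(1) by auto
   have "a+.M a' = (u+.M u')+.M b**.M (x+.M x')"
   using ux ux' b a a' by(simp add: R.smult_r_distr S.M.a_ac)
   thus "a+.M a' : ?D" using DI[OF TE(5)[OF a(2) a'(2)] QE(5)[OF a(3) a'(3)]] by simp }
  fix r assume r: "r : $S"
  hence rR: "r : $R" using SR by blast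
  have "r**.M a = r**.M u+.M b**.M (r**.M x)"
   using ux b a rR by(simp add: R.smult_r_distr R.smult_assoc1[symmetric] R.R.m_comm)
  thus "r**.M a : ?D" using DI[OF TE(4)[OF r a(2)] QE(4)[OF r a(3)]] by simp
 qed
qed

lemma submodule_scaled_sum:
 assumes R: "module R M" and S: "module S M" and SR: "$S \<subseteq> $R"
  and b: "!!j. j < q ==> b j : $R" and N: "submodule N S M"
 shows "submodule (scaled_sum M b N q) S M"
 using b by(induction q) (simp_all add: module.submodule_singleton_zero[OF S] submodule_add_scaled[OF R S SR _ _ N])

text \<open>The chain is repeated inside each scaled copy of \<open>N s\<close>, on top of the
  earlier copies. Independence keeps every inclusion strict, so a chain of length
  \<open>q * s\<close> arises inside \<open>P\<close>.\<close>

lemma ranked_scaled_sum: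
 assumes R: "module R M" and S: "module S M" and SR: "$S \<subseteq> $R"
  and b: "!!j. j < q ==> b j : $R"
  and N: "!!i. i \<le> s ==> submodule (N i) S M" "!!i. i < s ==> N i \<subset> N (Suc i)"
  and indep: "!!j u x. j < q ==> u : scaled_sum M b (N s) j ==> x : N s ==> u+.M b j**.M x = 0_M ==> x = 0_M"
  and f: "ranked S M P L f" and P: "scaled_sum M b (N s) q \<subseteq> P"
 shows "q * s \<le> L"
proof -
 interpret S: module S M by(rule S)
 interpret R: module R M by(rule R)
 let ?T = "scaled_sum M b (N s)"
 have NN: "N i \<subseteq> N j" if "i \<le> j" "j \<le> s" for i j
  using that
 proof(induction j rule: dec_induct)
  case (step n) thus ?case using N(2)[of n] by auto
 qed simp
 have T: "submodule (?T j) S M" if "j \<le> q" for j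
  using submodule_scaled_sum[OF R S SR, of j b "N s"] b N(1) that by simp
 let ?U = "%j i. {u+.M b j**.M x | u x. u : ?T j & x : N i}"
 have Ts: "?U j s = ?T (Suc j)" for j by simp
 have U: "submodule (?U j i) S M" if "j < q" "i \<le> s" for j i
  using submodule_add_scaled[OF R S SR b T N(1)] that by simp
 have TU: "?T j \<subseteq> ?U j i" if "j < q" "i \<le> s" for j i
 proof
  fix u assume u: "u : ?T j"
  hence "u : $M" using S.submoduleE(1)[OF T[of j]] that by auto
  hence "u = u+.M b j**.M 0_M" using b that by simp
  thus "u : ?U j i" using u S.submodule_zero_mem[OF N(1)] that by blast
 qed
 have Tq: "?T j \<subseteq> ?T q" if "j \<le> q" for j
  using that
 proof(induction "q - j" arbitrary: j)
  case (Suc k)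
  hence "?T (Suc j) \<subseteq> ?T q" using Suc.hyps(1)[of "Suc j"] by(simp del: scaled_sum.simps)
  moreover have "?T j \<subseteq> ?T (Suc j)" using TU[of j s] Suc.hyps(2) unfolding Ts by simp
  ultimately show ?case by blast
 qed simp
 have strict: "?U j i \<subset> ?U j (Suc i)" if j: "j < q" and i: "i < s" for j i
 proof -
  obtain x where x: "x : N (Suc i)" "x \<notin> N i" using N(2)[OF i] by blast
  have xs: "x : N s" using x NN[of "Suc i" s] i by auto
  have xM: "x : $M" using xs S.submoduleE(1)[OF N(1)] by blast
  have z: "0_M : ?T j" using S.submodule_zero_mem[OF T] j by simp
  have "0_M+.M b j**.M x : ?U j (Suc i)" using x z by blast
  moreover have "0_M+.M b j**.M x \<notin> ?U j i"
  proof
   assume "0_M+.M b j**.M x : ?U j i"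
   then obtain u y where uy: "0_M+.M b j**.M x = u+.M b j**.M y" "u : ?T j" "y : N i" by blast
   have ys: "y : N s" using uy NN[of i s] i by auto
   have yM: "y : $M" "u : $M" using ys uy(2) S.submoduleE(1)[OF N(1)[OF order_refl]] S.submoduleE(1)[OF T[of j]] j by auto
   have bj: "b j : $R" using b j by blast
   have "u+.M b j**.M (y-.M x) = (u+.M b j**.M y)-.M b j**.M x"
   using yM xM bj by(simp add: a_minus_def R.smult_r_distr R.smult_r_minus S.M.a_assoc)
   also have "\<dots> = 0_M" unfolding uy(1)[symmetric] using xM bj by(simp add: a_minus_def S.M.r_neg)
   finally have "y-.M x = 0_M"
   using indep[OF j uy(2)] S.submodule_minus_closed[OF N(1)[OF order_refl] ys xs] by blast
   moreover have "y = (y-.M x)+.M x" using yM xM by(simp add: a_minus_def S.M.a_assoc S.M.l_neg)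
   ultimately have "y = x" using xM by simp
   thus False using x uy(3) by simp
  qed
  moreover have "?U j i \<subseteq> ?U j (Suc i)" using N(2)[OF i] by blast
  ultimately show ?thesis by blast
 qed
 have fT: "j \<le> q ==> j * s \<le> f (?T j)" for j
 proof(induction j)
  case (Suc j)
  have UP: "?U j i \<subseteq> P" if "i \<le> s" for i
  proof -
   have "?U j i \<subseteq> ?U j s" using NN[OF that order_refl] by blast
   thus ?thesis using Tq[OF Suc.prems] P Ts by blast
  qed
  have "i \<le> s ==> j * s + i \<le> f (?U j i)" for i
  proof(induction i)
   case 0
   have "f (?T j) \<le> f (?U j 0)"
   using ranked_mono[OF f T U TU UP] Suc.prems by simp
   thus ?case using Suc by simp
  next
   case (Suc i)
   have "f (?U j i) < f (?U j (Suc i))"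
   using ranked_less[OF f U U strict UP] \<open>Suc j \<le> q\<close> Suc.prems by simp
   thus ?case using Suc by simp
  qed
  from this[of s] show ?case unfolding Ts by(simp del: scaled_sum.simps add: add.commute)
 qed simp
 have "q * s \<le> f (?T q)" using fT by blast
 also have "\<dots> \<le> L" using ranked_le[OF f T P] by simp
 finally show ?thesis .
qed

text \<open>A triangular filtration over the union of a tower of rings already lives over a ring of the
 tower, since it involves finitely many coefficients.\<close>

lemma triangular_descent:
 assumes S: "module S M" and R: "!!m::nat. module (R m) M"
  and mono: "!!m m'. m \<le> m' ==> $(R m) \<subseteq> $(R m')" and un: "$S = (\<Union>m. $(R m))"
  and E: "finite E" and T: "triangular S M E l P" and Y: "finite Y" "Y \<subseteq> P"
 shows "\<exists>m0. \<forall>m\<ge>m0. \<exists>P'. triangular (R m) M E l P' & Y \<subseteq> P' & P' \<subseteq> P"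
 using T Y
proof(induction arbitrary: Y rule: triangular.induct)
 case zero
 thus ?case using triangular.zero by blast
next
 case (step l P x)
 interpret S: module S M by(rule S)
 have P: "submodule P S M" using S.triangular_submodule step by blast
 have "\<forall>y\<in>Y. \<exists>t. y = fst t+.M fst (snd t)**.M x & fst t : P & fst (snd t) : $(R (snd (snd t)))"
 proof
  fix y assume "y : Y"
  then obtain u r m where "y = u+.M r**.M x" "u : P" "r : $(R m)"
   using step.prems un unfolding adjoin_def by blast
  thus "\<exists>t. y = fst t+.M fst (snd t)**.M x & fst t : P & fst (snd t) : $(R (snd (snd t)))"
   by(intro exI[of _ "(u, r, m)"]) simp
 qed
 from bchoice[OF this] obtain t where t: "\<forall>y\<in>Y. y = fst (t y)+.M fst (snd (t y))**.M x \<and>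
  fst (t y) : P & fst (snd (t y)) : $(R (snd (snd (t y))))" ..
 define u r m where "u = (%y. fst (t y))" and "r = (%y. fst (snd (t y)))" and "m = (%y. snd (snd (t y)))"
 have urm: "y = u y+.M r y**.M x & u y : P & r y : $(R (m y))" if "y : Y" for y
  using bspec[OF t that] unfolding u_def r_def m_def .
 note u = urm[THEN conjunct2, THEN conjunct1] and r = urm[THEN conjunct2, THEN conjunct2]
 \<comment> \<open>The smaller filtration has to contain the components of \<open>Y\<close> and also
   the products of \<open>E\<close> with the new generator, so that this generator remains
   admissible over the smaller ring.\<close>
 let ?Y' = "u ` Y \<union> (%a. a**.M x) ` E"
 have "finite ?Y'" using step.prems E by simp
 moreover have "?Y' \<subseteq> P" using step.hyps(3) u by auto
 ultimately have "\<exists>m0. \<forall>k\<ge>m0. \<exists>P'. triangular (R k) M E l P' & ?Y' \<subseteq> P' & P' \<subseteq> P"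
  by(rule step.IH)
 then obtain m0 where m0: "\<forall>k\<ge>m0. \<exists>P'. triangular (R k) M E l P' & ?Y' \<subseteq> P' & P' \<subseteq> P"
  ..
 define m1 where "m1 = Max (insert m0 (m ` Y))"
 have m1: "m0 \<le> m1" "!!y. y : Y ==> m y \<le> m1" unfolding m1_def using step.prems by auto
 show ?case
 proof(intro exI[of _ m1] allI impI)
  fix k assume k: "k \<ge> m1"
  obtain P' where P': "triangular (R k) M E l P'" "?Y' \<subseteq> P'" "P' \<subseteq> P" using m0[rule_format, OF order_trans[OF m1(1) k]] by(elim exE conjE)
  have T: "triangular (R k) M E (Suc l) (adjoin (R k) M P' x)"
  proof(rule triangular.step[OF P'(1) step.hyps(2)])
   show "a**.M x : P'" if "a : E" for a using P'(2) that by blast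
  qed
  moreover have "Y \<subseteq> adjoin (R k) M P' x"
  proof
   fix y assume y: "y : Y"
   have "r y : $(R k)" using r[OF y] mono[of "m y" k] m1(2)[OF y] k by auto
   moreover have "u y : P'" using P'(2) y by blast
   ultimately have "u y+.M r y**.M x : adjoin (R k) M P' x" unfolding adjoin_def by blast
   thus "y : adjoin (R k) M P' x" using urm[OF y] by simp
  qed
  moreover have "adjoin (R k) M P' x \<subseteq> adjoin S M P x"
  proof -
   have "$(R k) \<subseteq> $S" using un by blast
   thus ?thesis using P'(3) unfolding adjoin_def by blast
  qed
  ultimately show "\<exists>P'. triangular (R k) M E (Suc l) P' & Y \<subseteq> P' & P' \<subseteq> adjoin S M P x"
   by(intro exI conjI)
 qed
qed

section \<open>Transport, products, quotients and linear maps of modules\<close>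

lemma mk_module_simps [simp]:
 "$(mk_module C pl z sm) = C" "add (mk_module C pl z sm) = pl"
 "0_(mk_module C pl z sm) = z" "smult (mk_module C pl z sm) = sm"
 by(simp_all add: mk_module_def)

lemma self_module_simps [simp]:
 "$(self_module A) = $A" "add (self_module A) = add A"
 "0_(self_module A) = 0_A" "smult (self_module A) = monoid.mult A"
 by(simp_all add: self_module_def)

lemma restrict_scalars_simps [simp]:
 "$(restrict_scalars f M) = $M" "add (restrict_scalars f M) = add M"
 "0_(restrict_scalars f M) = 0_M" "a**.(restrict_scalars f M) x = f a**.M x"
 by(simp_all add: restrict_scalars_def)

lemma direct_product_simps:
 "$(direct_product I M) = (\<Pi>\<^sub>E i\<in>I. $(M i))"
 "f+.(direct_product I M) g = (\<lambda>i\<in>I. f i+.(M i) g i)"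
 "0_(direct_product I M) = (\<lambda>i\<in>I. 0_(M i))"
 "a**.(direct_product I M) f = (\<lambda>i\<in>I. a**.(M i) f i)"
 by(simp_all add: direct_product_def)

lemma abelian_group_minusI:
 assumes "x : $M" "y : $M" "abelian_group M" "x+.M y = 0_M"
 shows "-.M x = y"
 using assms by(metis abelian_group.minus_equality abelian_group.a_comm_group abelian_monoid.a_comm abelian_group_def)

text \<open>Every module axiom is an identity between images under \<open>h\<close>, so it holds in
  the image of a module. Quotient modules and transported copies are instances.\<close>

lemma module_pushforward:
 assumes M: "module A M" and surj: "h ` $M = $M'"
  and add: "!!x y. x : $M ==> y : $M ==> h x+.M' h y = h (x+.M y)"
  and hz: "h 0_M = 0_M'"
  and smult: "!!a x. a : $A ==> x : $M ==> a**.M' h x = h (a**.M x)"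
 shows "module A M'"
proof -
 interpret module A M by(rule M)
 note add[simp] smult[simp] hz[symmetric, simp]
 have ex: "\<exists>a\<in>$M. x = h a" if "x : $M'" for x using that surj by blast
 have cl: "h a : $M'" if "a : $M" for a using that surj by blast
 show ?thesis
 proof(rule moduleI)
  show "abelian_group M'"
  proof(rule abelian_groupI)
   fix x y assume "x : $M'" "y : $M'"
   then obtain a b where ab: "a : $M" "x = h a" "b : $M" "y = h b" using ex by blast
   thus "x+.M' y : $M'" using cl by simp
   show "x+.M' y = y+.M' x" using ab by(simp add: M.a_comm)
   show "0_M'+.M' x = x" using ab by simp
   show "\<exists>y\<in>$M'. y+.M' x = 0_M'"
   using ab cl by(intro bexI[of _ "h (-.M a)"]) (simp_all add: M.l_neg)
   fix z assume "z : $M'"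
   then obtain c where "c : $M" "z = h c" using ex by blast
   thus "x+.M' y+.M' z = x+.M' (y+.M' z)" using ab by(simp add: M.a_assoc)
  qed (use cl in simp)
  show "cring A" by(rule is_cring)
  fix a x assume a: "a : $A" and x: "x : $M'"
  obtain x' where x': "x' : $M" "x = h x'" using ex x by blast
  show "a**.M' x : $M'" using x' a cl by simp
  { fix b assume b: "b : $A"
   show "(a+.A b)**.M' x = a**.M' x+.M' b**.M' x"
   using a b x' by(simp add: smult_l_distr)
   show "(a*.A b)**.M' x = a**.M' (b**.M' x)"
   using a b x' by(simp add: smult_assoc1) }
  { fix y assume "y : $M'"
   then obtain y' where "y' : $M" "y = h y'" using ex by blast
   thus "a**.M' (x+.M' y) = a**.M' x+.M' a**.M' y"
   using a x' by(simp add: smult_r_distr) }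
 next
  fix x assume "x : $M'"
  then obtain x' where x': "x' : $M" "x = h x'" using ex by blast
  thus "1_A**.M' x = x" by simp
 qed
qed

text \<open>The image of \<open>h\<close> is a submodule, and the inverse of \<open>h\<close> on it
  reduces the claim to transport along a surjection.\<close>

lemma module_pullback:
 assumes M: "module A M" and h: "h : $M' \<rightarrow> $M" "inj_on h $M'"
  and cl: "!!x y. x : $M' ==> y : $M' ==> x+.M' y : $M'" "0_M' : $M'"
   "!!a x. a : $A ==> x : $M' ==> a**.M' x : $M'"
  and add: "!!x y. x : $M' ==> y : $M' ==> h (x+.M' y) = h x+.M h y"
  and hz: "h 0_M' = 0_M"
  and smult: "!!a x. a : $A ==> x : $M' ==> h (a**.M' x) = a**.M h x"
 shows "module A M'"
proof -
 interpret module A M by(rule M)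
 have sub: "submodule (h ` $M') A M"
 proof(rule submoduleI)
  show "h ` $M' \<subseteq> $M" using h by blast
  show "0_M : h ` $M'" using imageI[OF cl(2), of h] unfolding hz .
  fix a assume "a : h ` $M'"
  then obtain x where x: "x : $M'" "a = h x" by blast
  hence a: "a : $M" using h by blast
  show "a+.M b : h ` $M'" if b: "b : h ` $M'" for b
  proof -
   obtain y where y: "y : $M'" "b = h y" using b by blast
   show ?thesis using imageI[OF cl(1)[OF x(1) y(1)], of h] add[OF x(1) y(1)] x y by simp
  qed
  show 1: "r**.M a : h ` $M'" if "r : $A" for r
   using imageI[OF cl(3)[OF that x(1)], of h] smult[OF that x(1)] x by simp
  show "-.M a : h ` $M'" using 1[of "-.A 1_A"] a by(simp add: smult_l_minus)
 qed
 let ?g = "inv_into $M' h"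
 have g: "?g (h x) = x" if "x : $M'" for x using inv_into_f_f[OF h(2) that] .
 show ?thesis
 proof(rule module_pushforward[OF submodule.submodule_is_module[OF sub M]])
  show "?g ` $(M\<lparr>carrier := h ` $M'\<rparr>) = $M'" using g by force
  show "?g 0_(M\<lparr>carrier := h ` $M'\<rparr>) = 0_M'" using g[OF cl(2)] unfolding hz by simp
  fix x assume "x : $(M\<lparr>carrier := h ` $M'\<rparr>)"
  then obtain x' where x: "x' : $M'" "x = h x'" by auto
  { fix y assume "y : $(M\<lparr>carrier := h ` $M'\<rparr>)"
   then obtain y' where y: "y' : $M'" "y = h y'" by auto
   show "?g x+.M' ?g y = ?g (x+.(M\<lparr>carrier := h ` $M'\<rparr>) y)"
   using x y g[OF x(1)] g[OF y(1)] g[OF cl(1)[OF x(1) y(1)]] add[OF x(1) y(1)] by simp }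
  fix a assume a: "a : $A"
  show "a**.M' ?g x = ?g (a**.(M\<lparr>carrier := h ` $M'\<rparr>) x)"
   using x g[OF x(1)] g[OF cl(3)[OF a x(1)]] smult[OF a x(1)] by simp
 qed
qed

lemma module_self_module: "cring A ==> module A (self_module A)"
proof -
 assume "cring A"
 then interpret cring A .
 show ?thesis
 proof(rule moduleI)
  show "abelian_group (self_module A)"
  proof(rule abelian_groupI)
   fix x assume "x : $(self_module A)"
   thus "\<exists>y\<in>$(self_module A). y+.(self_module A) x = 0_(self_module A)"
   by(intro bexI[of _ "-.A x"]) (simp_all add: l_neg)
  qed (simp_all add: a_ac)
 qed (simp_all add: l_distr r_distr m_assoc is_cring)
qed

lemma module_restrict_scalars:
 assumes M: "module B M" and f: "f : ring_hom A B" and A: "cring A"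
 shows "module A (restrict_scalars f M)"
proof -
 interpret module B M by(rule M)
 interpret A: cring A by(rule A)
 have ab: "abelian_group (restrict_scalars f M)"
 proof(rule abelian_groupI)
  fix x assume "x : $(restrict_scalars f M)"
  thus "\<exists>y\<in>$(restrict_scalars f M). y+.(restrict_scalars f M) x = 0_(restrict_scalars f M)"
   by(intro bexI[of _ "-.M x"]) (simp_all add: M.l_neg)
 qed (simp_all add: M.a_ac)
 have fc: "f a : $B" if "a : $A" for a using ring_hom_closed[OF f that] .
 show ?thesis
  by(rule moduleI[OF A ab])
   (simp_all add: fc ring_hom_add[OF f] ring_hom_mult[OF f] ring_hom_one[OF f] smult_l_distr smult_r_distr smult_assoc1)
qed

lemma module_direct_product:
 assumes A: "cring A" and M: "!!i. i : I ==> module A (M i)"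
 shows "module A (direct_product I M)"
proof -
 have ab: "abelian_group (M i)" if "i : I" for i using M[OF that] by(rule module.axioms)
 have mo: "abelian_monoid (M i)" if "i : I" for i using ab[OF that] by(rule abelian_group.axioms)
 have "abelian_group (direct_product I M)"
 proof(rule abelian_groupI)
  fix x y assume x: "x : $(direct_product I M)" and y: "y : $(direct_product I M)"
  thus "x+.(direct_product I M) y : $(direct_product I M)"
   by(auto simp: direct_product_simps PiE_iff abelian_monoid.a_closed[OF mo])
  show "x+.(direct_product I M) y = y+.(direct_product I M) x"
   using x y by(auto simp: direct_product_simps PiE_iff abelian_monoid.a_comm[OF mo] intro!: restrict_ext)
  show "0_(direct_product I M)+.(direct_product I M) x = x"
   using x by(auto simp: direct_product_simps PiE_iff abelian_monoid.l_zero[OF mo] extensional_def)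
  show "\<exists>y\<in>$(direct_product I M). y+.(direct_product I M) x = 0_(direct_product I M)"
   using x by(intro bexI[of _ "\<lambda>i\<in>I.-.(M i) x i"])
   (auto simp: direct_product_simps PiE_iff abelian_group.l_neg[OF ab] abelian_group.a_inv_closed[OF ab] intro!: restrict_ext)
  fix z assume z: "z : $(direct_product I M)"
  show "x+.(direct_product I M) y+.(direct_product I M) z = x+.(direct_product I M) (y+.(direct_product I M) z)"
   using x y z by(auto simp: direct_product_simps PiE_iff abelian_monoid.a_assoc[OF mo] intro!: restrict_ext)
 qed (auto simp: direct_product_simps PiE_iff abelian_monoid.zero_closed[OF mo])
 thus ?thesis
 proof(rule moduleI[OF A])
  fix a x assume a: "a : $A" and x: "x : $(direct_product I M)"
  thus "a**.(direct_product I M) x : $(direct_product I M)"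
   by(auto simp: direct_product_simps PiE_iff module.smult_closed[OF M])
  { fix b assume b: "b : $A"
   show "(a+.A b)**.(direct_product I M) x = a**.(direct_product I M) x+.(direct_product I M) b**.(direct_product I M) x"
   using a b x by(auto simp: direct_product_simps PiE_iff module.smult_l_distr[OF M] intro!: restrict_ext)
   show "(a*.A b)**.(direct_product I M) x = a**.(direct_product I M) (b**.(direct_product I M) x)"
   using a b x by(auto simp: direct_product_simps PiE_iff module.smult_assoc1[OF M] intro!: restrict_ext) }
  { fix y assume y: "y : $(direct_product I M)"
   show "a**.(direct_product I M) (x+.(direct_product I M) y) = a**.(direct_product I M) x+.(direct_product I M) a**.(direct_product I M) y"
   using a x y by(auto simp: direct_product_simps PiE_iff module.smult_r_distr[OF M] intro!: restrict_ext) }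
 next
  fix x assume x: "x : $(direct_product I M)"
  thus "1_A**.(direct_product I M) x = x"
   by(auto simp: direct_product_simps PiE_iff module.smult_one[OF M] extensional_def)
 qed
qed

context
 fixes A :: "'a ring" and M :: "('a, 'm) module" and N
 assumes M: "module A M" and N: "submodule N A M"
begin

interpretation module A M by(rule M)

interpretation Q: abelian_subgroup N M
 using N by(intro abelian_subgroupI3 additive_subgroup.intro submodule.axioms M.abelian_group_axioms)

lemma submodule_coset_eq:
 assumes "x : $M" "y : $M"
 shows "N +>\<^bsub>M\<^esub> x = N +>\<^bsub>M\<^esub> y \<longleftrightarrow> x-.M y : N"
proof
 assume "N +>\<^bsub>M\<^esub> x = N +>\<^bsub>M\<^esub> y"
 hence "x : N +>\<^bsub>M\<^esub> y" using Q.a_rcos_self[OF assms(1)] by simp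
 thus "x-.M y : N" using Q.a_rcos_module_minus[of y x] assms by(simp add: Q.a_rcos_module a_minus_def)
next
 assume "x-.M y : N"
 hence "x : N +>\<^bsub>M\<^esub> y" using assms by(simp add: Q.a_rcos_module a_minus_def)
 thus "N +>\<^bsub>M\<^esub> x = N +>\<^bsub>M\<^esub> y" using Q.a_repr_independence'[of x y] assms by(metis)
qed

lemma submodule_coset_self: "x : $M ==> x : N +>\<^bsub>M\<^esub> x"
 by(rule Q.a_rcos_self)

lemma submodule_coset_mem:
 "x : $M ==> y : N +>\<^bsub>M\<^esub> x \<longleftrightarrow> y : $M & y-.M x : N"
 using Q.a_rcos_module[of x y] submoduleE(1)[OF N]
 by(auto simp: a_minus_def a_r_coset_def')

lemma carrier_quotient_module: "$(quotient_module M N) = (%x. N +>\<^bsub>M\<^esub> x) ` $M"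
 by(auto simp: quotient_module_def A_RCOSETS_def')

lemma zero_quotient_module: "0_(quotient_module M N) = N +>\<^bsub>M\<^esub> 0_M"
 using submoduleE(1)[OF N] by(simp add: quotient_module_def M.a_coset_add_zero)

lemma add_quotient_module:
 "x : $M ==> y : $M ==>
  (N +>\<^bsub>M\<^esub> x)+.(quotient_module M N) (N +>\<^bsub>M\<^esub> y) = N +>\<^bsub>M\<^esub> (x+.M y)"
 by(simp add: quotient_module_def Q.a_rcos_sum)

text \<open>The action is defined as a union over representatives; since \<open>N\<close> is closed
  under scalars they all give the same coset, and the union collapses.\<close>

lemma smult_quotient_module:
 assumes a: "a : $A" and x: "x : $M"
 shows "a**.(quotient_module M N) (N +>\<^bsub>M\<^esub> x) = N +>\<^bsub>M\<^esub> (a**.M x)"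
proof -
 have eq: "N +>\<^bsub>M\<^esub> (a**.M y) = N +>\<^bsub>M\<^esub> (a**.M x)" if "y : N +>\<^bsub>M\<^esub> x" for y
 proof -
  have y: "y : $M" "y-.M x : N" using that x submodule_coset_mem by auto
  have "a**.M y-.M a**.M x = a**.M (y-.M x)"
   using y x a by(simp add: a_minus_def smult_r_distr smult_r_minus)
  also have "\<dots> : N" using submoduleE(4)[OF N a y(2)] .
  finally show ?thesis using submodule_coset_eq y x a by simp
 qed
 have "N +>\<^bsub>M\<^esub> x ~= {}" using submodule_coset_self[OF x] by blast
 hence "(\<Union>y\<in>N +>\<^bsub>M\<^esub> x. N +>\<^bsub>M\<^esub> (a**.M y)) = N +>\<^bsub>M\<^esub> (a**.M x)"
  by(rule SUP_eq_const) (rule eq)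
 thus ?thesis by(simp add: quotient_module_def)
qed

lemma module_quotient_module: "module A (quotient_module M N)"
 by(rule module_pushforward[OF M, of "%x. N +>\<^bsub>M\<^esub> x"])
  (simp_all add: carrier_quotient_module zero_quotient_module add_quotient_module smult_quotient_module)

end

lemma linear_mapsD:
 assumes "f : linear_maps A M N"
 shows "x : $M ==> f x : $N"
  "x : $M ==> y : $M ==> f (x+.M y) = f x+.N f y"
  "a : $A ==> x : $M ==> f (a**.M x) = a**.N f x"
 using assms by(auto simp: linear_maps_def)

lemma linear_maps_zero:
 assumes f: "f : linear_maps A M N" and M: "module A M" and N: "module A N"
 shows "f 0_M = 0_N"
proof -
 interpret M: module A M by(rule M)
 interpret N: module A N by(rule N)
 have "f (0_A**.M 0_M) = 0_A**.N f 0_M" by(rule linear_mapsD(3)[OF f]) simp_all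
 thus ?thesis using linear_mapsD(1)[OF f] by simp
qed

lemma linear_maps_minus:
 assumes f: "f : linear_maps A M N" and M: "module A M" and N: "module A N" and x: "x : $M"
 shows "f (-.M x) =-.N f x"
proof -
 interpret M: module A M by(rule M)
 interpret N: module A N by(rule N)
 have "f ((-.A 1_A)**.M x) = (-.A 1_A)**.N f x" using linear_mapsD(3)[OF f _ x] by simp
 thus ?thesis using linear_mapsD(1)[OF f x] x by(simp add: M.smult_l_minus N.smult_l_minus)
qed

lemma linear_maps_image_submodule:
 assumes f: "f : linear_maps A M N" and M: "module A M" and N: "module A N" and P: "submodule P A M"
 shows "submodule (f ` P) A N"
proof -
 interpret M: module A M by(rule M)
 interpret N: module A N by(rule N)
 note PE = M.submoduleE[OF P] and fl = linear_mapsD[OF f]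
 show ?thesis
 proof(rule N.submoduleI)
  show "f ` P \<subseteq> $N" using PE(1) fl(1) by blast
  show "0_N : f ` P" using imageI[OF M.submodule_zero_mem[OF P], of f] unfolding linear_maps_zero[OF f M N] .
  fix a assume "a : f ` P"
  then obtain x where x: "x : P" "a = f x" by blast
  have xM: "x : $M" using x PE(1) by blast
  show "-.N a : f ` P" using imageI[OF PE(3)[OF x(1)], of f] linear_maps_minus[OF f M N xM] x by simp
  show "a+.N b : f ` P" if b: "b : f ` P" for b
  proof -
   obtain y where y: "y : P" "b = f y" using b by blast
   hence "y : $M" using PE(1) by blast
   thus ?thesis using imageI[OF PE(5)[OF x(1) y(1)], of f] fl(2)[OF xM] x y by simp
  qed
  show "r**.N a : f ` P" if "r : $A" for r
   using imageI[OF PE(4)[OF that x(1)], of f] fl(3)[OF that xM] x by simp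
 qed
qed

lemma linear_maps_inv_into:
 assumes f: "f : linear_maps A M N" and bij: "bij_betw f $M $N" and M: "module A M"
 shows "inv_into $M f : linear_maps A N M"
proof -
 interpret M: module A M by(rule M)
 let ?g = "inv_into $M f"
 have gf: "?g (f x) = x" if "x : $M" for x using bij that by(simp add: bij_betw_inv_into_left)
 have ex: "\<exists>x\<in>$M. y = f x" if "y : $N" for y using bij that by(auto simp: bij_betw_def)
 show ?thesis
  unfolding linear_maps_def
 proof(intro CollectI conjI ballI funcsetI)
  fix y assume "y : $N"
  then obtain x where x: "x : $M" "y = f x" using ex by blast
  show "?g y : $M" using gf x by simp
  show "?g (y+.N y') = ?g y+.M ?g y'" if y': "y' : $N" for y'
  proof -
   obtain x' where x': "x' : $M" "y' = f x'" using ex y' by blast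
   have "y+.N y' = f (x+.M x')" using linear_mapsD(2)[OF f] x x' by simp
   thus ?thesis using gf x x' by simp
  qed
 next
  fix a y assume a: "a : $A" and "y : $N"
  then obtain x where x: "x : $M" "y = f x" using ex by blast
  have "a**.N y = f (a**.M x)" using linear_mapsD(3)[OF f a] x by simp
  thus "?g (a**.N y) = a**.M ?g y" using gf x a by simp
 qed
qed

lemma module_span_subset: "submodule N A M ==> Y \<subseteq> N ==> module_span A M Y \<subseteq> N"
 unfolding module_span_def by blast

lemma subset_module_span: "Y \<subseteq> module_span A M Y"
 unfolding module_span_def by blast

lemma submodule_module_span:
 assumes M: "module A M" and Y: "Y \<subseteq> $M"
 shows "submodule (module_span A M Y) A M"
proof -
 interpret module A M by(rule M)
 show ?thesis
 proof(rule submoduleI)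
  show "module_span A M Y \<subseteq> $M" by(rule module_span_subset[OF carrier_is_submodule Y])
  have I: "x : module_span A M Y" if "!!N. submodule N A M ==> Y \<subseteq> N ==> x : N" for x
   unfolding module_span_def using that by simp
  have D: "x : N" if "x : module_span A M Y" "submodule N A M" "Y \<subseteq> N" for x N
   using module_span_subset[OF that(2,3)] that(1) by(rule subsetD)
  show "0_M : module_span A M Y" by(rule I) (rule submodule_zero_mem)
  show "-.M a : module_span A M Y" if a: "a : module_span A M Y" for a
   by(rule I) (rule submoduleE(3)[OF _ D[OF a]])
  show "a+.M b : module_span A M Y" if a: "a : module_span A M Y" and b: "b : module_span A M Y" for a b
   by(rule I) (rule submoduleE(5)[OF _ D[OF a] D[OF b]])
  show "r**.M a : module_span A M Y" if r: "r : $A" and a: "a : module_span A M Y" for r a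
   by(rule I) (rule submoduleE(4)[OF _ r D[OF a]])
 qed
qed

section \<open>Base change\<close>

abbreviation tensor_kernel :: "'a ring => ('a => 'b) => 'b ring => ('a, 'm) module => ('m \<times> 'b \<Rightarrow>\<^sub>0 int) set"
 where "tensor_kernel A f B M \<equiv> generate (free_Abelian_group ($M \<times> $B))
  (tensor_relations A M (restrict_scalars f (self_module B)))"

definition tensor_class ::
 "'a ring => ('a => 'b) => 'b ring => ('a, 'm) module => ('m \<times> 'b \<Rightarrow>\<^sub>0 int) => ('m \<times> 'b \<Rightarrow>\<^sub>0 int) set"
 where "tensor_class A f B M c =
  tensor_kernel A f B M #>\<^bsub>free_Abelian_group ($M \<times> $B)\<^esub> c"

definition pure :: "'a ring => ('a => 'b) => 'b ring => ('a, 'm) module => 'm => 'b => ('m \<times> 'b \<Rightarrow>\<^sub>0 int) set"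
 where "pure A f B M x b = tensor_class A f B M (frag_of (x, b))"

definition tensor_eval :: "('b, 'n, 'y) module_scheme => ('z => 'n) => ('z \<Rightarrow>\<^sub>0 int) => 'n"
 where "tensor_eval P g c = (\<Oplus>\<^bsub>P\<^esub>z\<in>Poly_Mapping.keys c. add_pow P (Poly_Mapping.lookup c z) (g z))"

text \<open>The universal property of the free abelian group supplies a homomorphism with the right
  values on generators; expanding a formal sum over its support identifies it with the explicit
  formula.\<close>

lemma tensor_eval_hom:
 assumes P: "abelian_group P" and g: "!!z. z : S ==> g z : $P"
 shows "tensor_eval P g : hom (free_Abelian_group S) (add_monoid P)"
  and "!!z. z : S ==> tensor_eval P g (frag_of z) = g z"
proof -
 interpret abelian_group P by(rule P)
 let ?F = "free_Abelian_group S"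
 obtain h where h: "h : hom ?F (add_monoid P)" "!!z. z : S ==> h (frag_of z) = g z"
  using comm_group.free_Abelian_group_universal[OF a_comm_group, of g S] g by auto
 interpret H: group_hom ?F "add_monoid P" h
  using h(1) group_free_Abelian_group a_group by(simp add: group_hom_def group_hom_axioms_def)
 have h0: "h 0 = 0_P" using H.hom_one by simp
 have hpow: "h (frag_cmul n (frag_of z)) = add_pow P n (g z)" if z: "z : S" for n z
 proof -
  have "h (frag_of z^.?F n) = h (frag_of z)^.(add_monoid P) n"
   by(rule H.hom_int_pow) (use z in simp)
  moreover have "frag_of z^.?F n = frag_cmul n (frag_of z)"
   using z by(intro int_pow_free_Abelian_group) simp
  ultimately show ?thesis using h(2)[OF z] by(simp add: add_pow_def)
 qed
 have eq: "h c = tensor_eval P g c" if c: "Poly_Mapping.keys c \<subseteq> S" for c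
 proof -
  have *: "h (\<Sum>z\<in>I. frag_cmul (Poly_Mapping.lookup c z) (frag_of z)) =
   (\<Oplus>\<^bsub>P\<^esub>z\<in>I. add_pow P (Poly_Mapping.lookup c z) (g z))
   & Poly_Mapping.keys (\<Sum>z\<in>I. frag_cmul (Poly_Mapping.lookup c z) (frag_of z)) \<subseteq> S"
   if I: "I \<subseteq> Poly_Mapping.keys c" for I
   using finite_subset[OF I finite_keys] I
  proof(induction I rule: finite_induct)
   case empty
   thus ?case using h0 by simp
  next
   case (insert z I)
   let ?r = "\<Sum>z\<in>I. frag_cmul (Poly_Mapping.lookup c z) (frag_of z)"
   let ?a = "frag_cmul (Poly_Mapping.lookup c z) (frag_of z)"
   have z: "z : S" and IS: "I \<subseteq> S" using insert.prems c by auto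
   have IH: "h ?r = (\<Oplus>\<^bsub>P\<^esub>z\<in>I. add_pow P (Poly_Mapping.lookup c z) (g z))" "Poly_Mapping.keys ?r \<subseteq> S"
   using insert.IH insert.prems by auto
   have ka: "Poly_Mapping.keys ?a \<subseteq> S" by(rule order_trans[OF keys_cmul]) (use z in "simp add: keys_frag_of")
   have sum: "(\<Sum>z\<in>insert z I. frag_cmul (Poly_Mapping.lookup c z) (frag_of z)) = ?a + ?r"
   using insert by simp
   have "h (?a + ?r) = h ?a+.P h ?r"
   using H.hom_mult[of ?a ?r] ka IH(2) by simp
   also have "\<dots> = (\<Oplus>\<^bsub>P\<^esub>z\<in>insert z I. add_pow P (Poly_Mapping.lookup c z) (g z))"
   unfolding IH(1) hpow[OF z]
   using insert.hyps g z IS by(subst finsum_insert) (auto simp: Pi_iff subset_iff)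
   finally show ?case unfolding sum using keys_add[of ?a ?r] ka IH(2) by blast
  qed
  have "c = (\<Sum>z\<in>Poly_Mapping.keys c. frag_cmul (Poly_Mapping.lookup c z) (frag_of z))"
   using frag_expansion[of c] unfolding frag_extend_def .
  thus ?thesis using *[OF order_refl] unfolding tensor_eval_def by metis
 qed
 show "tensor_eval P g : hom ?F (add_monoid P)"
 proof(rule homI)
  fix c c' assume c: "c : $?F" "c' : $?F"
  hence kc: "Poly_Mapping.keys c \<subseteq> S" "Poly_Mapping.keys c' \<subseteq> S" by simp_all
  hence k: "Poly_Mapping.keys (c + c') \<subseteq> S" using keys_add[of c c'] by blast
  show "tensor_eval P g c : $(add_monoid P)" using H.hom_closed[OF c(1)] eq[OF kc(1)] by simp
  show "tensor_eval P g (c*.?F c') = tensor_eval P g c*.(add_monoid P) tensor_eval P g c'"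
   using H.hom_mult[OF c] eq[OF kc(1)] eq[OF kc(2)] eq[OF k] by simp
 qed
 show "tensor_eval P g (frag_of z) = g z" if "z : S" for z
  using eq[of "frag_of z"] h(2)[OF that] that by(simp add: keys_frag_of)
qed

locale base_change_setup =
 fixes A :: "'a ring" and f :: "'a => 'b" and B :: "'b ring" and M :: "('a, 'm) module"
 assumes M: "module A M" and B: "cring B" and f: "f : ring_hom A B"
begin

sublocale A: module A M by(rule M)
sublocale B: cring B by(rule B)

abbreviation "S \<equiv> $M \<times> $B"
abbreviation "F \<equiv> free_Abelian_group S"
abbreviation "K \<equiv> tensor_kernel A f B M"
abbreviation "T \<equiv> base_change A f B M"
abbreviation "cls \<equiv> tensor_class A f B M"
abbreviation "pur \<equiv> pure A f B M"
abbreviation "ext b \<equiv> frag_extend (%(x, y). frag_of (x, b*.B y))"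

lemma f_closed: "a : $A ==> f a : $B"
 using ring_hom_closed[OF f] .

sublocale F: comm_group F by(rule abelian_free_Abelian_group)

lemma relation_cases:
 assumes "r : tensor_relations A M (restrict_scalars f (self_module B))"
 obtains (left) x x' y where "r = frag_of (x+.M x', y) - frag_of (x, y) - frag_of (x', y)"
   "x : $M" "x' : $M" "y : $B"
  | (right) x y y' where "r = frag_of (x, y+.B y') - frag_of (x, y) - frag_of (x, y')"
   "x : $M" "y : $B" "y' : $B"
  | (scalar) a x y where "r = frag_of (a**.M x, y) - frag_of (x, f a*.B y)"
   "a : $A" "x : $M" "y : $B"
 using assms unfolding tensor_relations_def by auto

lemma relations_subset: "tensor_relations A M (restrict_scalars f (self_module B)) \<subseteq> $F"
proof
 have d: "Poly_Mapping.keys (a - b) \<subseteq> S" if "Poly_Mapping.keys a \<subseteq> S" "Poly_Mapping.keys b \<subseteq> S" for a b :: "'m \<times> 'b \<Rightarrow>\<^sub>0 int"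
  using that keys_diff[of a b] by blast
 have o: "Poly_Mapping.keys (frag_of z) \<subseteq> S" if "z : S" for z :: "'m \<times> 'b"
  using that by(simp add: keys_frag_of)
 fix r assume "r : tensor_relations A M (restrict_scalars f (self_module B))"
 thus "r : $F"
 proof(cases rule: relation_cases)
  case left thus ?thesis by(simp add: d o)
 next
  case right thus ?thesis by(simp add: d o)
 next
  case scalar thus ?thesis by(simp add: d o f_closed)
 qed
qed

sublocale K: subgroup K F by(rule F.generate_is_subgroup[OF relations_subset])
sublocale K: normal K F by(rule F.normal_iff_subgroup[THEN iffD2]) (rule K.subgroup_axioms)

lemma carrier_T: "$T = cls ` {c. Poly_Mapping.keys c \<subseteq> S}"
 by(auto simp: base_change_def Let_def carrier_FactGroup tensor_class_def free_Abelian_group_def)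

lemma cls_eq_iff:
 assumes "Poly_Mapping.keys c \<subseteq> S" "Poly_Mapping.keys c' \<subseteq> S"
 shows "cls c = cls c' \<longleftrightarrow> c - c' : K"
proof -
 have cF: "c : $F" "c' : $F" using assms by simp_all
 have m: "c : K #>\<^bsub>F\<^esub> c' \<longleftrightarrow> c - c' : K"
  using K.rcos_module[OF F.group_axioms cF(2,1)] assms by simp
 show ?thesis
 proof
  assume "cls c = cls c'"
  hence "c : K #>\<^bsub>F\<^esub> c'" using F.rcos_self[OF cF(1) K.subgroup_axioms] unfolding tensor_class_def by simp
  thus "c - c' : K" using m by simp
 next
  assume "c - c' : K"
  hence "c : K #>\<^bsub>F\<^esub> c'" using m by simp
  thus "cls c = cls c'" unfolding tensor_class_def
   using F.repr_independence[OF _ cF(2) K.subgroup_axioms, of c] by simp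
 qed
qed

lemma mem_cls: "Poly_Mapping.keys c \<subseteq> S ==> c' : cls c \<longleftrightarrow> Poly_Mapping.keys c' \<subseteq> S & c' - c : K"
proof -
 assume c: "Poly_Mapping.keys c \<subseteq> S"
 have "c' : $F" if "c' : cls c"
  using that c F.r_coset_subset_G[OF K.subset, of c] unfolding tensor_class_def
  by(auto simp del: carrier_free_Abelian_group_iff simp: carrier_free_Abelian_group_iff[symmetric])
 moreover have "c' : cls c \<longleftrightarrow> c' - c : K" if "c' : $F"
  using K.rcos_module[OF F.group_axioms _ that, of c] c unfolding tensor_class_def by simp
 ultimately show ?thesis by auto
qed

lemma cls_self: "Poly_Mapping.keys c \<subseteq> S ==> c : cls c"
 using mem_cls K.one_closed by simp

lemma cls_add: "Poly_Mapping.keys c \<subseteq> S ==> Poly_Mapping.keys c' \<subseteq> S ==> cls c+.T cls c' = cls (c + c')"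
 using K.rcos_sum[of c c'] by(simp add: base_change_def Let_def tensor_class_def)

lemma T_zero: "0_T = cls 0"
 using F.coset_mult_one[OF K.subset] by(simp add: base_change_def Let_def tensor_class_def)

lemma ext_keys:
 assumes "b : $B" "Poly_Mapping.keys c \<subseteq> S" shows "Poly_Mapping.keys (ext b c) \<subseteq> S"
 using assms(2)
proof(induction c rule: frag_induction)
 case (one z) thus ?case using assms(1) by(cases z) (simp add: keys_frag_of)
next
 case (diff c c') thus ?case using keys_diff[of "ext b c" "ext b c'"] by(auto simp: frag_extend_diff)
qed simp

lemma ext_relation:
 assumes b: "b : $B" and r: "r : tensor_relations A M (restrict_scalars f (self_module B))"
 shows "ext b r : tensor_relations A M (restrict_scalars f (self_module B))"
proof -
 let ?N = "restrict_scalars f (self_module B)"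
 from r show ?thesis
 proof(cases rule: relation_cases)
  case (left x x' y)
  hence "ext b r = frag_of (x+.M x', b*.B y) - frag_of (x, b*.B y) - frag_of (x', b*.B y)"
   by(simp add: frag_extend_diff)
  moreover have "b*.B y : $?N" using b left by simp
  ultimately show ?thesis unfolding tensor_relations_def using left by blast
 next
  case (right x y y')
  hence "ext b r = frag_of (x, b*.B y+.?N b*.B y') - frag_of (x, b*.B y) - frag_of (x, b*.B y')"
   using b by(simp add: frag_extend_diff B.r_distr)
  moreover have "b*.B y : $?N" "b*.B y' : $?N" using b right by simp_all
  ultimately show ?thesis unfolding tensor_relations_def using right by blast
 next
  case (scalar a x y)
  hence "ext b r = frag_of (a**.M x, b*.B y) - frag_of (x, a**.?N (b*.B y))"
   using b f_closed[OF scalar(2)] by(simp add: frag_extend_diff B.m_lcomm)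
  moreover have "b*.B y : $?N" using b scalar by simp
  ultimately show ?thesis unfolding tensor_relations_def using scalar by blast
 qed
qed

text \<open>Multiplying the right factor by \<open>b\<close> sends each of the three kinds of
  relations to one of the same kind, hence preserves the subgroup they generate.\<close>

lemma ext_K:
 assumes b: "b : $B" and c: "c : K" shows "ext b c : K"
 using c
proof(induction rule: generate.induct)
 case one thus ?case using K.one_closed by simp
next
 case (incl h) thus ?case using generate.incl ext_relation[OF b] by metis
next
 case (inv h)
 have k: "Poly_Mapping.keys h \<subseteq> S" using subsetD[OF relations_subset inv] by simp
 have "ext b h : K" using generate.incl ext_relation[OF b inv] by metis
 hence "inv\<^bsub>F\<^esub> (ext b h) : K" by(rule K.m_inv_closed)
 thus ?case using k ext_keys[OF b k] by(simp add: frag_extend_minus)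
next
 case (eng h1 h2)
 hence "ext b h1*.F ext b h2 : K" using K.m_closed by blast
 thus ?case by(simp add: frag_extend_add)
qed

lemma cls_smult:
 assumes b: "b : $B" and c: "Poly_Mapping.keys c \<subseteq> S"
 shows "b**.T cls c = cls (ext b c)"
proof -
 have eq: "cls (ext b d) = cls (ext b c)" if d: "d : cls c" for d
 proof -
  have dk: "Poly_Mapping.keys d \<subseteq> S" "d - c : K" using mem_cls[OF c] d by auto
  have "ext b d - ext b c : K" using ext_K[OF b dk(2)] by(simp add: frag_extend_diff)
  thus ?thesis using cls_eq_iff[OF ext_keys[OF b dk(1)] ext_keys[OF b c]] by simp
 qed
 have "b**.T cls c = (\<Union>d\<in>cls c. cls (ext b d))"
  by(simp add: base_change_def Let_def tensor_class_def)
 also have "\<dots> = cls (ext b c)"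
  using cls_self[OF c] by(intro SUP_eq_const) (blast, erule eq)
 finally show ?thesis .
qed

lemma pur_closed: "x : $M ==> b : $B ==> pur x b : $T"
 unfolding pure_def carrier_T by(intro imageI CollectI) (simp add: keys_frag_of)

lemma pur_smult: "x : $M ==> b : $B ==> b' : $B ==> b'**.T pur x b = pur x (b'*.B b)"
 unfolding pure_def by(subst cls_smult) (simp_all add: keys_frag_of)

lemma rel_mem: "r : tensor_relations A M (restrict_scalars f (self_module B)) ==> r : K"
 by(rule generate.incl)

lemma pur_add_left:
 assumes "x : $M" "x' : $M" "b : $B"
 shows "pur (x+.M x') b = pur x b+.T pur x' b"
proof -
 have "frag_of (x+.M x', b) - frag_of (x, b) - frag_of (x', b) : K"
  using assms by(intro rel_mem) (auto simp: tensor_relations_def)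
 hence "frag_of (x+.M x', b) - (frag_of (x, b) + frag_of (x', b)) : K" by(simp add: diff_diff_eq)
 moreover have "Poly_Mapping.keys (frag_of (x, b) + frag_of (x', b)) \<subseteq> S"
  using assms keys_add[of "frag_of (x, b)" "frag_of (x', b)"] by(auto simp: keys_frag_of)
 ultimately show ?thesis unfolding pure_def
  using assms by(subst cls_add) (auto simp: keys_frag_of cls_eq_iff)
qed

lemma pur_add_right:
 assumes "x : $M" "b : $B" "b' : $B"
 shows "pur x (b+.B b') = pur x b+.T pur x b'"
proof -
 have "frag_of (x, b+.B b') - frag_of (x, b) - frag_of (x, b') : K"
  using assms by(intro rel_mem) (auto simp: tensor_relations_def)
 hence "frag_of (x, b+.B b') - (frag_of (x, b) + frag_of (x, b')) : K" by(simp add: diff_diff_eq)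
 moreover have "Poly_Mapping.keys (frag_of (x, b) + frag_of (x, b')) \<subseteq> S"
  using assms keys_add[of "frag_of (x, b)" "frag_of (x, b')"] by(auto simp: keys_frag_of)
 ultimately show ?thesis unfolding pure_def
  using assms by(subst cls_add) (auto simp: keys_frag_of cls_eq_iff)
qed

lemma pur_scalar:
 assumes "x : $M" "a : $A" "b : $B"
 shows "pur (a**.M x) b = pur x (f a*.B b)"
proof -
 have "frag_of (a**.M x, b) - frag_of (x, a**.(restrict_scalars f (self_module B)) b) : K"
 proof(rule rel_mem)
  have "b : $(restrict_scalars f (self_module B))" using assms by simp
  thus "frag_of (a**.M x, b) - frag_of (x, a**.(restrict_scalars f (self_module B)) b)
   : tensor_relations A M (restrict_scalars f (self_module B))"
   unfolding tensor_relations_def using assms by blast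
 qed
 thus ?thesis unfolding pure_def using assms f_closed by(subst cls_eq_iff) (auto simp: keys_frag_of)
qed

lemma T_abelian_group: "abelian_group T"
proof(rule abelian_groupI)
 show "0_T : $T" unfolding T_zero carrier_T by(rule imageI) simp
 fix s t assume "s : $T" "t : $T"
 then obtain c d where c: "s = cls c" "Poly_Mapping.keys c \<subseteq> S" and d: "t = cls d" "Poly_Mapping.keys d \<subseteq> S"
  unfolding carrier_T by blast
 have cd: "Poly_Mapping.keys (c + d) \<subseteq> S" using c d keys_add[of c d] by blast
 show "s+.T t : $T" using c d cd by(simp add: cls_add carrier_T)
 show "s+.T t = t+.T s" using c d by(simp add: cls_add add.commute)
 show "0_T+.T s = s" using c by(simp add: T_zero cls_add)
 show "\<exists>y\<in>$T. y+.T s = 0_T"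
  using c by(intro bexI[of _ "cls (- c)"]) (simp_all add: T_zero cls_add carrier_T keys_minus)
 fix u assume "u : $T"
 then obtain e where e: "u = cls e" "Poly_Mapping.keys e \<subseteq> S" unfolding carrier_T by blast
 have de: "Poly_Mapping.keys (d + e) \<subseteq> S" using e d keys_add[of d e] by blast
 show "s+.T t+.T u = s+.T (t+.T u)" using c d e cd de by(simp add: cls_add add.assoc)
qed

sublocale T: abelian_group T by(rule T_abelian_group)

text \<open>Differences are the inductive step because the free abelian group is exhausted by
  generators and differences; negatives are thereby covered too.\<close>

lemma T_induct [consumes 1, case_names pure diff]:
 assumes t: "t : $T"
  and pure: "!!x b. x : $M ==> b : $B ==> Q (pur x b)"
  and diff: "!!s t. s : $T ==> t : $T ==> Q s ==> Q t ==> Q (s-.T t)"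
 shows "Q t"
proof -
 obtain c where c: "t = cls c" "Poly_Mapping.keys c \<subseteq> S" using t unfolding carrier_T by blast
 have cl: "cls d : $T" if "Poly_Mapping.keys d \<subseteq> S" for d using that unfolding carrier_T by blast
 have m: "cls (d - e) = cls d-.T cls e" if "Poly_Mapping.keys d \<subseteq> S" "Poly_Mapping.keys e \<subseteq> S" for d e
 proof -
  have k: "Poly_Mapping.keys (d - e) \<subseteq> S" using that keys_diff[of d e] by blast
  have "cls d = cls (d - e)+.T cls e" using that k by(simp add: cls_add)
  thus ?thesis using cl[OF k] cl[OF that(2)] by(simp add: a_minus_def T.a_assoc T.r_neg)
 qed
 have Q0: "Q (cls 0)"
 proof -
  have p: "pur 0_M 0_B : $T" by(rule pur_closed) simp_all
  have "Q (pur 0_M 0_B-.T pur 0_M 0_B)" using pure by(intro diff p) simp_all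
  thus ?thesis using p by(simp add: a_minus_def T.r_neg T_zero)
 qed
 have "Poly_Mapping.keys c \<subseteq> S & Q (cls c)"
  using c(2)
 proof(induction c rule: frag_induction)
  case zero show ?case using Q0 by simp
 next
  case (one z)
  thus ?case using pure[of "fst z" "snd z"] by(auto simp: pure_def keys_frag_of)
 next
  case (diff d e)
  hence k: "Poly_Mapping.keys d \<subseteq> S" "Poly_Mapping.keys e \<subseteq> S" "Q (cls d)" "Q (cls e)" by blast+
  have "Q (cls d-.T cls e)" using assms(3)[OF cl[OF k(1)] cl[OF k(2)]] k by blast
  thus ?case using m[OF k(1,2)] keys_diff[of d e] k(1,2) by auto
 qed
 thus ?thesis using c by simp
qed

lemma T_module: "module B T"
proof -
 have sm_add: "b**.T (s+.T t) = b**.T s+.T b**.T t" "b**.T s : $T"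
  if b: "b : $B" and st: "s : $T" "t : $T" for b s t
 proof -
  obtain c d where c: "s = cls c" "Poly_Mapping.keys c \<subseteq> S" and d: "t = cls d" "Poly_Mapping.keys d \<subseteq> S"
   using st unfolding carrier_T by blast
  have cd: "Poly_Mapping.keys (c + d) \<subseteq> S" using c d keys_add[of c d] by blast
  show "b**.T (s+.T t) = b**.T s+.T b**.T t"
   using b c d cd ext_keys[OF b c(2)] ext_keys[OF b d(2)] by(simp add: cls_add cls_smult frag_extend_add)
  show "b**.T s : $T" using b c ext_keys[OF b c(2)] by(simp add: cls_smult carrier_T)
 qed
 have sm_minus: "b**.T (s-.T t) = b**.T s-.T b**.T t"
  if b: "b : $B" and st: "s : $T" "t : $T" for b s t
 proof -
  have d: "s-.T t : $T" using st by simp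
  have "s = (s-.T t)+.T t" using st by(simp add: a_minus_def T.a_assoc T.l_neg)
  hence "b**.T s = b**.T (s-.T t)+.T b**.T t" using sm_add(1)[OF b d st(2)] by simp
  thus ?thesis using sm_add(2)[OF b d d] sm_add(2)[OF b st(2) d] by(simp add: a_minus_def T.a_assoc T.r_neg)
 qed
 show ?thesis
 proof(rule moduleI[OF B T_abelian_group])
  show "b**.T s : $T" if "b : $B" "s : $T" for b s using sm_add(2)[OF that that(2)] .
  show "b**.T (s+.T t) = b**.T s+.T b**.T t"
   if "b : $B" "s : $T" "t : $T" for b s t using sm_add(1)[OF that] .
  fix s assume s: "s : $T"
  show "1_B**.T s = s"
   using s
  proof(induction s rule: T_induct)
   case (pure x b) thus ?case by(simp add: pur_smult)
  next
   case (diff s t) thus ?case by(simp add: sm_minus)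
  qed
  fix a b assume ab: "a : $B" "b : $B"
  show "(a*.B b)**.T s = a**.T (b**.T s)"
   using s
  proof(induction s rule: T_induct)
   case (pure x c) thus ?case using ab by(simp add: pur_smult B.m_assoc)
  next
   case (diff s t) thus ?case using ab sm_add(2)[OF ab(2)] by(simp add: sm_minus)
  qed
  show "(a+.B b)**.T s = a**.T s+.T b**.T s"
   using s
  proof(induction s rule: T_induct)
   case (pure x c) thus ?case using ab by(simp add: pur_smult B.l_distr pur_add_right)
  next
   case (diff s t)
   have cl: "a**.T s : $T" "b**.T s : $T" "a**.T t : $T" "b**.T t : $T"
   using diff ab sm_add(2) by blast+
   show ?case using diff ab cl by(simp add: sm_minus) (simp add: a_minus_def T.minus_add T.a_ac)
  qed
 qed
qed

sublocale T: module B T by(rule T_module)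

text \<open>The elements x \<otimes> 1 generate, since x \<otimes> b is \<open>b\<close> times x
  \<otimes> 1.\<close>

lemma T_subset:
 assumes N: "submodule N B T" and p: "!!x. x : $M ==> pur x 1_B : N"
 shows "$T \<subseteq> N"
proof
 fix t assume "t : $T"
 thus "t : N"
 proof(induction t rule: T_induct)
  case (pure x b)
  have "b**.T pur x 1_B : N" using T.submoduleE(4)[OF N pure(2) p[OF pure(1)]] .
  thus ?case using pure by(simp add: pur_smult)
 next
  case (diff s t) thus ?case using T.submodule_minus_closed[OF N] by blast
 qed
qed

text \<open>The compatibility assumptions make the additive extension of \<open>g\<close> vanish on
  the three kinds of relations, so it is constant on cosets and \<open>the_elem\<close> returns its
  value. Linearity over \<open>B\<close> is kept separate, so that functionals that are linear over
  \<open>A\<close> alone can be lifted as well.\<close>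

lemma tensor_lift_additive:
 assumes P: "abelian_group P"
  and g: "!!x b. x : $M ==> b : $B ==> g (x, b) : $P"
   "!!x x' b. x : $M ==> x' : $M ==> b : $B ==> g (x+.M x', b) = g (x, b)+.P g (x', b)"
   "!!x b b'. x : $M ==> b : $B ==> b' : $B ==> g (x, b+.B b') = g (x, b)+.P g (x, b')"
   "!!a x b. a : $A ==> x : $M ==> b : $B ==> g (a**.M x, b) = g (x, f a*.B b)"
 shows "t : $T ==> tensor_lift P g t : $P"
  and "s : $T ==> t : $T ==> tensor_lift P g (s+.T t) = tensor_lift P g s+.P tensor_lift P g t"
  and "x : $M ==> b : $B ==> tensor_lift P g (pur x b) = g (x, b)"
proof -
 interpret P: abelian_group P by(rule P)
 have gS: "g z : $P" if "z : S" for z using that g(1) by(cases z) auto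
 note ev = tensor_eval_hom[OF P, of S g, OF gS]
 let ?h = "tensor_eval P g"
 interpret H: group_hom F "add_monoid P" ?h
  using ev(1) F.group_axioms P.a_group by(simp add: group_hom_def group_hom_axioms_def)
 have hdiff: "?h (c - d) = ?h c-.P ?h d" if "Poly_Mapping.keys c \<subseteq> S" "Poly_Mapping.keys d \<subseteq> S" for c d
 proof -
  have k: "Poly_Mapping.keys (c - d) \<subseteq> S" using that keys_diff[of c d] by blast
  have "?h (c - d + d) = ?h (c - d)+.P ?h d" using H.hom_mult[of "c - d" d] k that by simp
  thus ?thesis using H.hom_closed[of "c - d"] H.hom_closed[of d] k that
   by(simp add: a_minus_def P.a_assoc P.r_neg)
 qed
 have rel: "?h r = 0_P" if r: "r : tensor_relations A M (restrict_scalars f (self_module B))" for r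
 proof -
  have o: "Poly_Mapping.keys (frag_of (x, y)) \<subseteq> S" if "x : $M" "y : $B" for x y
   using that by(simp add: keys_frag_of)
  have d: "Poly_Mapping.keys (frag_of (x, y) - frag_of (x', y')) \<subseteq> S"
   if "x : $M" "y : $B" "x' : $M" "y' : $B" for x y x' y'
   using that keys_diff[of "frag_of (x, y)" "frag_of (x', y')"] by(auto simp: keys_frag_of)
  from r show ?thesis
  proof(cases rule: relation_cases)
   case (left x x' y)
   hence "?h r = (g (x, y)+.P g (x', y))-.P g (x, y)-.P g (x', y)"
   by(simp add: hdiff d o ev(2) g(2))
   thus ?thesis using left g(1) by(simp add: a_minus_def P.a_ac P.r_neg P.r_neg1)
  next
   case (right x y y')
   hence "?h r = (g (x, y)+.P g (x, y'))-.P g (x, y)-.P g (x, y')"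
   by(simp add: hdiff d o ev(2) g(3))
   thus ?thesis using right g(1) by(simp add: a_minus_def P.a_ac P.r_neg P.r_neg1)
  next
   case (scalar a x y)
   hence "?h r = g (x, f a*.B y)-.P g (x, f a*.B y)"
   using f_closed by(simp add: hdiff o ev(2) g(4))
   thus ?thesis using scalar g(1) f_closed by(simp add: a_minus_def P.r_neg)
  qed
 qed
 have K0: "?h c = 0_P" if "c : K" for c
  using that
 proof(induction rule: generate.induct)
  case one thus ?case using H.hom_one by simp
 next
  case (incl h) thus ?case by(rule rel)
 next
  case (inv h)
  have "h : $F" using relations_subset inv by blast
  hence "?h (inv\<^bsub>F\<^esub> h) = inv\<^bsub>add_monoid P\<^esub> (?h h)" by(rule H.hom_inv)
  thus ?case using rel[OF inv] abelian_group_minusI[OF P.zero_closed P.zero_closed P] by(simp add: a_inv_def[symmetric])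
 next
  case (eng h1 h2)
  have "h1 : $F" "h2 : $F" using eng(1,2) K.subset by blast+
  hence "?h (h1*.F h2) = ?h h1*.(add_monoid P) ?h h2" by(rule H.hom_mult)
  thus ?case using eng(3,4) by simp
 qed
 have lift: "tensor_lift P g (cls c) = ?h c" if c: "Poly_Mapping.keys c \<subseteq> S" for c
 proof -
  have "?h d = ?h c" if "d : cls c" for d
  proof -
   have d: "Poly_Mapping.keys d \<subseteq> S" "d - c : K" using that mem_cls[OF c] by auto
   have "?h d-.P ?h c = 0_P" using hdiff[OF d(1) c] K0[OF d(2)] by simp
   moreover have cl: "?h d : $P" "?h c : $P" using H.hom_closed[of d] H.hom_closed[of c] c d by simp_all
   moreover have "?h d = (?h d-.P ?h c)+.P ?h c" using cl by(simp add: a_minus_def P.a_assoc P.l_neg)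
   ultimately show ?thesis by simp
  qed
  hence "?h ` cls c \<subseteq> {?h c}" by blast
  moreover have "?h c : ?h ` cls c" using cls_self[OF c] by blast
  ultimately have "?h ` cls c = {?h c}" by blast
  thus ?thesis unfolding tensor_lift_def tensor_eval_def by simp
 qed
 show "tensor_lift P g t : $P" if "t : $T"
  using that lift H.hom_closed unfolding carrier_T by auto
 show "tensor_lift P g (pur x b) = g (x, b)" if "x : $M" "b : $B"
  using that unfolding pure_def by(subst lift) (simp_all add: keys_frag_of ev(2))
 show "tensor_lift P g (s+.T t) = tensor_lift P g s+.P tensor_lift P g t" if "s : $T" "t : $T"
 proof -
  obtain c d where c: "s = cls c" "Poly_Mapping.keys c \<subseteq> S" and d: "t = cls d" "Poly_Mapping.keys d \<subseteq> S"
   using \<open>s \<in> carrier T\<close> \<open>t \<in> carrier T\<close> unfolding carrier_T by blast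
  have cd: "Poly_Mapping.keys (c + d) \<subseteq> S" using c d keys_add[of c d] by blast
  show ?thesis using c d cd H.hom_mult[of c d] by(simp add: cls_add lift)
 qed
qed

lemma tensor_lift_linear:
 assumes P: "module B P"
  and g: "!!x. x : $M ==> g x : $P"
   "!!x x'. x : $M ==> x' : $M ==> g (x+.M x') = g x+.P g x'"
   "!!a x. a : $A ==> x : $M ==> g (a**.M x) = f a**.P g x"
 defines "L \<equiv> tensor_lift P (%(x, b). b**.P g x)"
 shows "L : linear_maps B T P" and "!!x b. x : $M ==> b : $B ==> L (pur x b) = b**.P g x"
proof -
 interpret P: module B P by(rule P)
 let ?g = "%(x, b). b**.P g x"
 have 4: "?g (a**.M x, b) = ?g (x, f a*.B b)" if "a : $A" "x : $M" "b : $B" for a x b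
  using that g f_closed P.smult_assoc1[of b "f a" "g x"] by(simp add: B.m_comm)
 have L: "t : $T ==> L t : $P"
   "s : $T ==> t : $T ==> L (s+.T t) = L s+.P L t"
   "x : $M ==> b : $B ==> L (pur x b) = b**.P g x" for s t x b
  unfolding L_def
  using tensor_lift_additive[of P ?g, OF P.abelian_group_axioms _ _ _ 4] g
  by(simp_all add: P.smult_l_distr P.smult_r_distr)
 show "L (pur x b) = b**.P g x" if "x : $M" "b : $B" for x b using L(3)[OF that] .
 have Lm: "L (s-.T t) = L s-.P L t" if st: "s : $T" "t : $T" for s t
 proof -
  have d: "s-.T t : $T" using st by simp
  have "s = (s-.T t)+.T t" using st by(simp add: a_minus_def T.a_assoc T.l_neg)
  hence "L s = L (s-.T t)+.P L t" using L(2)[OF d st(2)] by simp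
  thus ?thesis using L(1)[OF d] L(1)[OF st(2)] by(simp add: a_minus_def P.a_assoc P.r_neg)
 qed
 have Ls: "L (b**.T t) = b**.P L t" if b: "b : $B" and t: "t : $T" for b t
  using t
 proof(induction t rule: T_induct)
  case (pure x c) thus ?case using b g by(simp add: pur_smult L(3) P.smult_assoc1)
 next
  case (diff s t)
  have "b**.T (s-.T t) = b**.T s-.T b**.T t"
   using diff b by(simp add: a_minus_def T.smult_r_distr T.smult_r_minus)
  thus ?case using diff b L(1)
   by(simp add: Lm) (simp add: a_minus_def P.smult_r_distr P.smult_r_minus)
 qed
 show "L : linear_maps B T P" unfolding linear_maps_def using L(1,2) Ls by auto
qed

end

section \<open>Frobenius modulo p, and combinations of powers of one element\<close>

lemma ring_nat_carrier_update [simp]: "ring_nat (A\<lparr>carrier := C\<rparr>) n = ring_nat A n"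
 by(simp add: ring_nat_def add_pow_def nat_pow_def)

lemma ring_nat_closed: "ring A ==> ring_nat A n : $A"
proof -
 assume "ring A"
 then interpret ring A .
 show ?thesis by(simp add: ring_nat_def)
qed

lemma (in cring) mem_PIdl: "a : $R ==> x : PIdl\<^bsub>R\<^esub> a \<longleftrightarrow> (\<exists>y\<in>$R. x = a \<otimes> y)"
 unfolding cgenideal_def using m_comm by auto

lemma frobenius_surjective_mod_p:
 fixes R :: "'a ring" (structure)
 assumes "cring R" "frobenius_surjective p (mod_p p R)" "y : $R"
 shows "\<exists>x\<in>$R. \<exists>z\<in>$R. y = x [^] p \<oplus> ring_nat R p \<otimes> z"
proof -
 interpret cring R by(rule assms(1))
 have [simp]: "ring_nat R p : $R" by(rule ring_nat_closed) (rule ring_axioms)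
 let ?I = "PIdl\<^bsub>R\<^esub> (ring_nat R p)"
 interpret I: ideal ?I R by(rule cgenideal_ideal) simp
 interpret h: ring_hom_ring R "R Quot ?I" "(+>) ?I" by(rule I.rcos_ring_hom_ring)
 obtain c where c: "c : $(R Quot ?I)" "c^.(R Quot ?I) p = ?I +> y"
  using assms h.hom_closed[OF assms(3)] unfolding frobenius_surjective_def mod_p_def by blast
 obtain x where x: "x : $R" "c = ?I +> x"
  using c(1) unfolding FactRing_def A_RCOSETS_def' by auto
 have "?I +> (x [^] n) = (?I +> x)^.(R Quot ?I) n" for n :: nat
  by(induction n) (use x in simp_all)
 hence "?I +> (x [^] p) = ?I +> y" using c(2) x by simp
 hence "y \<ominus> x [^] p : ?I" using quotient_eq_iff_same_a_r_cos[OF I.ideal_axioms assms(3), of "x [^] p"] x by simp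
 then obtain z where z: "z : $R" "y \<ominus> x [^] p = ring_nat R p \<otimes> z" using mem_PIdl[of "ring_nat R p"] by auto
 have "y = x [^] p \<oplus> (y \<ominus> x [^] p)" using assms(3) x by(simp add: a_minus_def a_lcomm r_neg)
 thus ?thesis using x z by auto
qed

text \<open>The value at \<open>x\<close> of a polynomial of degree below \<open>r\<close>. The
  recursion makes shifting, spreading and splitting of coefficients into inductions on
  \<open>r\<close>.\<close>

primrec power_comb :: "('a, 'b) ring_scheme => 'a => (nat => 'a) => nat => 'a"
 where "power_comb A x c 0 = 0_A"
 | "power_comb A x c (Suc r) = power_comb A x c r+.A c r*.A x^.A r"

context cring
begin

lemma power_comb_closed [simp]:
 "x : $R ==> (!!j. j < r ==> c j : $R) ==> power_comb R x c r : $R"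
 by(induction r) auto

lemma power_comb_subring:
 assumes "subring K R" "x : K" shows "(!!j. j < r ==> c j : K) ==> power_comb R x c r : K"
proof(induction r)
 case (Suc r)
 have "x [^] n : K" for n :: nat
  by(induction n) (use assms subringE(3,6)[OF assms(1)] in auto)
 thus ?case using Suc subringE(6,7)[OF assms(1)] by simp
qed (use subringE(2)[OF assms(1)] in simp)

lemma power_comb_cong: "(!!j. j < r ==> c j = c' j) ==> power_comb R x c r = power_comb R x c' r"
 by(induction r) auto

lemma power_comb_add:
 assumes "x : $R"
 shows "(!!j. j < r ==> c j : $R) ==> (!!j. j < r ==> c' j : $R) ==>
  power_comb R x (%j. c j \<oplus> c' j) r = power_comb R x c r \<oplus> power_comb R x c' r"
 by(induction r) (use assms in "auto simp: l_distr a_ac")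

lemma power_comb_smult:
 assumes "x : $R" "a : $R"
 shows "(!!j. j < r ==> c j : $R) ==>
  power_comb R x (%j. a \<otimes> c j) r = a \<otimes> power_comb R x c r"
 by(induction r) (use assms in "auto simp: r_distr m_assoc")

lemma power_comb_zero: "x : $R ==> (!!j. j < r ==> c j = \<zero>) ==> power_comb R x c r = \<zero>"
 by(induction r) auto

lemma power_comb_delta:
 assumes "x : $R" "a : $R"
 shows "power_comb R x (%j. if j = i then a else \<zero>) r = (if i < r then a \<otimes> x [^] i else \<zero>)"
 by(induction r) (use assms in "auto simp: less_Suc_eq")

lemma power_comb_shift:
 assumes "x : $R"
 shows "(!!j. j < r ==> c j : $R) ==>
  power_comb R x (%j. case j of 0 => \<zero> | Suc i => c i) (Suc r) = x \<otimes> power_comb R x c r"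
proof(induction r)
 case (Suc r)
 have "power_comb R x c r : $R" using assms Suc.prems by simp
 thus ?case using Suc.IH Suc.prems assms by(simp add: r_distr m_ac)
qed (use assms in simp)

text \<open>The powers of x^p sit at the multiples of \<open>p\<close> among the powers of
  \<open>x\<close>; each step of the induction passes over the p - 1 exponents in between, whose
  coefficients vanish.\<close>

lemma power_comb_spread:
 assumes x: "x : $R" and p: "0 < p"
 shows "(!!j. j < r ==> c j : $R) ==>
  power_comb R x (%i. if p dvd i then c (i div p) else \<zero>) (p * r) = power_comb R (x [^] p) c r"
proof(induction r)
 case (Suc r)
 let ?c = "%i. if p dvd i then c (i div p) else \<zero>"
 have cl: "power_comb R (x [^] p) c r : $R" using x Suc.prems by simp
 have "power_comb R x ?c (p * r + Suc s) = power_comb R (x [^] p) c r \<oplus> c r \<otimes> (x [^] p) [^] r" if "s < p" for s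
  using that
 proof(induction s)
  case 0
  thus ?case using Suc.IH Suc.prems p x by(simp add: nat_pow_pow)
 next
  case (Suc s)
  have "\<not> p dvd p * r + Suc s" using Suc.prems
   by(metis dvd_add_right_iff dvd_triv_left less_Suc_eq_0_disj nat_dvd_not_less old.nat.distinct(2) zero_less_Suc)
  thus ?case using Suc \<open>!!j. j < Suc r ==> c j \<in> carrier R\<close> x cl by simp
 qed
 from this[of "p - 1"] show ?case using p by(simp add: algebra_simps)
qed simp

end

section \<open>The ramified rings V[p^(1/p^e)]\<close>

locale ramified_tower =
 fixes p :: nat and W :: "'w ring" and V :: "'w set" and \<pi> :: "nat => 'w"
 assumes p: "Factorial_Ring.prime p"
  and W: "domain W" and V: "subring V W" and dvr: "complete_mixed_dvr p (W\<lparr>carrier := V\<rparr>)"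
  and roots: "compatible_roots p W \<pi>"
begin

sublocale domain W by(rule W)

abbreviation "P \<equiv> ring_nat W p"
abbreviation "Ve e \<equiv> ring.simple_extension W V (\<pi> e)"

lemma P_closed [simp]: "P : $W"
 by(rule ring_nat_closed) (rule ring_axioms)

lemma p0: "0 < p" using p prime_gt_0_nat by blast

lemma \<pi>_closed [simp]: "\<pi> e : $W"
 and \<pi>_0: "\<pi> 0 = P" and \<pi>_Suc: "\<pi> (Suc e)^.W p = \<pi> e"
 using roots by(auto simp: compatible_roots_def)

lemma \<pi>_pow: "\<pi> (e + j)^.W (p ^ j) = \<pi> e"
proof(induction j)
 case (Suc j)
 have "\<pi> (e + Suc j)^.W (p ^ Suc j) = (\<pi> (Suc (e + j))^.W p)^.W (p ^ j)"
  by(simp add: nat_pow_pow)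
 thus ?case using Suc by(simp add: \<pi>_Suc)
qed simp

lemma \<pi>_pow_P: "\<pi> e^.W (p ^ e) = P"
 using \<pi>_pow[of 0 e] \<pi>_0 by simp

lemma V_sub: "V \<subseteq> $W" using subringE(1)[OF V] .

lemma Ve_subring: "subring (Ve e) W"
 by(rule simple_extension_is_subring[OF V]) simp

lemma Ve_sub: "Ve e \<subseteq> $W" using subringE(1)[OF Ve_subring] .

lemma V_Ve: "V \<subseteq> Ve e"
 by(rule simple_extension_incl) (use V_sub in auto)

lemma \<pi>_Ve: "\<pi> e : Ve e"
 by(rule simple_extension_mem[OF V]) simp

lemma subring_pow: "subring K W ==> x : K ==> x^.W (n::nat) : K"
 by(induction n) (auto simp: subringE)

lemma Ve_Suc: "Ve e \<subseteq> Ve (Suc e)"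
 using subring_pow[OF Ve_subring \<pi>_Ve, of "Suc e" p] V_Ve
 by(intro simple_extension_subring_incl[OF Ve_subring]) (auto simp: \<pi>_Suc)

lemma Ve_mono: "e \<le> e' ==> Ve e \<subseteq> Ve e'"
 using Ve_Suc by(rule lift_Suc_mono_le)

lemma V_cring: "cring (W\<lparr>carrier := V\<rparr>)"
 using subring_is_domain[OF V] by(rule domain.axioms)

lemma V_PIdl: "x : PIdl\<^bsub>W\<lparr>carrier := V\<rparr>\<^esub> P \<longleftrightarrow> (\<exists>y\<in>V. x = P*.W y)"
 and P_V: "P : V"
proof -
 interpret V: cring "W\<lparr>carrier := V\<rparr>" by(rule V_cring)
 show "P : V" using ring_nat_closed[OF V.ring_axioms, of p] by simp
 thus "x : PIdl\<^bsub>W\<lparr>carrier := V\<rparr>\<^esub> P \<longleftrightarrow> (\<exists>y\<in>V. x = P*.W y)" using V.mem_PIdl[of P x] by simp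
qed

lemma P_not_unit: "v : V ==> P*.W v ~= 1_W"
proof
 assume v: "v : V" "P*.W v = 1_W"
 interpret M: maximalideal "PIdl\<^bsub>W\<lparr>carrier := V\<rparr>\<^esub> P" "W\<lparr>carrier := V\<rparr>"
  using dvr by(simp add: complete_mixed_dvr_def)
 have "1_W : PIdl\<^bsub>W\<lparr>carrier := V\<rparr>\<^esub> P" using v V_PIdl by metis
 hence "PIdl\<^bsub>W\<lparr>carrier := V\<rparr>\<^esub> P = V" using M.one_imp_carrier by simp
 thus False using M.I_notcarr by simp
qed

text \<open>The ideal of \<open>P\<close> is maximal in \<open>V\<close>, so together with an
  element outside it it generates the unit ideal.\<close>

lemma V_unit_mod_P:
 assumes v: "v : V" and n: "!!y. y : V ==> v ~= P*.W y"
 shows "\<exists>u\<in>V. \<exists>w\<in>V. u*.W v = 1_W+.W P*.W w"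
proof -
 let ?V = "W\<lparr>carrier := V\<rparr>" let ?I = "PIdl\<^bsub>?V\<^esub> P"
 interpret V: cring ?V by(rule V_cring)
 interpret M: maximalideal ?I ?V using dvr by(simp add: complete_mixed_dvr_def)
 interpret J: ideal "PIdl\<^bsub>?V\<^esub> v" ?V by(rule V.cgenideal_ideal) (use v in simp)
 have S: "ideal (?I <+>\<^bsub>?V\<^esub> PIdl\<^bsub>?V\<^esub> v) ?V"
  by(rule V.add_ideals[OF M.ideal_axioms J.ideal_axioms])
 have I: "?I \<subseteq> ?I <+>\<^bsub>?V\<^esub> PIdl\<^bsub>?V\<^esub> v"
 proof
  fix x assume x: "x : ?I"
  have "x = x+.?V 0_?V" using M.a_subset x by(intro V.r_zero[symmetric]) auto
  thus "x : ?I <+>\<^bsub>?V\<^esub> PIdl\<^bsub>?V\<^esub> v"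
   unfolding set_add_defs using x J.zero_closed by auto
 qed
 have "v : ?I <+>\<^bsub>?V\<^esub> PIdl\<^bsub>?V\<^esub> v"
 proof -
  have "v = 0_?V+.?V v" using v by(intro V.l_zero[symmetric]) simp
  moreover have "v : PIdl\<^bsub>?V\<^esub> v" using V.cgenideal_self[of v] v by simp
  ultimately show ?thesis unfolding set_add_defs using M.zero_closed by auto
 qed
 moreover have "v \<notin> ?I" using n V_PIdl by blast
 ultimately have "?I <+>\<^bsub>?V\<^esub> PIdl\<^bsub>?V\<^esub> v = V"
  using M.I_maximal[OF S I] S ideal.Icarr[OF S] by auto
 hence "1_W : ?I <+>\<^bsub>?V\<^esub> PIdl\<^bsub>?V\<^esub> v" using subringE(3)[OF V] by simp
 then obtain a b where ab: "a : ?I" "b : PIdl\<^bsub>?V\<^esub> v" "1_W = a+.W b"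
  unfolding set_add_defs by auto
 obtain y where y: "y : V" "a = P*.W y" using ab V_PIdl by blast
 obtain u where u: "u : V" "b = u*.W v" using ab(2) unfolding cgenideal_def by auto
 have cl: "y : $W" "u : $W" "v : $W" using y u v V_sub by auto
 have "u*.W v = 1_W+.W P*.W (-.W y)"
  unfolding ab(3) y u using cl a_comm[of "P*.W y" "u*.W v"] by(simp add: r_minus a_assoc r_neg)
 thus ?thesis using u(1) subringE(5)[OF V y(1)] by blast
qed

text \<open>Adic completeness includes that the powers of the ideal of \<open>P\<close> intersect in
  zero, and a multiple of P^t lies in the t-th power.\<close>

lemma V_separated:
 assumes v: "v : V" and n: "!!t::nat. \<exists>y\<in>V. v = P^.W t*.W y"
 shows "v = 0_W"
proof -
 let ?V = "W\<lparr>carrier := V\<rparr>" let ?I = "PIdl\<^bsub>?V\<^esub> P"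
 interpret V: cring ?V by(rule V_cring)
 have "P^.W t*.W y : ideal_power ?V ?I t" if "y : V" for t :: nat and y
  using that
 proof(induction t arbitrary: y)
  case 0
  thus ?case using V_sub by(auto simp: ideal_power_def ideals_set_def)
 next
  case (Suc t)
  have "(P^.W t*.W 1_W)*.?V (P*.W y) : ideal_prod ?V (ideal_power ?V ?I t) ?I"
   using Suc.IH[OF subringE(3)[OF V]] Suc.prems V_PIdl by(intro ideal_prod.prod) blast+
  moreover have "(P^.W t*.W 1_W)*.?V (P*.W y) = P^.W Suc t*.W y"
   using Suc.prems V_sub by(auto simp: m_assoc)
  ultimately show ?case by(simp add: ideal_power_def ideals_set_def)
 qed
 hence "v : (\<Inter>t. ideal_power ?V ?I t)" using n by(metis INT_I)
 moreover have "(\<Inter>t. ideal_power ?V ?I t) = {0_W}"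
  using dvr unfolding complete_mixed_dvr_def adically_complete_def ring_nat_carrier_update by(elim conjE) simp
 ultimately show ?thesis by simp
qed

lemma V_perfect: "v : V ==> \<exists>u\<in>V. \<exists>w\<in>V. v = u^.W p+.W P*.W w"
 using frobenius_surjective_mod_p[OF V_cring, of p v] dvr
 by(simp add: complete_mixed_dvr_def nat_pow_def)

lemma P_nonzero: "P ~= 0_W"
 using dvr p0 unfolding complete_mixed_dvr_def by simp

lemma \<pi>_nonzero: "\<pi> e ~= 0_W"
proof
 assume "\<pi> e = 0_W"
 hence "P = 0_W" using \<pi>_pow_P[of e] p0 by(simp add: nat_pow_zero)
 thus False using P_nonzero by simp
qed

text \<open>A simple extension is built by Horner steps. Multiplication by \<open>\<pi> e\<close>
  shifts the coefficients, and the top one wraps around to degree zero with factor \<open>P\<close>,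
  since the p^e-th power of \<open>\<pi> e\<close> is \<open>P\<close>.\<close>

lemma Ve_power_comb:
 assumes "w : Ve e"
 shows "\<exists>c. (\<forall>j. c j : V) & w = power_comb W (\<pi> e) c (p ^ e)"
 using assms
proof(induction rule: simple_extension.induct)
 case zero
 show ?case using power_comb_zero[of "\<pi> e" "p ^ e" "%_. 0_W"] subringE(2)[OF V] by(metis \<pi>_closed)
next
 case (lin k1 k2)
 then obtain c where c: "!!j. c j : V" "k1 = power_comb W (\<pi> e) c (p ^ e)" by blast
 obtain N where N: "p ^ e = Suc N" using p0 by(metis gr0_implies_Suc zero_less_power)
 have cW: "c j : $W" "k2 : $W" for j using c lin V_sub by auto
 define c' where "c' = (%j. (case j of 0 => 0_W | Suc i => c i)+.W (if j = 0 then P*.W c N+.W k2 else 0_W))"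
 have pc: "power_comb W (\<pi> e) c N : $W" using cW by simp
 have "k1*.W \<pi> e = \<pi> e*.W power_comb W (\<pi> e) c N+.W c N*.W \<pi> e^.W Suc N"
  unfolding c(2) N using cW pc by(simp add: l_distr r_distr m_ac)
 also have "\<pi> e^.W Suc N = P" using \<pi>_pow_P[of e] N by simp
 finally have k1: "k1*.W \<pi> e+.W k2 = \<pi> e*.W power_comb W (\<pi> e) c N+.W (P*.W c N+.W k2)"
  using cW pc by(simp add: m_comm a_assoc)
 have "power_comb W (\<pi> e) c' (Suc N) = power_comb W (\<pi> e) (%j. case j of 0 => 0_W | Suc i => c i) (Suc N)+.W
   power_comb W (\<pi> e) (%j. if j = 0 then P*.W c N+.W k2 else 0_W) (Suc N)"
  unfolding c'_def using cW by(intro power_comb_add) (auto split: nat.split)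
 also have "\<dots> = k1*.W \<pi> e+.W k2"
  unfolding k1 using cW by(subst power_comb_shift, simp, simp, subst power_comb_delta) simp_all
 finally have eq: "k1*.W \<pi> e+.W k2 = power_comb W (\<pi> e) c' (p ^ e)" unfolding N by simp
 have "c' j : V" for j
  unfolding c'_def using c lin(2) P_V subringE(2,6,7)[OF V] by(auto split: nat.split)
 thus ?case using eq by blast
qed

text \<open>A Nakayama argument. If P y = 1, the multiple of the r-th power of
  \<open>\<pi> e\<close> by \<open>s\<close> is \<open>P\<close> times a combination of powers up to
  \<open>r\<close>; a further factor congruent to 1 modulo \<open>P\<close> expresses it by lower
  powers. Descending in \<open>r\<close> gives an \<open>s\<close> congruent to 1 modulo
  \<open>P\<close> that kills \<open>Ve e\<close>. Then s = 0, and \<open>P\<close> would be a unit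
  of \<open>V\<close>.\<close>

lemma P_not_unit_Ve: "y : Ve e ==> P*.W y ~= 1_W"
proof
 assume y: "y : Ve e" "P*.W y = 1_W"
 let ?x = "\<pi> e"
 have yW: "y : $W" using y Ve_sub by blast
 note VE = subringE[OF V] and VeE = subringE[OF Ve_subring]
 have "r \<le> p ^ e ==> \<exists>s\<in>V. (\<exists>w\<in>V. s = 1_W+.W P*.W w) \<and>
   (\<forall>z\<in>Ve e. \<exists>c. (\<forall>j. c j : V) & s*.W z = power_comb W ?x c r)" for r
 proof(induction "p ^ e - r" arbitrary: r)
  case 0
  hence r: "r = p ^ e" by simp
  have "\<exists>c. (\<forall>j. c j : V) & 1_W*.W z = power_comb W ?x c r" if "z : Ve e" for z
   using Ve_power_comb[OF that] Ve_sub that r by(metis l_one subsetD)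
  moreover have "1_W = 1_W+.W P*.W 0_W" by simp
  ultimately show ?case using VE(2,3) by blast
 next
  case (Suc k)
  hence "k = p ^ e - Suc r" "Suc r \<le> p ^ e" by simp_all
  from Suc.hyps(1)[OF this] obtain s w where s: "s : V" "w : V" "s = 1_W+.W P*.W w"
   "!!z. z : Ve e ==> \<exists>c. (\<forall>j. c j : V) & s*.W z = power_comb W ?x c (Suc r)" by blast
  have sW: "s : $W" "w : $W" using s V_sub by auto
  have g: "?x^.W r : Ve e" using subring_pow[OF Ve_subring \<pi>_Ve] .
  have gW: "?x^.W r : $W" by simp
  have yg: "y*.W ?x^.W r : Ve e" using VeE(6)[OF y(1) g] .
  obtain c where c: "!!j. c j : V" "s*.W (y*.W ?x^.W r) = power_comb W ?x c (Suc r)"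
   using s(4)[OF yg] by blast
  have cW: "c j : $W" for j using c V_sub by blast
  \<comment> \<open>The subtracted term cancels the coefficient with which the r-th power reappears
    on the right.\<close>
  let ?t = "s-.W P*.W c r"
  have tV: "?t : V" unfolding a_minus_def using s c P_V VE(5-7) by simp
  have tW: "?t : $W" using tV V_sub by blast
  define q where "q = power_comb W ?x c r"
  have qW: "q : $W" unfolding q_def using cW by simp
  have "s*.W ?x^.W r = (P*.W y)*.W (s*.W ?x^.W r)" using y sW gW by simp
  also have "\<dots> = P*.W (s*.W (y*.W ?x^.W r))" using yW sW gW by(simp add: m_ac)
  also have "\<dots> = P*.W q+.W (P*.W c r)*.W ?x^.W r"
   unfolding c(2) using qW cW gW by(simp add: q_def[symmetric] r_distr m_assoc)
  finally have sx: "s*.W ?x^.W r = P*.W q+.W (P*.W c r)*.W ?x^.W r" .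
  have "?t*.W ?x^.W r = s*.W ?x^.W r-.W (P*.W c r)*.W ?x^.W r"
   using sW cW gW by(simp add: a_minus_def l_distr l_minus)
  also have "\<dots> = P*.W q" unfolding sx using qW cW gW by(simp add: a_minus_def a_assoc r_neg)
  finally have tx: "?t*.W ?x^.W r = P*.W q" .
  have "\<exists>c'. (\<forall>j. c' j : V) & (?t*.W s)*.W z = power_comb W ?x c' r" if z: "z : Ve e" for z
  proof -
   obtain b where b: "!!j. b j : V" "s*.W z = power_comb W ?x b (Suc r)" using s(4)[OF z] by blast
   have bW: "b j : $W" for j using b V_sub by blast
   have zW: "z : $W" using z Ve_sub by blast
   define h where "h = power_comb W ?x b r"
   have hW: "h : $W" unfolding h_def using bW by simp
   have "(?t*.W s)*.W z = ?t*.W (h+.W b r*.W ?x^.W r)"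
   using b(2) tW sW zW by(simp add: m_assoc h_def)
   also have "\<dots> = ?t*.W h+.W b r*.W (?t*.W ?x^.W r)"
   using tW hW bW gW by(simp add: r_distr m_lcomm)
   also have "\<dots> = ?t*.W h+.W (b r*.W P)*.W q" unfolding tx using bW qW by(simp add: m_assoc)
   also have "\<dots> = power_comb W ?x (%j. ?t*.W b j+.W (b r*.W P)*.W c j) r"
   using tW bW cW by(subst power_comb_add) (simp_all add: power_comb_smult h_def q_def)
   finally show ?thesis using tV b(1) c(1) P_V VE(6,7)
   by(intro exI[of _ "%j. ?t*.W b j+.W (b r*.W P)*.W c j"]) simp
  qed
  moreover have "?t*.W s = 1_W+.W P*.W ((w-.W c r)+.W ?t*.W w)"
  proof -
   have t1: "?t = 1_W+.W P*.W (w-.W c r)" unfolding s(3)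
   using sW cW by(simp add: a_minus_def r_distr r_minus a_assoc)
   have "?t*.W s = ?t+.W P*.W (?t*.W w)"
   by(subst (2) s(3)) (use tW sW in "simp add: r_distr m_ac")
   also have "\<dots> = 1_W+.W P*.W (w-.W c r)+.W P*.W (?t*.W w)" by(subst (1) t1) (rule refl)
   finally show ?thesis using sW cW tW by(simp add: r_distr a_assoc)
  qed
  moreover have "(w-.W c r)+.W ?t*.W w : V" using s(2) c(1) tV VE(5-7) unfolding a_minus_def by simp
  moreover have "?t*.W s : V" using tV s VE(6) by blast
  ultimately show ?case by blast
 qed
 from this[of 0] obtain s w where s: "s : V" "w : V" "s = 1_W+.W P*.W w" "!!z. z : Ve e ==> s*.W z = 0_W"
  by auto
 have sW: "s : $W" "w : $W" using s V_sub by auto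
 have "s = 0_W" using s(4)[OF VeE(3)] sW by simp
 hence "1_W =-.W (P*.W w)" using s(3) sW by(simp add: minus_equality)
 hence "P*.W (-.W w) = 1_W" using sW by(simp add: r_minus)
 thus False using P_not_unit VE(5)[OF s(2)] by blast
qed

text \<open>Raising to the power p^e turns an inverse of \<open>\<pi> e\<close> into an inverse of
  \<open>P\<close>.\<close>

lemma \<pi>_not_unit: "y : Ve e ==> \<pi> e*.W y ~= 1_W"
proof
 assume y: "y : Ve e" "\<pi> e*.W y = 1_W"
 have yW: "y : $W" using y Ve_sub by blast
 have "P*.W y^.W (p ^ e) = (\<pi> e*.W y)^.W (p ^ e)"
  using yW by(simp add: nat_pow_distrib \<pi>_pow_P)
 hence "P*.W y^.W (p ^ e) = 1_W" using y by simp
 thus False using P_not_unit_Ve subring_pow[OF Ve_subring y(1)] by blast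
qed

lemma power_comb_split:
 assumes x: "x : $W" and c: "!!j. c j : $W"
 shows "power_comb W x c (s + r) = power_comb W x c s+.W x^.W s*.W power_comb W x (%i. c (s + i)) r"
proof(induction r)
 case 0 thus ?case using x c by simp
next
 case (Suc r)
 have "x^.W (s + r) = x^.W s*.W x^.W r" using x by(simp add: nat_pow_mult)
 thus ?case using Suc x c by(simp add: r_distr a_assoc m_lcomm)
qed

text \<open>The Eisenstein argument for independence. After division by the largest power of
  \<open>P\<close> common to all coefficients, take the first one, at \<open>j0\<close>, that
  \<open>P\<close> does not divide. All other terms are divisible by the power of
  \<open>\<pi> e\<close> with exponent j0 + 1, so this coefficient is a multiple of
  \<open>\<pi> e\<close>; being invertible modulo \<open>P\<close>, it would make
  \<open>\<pi> e\<close> a unit.\<close>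

lemma power_comb_eq_zero:
 assumes c: "!!j. c j : V" and z: "power_comb W (\<pi> e) c (p ^ e) = 0_W" and j: "j < p ^ e"
 shows "c j = 0_W"
proof(rule ccontr)
 let ?x = "\<pi> e" let ?N = "p ^ e"
 note VE = subringE[OF V] and VeE = subringE[OF Ve_subring]
 assume nz: "c j ~= 0_W"
 define D where "D = (%t::nat. \<forall>j<?N. \<exists>y\<in>V. c j = P^.W t*.W y)"
 have D0: "D 0" unfolding D_def using c V_sub by(auto intro!: bexI[OF _ c] simp: subset_iff)
 \<comment> \<open>Otherwise every power of \<open>P\<close> would divide all coefficients, and
   separatedness would make \<open>c j\<close> zero.\<close>
 have "\<exists>t. D t & \<not> D (Suc t)"
 proof(rule ccontr)
  assume "\<not> ?thesis"
  hence "D t" for t by(induction t) (use D0 in auto)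
  hence "c j = 0_W" using V_separated[OF c, of j] j unfolding D_def by blast
  thus False using nz by simp
 qed
 then obtain t where t: "D t" "\<not> D (Suc t)" by blast
 define y where "y = (%j. if j < ?N then (SOME y. y : V & c j = P^.W t*.W y) else 0_W)"
 have y1: "y j : V & c j = P^.W t*.W y j" if "j < ?N" for j
 proof -
  have "\<exists>y. y : V & c j = P^.W t*.W y" using t(1) that unfolding D_def by blast
  from someI_ex[OF this] show ?thesis unfolding y_def using that by simp
 qed
 have yV: "y j : V" for j using y1 VE(2) by(cases "j < ?N") (auto simp: y_def)
 hence yW: "y j : $W" for j using V_sub by blast
 have Pt: "P^.W t ~= 0_W" using P_nonzero by(induction t) (auto simp: integral_iff)
 have "P^.W t*.W power_comb W ?x y ?N = power_comb W ?x (%j. P^.W t*.W y j) ?N"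
  using yW by(subst power_comb_smult) simp_all
 also have "\<dots> = 0_W" unfolding z[symmetric] using y1 by(intro power_comb_cong) simp
 finally have py: "power_comb W ?x y ?N = 0_W" using Pt yW by(simp add: integral_iff)
 define U where "U = (%j. j < ?N & (\<forall>z\<in>V. y j ~= P*.W z))"
 have exU: "\<exists>j. U j"
 proof -
  from t(2) obtain j where j: "j < ?N" "!!z. z : V ==> c j ~= P^.W Suc t*.W z" unfolding D_def by blast
  have "y j ~= P*.W z" if z: "z : V" for z
  proof
   assume "y j = P*.W z"
   hence "c j = P^.W Suc t*.W z" using y1[OF j(1)] z V_sub by(auto simp: m_assoc)
   thus False using j(2)[OF z] by simp
  qed
  thus ?thesis using j unfolding U_def by blast
 qed
 define j0 where "j0 = (LEAST j. U j)"
 have Uj0: "U j0" unfolding j0_def using exU by(rule LeastI_ex)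
 have less: "\<exists>z\<in>V. y i = P*.W z" if "i < j0" for i
 proof -
  have "\<not> U i" using not_less_Least[of i U] that unfolding j0_def by simp
  thus ?thesis using that Uj0 unfolding U_def by auto
 qed
 define u where "u = (%i. if i < j0 then (SOME z. z : V & y i = P*.W z) else 0_W)"
 have u1: "u i : V & y i = P*.W u i" if "i < j0" for i
 proof -
  have "\<exists>z. z : V & y i = P*.W z" using less[OF that] by blast
  from someI_ex[OF this] show ?thesis unfolding u_def using that by simp
 qed
 have uV: "u j : V" for j using u1 VE(2) by(cases "j < j0") (auto simp: u_def)
 hence uW: "u j : $W" for j using V_sub by blast
 define a where "a = power_comb W ?x u j0"
 define b where "b = power_comb W ?x (%i. y (Suc j0 + i)) (?N - Suc j0)"
 have aVe: "a : Ve e" unfolding a_def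
  by(rule power_comb_subring[OF Ve_subring \<pi>_Ve]) (rule subsetD[OF V_Ve uV])
 have bVe: "b : Ve e" unfolding b_def
  by(rule power_comb_subring[OF Ve_subring \<pi>_Ve]) (rule subsetD[OF V_Ve yV])
 have abW: "a : $W" "b : $W" using aVe bVe Ve_sub by auto
 define r where "r = ?N - Suc j0"
 have "j0 < ?N" using Uj0 unfolding U_def by blast
 hence N: "?N = Suc j0 + r" unfolding r_def by linarith
 have "power_comb W ?x y j0 = P*.W a"
 proof -
  have "power_comb W ?x y j0 = power_comb W ?x (%i. P*.W u i) j0" using u1 by(intro power_comb_cong) simp
  also have "\<dots> = P*.W a" unfolding a_def using uW by(subst power_comb_smult) simp_all
  finally show ?thesis .
 qed
 \<comment> \<open>As j0 < p^e, the factor \<open>P\<close> of the earlier terms carries the j0-th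
   power of \<open>\<pi> e\<close> and at least one factor more.\<close>
 moreover have PN: "P = ?x^.W j0*.W (?x*.W ?x^.W r)"
 proof -
  have "P = ?x^.W (Suc j0 + r)" using \<pi>_pow_P[of e] N by simp
  also have "\<dots> = ?x^.W Suc j0*.W ?x^.W r" by(simp only: nat_pow_mult[OF \<pi>_closed])
  finally show ?thesis by(simp add: m_assoc)
 qed
 ultimately have y0: "power_comb W ?x y j0 = ?x^.W j0*.W (?x*.W (?x^.W r*.W a))"
  using abW by(simp add: m_assoc)
 have "0_W = power_comb W ?x y (Suc j0 + r)" using py N by simp
 also have "\<dots> = (power_comb W ?x y j0+.W y j0*.W ?x^.W j0)+.W ?x^.W Suc j0*.W b"
  using yW by(subst power_comb_split) (simp_all add: b_def r_def)
 also have "\<dots> = ?x^.W j0*.W ((?x*.W (?x^.W r*.W a)+.W y j0)+.W ?x*.W b)"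
  unfolding y0 using yW abW by(simp add: r_distr m_assoc m_comm[of "y j0"])
 finally have "?x^.W j0*.W ((?x*.W (?x^.W r*.W a)+.W y j0)+.W ?x*.W b) = 0_W" by simp
 moreover have "?x^.W j0 ~= 0_W" using \<pi>_nonzero by(induction j0) (auto simp: integral_iff)
 ultimately have "(?x*.W (?x^.W r*.W a)+.W y j0)+.W ?x*.W b = 0_W"
  using yW abW by(simp add: integral_iff)
 moreover define q where "q = ?x^.W r*.W a+.W b"
 have qVe: "q : Ve e" unfolding q_def using aVe bVe subring_pow[OF Ve_subring \<pi>_Ve] VeE(6,7) by blast
 hence qW: "q : $W" using Ve_sub by blast
 ultimately have "y j0+.W ?x*.W q = 0_W" unfolding q_def using yW abW by(simp add: r_distr a_ac)
 hence yq: "y j0 =-.W (?x*.W q)" using yW qW by(metis minus_equality minus_minus m_closed \<pi>_closed)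
 obtain v w where vw: "v : V" "w : V" "v*.W y j0 = 1_W+.W P*.W w"
  using V_unit_mod_P[OF yV, of j0] Uj0 unfolding U_def by blast
 have vwW: "v : $W" "w : $W" using vw V_sub by auto
 define g where "g = ?x^.W j0*.W ?x^.W r"
 have gVe: "g : Ve e" unfolding g_def using subring_pow[OF Ve_subring \<pi>_Ve] VeE(6) by blast
 have gW: "g : $W" unfolding g_def by simp
 have Pg: "P = ?x*.W g" unfolding g_def by(subst PN) (simp add: m_ac)
 have "1_W = v*.W y j0-.W P*.W w" unfolding vw(3) using vwW by(simp add: a_minus_def a_assoc r_neg)
 also have "\<dots> = ?x*.W (-.W (v*.W q)+.W-.W (g*.W w))"
  unfolding yq Pg using vwW qW gW by(simp add: a_minus_def r_distr r_minus m_ac)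
 finally have "?x*.W (-.W (v*.W q)+.W-.W (g*.W w)) = 1_W" by simp
 moreover have "v : Ve e" "w : Ve e" using vw V_Ve by auto
 hence "-.W (v*.W q)+.W-.W (g*.W w) : Ve e" using qVe gVe by(intro VeE(5-7))
 ultimately show False using \<pi>_not_unit by blast
qed

definition coords :: "nat => 'w => nat => 'w"
 where "coords e w = (SOME c. (\<forall>j. c j : V) & (\<forall>j\<ge>p ^ e. c j = 0_W) & w = power_comb W (\<pi> e) c (p ^ e))"

lemma coords:
 assumes "w : Ve e"
 shows "coords e w j : V" "j \<ge> p ^ e ==> coords e w j = 0_W" "w = power_comb W (\<pi> e) (coords e w) (p ^ e)"
proof -
 obtain c where c: "\<forall>j. c j : V" "w = power_comb W (\<pi> e) c (p ^ e)" using Ve_power_comb[OF assms] by blast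
 let ?c = "%j. if j < p ^ e then c j else 0_W"
 have "(\<forall>j. ?c j : V) & (\<forall>j\<ge>p ^ e. ?c j = 0_W) & w = power_comb W (\<pi> e) ?c (p ^ e)"
  using c subringE(2)[OF V] power_comb_cong[of "p ^ e" c ?c "\<pi> e"] by simp
 hence "\<exists>c. (\<forall>j. c j : V) & (\<forall>j\<ge>p ^ e. c j = 0_W) & w = power_comb W (\<pi> e) c (p ^ e)" by(rule exI[of _ ?c])
 from someI_ex[OF this] show "coords e w j : V" "j \<ge> p ^ e ==> coords e w j = 0_W"
  "w = power_comb W (\<pi> e) (coords e w) (p ^ e)"
  unfolding coords_def by simp_all
qed

text \<open>Uniqueness of coordinates: the difference of two families is a combination with value
  zero.\<close>

lemma coordsI:
 assumes c: "!!j. c j : V" "!!j. j \<ge> p ^ e ==> c j = 0_W" and w: "w = power_comb W (\<pi> e) c (p ^ e)"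
 shows "coords e w = c"
proof
 fix j
 have cW: "c j : $W" for j using c V_sub by blast
 have wVe: "w : Ve e" unfolding w using power_comb_subring[OF Ve_subring \<pi>_Ve] c(1) V_Ve by blast
 let ?k = "coords e w"
 note k = coords[OF wVe]
 have kW: "?k j : $W" for j using k(1) V_sub by blast
 have wW: "w : $W" using wVe Ve_sub by blast
 let ?d = "%j. ?k j+.W (-.W 1_W)*.W c j"
 have "power_comb W (\<pi> e) ?d (p ^ e) = power_comb W (\<pi> e) ?k (p ^ e)+.W power_comb W (\<pi> e) (%j. (-.W 1_W)*.W c j) (p ^ e)"
  using kW cW by(intro power_comb_add) simp_all
 also have "\<dots> = power_comb W (\<pi> e) ?k (p ^ e)+.W (-.W 1_W)*.W power_comb W (\<pi> e) c (p ^ e)"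
  using power_comb_smult[of "\<pi> e" "-.W 1_W" "p ^ e" c] cW by simp
 also have "\<dots> = w+.W (-.W 1_W)*.W w" unfolding k(3)[symmetric] w[symmetric] ..
 also have "\<dots> = 0_W" using wW by(simp add: l_minus r_neg)
 finally have "power_comb W (\<pi> e) ?d (p ^ e) = 0_W" .
 moreover have "?d j : V" for j using k(1) c(1) subringE(3,5,6,7)[OF V] by simp
 ultimately have d0: "j < p ^ e ==> ?d j = 0_W" using power_comb_eq_zero[of ?d e j] by simp
 show "?k j = c j"
 proof(cases "j < p ^ e")
  case True
  have "?k j-.W c j = 0_W" using d0[OF True] cW kW by(simp add: a_minus_def l_minus)
  thus ?thesis using cW kW by simp
 next
  case False thus ?thesis using k(2) c(2) by simp
 qed
qed

lemma coords_W: "w : Ve e ==> coords e w j : $W"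
 using coords(1) V_sub by blast

lemma coords_add:
 assumes "w : Ve e" "w' : Ve e" shows "coords e (w+.W w') = (%j. coords e w j+.W coords e w' j)"
proof(rule coordsI)
 show "w+.W w' = power_comb W (\<pi> e) (%j. coords e w j+.W coords e w' j) (p ^ e)"
  using assms coords_W by(subst power_comb_add) (simp_all add: coords(3)[symmetric])
qed (use assms coords(1,2) subringE(7)[OF V] in simp_all)

lemma coords_smult:
 assumes "w : Ve e" "a : V" shows "coords e (a*.W w) = (%j. a*.W coords e w j)"
proof(rule coordsI)
 have aW: "a : $W" using assms V_sub by blast
 show "a*.W w = power_comb W (\<pi> e) (%j. a*.W coords e w j) (p ^ e)"
  using assms coords_W aW by(subst power_comb_smult) (simp_all add: coords(3)[symmetric])
 show "a*.W coords e w j = 0_W" if "j \<ge> p ^ e" for j using that assms aW by(simp add: coords(2))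
qed (use assms coords(1) subringE(6)[OF V] in simp)

lemma coords_\<pi>:
 assumes w: "w : Ve e"
 shows "coords e (\<pi> e*.W w) =
  (%j. if j < p ^ e then case j of 0 => P*.W coords e w (p ^ e - 1) | Suc i => coords e w i else 0_W)"
proof(rule coordsI)
 let ?c = "coords e w"
 obtain N where N: "p ^ e = Suc N" using p0 by(metis gr0_implies_Suc zero_less_power)
 have cW: "?c j : $W" for j using coords_W[OF w] .
 define q where "q = power_comb W (\<pi> e) ?c N"
 have q: "q : $W" unfolding q_def using cW by simp
 have "\<pi> e*.W w = \<pi> e*.W (q+.W ?c N*.W \<pi> e^.W N)"
  using coords(3)[OF w] N by(simp add: q_def)
 also have "\<dots> = \<pi> e*.W q+.W \<pi> e^.W Suc N*.W ?c N"
  using q cW by(simp add: r_distr m_ac)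
 also have "\<pi> e^.W Suc N = P" using \<pi>_pow_P[of e] N by simp
 finally have pw: "\<pi> e*.W w = \<pi> e*.W q+.W P*.W ?c N" .
 let ?b = "%j. case j of 0 => P*.W ?c N | Suc i => ?c i"
 have "power_comb W (\<pi> e) ?b (Suc N) = power_comb W (\<pi> e) (%j. (case j of 0 => 0_W | Suc i => ?c i)+.W (if j = 0 then P*.W ?c N else 0_W)) (Suc N)"
  using cW by(intro power_comb_cong) (auto split: nat.split)
 also have "\<dots> = power_comb W (\<pi> e) (%j. case j of 0 => 0_W | Suc i => ?c i) (Suc N)+.W
   power_comb W (\<pi> e) (%j. if j = 0 then P*.W ?c N else 0_W) (Suc N)"
  using cW by(intro power_comb_add) (auto split: nat.split)
 also have "power_comb W (\<pi> e) (%j. case j of 0 => 0_W | Suc i => ?c i) (Suc N) = \<pi> e*.W q"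
  unfolding q_def using cW by(intro power_comb_shift) simp_all
 also have "power_comb W (\<pi> e) (%j. if j = 0 then P*.W ?c N else 0_W) (Suc N) = P*.W ?c N"
  using cW by(subst power_comb_delta) simp_all
 finally have "\<pi> e*.W w = power_comb W (\<pi> e) ?b (p ^ e)" using pw N by simp
 also have "\<dots> = power_comb W (\<pi> e) (%j. if j < p ^ e then case j of 0 => P*.W ?c (p ^ e - 1) | Suc i => ?c i else 0_W) (p ^ e)"
  unfolding N diff_Suc_1 by(intro power_comb_cong) simp
 finally show "\<pi> e*.W w = power_comb W (\<pi> e) (%j. if j < p ^ e then case j of 0 => P*.W ?c (p ^ e - 1) | Suc i => ?c i else 0_W) (p ^ e)" .
qed (use coords(1)[OF w] P_V subringE(2,6)[OF V] in "auto split: nat.split")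

lemma coords_\<pi>_pow:
 assumes w: "w : Ve e" and q: "q \<le> p ^ e"
 shows "coords e (\<pi> e^.W q*.W w) =
  (%j. if j < p ^ e then if j < q then P*.W coords e w (j + p ^ e - q) else coords e w (j - q) else 0_W)"
 using q
proof(induction q)
 case 0
 show ?case using w Ve_sub coords(2)[OF w] by(auto simp: fun_eq_iff subset_iff)
next
 case (Suc q)
 have wW: "w : $W" using w Ve_sub by blast
 have m: "\<pi> e^.W q*.W w : Ve e" using w subring_pow[OF Ve_subring \<pi>_Ve] subringE(6)[OF Ve_subring] by blast
 have "\<pi> e^.W Suc q*.W w = \<pi> e*.W (\<pi> e^.W q*.W w)" using wW by(simp add: m_ac)
 thus ?case unfolding coords_\<pi>[OF m] using Suc coords_\<pi>[OF m]
  by(auto simp: fun_eq_iff split: nat.split)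
qed

text \<open>As \<open>\<pi> e\<close> is the p-th power of \<open>\<pi> (Suc e)\<close>, the old
  coordinates reappear at the multiples of \<open>p\<close>.\<close>

lemma coords_Suc:
 assumes w: "w : Ve e" shows "coords (Suc e) w (p * j) = coords e w j"
proof -
 have "coords (Suc e) w = (%i. if p dvd i then coords e w (i div p) else 0_W)"
 proof(rule coordsI)
  have "power_comb W (\<pi> (Suc e)) (%i. if p dvd i then coords e w (i div p) else 0_W) (p * p ^ e) =
   power_comb W (\<pi> (Suc e)^.W p) (coords e w) (p ^ e)"
   using coords_W[OF w] p0 by(intro power_comb_spread) simp_all
  thus "w = power_comb W (\<pi> (Suc e)) (%i. if p dvd i then coords e w (i div p) else 0_W) (p ^ Suc e)"
   using coords(3)[OF w] by(simp add: \<pi>_Suc)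
  fix i assume i: "i \<ge> p ^ Suc e"
  have "i div p \<ge> p ^ e" if "p dvd i" using i that p0 by(simp add: less_eq_div_iff_mult_less_eq mult.commute)
  thus "(if p dvd i then coords e w (i div p) else 0_W) = 0_W" using coords(2)[OF w] by simp
 qed (use coords(1)[OF w] subringE(2)[OF V] in simp)
 thus ?thesis using p0 by simp
qed

lemma coords_level:
 assumes w: "w : Ve e" shows "coords (e + s) w (p ^ s * j) = coords e w j"
proof(induction s)
 case (Suc s)
 have "w : Ve (e + s)" using w Ve_mono[of e "e + s"] by auto
 thus ?case using Suc coords_Suc[of w "e + s" "p ^ s * j"] by(simp add: mult.assoc)
qed simp

text \<open>The coordinate functional, with values in \<open>V[\<pi> n]\<close>, on the union of the \<open>V[\<pi> e]\<close>, belonging to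
 the member \<open>\<pi> m ^ j\<close> of the basis of \<open>V[\<pi> m]\<close> over \<open>V[\<pi> n]\<close>. Exponents of \<open>p\<close> are scaled by
 \<open>p ^ e\<close> at level \<open>e\<close>.\<close>

definition proj_at :: "nat => nat => nat => nat => 'w => 'w"
 where "proj_at n m j e w = power_comb W (\<pi> n) (%i. coords e w (p ^ (e - m) * (i * p ^ (m - n) + j))) (p ^ n)"

definition proj :: "nat => nat => nat => 'w => 'w"
 where "proj n m j w = proj_at n m j (LEAST e. m \<le> e & w : Ve e) w"

text \<open>\<open>proj\<close> reads coordinates at the least admissible level. Raising the level
  multiplies all positions by one power of \<open>p\<close>, which the scaling in
  \<open>proj_at\<close> absorbs.\<close>

lemma proj_eq:
 assumes w: "w : Ve e" "m \<le> e"
 shows "proj n m j w = proj_at n m j e w"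
proof -
 define e0 where "e0 = (LEAST e. m \<le> e & w : Ve e)"
 have e0: "m \<le> e0" "w : Ve e0" using LeastI[of "%e. m \<le> e & w : Ve e" e] w unfolding e0_def by auto
 have "e0 \<le> e" unfolding e0_def using w by(intro Least_le) simp
 then obtain s where s: "e = e0 + s" using le_Suc_ex by blast
 have "p ^ (e - m) = p ^ s * p ^ (e0 - m)" using s e0 by(simp add: power_add[symmetric] add.commute)
 hence "coords e w (p ^ (e - m) * t) = coords e0 w (p ^ (e0 - m) * t)" for t
  using coords_level[OF e0(2), of s "p ^ (e0 - m) * t"] s by(simp add: mult.assoc)
 thus ?thesis unfolding proj_def e0_def[symmetric] proj_at_def by simp
qed

lemma proj_closed: "w : Ve e ==> m \<le> e ==> proj n m j w : Ve n"
 unfolding proj_eq proj_at_def using coords(1) V_Ve by(intro power_comb_subring[OF Ve_subring \<pi>_Ve]) blast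

lemma proj_add:
 assumes "w : Ve e" "w' : Ve e" "m \<le> e"
 shows "proj n m j (w+.W w') = proj n m j w+.W proj n m j w'"
proof -
 have "w+.W w' : Ve e" using assms subringE(7)[OF Ve_subring] by blast
 thus ?thesis using assms coords_W
  by(simp add: proj_eq[of _ e] proj_at_def coords_add power_comb_add)
qed

lemma proj_smult_V:
 assumes "w : Ve e" "a : V" "m \<le> e"
 shows "proj n m j (a*.W w) = a*.W proj n m j w"
proof -
 have "a*.W w : Ve e" using assms subringE(6)[OF Ve_subring] V_Ve by blast
 moreover have "a : $W" using assms V_sub by blast
 ultimately show ?thesis using assms coords_W
  by(simp add: proj_eq[of _ e] proj_at_def coords_smult power_comb_smult)
qed

text \<open>At level \<open>e\<close>, multiplication by \<open>\<pi> n\<close> is a shift by q =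
  p^(e-n). The functional reads the positions i q + r with a fixed remainder \<open>r\<close>, so
  the shift moves \<open>i\<close> to \<open>i + 1\<close>, and the last position wraps around with
  factor \<open>P\<close>, the p^n-th power of \<open>\<pi> n\<close>.\<close>

lemma proj_\<pi>:
 assumes w: "w : Ve e" and nm: "n \<le> m" "m \<le> e" and j: "j < p ^ (m - n)"
 shows "proj n m j (\<pi> n*.W w) = \<pi> n*.W proj n m j w"
proof -
 define q where "q = p ^ (e - n)"
 have pn: "\<pi> n = \<pi> e^.W q" unfolding q_def using \<pi>_pow[of n "e - n"] nm by simp
 have qe: "q * p ^ n = p ^ e" unfolding q_def using nm by(simp add: power_add[symmetric])
 have q: "q \<le> p ^ e" unfolding q_def using p0 by(intro power_increasing) auto
 have qm: "q = p ^ (e - m) * p ^ (m - n)" unfolding q_def using nm by(simp add: power_add[symmetric])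
 have mW: "\<pi> n*.W w : Ve e"
  using w \<pi>_Ve[of n] Ve_mono[of n e] nm subringE(6)[OF Ve_subring] by(meson le_trans subsetD)
 define r where "r = p ^ (e - m) * j"
 have r: "r < q" unfolding r_def qm using j p0 by simp
 have ix: "p ^ (e - m) * (i * p ^ (m - n) + j) = i * q + r" for i unfolding qm r_def by(simp add: algebra_simps)
 obtain N where N: "p ^ n = Suc N" using p0 by(metis gr0_implies_Suc zero_less_power)
 let ?c = "coords e w"
 let ?g = "%i. ?c (i * q + r)"
 have cW: "?c i : $W" for i using coords_W[OF w] .
 have wW: "w : $W" using w Ve_sub by blast
 have bound: "i * q + r < p ^ e" if "i < p ^ n" for i
 proof -
  have "i * q + r < Suc i * q" using r by simp
  also have "\<dots> \<le> p ^ n * q" using that by(intro mult_right_mono) auto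
  finally show ?thesis using qe by(simp add: mult.commute)
 qed
 have cc: "coords e (\<pi> n*.W w) (i * q + r) = (case i of 0 => P*.W ?g N | Suc i' => ?g i')" if i: "i < p ^ n" for i
 proof(cases i)
  case 0
  have "r + p ^ e - q = N * q + r" using qe N r by(simp add: algebra_simps flip: qe)
  thus ?thesis unfolding pn coords_\<pi>_pow[OF w q] using 0 r bound[OF i] by simp
 next
  case (Suc i')
  thus ?thesis unfolding pn coords_\<pi>_pow[OF w q] using bound[OF i] by simp
 qed
 have "proj n m j (\<pi> n*.W w) = power_comb W (\<pi> n) (%i. coords e (\<pi> n*.W w) (i * q + r)) (p ^ n)"
  unfolding proj_eq[OF mW nm(2)] proj_at_def ix ..
 also have "\<dots> = power_comb W (\<pi> n) (%i. (case i of 0 => 0_W | Suc i' => ?g i')+.W (if i = 0 then P*.W ?g N else 0_W)) (p ^ n)"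
  using cc cW by(intro power_comb_cong) (auto split: nat.split)
 also have "\<dots> = power_comb W (\<pi> n) (%i. case i of 0 => 0_W | Suc i' => ?g i') (Suc N)+.W
   power_comb W (\<pi> n) (%i. if i = 0 then P*.W ?g N else 0_W) (Suc N)"
  unfolding N using cW by(intro power_comb_add) (auto split: nat.split)
 also have "\<dots> = \<pi> n*.W power_comb W (\<pi> n) ?g N+.W P*.W ?g N"
  using cW by(subst power_comb_shift, simp, simp, subst power_comb_delta) simp_all
 also have "\<dots> = \<pi> n*.W power_comb W (\<pi> n) ?g (Suc N)"
 proof -
  have PN: "P = \<pi> n*.W \<pi> n^.W N" using \<pi>_pow_P[of n] N by(simp add: m_comm)
  show ?thesis using cW by(subst PN) (simp add: r_distr m_ac)
 qed
 also have "power_comb W (\<pi> n) ?g (Suc N) = proj n m j w"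
  unfolding proj_eq[OF w nm(2)] proj_at_def ix N ..
 finally show ?thesis .
qed

text \<open>Horner induction on \<open>a\<close> reduces linearity to scalars from \<open>V\<close>
  and the single scalar \<open>\<pi> n\<close>.\<close>

lemma proj_smult:
 assumes a: "a : Ve n" and w: "w : Ve e" and nm: "n \<le> m" "m \<le> e" and j: "j < p ^ (m - n)"
 shows "proj n m j (a*.W w) = a*.W proj n m j w"
 using a
proof(induction rule: simple_extension.induct)
 case zero
 have 0: "0_W : V" using subringE(2)[OF V] .
 show ?case using proj_smult_V[OF w 0 nm(2)] .
next
 case (lin k1 k2)
 have wW: "w : $W" "proj n m j w : $W" using w proj_closed[OF w nm(2)] Ve_sub by auto
 have kW: "k1 : $W" "k2 : $W" using lin Ve_sub V_sub by auto
 have ne: "Ve n \<subseteq> Ve e" using Ve_mono nm by simp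
 have k1w: "k1*.W w : Ve e" using lin(1) ne w subringE(6)[OF Ve_subring] by blast
 have "(k1*.W \<pi> n+.W k2)*.W w = \<pi> n*.W (k1*.W w)+.W k2*.W w"
  using kW wW by(simp add: l_distr r_distr m_ac)
 moreover have "\<pi> n*.W (k1*.W w) : Ve e" "k2*.W w : Ve e"
  using k1w \<pi>_Ve[of n] ne lin(2) V_Ve[of e] w subringE(6)[OF Ve_subring] by blast+
 ultimately have "proj n m j ((k1*.W \<pi> n+.W k2)*.W w) = \<pi> n*.W proj n m j (k1*.W w)+.W k2*.W proj n m j w"
  using proj_add[OF _ _ nm(2)] proj_\<pi>[OF k1w nm j] proj_smult_V[OF w lin(2) nm(2)] by simp
 thus ?case using lin(3) kW wW by(simp add: l_distr m_ac)
qed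

lemma proj_basis:
 assumes nm: "n \<le> m" and j: "j < p ^ (m - n)" "j' < p ^ (m - n)"
 shows "proj n m j (\<pi> m^.W j') = (if j = j' then 1_W else 0_W)"
proof -
 have le: "p ^ (m - n) \<le> p ^ m" using p0 by(intro power_increasing) auto
 have w: "\<pi> m^.W j' : Ve m" using subring_pow[OF Ve_subring \<pi>_Ve] .
 have k: "coords m (\<pi> m^.W j') = (%i. if i = j' then 1_W else 0_W)"
 proof(rule coordsI)
  show "\<pi> m^.W j' = power_comb W (\<pi> m) (%i. if i = j' then 1_W else 0_W) (p ^ m)"
   using j(2) le by(subst power_comb_delta) simp_all
 qed (use j(2) le subringE(2,3)[OF V] in auto)
 have eq: "i * p ^ (m - n) + j = j' \<longleftrightarrow> i = 0 & j = j'" for i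
  using j by(cases i) auto
 have "proj n m j (\<pi> m^.W j') = power_comb W (\<pi> n) (%i. if i * p ^ (m - n) + j = j' then 1_W else 0_W) (p ^ n)"
  unfolding proj_eq[OF w order_refl] proj_at_def k by simp
 also have "\<dots> = power_comb W (\<pi> n) (%i. if i = 0 then (if j = j' then 1_W else 0_W) else 0_W) (p ^ n)"
  using eq by(intro power_comb_cong) auto
 also have "\<dots> = (if j = j' then 1_W else 0_W)"
  using p0 by(subst power_comb_delta) simp_all
 finally show ?thesis .
qed

text \<open>All levels have the residue field of \<open>V\<close>. This is why simple steps over
  different levels correspond one to one.\<close>

lemma Ve_cases:
 assumes "w : Ve e" shows "\<exists>k\<in>Ve e. \<exists>v\<in>V. w = v+.W \<pi> e*.W k"
 using assms
proof(cases rule: simple_extension.cases)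
 case zero
 thus ?thesis using subringE(2)[OF V] subringE(2)[OF Ve_subring, of e]
  by(intro bexI[of _ "0_W"]) simp_all
next
 case (lin k v)
 hence "k : $W" "v : $W" using Ve_sub V_sub by auto
 hence "w = v+.W \<pi> e*.W k" using lin by(simp add: a_comm m_comm)
 thus ?thesis using lin by blast
qed

end

section \<open>The tower of power series rings and its dual bases\<close>

lemma (in cring) subring_finsum:
 assumes K: "subring K R" and h: "!!a. a : A ==> h a : K"
 shows "finsum R h A : K"
 using h
proof(induction A rule: infinite_finite_induct)
 case (infinite A) thus ?case using subringE(2)[OF K] by(simp add: finsum_def finprod_def)
next
 case empty thus ?case using subringE(2)[OF K] by simp
next
 case (insert a A)
 hence "finsum R h (insert a A) = h a \<oplus> finsum R h A"
  using subringE(1)[OF K] by(intro finsum_insert) auto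
 thus ?case using insert subringE(7)[OF K] by simp
qed

lemma module_restrict_ring:
 assumes M: "module B M" and A: "cring A" and sub: "$A \<subseteq> $B"
  and ops: "monoid.mult A = monoid.mult B" "add A = add B" "1_A = 1_B"
 shows "module A M"
proof -
 interpret module B M by(rule M)
 show ?thesis
  by(rule moduleI[OF A M.abelian_group_axioms])
   (use sub in "auto simp: ops smult_l_distr smult_r_distr smult_assoc1 subset_iff")
qed

definition single :: "'w ring => (nat => rat) => 'w => 'w series"
 where "single W \<alpha> c = (%\<beta>. if \<beta> = \<alpha> then c else 0_W)"

lemma constant_series_single: "constant_series W c = single W (%_. 0) c"
 by(simp add: constant_series_def single_def)

definition unit_exponent :: "nat => rat => nat => rat"
 where "unit_exponent i r = (%_. 0)(i := r)"

text \<open>That \<open>Rinf\<close> is a domain is supplied by semi-perfectness; the levels obtain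
  their ring axioms as subrings of it.\<close>

locale power_series_tower = ramified_tower p W V \<pi>
 for p :: nat and W :: "'w ring" and V :: "'w set" and \<pi> :: "nat => 'w" +
 fixes d :: nat
 assumes d: "2 \<le> d" and Rinf: "domain (R_infinity p d W V \<pi>)"
begin

abbreviation "SC e \<equiv> series_carrier p d W V \<pi> e"
abbreviation "Exps e \<equiv> exponents p d e"
abbreviation "R m \<equiv> R_level p d W V \<pi> m"
abbreviation "Rinf \<equiv> R_infinity p d W V \<pi>"
abbreviation "const \<equiv> constant_series W"

sublocale S: domain Rinf by(rule Rinf)

lemma R_simps:
 "$(R m) = SC m" "monoid.mult (R m) = monoid.mult Rinf" "add (R m) = add Rinf"
 "1_(R m) = 1_Rinf" "0_(R m) = 0_Rinf"
 by(simp_all add: R_level_def R_infinity_def series_ring_def)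

lemma carrier_Rinf: "$Rinf = (\<Union>e. SC e)"
 by(simp add: R_infinity_def series_ring_def)

lemma one_Rinf: "1_Rinf = const 1_W" and zero_Rinf: "0_Rinf = (%_. 0_W)"
 and add_Rinf: "f+.Rinf g = (%\<alpha>. f \<alpha>+.W g \<alpha>)"
 and mult_Rinf: "f*.Rinf g = (%\<gamma>. \<Oplus>\<^bsub>W\<^esub>\<alpha>\<in>{\<alpha>. f \<alpha> ~= 0_W & g (%i. \<gamma> i - \<alpha> i) ~= 0_W}. f \<alpha>*.W g (%i. \<gamma> i - \<alpha> i))"
 by(simp_all add: R_infinity_def series_ring_def constant_series_def)

lemma Exps_zero: "(%_. 0) : Exps e"
 unfolding exponents_def by(auto intro!: exI[of _ "0::nat"])

lemma Exps_add: "\<alpha> : Exps e ==> \<beta> : Exps e ==> (%i. \<alpha> i + \<beta> i) : Exps e"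
 unfolding exponents_def
proof(intro CollectI conjI ballI; elim CollectE conjE)
 fix i assume "\<forall>i\<in>{2..d}. \<exists>m::nat. \<alpha> i = of_nat m / of_nat (p ^ e)" "\<forall>i\<in>{2..d}. \<exists>m::nat. \<beta> i = of_nat m / of_nat (p ^ e)" "i : {2..d}"
 then obtain m m' :: nat where "\<alpha> i = of_nat m / of_nat (p ^ e)" "\<beta> i = of_nat m' / of_nat (p ^ e)" by blast
 thus "\<exists>m::nat. \<alpha> i + \<beta> i = of_nat m / of_nat (p ^ e)"
  by(intro exI[of _ "m + m'"]) (simp add: add_divide_distrib)
qed auto

lemma Exps_mono: assumes "e \<le> e'" shows "Exps e \<subseteq> Exps e'"
proof
 fix \<alpha> assume a: "\<alpha> : Exps e"
 have "\<exists>m::nat. \<alpha> i = of_nat m / of_nat (p ^ e')" if i: "i : {2..d}" for i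
 proof -
  obtain m :: nat where m: "\<alpha> i = of_nat m / of_nat (p ^ e)" using a i unfolding exponents_def by blast
  have "p ^ e' = p ^ e * p ^ (e' - e)" using assms by(simp add: power_add[symmetric])
  hence "\<alpha> i = of_nat (m * p ^ (e' - e)) / of_nat (p ^ e')" using m p0 by simp
  thus ?thesis by blast
 qed
 thus "\<alpha> : Exps e'" using a unfolding exponents_def by blast
qed

lemma Exps_nonneg: "\<alpha> : Exps e ==> 0 \<le> \<alpha> i"
proof(cases "i : {2..d}")
 case True
 assume "\<alpha> : Exps e"
 then obtain m :: nat where "\<alpha> i = of_nat m / of_nat (p ^ e)" using True unfolding exponents_def by blast
 thus ?thesis by simp
qed (auto simp: exponents_def)

lemma SC_mono: assumes "e \<le> e'" shows "SC e \<subseteq> SC e'"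
proof
 fix f assume f: "f : SC e"
 have "f \<alpha> : Ve e'" if "\<alpha> : Exps e'" for \<alpha>
 proof(cases "\<alpha> : Exps e")
  case True thus ?thesis using f Ve_mono[OF assms] unfolding series_carrier_def by blast
 next
  case False hence "f \<alpha> = 0_W" using f unfolding series_carrier_def by blast
  thus ?thesis using subringE(2)[OF Ve_subring] by simp
 qed
 thus "f : SC e'" using f Exps_mono[OF assms] unfolding series_carrier_def by blast
qed

lemma SC_Ve: "f : SC e ==> f \<alpha> : Ve e"
 unfolding series_carrier_def using subringE(2)[OF Ve_subring] by(cases "\<alpha> : Exps e") auto

lemma SC_outside: "f : SC e ==> \<alpha> \<notin> Exps e ==> f \<alpha> = 0_W"
 unfolding series_carrier_def by blast

lemma SC_I: "(!!\<alpha>. \<alpha> : Exps e ==> f \<alpha> : Ve e) ==> (!!\<alpha>. \<alpha> \<notin> Exps e ==> f \<alpha> = 0_W) ==> f : SC e"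
 unfolding series_carrier_def by blast

lemma SC_Rinf: "SC e \<subseteq> $Rinf" unfolding carrier_Rinf by blast

lemma Rinf_W: "f : $Rinf ==> f \<alpha> : $W"
 unfolding carrier_Rinf using SC_Ve Ve_sub by blast

lemma Rinf_level: assumes "f : $Rinf" obtains e where "m \<le> e" "f : SC e"
proof -
 obtain e where "f : SC e" using assms unfolding carrier_Rinf by blast
 hence "f : SC (max m e)" using SC_mono[of e "max m e"] by auto
 thus thesis using that[of "max m e"] by simp
qed

lemma SC_mult: assumes f: "f : SC e" and g: "g : SC e" shows "f*.Rinf g : SC e"
proof(rule SC_I)
 show "(f*.Rinf g) \<gamma> : Ve e" for \<gamma>
  unfolding mult_Rinf using SC_Ve[OF f] SC_Ve[OF g] subringE(6)[OF Ve_subring]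
  by(intro subring_finsum[OF Ve_subring]) blast
 fix \<gamma> assume n: "\<gamma> \<notin> Exps e"
 have "\<not> (f \<alpha> ~= 0_W & g (%i. \<gamma> i - \<alpha> i) ~= 0_W)" for \<alpha>
 proof
  assume a: "f \<alpha> ~= 0_W & g (%i. \<gamma> i - \<alpha> i) ~= 0_W"
  hence "\<alpha> : Exps e" "(%i. \<gamma> i - \<alpha> i) : Exps e" using SC_outside f g by blast+
  from Exps_add[OF this] show False using n by simp
 qed
 hence "{\<alpha>. f \<alpha> ~= 0_W & g (%i. \<gamma> i - \<alpha> i) ~= 0_W} = {}" by blast
 thus "(f*.Rinf g) \<gamma> = 0_W" unfolding mult_Rinf by(simp only: finsum_empty)
qed

lemma SC_subring: "subring (SC e) Rinf"
proof(rule S.subringI)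
 show "SC e \<subseteq> $Rinf" by(rule SC_Rinf)
 show "1_Rinf : SC e"
  unfolding one_Rinf constant_series_def using Exps_zero subringE(2,3)[OF Ve_subring] by(intro SC_I) auto
 show "f*.Rinf g : SC e" if "f : SC e" "g : SC e" for f g using SC_mult[OF that] .
 show "f+.Rinf g : SC e" if "f : SC e" "g : SC e" for f g
  unfolding add_Rinf using SC_Ve[OF that(1)] SC_Ve[OF that(2)] subringE(7)[OF Ve_subring]
   SC_outside[OF that(1)] SC_outside[OF that(2)] by(intro SC_I) auto
 fix f assume f: "f : SC e"
 have fW: "f \<alpha> : $W" for \<alpha> using SC_Ve[OF f] Ve_sub by blast
 have g: "(%\<alpha>.-.W f \<alpha>) : SC e"
  using SC_Ve[OF f] subringE(5)[OF Ve_subring] SC_outside[OF f] by(intro SC_I) auto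
 have "-.Rinf f = (%\<alpha>.-.W f \<alpha>)"
  using f g SC_Rinf S.abelian_group_axioms fW
  by(intro abelian_group_minusI) (auto simp: add_Rinf zero_Rinf r_neg)
 thus "-.Rinf f : SC e" using g by simp
qed

lemma R_eq: "R m = Rinf\<lparr>carrier := SC m\<rparr>"
 by(simp add: R_level_def R_infinity_def series_ring_def)

lemma R_domain: "domain (R m)"
 unfolding R_eq by(rule S.subring_is_domain[OF SC_subring])

lemma R_cring: "cring (R m)" using R_domain by(rule domain.axioms)

lemma module_R: "module Rinf M ==> module (R m) M"
 by(rule module_restrict_ring[OF _ R_cring]) (use SC_Rinf in "simp_all add: R_simps")

lemma module_R_mono: "n \<le> m ==> module (R m) M ==> module (R n) M"
 by(rule module_restrict_ring[where B = "R m", OF _ R_cring]) (use SC_mono in "simp_all add: R_simps")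

text \<open>Exponents of level \<open>e\<close> are nonnegative with denominator p^e, so \<gamma>
  has finitely many decompositions. Since \<open>finsum\<close> over an infinite set is zero by
  convention, this is what makes the product a genuine convolution.\<close>

lemma finite_support:
 assumes f: "f : SC e" and g: "g : SC e"
 shows "finite {\<alpha>. f \<alpha> ~= 0_W & g (%i. \<gamma> i - \<alpha> i) ~= 0_W}"
proof -
 let ?h = "%u i. if i : {2..d} then of_nat (u i) / of_nat (p ^ e) else (0::rat)"
 let ?B = "\<Pi>\<^sub>E i\<in>{2..d}. {..nat \<lfloor>\<gamma> i * of_nat (p ^ e)\<rfloor>}"
 have "\<alpha> : ?h ` ?B" if a: "\<alpha> : Exps e" "(%i. \<gamma> i - \<alpha> i) : Exps e" for \<alpha>
 proof -
  have "\<forall>i\<in>{2..d}. \<exists>m::nat. \<alpha> i = of_nat m / of_nat (p ^ e)" using a(1) unfolding exponents_def by blast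
  from bchoice[OF this] obtain u :: "nat => nat" where u: "\<forall>i\<in>{2..d}. \<alpha> i = of_nat (u i) / of_nat (p ^ e)" ..
  have "u i \<le> nat \<lfloor>\<gamma> i * of_nat (p ^ e)\<rfloor>" if i: "i : {2..d}" for i
  proof -
   have "\<alpha> i \<le> \<gamma> i" using Exps_nonneg[OF a(2), of i] by simp
   hence "of_nat (u i) \<le> \<gamma> i * of_nat (p ^ e)" using u i p0 by(simp add: pos_divide_le_eq)
   hence "int (u i) \<le> \<lfloor>\<gamma> i * of_nat (p ^ e)\<rfloor>" by(simp add: le_floor_iff)
   thus ?thesis by linarith
  qed
  hence "restrict u {2..d} : ?B" by auto
  moreover have "\<alpha> = ?h (restrict u {2..d})"
   using u a(1) by(auto simp: fun_eq_iff exponents_def)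
  ultimately show ?thesis by blast
 qed
 hence "{\<alpha>. f \<alpha> ~= 0_W & g (%i. \<gamma> i - \<alpha> i) ~= 0_W} \<subseteq> ?h ` ?B"
  using SC_outside[OF f] SC_outside[OF g] by blast
 thus ?thesis by(rule finite_subset) (intro finite_imageI finite_PiE, auto)
qed

lemma single_SC: "\<alpha> : Exps e ==> c : Ve e ==> single W \<alpha> c : SC e"
 unfolding single_def using subringE(2)[OF Ve_subring] by(intro SC_I) auto

lemma single_mult:
 assumes c: "c : $W" and f: "f : $Rinf"
 shows "single W \<alpha> c*.Rinf f = (%\<gamma>. c*.W f (%i. \<gamma> i - \<alpha> i))"
proof
 fix \<gamma>
 let ?A = "{\<beta>. single W \<alpha> c \<beta> ~= 0_W & f (%i. \<gamma> i - \<beta> i) ~= 0_W}"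
 have fW: "f \<beta> : $W" for \<beta> using Rinf_W[OF f] .
 show "(single W \<alpha> c*.Rinf f) \<gamma> = c*.W f (%i. \<gamma> i - \<alpha> i)"
 proof(cases "c = 0_W \<or> f (%i. \<gamma> i - \<alpha> i) = 0_W")
  case True
  hence "?A = {}" by(auto simp: single_def)
  hence "(single W \<alpha> c*.Rinf f) \<gamma> = 0_W" unfolding mult_Rinf by(simp only: finsum_empty)
  thus ?thesis using True c fW by auto
 next
  case False
  hence "?A = {\<alpha>}" by(auto simp: single_def)
  hence "(single W \<alpha> c*.Rinf f) \<gamma> = (\<Oplus>\<^bsub>W\<^esub>\<beta>\<in>{\<alpha>}. single W \<alpha> c \<beta>*.W f (%i. \<gamma> i - \<beta> i))"
   unfolding mult_Rinf by simp
  also have "\<dots> = c*.W f (%i. \<gamma> i - \<alpha> i)" using c fW by(subst finsum_insert) (auto simp: single_def)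
  finally show ?thesis .
 qed
qed

lemma single_mult_single:
 assumes "c : $W" "c' : Ve e" "\<beta> : Exps e"
 shows "single W \<alpha> c*.Rinf single W \<beta> c' = single W (%i. \<alpha> i + \<beta> i) (c*.W c')"
proof -
 have "single W \<beta> c' : $Rinf" using single_SC[OF assms(3,2)] SC_Rinf by blast
 moreover have "(%i. \<gamma> i - \<alpha> i) = \<beta> \<longleftrightarrow> \<gamma> = (%i. \<alpha> i + \<beta> i)" for \<gamma> :: "nat => rat"
  by(auto simp: fun_eq_iff algebra_simps)
 ultimately show ?thesis using assms(1) by(subst single_mult) (auto simp: single_def fun_eq_iff)
qed

lemma const_SC: "v : V ==> const v : SC e"
 unfolding constant_series_single using single_SC[OF Exps_zero] V_Ve by blast

lemma const_Ve_SC: "w : Ve e ==> const w : SC e"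
 unfolding constant_series_single using single_SC[OF Exps_zero] by blast

lemma const_mult_const: "c : $W ==> c' : Ve e ==> const (c*.W c') = const c*.Rinf const c'"
 unfolding constant_series_single using single_mult_single[OF _ _ Exps_zero, of c c' e "%_. 0"] by simp

lemma const_add: "c : $W ==> c' : $W ==> const (c+.W c') = const c+.Rinf const c'"
 by(auto simp: constant_series_def add_Rinf)

lemma const_P: "const P = ring_nat Rinf p"
proof -
 have "const (add_pow W (k::nat) 1_W) = add_pow Rinf k 1_Rinf" for k
 proof(induction k)
  case 0 thus ?case by(simp add: constant_series_def zero_Rinf)
 next
  case (Suc k) thus ?case by(simp add: const_add one_Rinf)
 qed
 thus ?thesis by(simp add: ring_nat_def)
qed

lemma const_pow:
 assumes "c : Ve e" shows "const c^.Rinf (k::nat) = const (c^.W k)"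
proof(induction k)
 case 0 thus ?case by(simp add: one_Rinf)
next
 case (Suc k)
 have "c^.W k : $W" using assms Ve_sub by auto
 thus ?case using Suc const_mult_const[OF _ assms] by simp
qed

text \<open>The p^m-th roots of the parameters, a regular system of parameters of \<open>R m\<close>
  with the root of \<open>p\<close> in position 1.\<close>

definition gen :: "nat => nat => 'w series"
 where "gen m i = (if i = 1 then const (\<pi> m) else single W (unit_exponent i (1 / of_nat (p ^ m))) 1_W)"

definition gens :: "nat => 'w series set" where "gens m = gen m ` {1..d}"

lemma unit_exponent_Exps: "i : {2..d} ==> unit_exponent i (1 / of_nat (p ^ m)) : Exps m"
 unfolding exponents_def unit_exponent_def
 by(auto intro: exI[of _ "1::nat"] exI[of _ "0::nat"])

lemma gen_SC: "i : {1..d} ==> gen m i : SC m"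
 unfolding gen_def using const_Ve_SC[OF \<pi>_Ve] single_SC[OF unit_exponent_Exps subringE(3)[OF Ve_subring]] by auto

lemma gens_SC: "gens m \<subseteq> SC m" unfolding gens_def using gen_SC by blast

lemma finite_gens: "finite (gens m)" unfolding gens_def by simp

lemma gen_pow: assumes i: "i : {1..d}" shows "gen (m + q) i^.Rinf (p ^ q) = gen m i"
proof(cases "i = 1")
 case True
 thus ?thesis unfolding gen_def using const_pow[OF \<pi>_Ve] \<pi>_pow by simp
next
 case False
 hence i2: "i : {2..d}" using i by auto
 let ?r = "1 / of_nat (p ^ (m + q)) :: rat"
 have "single W (unit_exponent i ?r) 1_W^.Rinf (k::nat) = single W (unit_exponent i (of_nat k * ?r)) 1_W" for k
 proof(induction k)
  case 0 thus ?case by(simp add: one_Rinf constant_series_single unit_exponent_def fun_upd_idem)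
 next
  case (Suc k)
  have "(%j. unit_exponent i (of_nat k * ?r) j + unit_exponent i ?r j) = unit_exponent i (of_nat (Suc k) * ?r)"
   by(auto simp: unit_exponent_def fun_eq_iff algebra_simps add_divide_distrib)
  thus ?case
   using Suc single_mult_single[OF one_closed subringE(3)[OF Ve_subring] unit_exponent_Exps[OF i2], of "unit_exponent i (of_nat k * ?r)" "m + q"]
   by simp
 qed
 moreover have "of_nat (p ^ q) * ?r = 1 / of_nat (p ^ m)" using p0 by(simp add: power_add)
 ultimately show ?thesis unfolding gen_def using False by simp
qed

lemma gen_0: "i : {1..d} ==> gen 0 i = parameters p W i"
 unfolding gen_def parameters_def variable_series_def single_def unit_exponent_def using \<pi>_0 by auto

text \<open>Modulo the roots in \<open>gens m\<close> every series is a constant from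
  \<open>V\<close>. The set \<open>J\<close> is only asked to be additive and to contain all
  multiples of the roots, so that sets of scalars moving an element into a given submodule can be
  inserted directly.\<close>

lemma V_add_gens:
 assumes J: "!!f g. f : J ==> g : J ==> f+.Rinf g : J" "0_Rinf : J"
   "!!i f. i : {1..d} ==> f : SC m ==> gen m i*.Rinf f : J"
  and f: "f : SC m"
 shows "\<exists>v\<in>V. \<exists>g\<in>J. f = const v+.Rinf g"
proof -
 have fW: "f \<alpha> : $W" for \<alpha> using SC_Ve[OF f] Ve_sub by blast
 \<comment> \<open>\<open>h j\<close> keeps the monomials of \<open>f\<close> in which some variable
   of index at most \<open>j\<close> occurs; raising \<open>j\<close> by one adds a multiple of the
   next root.\<close>
 define h where "h = (%j \<alpha>. if \<exists>i\<in>{2..j}. \<alpha> i ~= 0 then f \<alpha> else 0_W)"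
 have hJ: "h j : J" if "j \<le> d" for j
  using that
 proof(induction j)
  case 0
  have "h 0 = 0_Rinf" by(simp add: h_def zero_Rinf)
  thus ?case using J(2) by simp
 next
  case (Suc j)
  show ?case
  proof(cases "Suc j < 2")
   case True
   hence "h (Suc j) = 0_Rinf" by(auto simp: h_def zero_Rinf)
   thus ?thesis using J(2) by simp
  next
   case False
   hence i: "Suc j : {2..d}" using Suc.prems by simp
   let ?u = "unit_exponent (Suc j) (1 / of_nat (p ^ m))"
   \<comment> \<open>The monomials that contain the new variable and none of the earlier ones,
     divided by the new root. Nonzero exponents of level \<open>m\<close> are at least 1/p^m, so the
     division stays within level \<open>m\<close>.\<close>
   define k where "k = (%\<beta>. if \<beta> : Exps m & (\<forall>i\<in>{2..j}. \<beta> i = 0) then f (%i. \<beta> i + ?u i) else 0_W)"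
   have k: "k : SC m" unfolding k_def using SC_Ve[OF f] subringE(2)[OF Ve_subring] by(intro SC_I) auto
   have "h (Suc j) = h j+.Rinf gen m (Suc j)*.Rinf k"
   proof
   fix \<alpha>
   have gk: "(gen m (Suc j)*.Rinf k) \<alpha> = k (%i. \<alpha> i - ?u i)"
   proof -
   have "k \<beta> : $W" for \<beta> using SC_Ve[OF k] Ve_sub by blast
   moreover have "k : $Rinf" using k SC_Rinf by blast
   ultimately show ?thesis using i single_mult[OF one_closed, of k ?u] by(simp add: gen_def)
   qed
   have hj: "h j \<alpha> : $W" unfolding h_def using fW by simp
   have spl: "{2..Suc j} = insert (Suc j) {2..j}" using i by auto
   show "h (Suc j) \<alpha> = (h j+.Rinf gen m (Suc j)*.Rinf k) \<alpha>"
   proof(cases "\<exists>i\<in>{2..j}. \<alpha> i ~= 0")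
   case True
   then obtain i' where "i' : {2..j}" "\<alpha> i' ~= 0" by blast
   hence "\<not> (\<forall>i\<in>{2..j}. \<alpha> i - ?u i = 0)" by(auto simp: unit_exponent_def intro!: bexI[of _ i'])
   hence "k (%i. \<alpha> i - ?u i) = 0_W" unfolding k_def by auto
   thus ?thesis using True hj fW unfolding add_Rinf gk spl h_def by auto
   next
   case False
   hence z: "\<forall>i\<in>{2..j}. \<alpha> i - ?u i = 0" by(auto simp: unit_exponent_def)
   have "k (%i. \<alpha> i - ?u i) = (if \<alpha> (Suc j) ~= 0 then f \<alpha> else 0_W)"
   proof(cases "(%i. \<alpha> i - ?u i) : Exps m")
   case True
   hence "0 \<le> \<alpha> (Suc j) - ?u (Suc j)" using Exps_nonneg[OF True, of "Suc j"] by simp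
   moreover have "0 < ?u (Suc j)" using p0 by(simp add: unit_exponent_def)
   ultimately have "\<alpha> (Suc j) ~= 0" by simp
   thus ?thesis unfolding k_def using True z by simp
   next
   case n: False
   have "f \<alpha> = 0_W" if nz: "\<alpha> (Suc j) ~= 0"
   proof(rule SC_outside[OF f], rule notI)
   assume a: "\<alpha> : Exps m"
   then obtain c :: nat where c: "\<alpha> (Suc j) = of_nat c / of_nat (p ^ m)" using i unfolding exponents_def by blast
   then obtain c' where c': "c = Suc c'" using nz by(cases c) auto
   have "\<exists>t::nat. \<alpha> i' - ?u i' = of_nat t / of_nat (p ^ m)" if i': "i' : {2..d}" for i'
   proof(cases "i' = Suc j")
   case True
   thus ?thesis using c c' by(auto simp: unit_exponent_def diff_divide_distrib[symmetric])
   next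
   case False
   thus ?thesis using a i' unfolding exponents_def by(auto simp: unit_exponent_def)
   qed
   hence "(%i. \<alpha> i - ?u i) : Exps m" using a i unfolding exponents_def by(auto simp: unit_exponent_def)
   thus False using n by blast
   qed
   thus ?thesis unfolding k_def using n by simp
   qed
   thus ?thesis using False hj fW unfolding add_Rinf gk spl h_def by auto
   qed
   qed
   thus ?thesis using J(1)[OF Suc.IH J(3)[OF _ k]] Suc.prems i by simp
  qed
 qed
 \<comment> \<open>What remains is the constant coefficient, which is split modulo
   \<open>\<pi> m\<close>.\<close>
 obtain k v where kv: "k : Ve m" "v : V" "f (%_. 0) = v+.W \<pi> m*.W k" using Ve_cases[OF SC_Ve[OF f]] by blast
 have W: "k : $W" "v : $W" using kv Ve_sub V_sub by auto
 have c: "const k : SC m" using const_Ve_SC[OF kv(1)] .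
 have g1: "gen m 1*.Rinf const k = const (\<pi> m*.W k)" using const_mult_const[OF _ kv(1)] by(simp add: gen_def)
 have "f = const v+.Rinf (gen m 1*.Rinf const k+.Rinf h d)"
 proof
  fix \<alpha>
  show "f \<alpha> = (const v+.Rinf (gen m 1*.Rinf const k+.Rinf h d)) \<alpha>"
  proof(cases "\<alpha> = (%_. 0)")
   case True
   thus ?thesis unfolding g1 add_Rinf using kv(3) W by(simp add: h_def constant_series_def)
  next
   case False
   have "\<alpha> \<notin> Exps m" if z: "\<not> (\<exists>i\<in>{2..d}. \<alpha> i ~= 0)"
   proof
   assume "\<alpha> : Exps m"
   hence "\<alpha> i = 0" for i using z unfolding exponents_def by blast
   thus False using False by blast
   qed
   hence "f \<alpha> = h d \<alpha>" unfolding h_def using SC_outside[OF f] by auto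
   moreover have "h d \<alpha> : $W" unfolding h_def using fW by simp
   ultimately show ?thesis unfolding g1 add_Rinf using False W by(simp add: constant_series_def)
  qed
 qed
 moreover have "gen m 1*.Rinf const k+.Rinf h d : J" using J(1)[OF J(3)[OF _ c] hJ] d by simp
 ultimately show ?thesis using kv(2) by blast
qed

lemma proj_zero: "proj n m j 0_W = 0_W"
proof -
 have z: "0_W : V" "0_W : Ve m" using subringE(2)[OF V] subringE(2)[OF Ve_subring] by auto
 have "proj n m j (0_W*.W 0_W) = 0_W*.W proj n m j 0_W" by(rule proj_smult_V[OF z(2,1) order_refl])
 moreover have "proj n m j 0_W : $W" using proj_closed[OF z(2) order_refl] Ve_sub by blast
 ultimately show ?thesis by simp
qed

lemma proj_finsum:
 assumes h: "!!a. a : A ==> h a : Ve e" and m: "m \<le> e"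
 shows "proj n m j (finsum W h A) = (\<Oplus>\<^bsub>W\<^esub>a\<in>A. proj n m j (h a))"
 using h
proof(induction A rule: infinite_finite_induct)
 case (infinite A) thus ?case by(simp add: finsum_def finprod_def proj_zero)
next
 case empty thus ?case by(simp add: proj_zero)
next
 case (insert a A)
 have W: "h x : $W" "proj n m j (h x) : $W" if "x : insert a A" for x
  using insert.prems[OF that] proj_closed[OF insert.prems[OF that] m] Ve_sub by blast+
 have 1: "finsum W h (insert a A) = h a+.W finsum W h A" using insert W by(intro finsum_insert) auto
 have 2: "(\<Oplus>\<^bsub>W\<^esub>a\<in>insert a A. proj n m j (h a)) = proj n m j (h a)+.W (\<Oplus>\<^bsub>W\<^esub>a\<in>A. proj n m j (h a))"
  using insert W by(intro finsum_insert) auto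
 have "finsum W h A : Ve e" using insert.prems by(intro subring_finsum[OF Ve_subring]) auto
 thus ?case unfolding 1 2 using insert proj_add[OF insert.prems _ m] by simp
qed

text \<open>The functional over \<open>R n\<close> dual to the monomial with exponent
  \<open>a\<close> whose coefficient is the j-th power of \<open>\<pi> m\<close>.\<close>

definition series_proj :: "nat => nat => nat => (nat => rat) => 'w series => 'w series"
 where "series_proj n m j a f = (%\<beta>. if \<beta> : Exps n then proj n m j (f (%i. \<beta> i + a i)) else 0_W)"

lemma series_proj_SC:
 assumes "f : $Rinf" shows "series_proj n m j a f : SC n"
proof -
 obtain e where e: "m \<le> e" "f : SC e" using assms by(rule Rinf_level)
 show ?thesis unfolding series_proj_def using proj_closed[OF SC_Ve[OF e(2)] e(1)] by(intro SC_I) auto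
qed

lemma series_proj_add:
 assumes f: "f : $Rinf" and g: "g : $Rinf"
 shows "series_proj n m j a (f+.Rinf g) = series_proj n m j a f+.Rinf series_proj n m j a g"
proof -
 obtain e where e: "m \<le> e" "f : SC e" using f by(rule Rinf_level)
 obtain e' where e': "e \<le> e'" "g : SC e'" using g by(rule Rinf_level)
 have f': "f : SC e'" "m \<le> e'" using e e' SC_mono by auto
 show ?thesis
  unfolding series_proj_def add_Rinf
  using proj_add[OF SC_Ve[OF f'(1)] SC_Ve[OF e'(2)] f'(2)] by(auto simp: fun_eq_iff)
qed

text \<open>The bound a_i < 1/p^n carries the linearity: if \<beta> + a - \<gamma> is an admissible
  exponent and \<beta>, \<gamma> have level \<open>n\<close>, then \<beta> - \<gamma> is already
  nonnegative, so no term of the product is lost.\<close>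

lemma series_proj_mult:
 assumes nm: "n \<le> m" and j: "j < p ^ (m - n)" and a: "!!i. a i < 1 / of_nat (p ^ n)"
  and g: "g : SC n" and f: "f : $Rinf"
 shows "series_proj n m j a (g*.Rinf f) = g*.Rinf series_proj n m j a f"
proof
 fix \<beta>
 obtain e where e: "m \<le> e" "f : SC e" using f by(rule Rinf_level)
 have ge: "g : SC e" using g SC_mono[of n e] nm e by auto
 have cf: "series_proj n m j a f : SC n" by(rule series_proj_SC[OF f])
 show "series_proj n m j a (g*.Rinf f) \<beta> = (g*.Rinf series_proj n m j a f) \<beta>"
 proof(cases "\<beta> : Exps n")
  case False
  thus ?thesis using SC_outside[OF SC_mult[OF g cf]] by(simp add: series_proj_def)
 next
  case b: True
  let ?S1 = "{\<gamma>. g \<gamma> ~= 0_W & f (%i. \<beta> i + a i - \<gamma> i) ~= 0_W}"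
  let ?S2 = "{\<gamma>. g \<gamma> ~= 0_W & series_proj n m j a f (%i. \<beta> i - \<gamma> i) ~= 0_W}"
  let ?h = "%\<gamma>. g \<gamma>*.W f (%i. \<beta> i + a i - \<gamma> i)"
  have fin: "finite ?S1" using finite_support[OF ge e(2), of "%i. \<beta> i + a i"] .
  have arg: "(%i. \<beta> i - \<gamma> i + a i) = (%i. \<beta> i + a i - \<gamma> i)" for \<gamma> :: "nat => rat" by(simp add: fun_eq_iff)
  have sub: "?S2 \<subseteq> ?S1"
  proof
   fix \<gamma> assume "\<gamma> : ?S2"
   hence "g \<gamma> ~= 0_W" "proj n m j (f (%i. \<beta> i + a i - \<gamma> i)) ~= 0_W"
   by(auto simp: series_proj_def arg split: if_splits)
   thus "\<gamma> : ?S1" using proj_zero by auto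
  qed
  have coeff: "proj n m j (?h \<gamma>) = g \<gamma>*.W series_proj n m j a f (%i. \<beta> i - \<gamma> i)" if s: "\<gamma> : ?S1" for \<gamma>
  proof -
   have c: "\<gamma> : Exps n" using s SC_outside[OF g] by blast
   have ce: "(%i. \<beta> i + a i - \<gamma> i) : Exps e" using s SC_outside[OF e(2)] by blast
   have "(%i. \<beta> i - \<gamma> i) : Exps n"
   proof -
   have "\<exists>t::nat. \<beta> i - \<gamma> i = of_nat t / of_nat (p ^ n)" if i: "i : {2..d}" for i
   proof -
   obtain k l :: nat where kl: "\<beta> i = of_nat k / of_nat (p ^ n)" "\<gamma> i = of_nat l / of_nat (p ^ n)"
   using b c i unfolding exponents_def by blast
   have "0 \<le> \<beta> i + a i - \<gamma> i" using Exps_nonneg[OF ce, of i] by simp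
   hence "\<gamma> i < \<beta> i + 1 / of_nat (p ^ n)" using a[of i] by linarith
   hence "of_nat l / of_nat (p ^ n) < (of_nat (Suc k) / of_nat (p ^ n) :: rat)"
   unfolding kl by(simp add: add_divide_distrib)
   hence "(of_nat l :: rat) < of_nat (Suc k)" using p0 by(simp add: divide_less_cancel)
   hence "l \<le> k" unfolding of_nat_less_iff by simp
   thus ?thesis unfolding kl by(intro exI[of _ "k - l"]) (simp add: of_nat_diff diff_divide_distrib)
   qed
   thus ?thesis using b c unfolding exponents_def by auto
   qed
   thus ?thesis using proj_smult[OF SC_Ve[OF g] SC_Ve[OF e(2)] nm e(1) j] by(simp add: series_proj_def arg)
  qed
  have hVe: "?h \<gamma> : Ve e" for \<gamma> using SC_Ve[OF ge] SC_Ve[OF e(2)] subringE(6)[OF Ve_subring] by blast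
  have "series_proj n m j a (g*.Rinf f) \<beta> = proj n m j (finsum W ?h ?S1)"
   using b by(simp add: series_proj_def mult_Rinf)
  also have "\<dots> = (\<Oplus>\<^bsub>W\<^esub>\<gamma>\<in>?S1. proj n m j (?h \<gamma>))" by(rule proj_finsum[OF hVe e(1)])
  also have "\<dots> = (\<Oplus>\<^bsub>W\<^esub>\<gamma>\<in>?S2. g \<gamma>*.W series_proj n m j a f (%i. \<beta> i - \<gamma> i))"
  proof(rule add.finprod_mono_neutral_cong_right[OF fin sub])
   have gW: "g \<gamma> : $W" for \<gamma> using Rinf_W g SC_Rinf by blast
   show "proj n m j (?h \<gamma>) = 0_W" if "\<gamma> : ?S1 - ?S2" for \<gamma>
   using that coeff[of \<gamma>] gW by auto
   show "proj n m j (?h \<gamma>) = g \<gamma>*.W series_proj n m j a f (%i. \<beta> i - \<gamma> i)" if "\<gamma> : ?S2" for \<gamma>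
   using coeff sub that by blast
   show "(%\<gamma>. proj n m j (?h \<gamma>)) : ?S1 \<rightarrow> $W"
   using proj_closed[OF hVe e(1)] Ve_sub by blast
  qed
  also have "\<dots> = (g*.Rinf series_proj n m j a f) \<beta>" by(simp add: mult_Rinf)
  finally show ?thesis .
 qed
qed

lemma series_proj_single:
 assumes nm: "n \<le> m" and j: "j < p ^ (m - n)" "j' < p ^ (m - n)"
  and a: "!!i. 0 \<le> a i" "!!i. a' i < 1 / of_nat (p ^ n)"
 shows "series_proj n m j a (single W a' (\<pi> m^.W j')) = (if j = j' & a = a' then 1_Rinf else 0_Rinf)"
proof
 fix \<beta>
 show "series_proj n m j a (single W a' (\<pi> m^.W j')) \<beta> = (if j = j' & a = a' then 1_Rinf else 0_Rinf) \<beta>"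
 proof(cases "\<beta> : Exps n & (%i. \<beta> i + a i) = a'")
  case True
  hence b: "\<beta> : Exps n" and ba: "!!i. \<beta> i + a i = a' i" by auto
  have "\<beta> i = 0" for i
  proof(cases "i : {2..d}")
   case True
   then obtain k :: nat where k: "\<beta> i = of_nat k / of_nat (p ^ n)" using b unfolding exponents_def by blast
   have "\<beta> i < 1 / of_nat (p ^ n)" using ba[of i] a(1)[of i] a(2)[of i] by linarith
   hence "(of_nat k :: rat) < 1" unfolding k using p0 by(simp add: divide_less_cancel)
   thus ?thesis unfolding k by simp
  next
   case False thus ?thesis using b unfolding exponents_def by blast
  qed
  hence b0: "\<beta> = (%_. 0)" by blast
  hence "a = a'" using ba by(auto simp: fun_eq_iff)
  thus ?thesis using b b0 proj_basis[OF nm j] by(simp add: series_proj_def single_def one_Rinf zero_Rinf constant_series_def)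
 next
  case False
  hence "series_proj n m j a (single W a' (\<pi> m^.W j')) \<beta> = 0_W"
   by(auto simp: series_proj_def single_def proj_zero)
  moreover have "\<beta> ~= (%_. 0)" if "a = a'" using False that Exps_zero by auto
  ultimately show ?thesis by(auto simp: one_Rinf zero_Rinf constant_series_def)
 qed
qed

text \<open>The form in which freeness of \<open>R m\<close> over \<open>R n\<close> is used:
  p^(d(m-n)) elements of \<open>R m\<close> together with dual functionals defined on all of
  \<open>Rinf\<close>. It encodes independence, and it does so over the union as well as over
  \<open>R m\<close>.\<close>

definition dual_basis :: "nat => nat => (nat => 'w series) => (nat => 'w series => 'w series) => bool"
 where "dual_basis n m b c \<longleftrightarrow> (\<forall>j<(p ^ (m - n)) ^ d. b j : SC m \<and>
  (\<forall>x\<in>$Rinf. c j x : SC n) \<and>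
  (\<forall>x\<in>$Rinf. \<forall>y\<in>$Rinf. c j (x+.Rinf y) = c j x+.Rinf c j y) \<and>
  (\<forall>a\<in>SC n. \<forall>x\<in>$Rinf. c j (a*.Rinf x) = a*.Rinf c j x) \<and>
  (\<forall>j'<(p ^ (m - n)) ^ d. c j (b j') = (if j = j' then 1_Rinf else 0_Rinf)))"

text \<open>The basis consists of monomials with all exponents below 1/p^n in the d - 1 variables,
  times powers of \<open>\<pi> m\<close> below p^(m-n). This leaves p^(m-n) choices in each of
  \<open>d\<close> places.\<close>

lemma exists_dual_basis:
 assumes nm: "n \<le> m" shows "\<exists>b c. dual_basis n m b c"
proof -
 let ?q = "p ^ (m - n)"
 let ?I = "{..<?q} \<times> (\<Pi>\<^sub>E i\<in>{2..d}. {..<?q})"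
 define av where "av = (%u i. if i : {2..d} then of_nat (u i) / of_nat (p ^ m) else (0::rat))"
 have "card ?I = ?q * ?q ^ (d - 1)" by(simp add: card_cartesian_product card_PiE)
 also have "\<dots> = ?q ^ d" using d by(simp add: power_Suc[symmetric] del: power_Suc)
 finally have cI: "card ?I = ?q ^ d" .
 have "finite ?I" by(intro finite_cartesian_product finite_PiE) auto
 then obtain h where h: "bij_betw h {..<?q ^ d} ?I"
  using ex_bij_betw_nat_finite[of ?I] cI by(auto simp: atLeast0LessThan)
 have hI: "fst (h t) < ?q & snd (h t) : (\<Pi>\<^sub>E i\<in>{2..d}. {..<?q})" if "t < ?q ^ d" for t
  using bij_betwE[OF h] that by(metis lessThan_iff mem_Times_iff)
 have pm: "p ^ m = p ^ (m - n) * p ^ n" using nm by(simp add: power_add[symmetric])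
 have av0: "0 \<le> av u i" for u i unfolding av_def by simp
 have av1: "av u i < 1 / of_nat (p ^ n)" if "u : (\<Pi>\<^sub>E i\<in>{2..d}. {..<?q})" for u i
 proof(cases "i : {2..d}")
  case True
  hence "u i < ?q" using that by auto
  hence "(of_nat (u i) :: rat) < of_nat ?q" by(simp only: of_nat_less_iff)
  moreover have pp: "(of_nat p :: rat) > 0" using p0 by simp
  ultimately show ?thesis unfolding av_def pm using True by(simp add: field_simps)
 next
  case False
  hence "av u i = 0" unfolding av_def by(rule if_not_P)
  thus ?thesis using p0 by simp
 qed
 have avE: "av u : Exps m" for u unfolding av_def exponents_def by auto
 have avinj: "u = u'" if "av u = av u'" "u : (\<Pi>\<^sub>E i\<in>{2..d}. {..<?q})" "u' : (\<Pi>\<^sub>E i\<in>{2..d}. {..<?q})" for u u'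
 proof(rule PiE_ext[OF that(2,3)])
  fix i assume i: "i : {2..d}"
  have "av u i = av u' i" using that(1) by simp
  thus "u i = u' i" using i p0 by(simp add: av_def)
 qed
 define b where "b = (%t. single W (av (snd (h t))) (\<pi> m^.W fst (h t)))"
 define c where "c = (%t. series_proj n m (fst (h t)) (av (snd (h t))))"
 have "dual_basis n m b c"
  unfolding dual_basis_def
 proof(intro allI impI conjI ballI)
  fix t assume t: "t < ?q ^ d"
  note ht = hI[OF t]
  show "b t : SC m" unfolding b_def using single_SC[OF avE subring_pow[OF Ve_subring \<pi>_Ve]] .
  show "c t x : SC n" if "x : $Rinf" for x unfolding c_def by(rule series_proj_SC[OF that])
  show "c t (x+.Rinf y) = c t x+.Rinf c t y" if "x : $Rinf" "y : $Rinf" for x y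
   unfolding c_def by(rule series_proj_add[OF that])
  show "c t (a*.Rinf x) = a*.Rinf c t x" if "a : SC n" "x : $Rinf" for a x
   unfolding c_def by(rule series_proj_mult[OF nm conjunct1[OF ht] av1[OF conjunct2[OF ht]] that])
  fix t' assume t': "t' < ?q ^ d"
  note ht' = hI[OF t']
  have "fst (h t) = fst (h t') & av (snd (h t)) = av (snd (h t')) \<longleftrightarrow> t = t'"
  proof
   assume a: "fst (h t) = fst (h t') & av (snd (h t)) = av (snd (h t'))"
   hence "snd (h t) = snd (h t')" using avinj ht ht' by blast
   hence "h t = h t'" using a by(simp add: prod_eq_iff)
   thus "t = t'" using h t t' by(auto simp: bij_betw_def inj_on_def)
  qed simp
  thus "c t (b t') = (if t = t' then 1_Rinf else 0_Rinf)"
   unfolding c_def b_def using series_proj_single[OF nm _ _ av0 av1] ht ht' by simp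
 qed
 thus ?thesis by blast
qed

end

section \<open>Comparing filtrations and lengths at different levels\<close>

context power_series_tower
begin

text \<open>\<open>P\<close> is a power, with positive exponent, of the first root, which moves
  \<open>x\<close> into \<open>D\<close>.\<close>

lemma p_smult_gens:
 assumes M: "module (R m) M" and D: "submodule D (R m) M" and x: "x : $M"
  and E: "!!a. a : gens m ==> a**.M x : D" and w: "w : SC m"
 shows "(const P*.Rinf w)**.M x : D"
proof -
 interpret M: module "R m" M by(rule M)
 let ?g = "gen m 1"
 have g: "?g : gens m" "?g : SC m" using d gen_SC[of 1 m] unfolding gens_def by auto
 have gC: "?g : $(R m)" "w : $(R m)" using g w by(simp_all add: R_simps)
 obtain N where N: "p ^ m = Suc N" using p0 by(metis gr0_implies_Suc zero_less_power)
 have gpow: "?g^.Rinf k : SC m" for k :: nat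
  using g(2) SC_Rinf[of m] subringE(3,6)[OF SC_subring[of m]] by(induction k) auto
 have "const P = ?g^.Rinf (p ^ m)"
  using gen_pow[of 1 0 m] d \<pi>_0 by(simp add: gen_def)
 also have "\<dots> = ?g^.Rinf N*.Rinf ?g" unfolding N by simp
 finally have "const P*.Rinf w = (w*.Rinf ?g^.Rinf N)*.Rinf ?g"
  using g(2) w gpow[of N] SC_Rinf[of m] by(auto simp: S.m_ac subset_iff)
 moreover have c: "w*.Rinf ?g^.Rinf N : SC m" using w gpow subringE(6)[OF SC_subring] by blast
 ultimately have "(const P*.Rinf w)**.M x = (w*.Rinf ?g^.Rinf N)**.M (?g**.M x)"
  using M.smult_assoc1[of "w*.Rinf ?g^.Rinf N" ?g x] gC x by(simp add: R_simps)
 thus ?thesis using M.submoduleE(4)[OF D _ E[OF g(1)]] c by(simp add: R_simps)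
qed

text \<open>The scalars that move \<open>x\<close> into \<open>D\<close> include all multiples of
  the roots, so a series acts on \<open>x\<close> modulo \<open>D\<close> through its constant
  part.\<close>

lemma smult_mod_gens:
 assumes M: "module (R m) M" and D: "submodule D (R m) M" and x: "x : $M"
  and E: "!!a. a : gens m ==> a**.M x : D" and r: "r : SC m"
 shows "\<exists>v\<in>V. \<exists>y\<in>D. r**.M x = const v**.M x+.M y"
proof -
 interpret M: module "R m" M by(rule M)
 note PE = M.submoduleE[OF D]
 let ?J = "{a : SC m. a**.M x : D}"
 have "\<exists>v\<in>V. \<exists>g\<in>?J. r = const v+.Rinf g"
 proof(rule V_add_gens[OF _ _ _ r])
  fix a b assume ab: "a : ?J" "b : ?J"
  have "(a+.Rinf b)**.M x = a**.M x+.M b**.M x"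
   using M.smult_l_distr[of a b x] ab x by(simp add: R_simps)
  thus "a+.Rinf b : ?J" using ab PE(5) subringE(7)[OF SC_subring] by simp
 next
  show "0_Rinf : ?J" using M.smult_l_null[OF x] M.submodule_zero_mem[OF D] subringE(2)[OF SC_subring] by(simp add: R_simps)
 next
  fix i f assume i: "i : {1..d}" and f: "f : SC m"
  have g: "gen m i : gens m" "gen m i : SC m" using i gen_SC unfolding gens_def by auto
  have "gen m i*.Rinf f = f*.Rinf gen m i" using g f SC_Rinf by(intro S.m_comm) auto
  hence "(gen m i*.Rinf f)**.M x = f**.M (gen m i**.M x)"
   using M.smult_assoc1[of f "gen m i" x] g f x by(simp add: R_simps)
  thus "gen m i*.Rinf f : ?J"
   using PE(4)[OF _ E[OF g(1)]] f g subringE(6)[OF SC_subring] by(simp add: R_simps)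
 qed
 then obtain v g where vg: "v : V" "g : SC m" "g**.M x : D" "r = const v+.Rinf g" by blast
 have "r**.M x = const v**.M x+.M g**.M x"
  unfolding vg(4) using M.smult_l_distr[of "const v" g x] vg x const_SC by(simp add: R_simps)
 thus ?thesis using vg by blast
qed

text \<open>A step at level \<open>m\<close> is a quotient of the residue field of \<open>V\<close>,
  on which the constants in \<open>R n\<close> already act transitively; so it is zero or simple
  over \<open>R n\<close> too.\<close>

lemma triangular_gens_ranked:
 assumes nm: "n \<le> m" and M: "module (R m) M" and T: "triangular (R m) M (gens m) l D"
 shows "\<exists>f. ranked (R n) M D l f"
proof(rule triangular_ranked[OF M module_R_mono[OF nm M] _ _ T])
 show "$(R n) \<subseteq> $(R m)" using SC_mono[OF nm] by(simp add: R_simps)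
 interpret M: module "R m" M by(rule M)
 fix Q x r assume Q: "submodule Q (R m) M" and x: "x : $M"
  and E: "!!a. a : gens m ==> a**.M x : Q" and r: "r : $(R m)"
 note QE = M.submoduleE[OF Q]
 obtain v y where v: "v : V" "y : Q" "r**.M x = const v**.M x+.M y"
 proof -
  have "r : SC m" using r by(simp add: R_simps)
  from smult_mod_gens[OF M Q x E this] show thesis using that by blast
 qed
 have yM: "y : $M" using v QE(1) by blast
 have cv: "const v : $(R m)" "const v : $(R n)" using const_SC[OF v(1)] by(simp_all add: R_simps)
 have pQ: "(const P*.Rinf const w)**.M x : Q" if "w : V" for w
  using p_smult_gens[OF M Q x E const_SC[OF that]] by blast
 have "r**.M x-.M const v**.M x = y"
  unfolding v(3) using yM x cv by(simp add: a_minus_def M.M.a_comm[of "const v**.M x" y] M.M.a_assoc M.M.r_neg)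
 \<comment> \<open>Either \<open>P\<close> divides \<open>v\<close>, which then acts as zero, or
   \<open>v\<close> is invertible modulo \<open>P\<close>, and \<open>P\<close> acts as
   zero.\<close>
 moreover have "const v**.M x : Q \<or> (\<exists>u\<in>$(R n). u**.M (const v**.M x)-.M x : Q)"
 proof(cases "\<exists>w\<in>V. v = P*.W w")
  case True
  then obtain w where w: "w : V" "v = P*.W w" by blast
  have "const v = const P*.Rinf const w"
   unfolding w(2) using w(1) V_Ve[of 0] by(intro const_mult_const) auto
  thus ?thesis using pQ[OF w(1)] by simp
 next
  case False
  then obtain u w where u: "u : V" "w : V" "u*.W v = 1_W+.W P*.W w"
   using V_unit_mod_P[OF v(1)] by blast
  have W: "u : $W" "w : $W" "v : $W" using u v V_sub by auto
  have cu: "const u : $(R m)" "const u : $(R n)" "const w : $(R m)" using u const_SC by(simp_all add: R_simps)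
  have "const u*.Rinf const v = const (u*.W v)"
   using W(1) v(1) V_Ve[of 0] const_mult_const[of u v 0] by auto
  also have "\<dots> = 1_Rinf+.Rinf const P*.Rinf const w"
   unfolding u(3) one_Rinf using W u(2) V_Ve[of 0] const_mult_const[of P w 0] by(simp add: const_add subset_iff)
  finally have uv: "const u*.(R m) const v = 1_(R m)+.(R m) (const P*.Rinf const w)" by(simp add: R_simps)
  have pw: "const P*.Rinf const w : $(R m)"
   using const_SC[OF P_V] const_SC[OF u(2)] subringE(6)[OF SC_subring] by(simp add: R_simps)
  have "const u**.M (const v**.M x) = x+.M (const P*.Rinf const w)**.M x"
   using M.smult_assoc1[OF cu(1) cv(1) x] M.smult_l_distr[OF M.R.one_closed pw x] x unfolding uv by simp
  hence "const u**.M (const v**.M x)-.M x = (const P*.Rinf const w)**.M x"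
   using x pw M.M.a_comm[of x "(const P*.Rinf const w)**.M x"] by(simp add: a_minus_def M.M.a_assoc M.M.r_neg)
  thus ?thesis using pQ[OF u(2)] cu(2) by metis
 qed
 ultimately show "\<exists>v\<in>$(R n). r**.M x-.M v**.M x : Q \<and>
   (v**.M x : Q \<or> (\<exists>u\<in>$(R n). u**.M (v**.M x)-.M x : Q))"
  using cv(2) v(2) by(intro bexI[of _ "const v"]) simp_all
qed

lemma R_pow: "a^.(R m) (k::nat) = a^.Rinf k"
 by(simp add: nat_pow_def R_simps)

text \<open>The \<open>d\<close> roots are exchanged one at a time, each exchange multiplying the
  number of steps by p^(m-e).\<close>

lemma triangular_gens_refine:
 assumes em: "e \<le> m" and M: "module (R m) M" and T: "triangular (R m) M (gens e) l D"
 shows "triangular (R m) M (gens m) ((p ^ (m - e)) ^ d * l) D"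
proof -
 interpret M: module "R m" M by(rule M)
 let ?q = "p ^ (m - e)"
 have ge: "gen e i : $(R m)" if "i : {1..d}" for i using gen_SC[OF that, of e] SC_mono[OF em] by(auto simp: R_simps)
 have gm: "gen m i : $(R m)" if "i : {1..d}" for i using gen_SC[OF that, of m] by(simp add: R_simps)
 have "j \<le> d ==> triangular (R m) M (gen m ` {1..j} \<union> gen e ` {Suc j..d}) (?q ^ j * l) D" for j
 proof(induction j)
  case 0 thus ?case using T by(simp add: gens_def)
 next
  case (Suc j)
  let ?E = "gen m ` {1..j} \<union> gen e ` {Suc (Suc j)..d}"
  have s: "{Suc j..d} = insert (Suc j) {Suc (Suc j)..d}" using Suc.prems by auto
  have s': "{1..Suc j} = insert (Suc j) {1..j}" by auto
  have pw: "gen m (Suc j)^.(R m) ?q = gen e (Suc j)"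
   using gen_pow[of "Suc j" e "m - e"] Suc.prems em by(simp add: R_pow)
  have "triangular (R m) M (insert (gen m (Suc j)^.(R m) ?q) ?E) (?q ^ j * l) D"
   using Suc.IH Suc.prems unfolding pw s by simp
  hence "triangular (R m) M (insert (gen m (Suc j)) ?E) (?q * (?q ^ j * l)) D"
   by(rule M.triangular_refine) (use gm ge Suc.prems in auto)
  thus ?case unfolding s' by(simp add: mult.assoc)
 qed
 from this[of d] show ?thesis by(simp add: gens_def)
qed

text \<open>Both sides are counted over \<open>R n\<close> at a common high level \<open>m\<close>.
  The filtration has at most l p^(d(m-e)) steps there, while independence provides p^(d(m-n)) copies
  of the chain. The finite set \<open>Y\<close> generating \<open>N s\<close> is what allows the
  filtration to descend to \<open>R m\<close> with a last term containing
  \<open>N s\<close>.\<close>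

lemma length_le_of_triangular:
 assumes M: "module Rinf M" and T: "triangular Rinf M (gens e) l $M"
  and N: "!!i. i \<le> s ==> submodule (N i) (R n) M" "!!i. i < s ==> N i \<subset> N (Suc i)"
  and Y: "finite Y" "Y \<subseteq> N s" "!!Q. submodule Q (R n) M ==> Y \<subseteq> Q ==> N s \<subseteq> Q"
  and indep: "!!m b c j u x. n \<le> m ==> dual_basis n m b c ==> j < (p ^ (m - n)) ^ d ==>
   u : scaled_sum M b (N s) j ==> x : N s ==> u+.M b j**.M x = 0_M ==> x = 0_M"
 shows "s * p ^ (d * e) \<le> l * p ^ (d * n)"
proof -
 interpret M: module Rinf M by(rule M)
 have Nn: "module (R n) M" by(rule module_R[OF M])
 have YM: "Y \<subseteq> $M" using Y(2) module.submoduleE(1)[OF Nn N(1)[OF order_refl]] by blast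
 have "\<exists>m0. \<forall>m\<ge>m0. \<exists>P'. triangular (R m) M (gens e) l P' & Y \<subseteq> P' & P' \<subseteq> $M"
  by(rule triangular_descent[OF M module_R[OF M] _ _ finite_gens T Y(1) YM])
   (use SC_mono in "auto simp: R_simps carrier_Rinf")
 then obtain m0 where m0: "!!m. m \<ge> m0 ==> \<exists>P'. triangular (R m) M (gens e) l P' & Y \<subseteq> P' & P' \<subseteq> $M" by blast
 define m where "m = max m0 (max n e)"
 have m: "m0 \<le> m" "n \<le> m" "e \<le> m" unfolding m_def by auto
 obtain P' where P': "triangular (R m) M (gens e) l P'" "Y \<subseteq> P'" using m0[OF m(1)] by blast
 have Mm: "module (R m) M" by(rule module_R[OF M])
 have Psub: "submodule P' (R m) M" by(rule module.triangular_submodule[OF Mm P'(1)])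
 note PE = module.submoduleE[OF Mm Psub]
 obtain f where f: "ranked (R n) M P' ((p ^ (m - e)) ^ d * l) f"
  using triangular_gens_ranked[OF m(2) Mm triangular_gens_refine[OF m(3) Mm P'(1)]] by blast
 have "submodule P' (R n) M"
  using PE module.submodule_zero_mem[OF Mm Psub] SC_mono[OF m(2)]
  by(intro module.submoduleI[OF Nn]) (auto simp: R_simps)
 hence NP: "N s \<subseteq> P'" using Y(3) P'(2) by blast
 obtain b c where bc: "dual_basis n m b c" using exists_dual_basis[OF m(2)] by blast
 have bm: "b j : SC m" if "j < (p ^ (m - n)) ^ d" for j using bc that unfolding dual_basis_def by blast
 have "scaled_sum M b (N s) j \<subseteq> P'" if "j \<le> (p ^ (m - n)) ^ d" for j
  using that
 proof(induction j)
  case 0 thus ?case using module.submodule_zero_mem[OF Mm Psub] by simp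
 next
  case (Suc j)
  have "b j**.M x : P'" if "x : N s" for x
   using PE(4)[of "b j" x] bm[of j] Suc.prems that NP by(auto simp: R_simps)
  thus ?case using Suc PE(5) by fastforce
 qed
 hence sP: "scaled_sum M b (N s) ((p ^ (m - n)) ^ d) \<subseteq> P'" by blast
 have "(p ^ (m - n)) ^ d * s \<le> (p ^ (m - e)) ^ d * l"
 proof(rule ranked_scaled_sum[OF M Nn _ _ N _ f sP])
  show "$(R n) \<subseteq> $Rinf" using SC_Rinf by(simp add: R_simps)
  show "b j : $Rinf" if "j < (p ^ (m - n)) ^ d" for j using bm[OF that] SC_Rinf by blast
  show "x = 0_M" if "j < (p ^ (m - n)) ^ d" "u : scaled_sum M b (N s) j" "x : N s" "u+.M b j**.M x = 0_M" for j u x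
   using indep[OF m(2) bc that] .
 qed
 \<comment> \<open>The extra factors turn both sides into multiples of p^(dm), which can be
   cancelled without any subtraction of exponents.\<close>
 hence "(p ^ (m - n)) ^ d * s * (p ^ n) ^ d * (p ^ e) ^ d \<le> (p ^ (m - e)) ^ d * l * (p ^ n) ^ d * (p ^ e) ^ d"
  by(intro mult_right_mono) auto
 moreover have "(p ^ (m - n)) ^ d * (p ^ n) ^ d = (p ^ m) ^ d" "(p ^ (m - e)) ^ d * (p ^ e) ^ d = (p ^ m) ^ d"
  using m by(simp_all add: power_mult_distrib[symmetric] power_add[symmetric])
 moreover have "(p ^ (m - n)) ^ d * s * (p ^ n) ^ d * (p ^ e) ^ d = ((p ^ (m - n)) ^ d * (p ^ n) ^ d) * (s * (p ^ e) ^ d)"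
  "(p ^ (m - e)) ^ d * l * (p ^ n) ^ d * (p ^ e) ^ d = ((p ^ (m - e)) ^ d * (p ^ e) ^ d) * (l * (p ^ n) ^ d)"
  by(simp_all only: mult_ac)
 ultimately have "(p ^ m) ^ d * (s * (p ^ e) ^ d) \<le> (p ^ m) ^ d * (l * (p ^ n) ^ d)" by(simp only:)
 hence "s * (p ^ e) ^ d \<le> l * (p ^ n) ^ d" using p0 by simp
 thus ?thesis by(simp add: power_mult mult.commute[of d])
qed

end

section \<open>Free modules and triangular presentations\<close>

lemma free_module_simps:
 "$(free_module A r) = ({..<r} \<rightarrow>\<^sub>E $A)"
 "y+.(free_module A r) z = (\<lambda>i\<in>{..<r}. y i+.A z i)"
 "0_(free_module A r) = (\<lambda>i\<in>{..<r}. 0_A)"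
 "a**.(free_module A r) y = (\<lambda>i\<in>{..<r}. a*.A y i)"
 by(simp_all add: free_module_def direct_product_simps)

lemma module_free_module: "cring A ==> module A (free_module A r)"
 unfolding free_module_def by(rule module_direct_product) (simp_all add: module_self_module)

definition basis_vector :: "'a ring => nat => nat => nat => 'a"
 where "basis_vector A r i = (\<lambda>j\<in>{..<r}. if j = i then 1_A else 0_A)"

definition free_lift :: "('a, 'm, 'y) module_scheme => nat => (nat => 'm) => (nat => 'a) => 'm"
 where "free_lift M r v y = (\<Oplus>\<^bsub>M\<^esub>i\<in>{..<r}. y i**.M v i)"

lemma basis_vector_closed: "cring A ==> basis_vector A r i : $(free_module A r)"
proof -
 assume "cring A"
 then interpret cring A .
 show ?thesis by(simp add: basis_vector_def free_module_simps)
qed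

lemma free_lift_linear:
 assumes M: "module A M" and v: "!!i. i < r ==> v i : $M"
 shows "free_lift M r v : linear_maps A (free_module A r) M"
proof -
 interpret module A M by(rule M)
 have cl: "y i**.M v i : $M" if "y : {..<r} \<rightarrow>\<^sub>E $A" "i < r" for y i
  using that v by(auto simp: PiE_iff)
 show ?thesis
  unfolding linear_maps_def
 proof(intro CollectI conjI ballI funcsetI; unfold free_module_simps free_lift_def)
  fix y assume y: "y : {..<r} \<rightarrow>\<^sub>E $A"
  show "(\<Oplus>\<^bsub>M\<^esub>i\<in>{..<r}. y i**.M v i) : $M" using cl[OF y] by(intro M.finsum_closed) auto
  show "(\<Oplus>\<^bsub>M\<^esub>i\<in>{..<r}. (\<lambda>i\<in>{..<r}. y i+.A z i) i**.M v i) =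
   (\<Oplus>\<^bsub>M\<^esub>i\<in>{..<r}. y i**.M v i)+.M (\<Oplus>\<^bsub>M\<^esub>i\<in>{..<r}. z i**.M v i)"
   if z: "z : {..<r} \<rightarrow>\<^sub>E $A" for z
  proof -
   have "(\<Oplus>\<^bsub>M\<^esub>i\<in>{..<r}. (\<lambda>i\<in>{..<r}. y i+.A z i) i**.M v i) = (\<Oplus>\<^bsub>M\<^esub>i\<in>{..<r}. y i**.M v i+.M z i**.M v i)"
   using y z v cl[OF y] cl[OF z] by(intro M.finsum_cong') (auto simp: PiE_iff smult_l_distr)
   also have "\<dots> = (\<Oplus>\<^bsub>M\<^esub>i\<in>{..<r}. y i**.M v i)+.M (\<Oplus>\<^bsub>M\<^esub>i\<in>{..<r}. z i**.M v i)"
   using cl[OF y] cl[OF z] by(intro M.finsum_addf) auto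
   finally show ?thesis .
  qed
 next
  fix a y assume a: "a : $A" and y: "y : {..<r} \<rightarrow>\<^sub>E $A"
  have "(\<Oplus>\<^bsub>M\<^esub>i\<in>{..<r}. (\<lambda>i\<in>{..<r}. a*.A y i) i**.M v i) = (\<Oplus>\<^bsub>M\<^esub>i\<in>{..<r}. a**.M (y i**.M v i))"
   using y a v cl[OF y] by(intro M.finsum_cong') (auto simp: PiE_iff smult_assoc1)
  also have "\<dots> = a**.M (\<Oplus>\<^bsub>M\<^esub>i\<in>{..<r}. y i**.M v i)"
   using cl[OF y] a by(intro finsum_smult_ldistr[symmetric]) auto
  finally show "(\<Oplus>\<^bsub>M\<^esub>i\<in>{..<r}. (\<lambda>i\<in>{..<r}. a*.A y i) i**.M v i) = a**.M (\<Oplus>\<^bsub>M\<^esub>i\<in>{..<r}. y i**.M v i)" .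
 qed
qed

text \<open>The vector is assembled from its truncations, one coordinate at a time.\<close>

lemma free_module_induct:
 assumes A: "cring A" and y: "y : $(free_module A r)"
  and z: "Q 0_(free_module A r)"
  and step: "!!i u. i < r ==> u : $(free_module A r) ==> Q u ==>
   Q (u+.(free_module A r) y i**.(free_module A r) basis_vector A r i)"
 shows "Q y"
proof -
 interpret cring A by(rule A)
 let ?F = "free_module A r"
 let ?t = "%t. \<lambda>j\<in>{..<r}. if j < t then y j else 0_A"
 have yA: "y i : $A" if "i < r" for i using y that by(auto simp: free_module_simps)
 have tF: "?t t : $?F" for t using yA by(auto simp: free_module_simps)
 have "t \<le> r ==> Q (?t t)" for t
 proof(induction t)
  case 0
  have "?t 0 = 0_?F" by(auto simp: free_module_simps)
  thus ?case using z by simp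
 next
  case (Suc t)
  have "?t (Suc t) = ?t t+.?F y t**.?F basis_vector A r t"
  proof
   fix j show "?t (Suc t) j = (?t t+.?F y t**.?F basis_vector A r t) j"
   using yA Suc.prems by(auto simp: free_module_simps basis_vector_def less_Suc_eq)
  qed
  moreover have "Q (?t t)" by(rule Suc.IH) (use Suc.prems in simp)
  hence "Q (?t t+.?F y t**.?F basis_vector A r t)"
   using Suc.prems by(intro step tF) simp_all
  ultimately show ?case by(simp only:)
 qed
 from this[of r] have "Q (?t r)" by simp
 moreover have "?t r = y" using y by(auto simp: free_module_simps PiE_iff extensional_def)
 ultimately show ?thesis by simp
qed

lemma linear_map_free_module:
 assumes M: "module A M" and f: "f : linear_maps A (free_module A r) M" and y: "y : $(free_module A r)"
 shows "f y = free_lift M r (%i. f (basis_vector A r i)) y"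
proof -
 interpret module A M by(rule M)
 have A: "cring A" by(rule is_cring)
 let ?F = "free_module A r" and ?g = "free_lift M r (%i. f (basis_vector A r i))"
 note F = module_free_module[OF A, of r] and bv = basis_vector_closed[OF A, of r]
 have g: "?g : linear_maps A ?F M" by(rule free_lift_linear[OF M]) (rule linear_mapsD(1)[OF f bv])
 have gb: "?g (basis_vector A r i) = f (basis_vector A r i)" if i: "i < r" for i
 proof -
  have cl: "f (basis_vector A r j) : $M" for j by(rule linear_mapsD(1)[OF f bv])
  have "?g (basis_vector A r i) = (\<Oplus>\<^bsub>M\<^esub>j\<in>{..<r}. if i = j then f (basis_vector A r j) else 0_M)"
   unfolding free_lift_def using cl by(intro M.finsum_cong') (auto simp: basis_vector_def)
  also have "\<dots> = f (basis_vector A r i)" using i cl by(intro M.finsum_singleton) auto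
  finally show ?thesis .
 qed
 show ?thesis
 proof(rule free_module_induct[OF A y])
  show "f 0_?F = ?g 0_?F" unfolding linear_maps_zero[OF f F M] linear_maps_zero[OF g F M] ..
  fix i u assume i: "i < r" and u: "u : $?F" and eq: "f u = ?g u"
  have yi: "y i : $A" using y i by(auto simp: free_module_simps)
  have b: "y i**.?F basis_vector A r i : $?F" by(rule module.smult_closed[OF F yi bv])
  show "f (u+.?F y i**.?F basis_vector A r i) = ?g (u+.?F y i**.?F basis_vector A r i)"
   unfolding linear_mapsD(2)[OF f u b] linear_mapsD(2)[OF g u b] linear_mapsD(3)[OF f yi bv] linear_mapsD(3)[OF g yi bv] gb[OF i] eq ..
 qed
qed

lemma free_lift_mem:
 assumes M: "module A M" and Q: "submodule Q A M" and v: "!!i. i < r ==> v i : Q"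
  and y: "!!i. i < r ==> y i : $A"
 shows "free_lift M r v y : Q"
proof -
 interpret module A M by(rule M)
 note QE = submoduleE[OF Q]
 have "t \<le> r ==> (\<Oplus>\<^bsub>M\<^esub>i\<in>{..<t}. y i**.M v i) : Q" for t
 proof(induction t)
  case 0 thus ?case using submodule_zero_mem[OF Q] by simp
 next
  case (Suc t)
  have q: "y i**.M v i : Q" if "i \<le> t" for i using QE(4) v y that Suc.prems by simp
  have "(\<Oplus>\<^bsub>M\<^esub>i\<in>insert t {..<t}. y i**.M v i) = y t**.M v t+.M (\<Oplus>\<^bsub>M\<^esub>i\<in>{..<t}. y i**.M v i)"
   using q QE(1) by(intro M.finsum_insert) (auto simp: less_imp_le)
  thus ?case using QE(5) q Suc by(simp add: lessThan_Suc)
 qed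
 thus ?thesis unfolding free_lift_def by blast
qed

text \<open>Moves a module to a prescribed element type; the representatives in the definition of
  normalized length have their elements in one fixed type.\<close>

lemma module_transport:
 assumes M: "module A M" and g: "inj_on g $M"
 shows "\<exists>N. module A N & g : linear_maps A M N & $N = g ` $M"
proof -
 interpret module A M by(rule M)
 let ?i = "inv_into $M g"
 let ?N = "mk_module (g ` $M) (%x y. g (?i x+.M ?i y)) (g 0_M) (%a x. g (a**.M ?i x)) :: ('a, 'c) module"
 have i: "?i (g x) = x" if "x : $M" for x using inv_into_f_f[OF g that] .
 have "module A ?N"
  by(rule module_pushforward[OF M, of g]) (simp_all add: i)
 moreover have "g : linear_maps A M ?N" unfolding linear_maps_def by(simp add: i)
 ultimately show ?thesis by(intro exI[of _ ?N]) simp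
qed

text \<open>Each multiplication by \<open>a\<close> drops an element by one term of the
  filtration.\<close>

lemma triangular_power_zero:
 assumes M: "module A M" and T: "triangular A M E l Q" and a: "a : E" "E \<subseteq> $A" and x: "x : Q"
 shows "(a^.A l)**.M x = 0_M"
 using T x
proof(induction arbitrary: x rule: triangular.induct)
 case zero
 hence x: "x = 0_M" by simp
 interpret module A M by(rule M)
 show ?case using x by simp
next
 case (step l Q y)
 interpret module A M by(rule M)
 have aA: "a : $A" using a by blast
 have Q: "submodule Q A M" by(rule triangular_submodule[OF step.hyps(1)])
 note QE = submoduleE[OF Q]
 obtain u r where ur: "x = u+.M r**.M y" "u : Q" "r : $A"
  using step.prems unfolding adjoin_def by blast
 have uM: "u : $M" using ur QE(1) by blast
 have "a**.M x = a**.M u+.M r**.M (a**.M y)"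
  using ur uM aA step.hyps(2) by(simp add: smult_r_distr smult_assoc1[symmetric] R.m_comm)
 also have "\<dots> : Q" using QE(4,5) aA ur step.hyps(3)[OF a(1)] by blast
 finally have "(a^.A l)**.M (a**.M x) = 0_M" by(rule step.IH)
 moreover have "x : $M" using ur uM step.hyps(2) by simp
 ultimately show ?case using aA by(simp add: smult_assoc1)
qed

lemma scaled_sum_image:
 assumes f: "f : linear_maps A M N" and M: "module A M" and N: "module A N"
  and K: "K \<subseteq> $M" and b: "!!j. j < k ==> b j : $A"
 shows "scaled_sum N b (f ` K) k = f ` scaled_sum M b K k & scaled_sum M b K k \<subseteq> $M"
 using b
proof(induction k)
 case 0
 interpret M: module A M by(rule M)
 show ?case using linear_maps_zero[OF f M N] by simp
next
 case (Suc k)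
 interpret M: module A M by(rule M)
 have IH: "scaled_sum N b (f ` K) k = f ` scaled_sum M b K k" "scaled_sum M b K k \<subseteq> $M" using Suc by auto
 have bk: "b k : $A" using Suc.prems by blast
 have eq: "f (u+.M b k**.M x) = f u+.N b k**.N f x" if "u : scaled_sum M b K k" "x : K" for u x
 proof -
  have "u : $M" "x : $M" using that IH K by auto
  thus ?thesis using linear_mapsD(2)[OF f, of u "b k**.M x"] linear_mapsD(3)[OF f bk, of x] bk by simp
 qed
 have "scaled_sum N b (f ` K) (Suc k) = f ` scaled_sum M b K (Suc k)"
 proof
  show "scaled_sum N b (f ` K) (Suc k) \<subseteq> f ` scaled_sum M b K (Suc k)"
  proof
   fix z assume "z : scaled_sum N b (f ` K) (Suc k)"
   then obtain u x where ux: "u : scaled_sum M b K k" "x : K" "z = f u+.N b k**.N f x" unfolding scaled_sum.simps IH(1) by blast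
   have "u+.M b k**.M x : scaled_sum M b K (Suc k)" unfolding scaled_sum.simps using ux(1,2) by blast
   from imageI[OF this, of f] show "z : f ` scaled_sum M b K (Suc k)" unfolding eq[OF ux(1,2)] ux(3) .
  qed
  show "f ` scaled_sum M b K (Suc k) \<subseteq> scaled_sum N b (f ` K) (Suc k)"
  proof
   fix z assume "z : f ` scaled_sum M b K (Suc k)"
   then obtain u x where ux: "u : scaled_sum M b K k" "x : K" "z = f (u+.M b k**.M x)" unfolding scaled_sum.simps by blast
   show "z : scaled_sum N b (f ` K) (Suc k)"
   unfolding scaled_sum.simps IH(1) ux(3) eq[OF ux(1,2)] using ux(1,2) by blast
  qed
 qed
 moreover have "scaled_sum M b K (Suc k) \<subseteq> $M" using IH(2) K bk by auto
 ultimately show ?case by blast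
qed

text \<open>The generators keep their relations when the scalars are extended, so their images
  generate a filtration with equally many steps.\<close>

lemma triangular_extend_scalars:
 assumes N: "module A N" and M: "module B M" and j: "j : linear_maps A N M"
  and AB: "$A \<subseteq> $B" and MA: "module A M" and E: "E \<subseteq> $A" and T: "triangular A N E l Q"
 shows "\<exists>Q'. triangular B M E l Q' & j ` Q \<subseteq> Q'"
 using T
proof(induction rule: triangular.induct)
 case zero
 show ?case using triangular.zero[of B M E] linear_maps_zero[OF j N MA] by(intro exI[of _ "{0_M}"]) simp
next
 case (step l Q x)
 interpret N: module A N by(rule N)
 obtain Q' where Q': "triangular B M E l Q'" "j ` Q \<subseteq> Q'" using step.IH by blast
 have jx: "j x : $M" using linear_mapsD(1)[OF j step.hyps(2)] .
 have QN: "Q \<subseteq> $N" by(rule N.submoduleE(1)[OF N.triangular_submodule[OF step.hyps(1)]])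
 have "triangular B M E (Suc l) (adjoin B M Q' (j x))"
 proof(rule triangular.step[OF Q'(1) jx])
  fix a assume a: "a : E"
  have "j (a**.N x) : Q'" using Q'(2) step.hyps(3)[OF a] by blast
  thus "a**.M j x : Q'" using linear_mapsD(3)[OF j subsetD[OF E a] step.hyps(2)] by simp
 qed
 moreover have "j ` adjoin A N Q x \<subseteq> adjoin B M Q' (j x)"
 proof
  fix z assume "z : j ` adjoin A N Q x"
  then obtain u r where ur: "z = j (u+.N r**.N x)" "u : Q" "r : $A" unfolding adjoin_def by blast
  have uN: "u : $N" using ur(2) QN by blast
  have "z = j u+.M r**.M j x"
   unfolding ur(1) using linear_mapsD(2)[OF j uN N.smult_closed[OF ur(3) step.hyps(2)]] linear_mapsD(3)[OF j ur(3) step.hyps(2)] by simp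
  moreover have "j u : Q'" "r : $B" using Q'(2) ur AB by auto
  ultimately show "z : adjoin B M Q' (j x)" unfolding adjoin_def by blast
 qed
 ultimately show ?case by blast
qed

context module
begin

lemma free_lift_0: "free_lift M 0 v y = 0_M"
 by(simp add: free_lift_def)

lemma free_lift_cong:
 assumes "!!i. i < r ==> v i = v' i" "!!i. i < r ==> y i = y' i"
  "!!i. i < r ==> v' i : $M" "!!i. i < r ==> y' i : $R"
 shows "free_lift M r v y = free_lift M r v' y'"
 unfolding free_lift_def using assms by(intro M.finsum_cong') auto

lemma free_lift_Suc:
 assumes "!!i. i < Suc r ==> v i : $M" "!!i. i < Suc r ==> y i : $R"
 shows "free_lift M (Suc r) v y = free_lift M r v y+.M y r**.M v r"
proof -
 have "(\<Oplus>\<^bsub>M\<^esub>i\<in>insert r {..<r}. y i**.M v i) = y r**.M v r+.M (\<Oplus>\<^bsub>M\<^esub>i\<in>{..<r}. y i**.M v i)"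
  using assms by(intro M.finsum_insert) auto
 moreover have "(\<Oplus>\<^bsub>M\<^esub>i\<in>{..<r}. y i**.M v i) : $M" using assms by(intro M.finsum_closed) auto
 ultimately show ?thesis using assms by(simp add: free_lift_def lessThan_Suc M.a_comm)
qed

lemma free_lift_closed:
 assumes "!!i. i < r ==> v i : $M" "!!i. i < r ==> y i : $R"
 shows "free_lift M r v y : $M"
 unfolding free_lift_def using assms by(intro M.finsum_closed) auto

lemma free_lift_truncate:
 assumes v: "!!k. k < l ==> v k : $M" and y: "!!k. k < i ==> y k : $R" and il: "i \<le> l"
 shows "free_lift M l v (\<lambda>k\<in>{..<l}. if k < i then y k else \<zero>) = free_lift M i v y"
proof -
 define y' where "y' = (\<lambda>k\<in>{..<l}. if k < i then y k else \<zero>)"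
 have y': "y' k = (if k < i then y k else \<zero>)" if "k < l" for k using that unfolding y'_def by simp
 have yR: "y' k : $R" if "k < l" for k using y y'[OF that] by simp
 have "i + s \<le> l ==> free_lift M (i + s) v y' = free_lift M i v y" for s
 proof(induction s)
  case 0
  show ?case using v y il y' by(simp, intro free_lift_cong) auto
 next
  case (Suc s)
  have "free_lift M (Suc (i + s)) v y' = free_lift M (i + s) v y'+.M y' (i + s)**.M v (i + s)"
   by(rule free_lift_Suc) (use v yR Suc.prems in simp_all)
  moreover have "y' (i + s) = \<zero>" using y' Suc.prems by simp
  moreover have "free_lift M i v y : $M" using v y il by(intro free_lift_closed) auto
  ultimately show ?case using Suc v by simp
 qed
 from this[of "l - i"] show ?thesis using il unfolding y'_def by simp
qed

end

lemma free_lift_basis_vector: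
 assumes M: "module A M" and v: "!!i. i < r ==> v i : $M" and i: "i < r"
 shows "free_lift M r v (basis_vector A r i) = v i"
proof -
 interpret module A M by(rule M)
 have "free_lift M r v (basis_vector A r i) = (\<Oplus>\<^bsub>M\<^esub>j\<in>{..<r}. if i = j then v j else 0_M)"
  unfolding free_lift_def using v by(intro M.finsum_cong') (auto simp: basis_vector_def)
 also have "\<dots> = v i" using i v by(intro M.finsum_singleton) auto
 finally show ?thesis .
qed

lemma quotient_module_lift:
 assumes M: "module A M" and K: "submodule K A M" and N: "module A N" and h: "h : linear_maps A M N"
  and hK: "!!x. x : K ==> h x = 0_N"
 shows "\<exists>f\<in>linear_maps A (quotient_module M K) N. \<forall>x\<in>$M. f (K +>\<^bsub>M\<^esub> x) = h x"
proof -
 interpret M: module A M by(rule M)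
 interpret N: module A N by(rule N)
 let ?f = "%c. h (SOME x. x : $M & c = K +>\<^bsub>M\<^esub> x)"
 have f: "?f (K +>\<^bsub>M\<^esub> x) = h x" if x: "x : $M" for x
 proof -
  define y where "y = (SOME y. y : $M & K +>\<^bsub>M\<^esub> x = K +>\<^bsub>M\<^esub> y)"
  have "y : $M & K +>\<^bsub>M\<^esub> x = K +>\<^bsub>M\<^esub> y"
   unfolding y_def by(rule someI[of _ x]) (use x in simp)
  hence y: "y : $M" "y-.M x : K" using submodule_coset_eq[OF M K, of y x] x by auto
  have "h (y-.M x) = h y-.N h x"
   using y(1) x by(simp add: a_minus_def linear_mapsD(2)[OF h] linear_maps_minus[OF h M N])
  hence z: "h y-.N h x = 0_N" using hK[OF y(2)] by simp
  have c: "h y : $N" "h x : $N" using linear_mapsD(1)[OF h] x y by auto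
  have "h y = (h y-.N h x)+.N h x" using c by(simp add: a_minus_def N.a_assoc N.l_neg)
  thus ?thesis unfolding y_def[symmetric] using z c by simp
 qed
 note cq = carrier_quotient_module[OF M K]
 have "?f : linear_maps A (quotient_module M K) N"
  unfolding linear_maps_def
 proof(intro CollectI conjI ballI funcsetI)
  fix c assume "c : $(quotient_module M K)"
  then obtain x where x: "x : $M" "c = K +>\<^bsub>M\<^esub> x" unfolding cq by blast
  show "?f c : $N" unfolding x(2) f[OF x(1)] by(rule linear_mapsD(1)[OF h x(1)])
  fix c' assume "c' : $(quotient_module M K)"
  then obtain x' where x': "x' : $M" "c' = K +>\<^bsub>M\<^esub> x'" unfolding cq by blast
  show "?f (c+.(quotient_module M K) c') = ?f c+.N ?f c'"
   unfolding x(2) x'(2) add_quotient_module[OF M K x(1) x'(1)] f[OF x(1)] f[OF x'(1)] f[OF M.a_closed[OF x(1) x'(1)]]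
   by(rule linear_mapsD(2)[OF h x(1) x'(1)])
 next
  fix a c assume a: "a : $A" and "c : $(quotient_module M K)"
  then obtain x where x: "x : $M" "c = K +>\<^bsub>M\<^esub> x" unfolding cq by blast
  show "?f (a**.(quotient_module M K) c) = a**.N ?f c"
   unfolding x(2) smult_quotient_module[OF M K a x(1)] f[OF x(1)] f[OF M.smult_closed[OF a x(1)]]
   by(rule linear_mapsD(3)[OF h a x(1)])
 qed
 thus ?thesis using f by(intro bexI[of _ ?f] ballI)
qed

text \<open>The filtration read as strictly triangular matrices: each operator in \<open>E\<close>
  sends the i-th generator to a combination of the earlier ones.\<close>

lemma triangular_generators:
 assumes M: "module A M" and T: "triangular A M E l Q"
 shows "\<exists>x c. (\<forall>i<l. x i : $M) \<and>
  (\<forall>i<l. \<forall>a\<in>E. (\<forall>k<i. c a i k : $A) & a**.M x i = free_lift M i x (c a i)) \<and>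
  Q = {free_lift M l x y | y. \<forall>i<l. y i : $A}"
 using T
proof(induction rule: triangular.induct)
 case zero
 have "free_lift M 0 x y = 0_M" for x y by(rule module.free_lift_0[OF M])
 thus ?case by simp
next
 case (step l Q z)
 interpret module A M by(rule M)
 from step.IH obtain x c where xc: "\<forall>i<l. x i : $M"
  "\<forall>i<l. \<forall>a\<in>E. (\<forall>k<i. c a i k : $A) & a**.M x i = free_lift M i x (c a i)"
  "Q = {free_lift M l x y | y. \<forall>i<l. y i : $A}" by blast
 have "\<forall>a\<in>E. \<exists>y. (\<forall>i<l. y i : $A) & a**.M z = free_lift M l x y"
  using step.hyps(3) unfolding xc(3) by blast
 from bchoice[OF this] obtain c' where c': "\<forall>a\<in>E. (\<forall>i<l. c' a i : $A) & a**.M z = free_lift M l x (c' a)" ..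
 define x1 where "x1 = x(l := z)"
 define c1 where "c1 = (%a. (c a)(l := c' a))"
 have fl: "free_lift M i x1 y = free_lift M i x y" if i: "i \<le> l" and y: "\<forall>k<i. y k : $A" for i y
  by(rule free_lift_cong) (use i y xc(1) in "auto simp: x1_def")
 have x1M: "\<forall>i<Suc l. x1 i : $M" using xc(1) step.hyps(2) by(simp add: x1_def less_Suc_eq)
 moreover have "\<forall>i<Suc l. \<forall>a\<in>E. (\<forall>k<i. c1 a i k : $A) & a**.M x1 i = free_lift M i x1 (c1 a i)"
 proof(intro allI impI ballI)
  fix i a assume i: "i < Suc l" and a: "a : E"
  show "(\<forall>k<i. c1 a i k : $A) & a**.M x1 i = free_lift M i x1 (c1 a i)"
  proof(cases "i = l")
   case True
   thus ?thesis using c' a fl[of l "c' a"] by(simp add: c1_def x1_def)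
  next
   case False
   thus ?thesis using xc(2) a i fl[of i "c a i"] by(simp add: c1_def x1_def)
  qed
 qed
 moreover have "adjoin A M Q z = {free_lift M (Suc l) x1 y | y. \<forall>i<Suc l. y i : $A}"
 proof -
  have S: "free_lift M (Suc l) x1 y = free_lift M l x y+.M y l**.M z" if y: "\<forall>i<Suc l. y i : $A" for y
  proof -
   have "free_lift M (Suc l) x1 y = free_lift M l x1 y+.M y l**.M x1 l"
   by(rule free_lift_Suc) (use x1M y in simp_all)
   thus ?thesis using fl[of l y] y by(simp add: x1_def)
  qed
  show ?thesis
  proof
   show "adjoin A M Q z \<subseteq> {free_lift M (Suc l) x1 y | y. \<forall>i<Suc l. y i : $A}"
   proof
   fix w assume "w : adjoin A M Q z"
   then obtain y r where y: "w = free_lift M l x y+.M r**.M z" "\<forall>i<l. y i : $A" "r : $A"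
   unfolding adjoin_def xc(3) by blast
   let ?y = "y(l := r)"
   have y': "\<forall>i<Suc l. ?y i : $A" using y by(simp add: less_Suc_eq)
   have eq: "free_lift M l x ?y = free_lift M l x y"
   by(rule free_lift_cong) (use xc(1) y(2) in auto)
   have "w = free_lift M (Suc l) x1 ?y" unfolding S[OF y'] eq y(1) by simp
   thus "w : {free_lift M (Suc l) x1 y | y. \<forall>i<Suc l. y i : $A}" using y' by blast
   qed
   show "{free_lift M (Suc l) x1 y | y. \<forall>i<Suc l. y i : $A} \<subseteq> adjoin A M Q z"
   proof
   fix w assume "w : {free_lift M (Suc l) x1 y | y. \<forall>i<Suc l. y i : $A}"
   then obtain y where y: "w = free_lift M (Suc l) x1 y" "\<forall>i<Suc l. y i : $A" by blast
   have "free_lift M l x y : Q" unfolding xc(3) using y(2) by auto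
   thus "w : adjoin A M Q z" unfolding y(1) S[OF y(2)] adjoin_def using y(2) by blast
   qed
  qed
 qed
 ultimately show ?case by blast
qed

text \<open>Imposing the triangular relations alone gives a finitely presented module that maps onto
  \<open>M\<close> and has a filtration with the same number of steps. It is the competitor that
  bounds the infimum for finitely generated modules.\<close>

lemma triangular_cover:
 assumes M: "module A M" and T: "triangular A M E l $M" and E: "finite E" "E \<subseteq> $A"
 obtains Y where "finite Y" "Y \<subseteq> $(free_module A l)"
  "triangular A (quotient_module (free_module A l) (module_span A (free_module A l) Y)) E l
   ($(quotient_module (free_module A l) (module_span A (free_module A l) Y)))"
  "\<exists>f\<in>linear_maps A (quotient_module (free_module A l) (module_span A (free_module A l) Y)) M.
   f ` $(quotient_module (free_module A l) (module_span A (free_module A l) Y)) = $M"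
proof -
 interpret M: module A M by(rule M)
 have A: "cring A" by(rule M.is_cring)
 let ?F = "free_module A l"
 have Fm: "module A ?F" by(rule module_free_module[OF A])
 interpret F: module A ?F by(rule Fm)
 obtain x c where xc: "(\<forall>i<l. x i : $M) \<and>
  (\<forall>i<l. \<forall>a\<in>E. (\<forall>k<i. c a i k : $A) & a**.M x i = free_lift M i x (c a i)) \<and>
  $M = {free_lift M l x y | y. \<forall>i<l. y i : $A}"
  using triangular_generators[OF M T] by(elim exE)
 have x: "x i : $M" if "i < l" for i using conjunct1[OF xc] that by blast
 have c: "c a i k : $A" if "i < l" "a : E" "k < i" for i a k using conjunct1[OF conjunct2[OF xc]] that by blast
 have cx: "a**.M x i = free_lift M i x (c a i)" if "i < l" "a : E" for i a using conjunct1[OF conjunct2[OF xc]] that by blast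
 note Q = conjunct2[OF conjunct2[OF xc]]
 let ?b = "basis_vector A l"
 let ?t = "%a i. \<lambda>k\<in>{..<l}. if k < i then c a i k else 0_A"
 have bF: "?b i : $?F" for i by(rule basis_vector_closed[OF A])
 have tF: "?t a i : $?F" if "a : E" "i < l" for a i using c[OF that(2,1)] by(auto simp: free_module_simps)
 have aA: "a : $A" if "a : E" for a using E(2) that by blast
 \<comment> \<open>One relation for each operator and each basis vector: the operator applied to the
   vector, minus the prescribed combination of earlier ones. Finiteness of \<open>E\<close> makes
   the presentation finite.\<close>
 define Y where "Y = (%(a, i). a**.?F ?b i-.?F ?t a i) ` (E \<times> {..<l})"
 have Yfin: "finite Y" unfolding Y_def using E by simp
 have YF: "Y \<subseteq> $?F" unfolding Y_def using bF tF aA by auto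
 let ?S = "module_span A ?F Y"
 have S: "submodule ?S A ?F" by(rule submodule_module_span[OF Fm YF])
 let ?N = "quotient_module ?F ?S"
 have Nm: "module A ?N" by(rule module_quotient_module[OF Fm S])
 let ?lam = "free_lift M l x"
 have lam: "?lam : linear_maps A ?F M" by(rule free_lift_linear[OF M x])
 have "submodule {y : $?F. ?lam y = 0_M} A ?F"
  by(rule F.submoduleI)
   (auto simp: linear_maps_zero[OF lam Fm M] linear_maps_minus[OF lam Fm M] linear_mapsD(2,3)[OF lam])
 moreover have "Y \<subseteq> {y : $?F. ?lam y = 0_M}"
 proof
  fix y assume "y : Y"
  then obtain a i where y: "y = a**.?F ?b i-.?F ?t a i" "a : E" "i < l" unfolding Y_def by auto
  have "?lam y = ?lam (a**.?F ?b i)+.M ?lam (-.?F ?t a i)"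
   unfolding y(1) a_minus_def
   by(rule linear_mapsD(2)[OF lam F.smult_closed[OF aA[OF y(2)] bF] F.a_inv_closed[OF tF[OF y(2,3)]]])
  also have "?lam (a**.?F ?b i) = a**.M x i"
   using linear_mapsD(3)[OF lam aA[OF y(2)] bF] free_lift_basis_vector[OF M _ y(3), of x] x by simp
  also have "?lam (-.?F ?t a i) =-.M (a**.M x i)"
   unfolding linear_maps_minus[OF lam Fm M tF[OF y(2,3)]] cx[OF y(3,2)]
   using x c[OF y(3,2)] y(3) by(subst M.free_lift_truncate) auto
  finally have "?lam y = 0_M" using x[OF y(3)] aA[OF y(2)] by(simp add: M.r_neg)
  thus "y : {y : $?F. ?lam y = 0_M}" using YF \<open>y \<in> Y\<close> by blast
 qed
 ultimately have Sk: "?lam y = 0_M" if "y : ?S" for y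
  using module_span_subset that by blast
 obtain f where f: "f : linear_maps A ?N M" "!!y. y : $?F ==> f (?S +>\<^bsub>?F\<^esub> y) = ?lam y"
  using quotient_module_lift[OF Fm S M lam Sk] by blast
 note cN = carrier_quotient_module[OF Fm S]
 have "f ` $?N = $M"
 proof
  show "f ` $?N \<subseteq> $M" using linear_mapsD(1)[OF f(1)] by blast
  show "$M \<subseteq> f ` $?N"
  proof
   fix m assume "m : $M"
   then obtain y where y: "m = ?lam y" "\<forall>i<l. y i : $A" unfolding Q by blast
   let ?y = "restrict y {..<l}"
   have y': "?y : $?F" using y(2) by(simp add: free_module_simps)
   have "?lam ?y = m" unfolding y(1) by(rule M.free_lift_cong) (use x y in auto)
   hence "f (?S +>\<^bsub>?F\<^esub> ?y) = m" using f(2)[OF y'] by simp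
   thus "m : f ` $?N" unfolding cN using y' by blast
  qed
 qed
 \<comment> \<open>Vectors supported on the first \<open>i\<close> coordinates; their classes form
   the filtration of the quotient.\<close>
 let ?Fi = "%i. {y : $?F. \<forall>k. i \<le> k & k < l \<longrightarrow> y k = 0_A}"
 have "i \<le> l ==> triangular A ?N E i ((%y. ?S +>\<^bsub>?F\<^esub> y) ` ?Fi i)" for i
 proof(induction i)
  case 0
  have "?Fi 0 = {0_?F}"
  proof
   show "{0_?F} \<subseteq> ?Fi 0" using F.zero_closed by(auto simp: free_module_simps)
   show "?Fi 0 \<subseteq> {0_?F}" by(auto simp: free_module_simps PiE_iff extensional_def fun_eq_iff)
  qed
  thus ?case using triangular.zero[of A ?N E] by(simp add: zero_quotient_module[OF Fm S])
 next
  case (Suc i)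
  hence i: "i < l" by simp
  have T: "triangular A ?N E (Suc i) (adjoin A ?N ((%y. ?S +>\<^bsub>?F\<^esub> y) ` ?Fi i) (?S +>\<^bsub>?F\<^esub> ?b i))"
  proof(rule triangular.step)
   show "triangular A ?N E i ((%y. ?S +>\<^bsub>?F\<^esub> y) ` ?Fi i)" using Suc by simp
   show "?S +>\<^bsub>?F\<^esub> ?b i : $?N" unfolding cN using bF by blast
   fix a assume a: "a : E"
   have "a**.?F ?b i-.?F ?t a i : ?S" using subset_module_span[of Y A ?F] a i unfolding Y_def by auto
   hence "?S +>\<^bsub>?F\<^esub> (a**.?F ?b i) = ?S +>\<^bsub>?F\<^esub> ?t a i"
   using submodule_coset_eq[OF Fm S F.smult_closed[OF aA[OF a] bF] tF[OF a i]] by blast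
   moreover have "?t a i : ?Fi i" using tF[OF a i] by simp
   ultimately show "a**.?N (?S +>\<^bsub>?F\<^esub> ?b i) : (%y. ?S +>\<^bsub>?F\<^esub> y) ` ?Fi i"
   unfolding smult_quotient_module[OF Fm S aA[OF a] bF] by blast
  qed
  have eq: "(?S +>\<^bsub>?F\<^esub> u)+.?N r**.?N (?S +>\<^bsub>?F\<^esub> ?b i) = ?S +>\<^bsub>?F\<^esub> (u+.?F r**.?F ?b i)"
   if "u : $?F" "r : $A" for u r
   unfolding smult_quotient_module[OF Fm S that(2) bF] add_quotient_module[OF Fm S that(1) F.smult_closed[OF that(2) bF]] ..
  have "adjoin A ?N ((%y. ?S +>\<^bsub>?F\<^esub> y) ` ?Fi i) (?S +>\<^bsub>?F\<^esub> ?b i) = (%y. ?S +>\<^bsub>?F\<^esub> y) ` ?Fi (Suc i)"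
  proof
   show "adjoin A ?N ((%y. ?S +>\<^bsub>?F\<^esub> y) ` ?Fi i) (?S +>\<^bsub>?F\<^esub> ?b i) \<subseteq> (%y. ?S +>\<^bsub>?F\<^esub> y) ` ?Fi (Suc i)"
   proof
   fix z assume "z : adjoin A ?N ((%y. ?S +>\<^bsub>?F\<^esub> y) ` ?Fi i) (?S +>\<^bsub>?F\<^esub> ?b i)"
   then obtain u r where u: "u : ?Fi i" "r : $A" "z = (?S +>\<^bsub>?F\<^esub> u)+.?N r**.?N (?S +>\<^bsub>?F\<^esub> ?b i)"
   unfolding adjoin_def by blast
   have uF: "u : $?F" using u(1) by blast
   have "u+.?F r**.?F ?b i : ?Fi (Suc i)"
   proof(intro CollectI conjI allI impI)
   show "u+.?F r**.?F ?b i : $?F" using uF u(2) bF by simp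
   show "(u+.?F r**.?F ?b i) k = 0_A" if "Suc i \<le> k & k < l" for k
   using that u(1,2) by(auto simp: free_module_simps basis_vector_def)
   qed
   thus "z : (%y. ?S +>\<^bsub>?F\<^esub> y) ` ?Fi (Suc i)" unfolding u(3) eq[OF uF u(2)] by blast
   qed
   show "(%y. ?S +>\<^bsub>?F\<^esub> y) ` ?Fi (Suc i) \<subseteq> adjoin A ?N ((%y. ?S +>\<^bsub>?F\<^esub> y) ` ?Fi i) (?S +>\<^bsub>?F\<^esub> ?b i)"
   proof
   fix z assume "z : (%y. ?S +>\<^bsub>?F\<^esub> y) ` ?Fi (Suc i)"
   then obtain y where y: "y : ?Fi (Suc i)" "z = ?S +>\<^bsub>?F\<^esub> y" by blast
   let ?u = "\<lambda>k\<in>{..<l}. if k = i then 0_A else y k"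
   have yA: "y k : $A" if "k < l" for k using y(1) that by(auto simp: free_module_simps)
   have u: "?u : ?Fi i" using y(1) yA by(auto simp: free_module_simps)
   have uF: "?u : $?F" using u by blast
   have "y = ?u+.?F y i**.?F ?b i"
   proof
   fix k
   have "y k = undefined" if "\<not> k < l" using y(1) that by(auto simp: free_module_simps PiE_iff extensional_def)
   thus "y k = (?u+.?F y i**.?F ?b i) k" using yA i by(auto simp: free_module_simps basis_vector_def)
   qed
   hence "z = (?S +>\<^bsub>?F\<^esub> ?u)+.?N y i**.?N (?S +>\<^bsub>?F\<^esub> ?b i)"
   using y(2) eq[OF uF yA[OF i]] by metis
   thus "z : adjoin A ?N ((%y. ?S +>\<^bsub>?F\<^esub> y) ` ?Fi i) (?S +>\<^bsub>?F\<^esub> ?b i)"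
   unfolding adjoin_def using u yA[OF i] by blast
   qed
  qed
  thus ?case using T by simp
 qed
 from this[of l] have "triangular A ?N E l ((%y. ?S +>\<^bsub>?F\<^esub> y) ` ?Fi l)" by simp
 moreover have "(%y. ?S +>\<^bsub>?F\<^esub> y) ` ?Fi l = $?N" unfolding cN by auto
 ultimately show thesis using that[OF Yfin YF] f(1) \<open>f ` carrier ?N = carrier M\<close> by auto
qed

section \<open>Modules over Rinf defined over a finite level\<close>

context power_series_tower
begin

lemma id_hom: "(%a. a) : ring_hom (R n) Rinf"
 unfolding ring_hom_def using SC_Rinf by(auto simp: R_simps)

lemma base_change_setup: "module (R n) N ==> base_change_setup (R n) (%a. a) Rinf N"
 using id_hom S.is_cring by(simp add: base_change_setup_def)

abbreviation "T n N \<equiv> base_change (R n) (%a. a) Rinf N"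
abbreviation "tens n N x \<equiv> pure (R n) (%a. a) Rinf N x 1_Rinf"

lemma T_module: "module (R n) N ==> module Rinf (T n N)"
 using base_change_setup.T_module[OF base_change_setup] .

lemma tens_linear:
 assumes N: "module (R n) N" shows "tens n N : linear_maps (R n) N (T n N)"
proof -
 interpret B: base_change_setup "R n" "%a. a" Rinf N by(rule base_change_setup[OF N])
 show ?thesis
  unfolding linear_maps_def
 proof(intro CollectI conjI ballI funcsetI)
  fix x assume x: "x : $N"
  show "tens n N x : $(T n N)" using B.pur_closed x by simp
  show "tens n N (x+.N y) = tens n N x+.(T n N) tens n N y" if "y : $N" for y
   using B.pur_add_left x that by simp
 next
  fix a x assume a: "a : $(R n)" and x: "x : $N"
  hence "a : $Rinf" using SC_Rinf by(auto simp: R_simps)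
  thus "tens n N (a**.N x) = a**.(T n N) tens n N x"
   using B.pur_scalar[OF x a] B.pur_smult[OF x] by simp
 qed
qed

lemma tens_comp_linear:
 assumes N: "module (R n) N" and g: "g : linear_maps Rinf (T n N) M"
 shows "(%x. g (tens n N x)) : linear_maps (R n) N M"
 unfolding linear_maps_def
proof(intro CollectI conjI ballI funcsetI)
 note t = linear_mapsD[OF tens_linear[OF N]]
 fix x assume x: "x : $N"
 show "g (tens n N x) : $M" using linear_mapsD(1)[OF g t(1)[OF x]] .
 show "g (tens n N (x+.N y)) = g (tens n N x)+.M g (tens n N y)" if y: "y : $N" for y
  unfolding t(2)[OF x y] by(rule linear_mapsD(2)[OF g t(1)[OF x] t(1)[OF y]])
next
 note t = linear_mapsD[OF tens_linear[OF N]]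
 fix a x assume a: "a : $(R n)" and x: "x : $N"
 have "a : $Rinf" using a SC_Rinf by(auto simp: R_simps)
 thus "g (tens n N (a**.N x)) = a**.M g (tens n N x)"
  unfolding t(3)[OF a x] by(intro linear_mapsD(3)[OF g _ t(1)[OF x]])
qed

lemma dual_basis_Rinf: "dual_basis n m b c ==> j < (p ^ (m - n)) ^ d ==> b j : $Rinf"
 unfolding dual_basis_def using SC_Rinf by blast

text \<open>Applying the k-th dual functional to the right tensor factor kills the contributions of
  the earlier basis elements and returns \<open>x\<close> from \<open>b k\<close> times x \<otimes>
  1.\<close>

lemma tens_independent:
 assumes N: "module (R n) N" and bc: "dual_basis n m b c" and k: "k < (p ^ (m - n)) ^ d"
  and u: "u : scaled_sum (T n N) b (tens n N ` $N) k" and x: "x : $N"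
  and z: "u+.(T n N) b k**.(T n N) tens n N x = 0_(T n N)"
 shows "x = 0_N"
proof -
 interpret N: module "R n" N by(rule N)
 interpret Tm: module Rinf "T n N" by(rule T_module[OF N])
 interpret B: base_change_setup "R n" "%a. a" Rinf N by(rule base_change_setup[OF N])
 have c: "c k y : $(R n)" if "y : $Rinf" for y using bc k that by(simp add: dual_basis_def R_simps)
 have cadd: "c k (y+.Rinf z) = c k y+.(R n) c k z" if "y : $Rinf" "z : $Rinf" for y z
  using bc k that by(simp add: dual_basis_def R_simps)
 have csm: "c k (a*.Rinf y) = a*.(R n) c k y" if "a : $(R n)" "y : $Rinf" for a y
  using bc k that by(simp add: dual_basis_def R_simps)
 note bR = dual_basis_Rinf[OF bc]
 have cb: "c k (b j) = (if k = j then 1_(R n) else 0_(R n))" if "j < (p ^ (m - n)) ^ d" for j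
  using bc k that by(simp add: dual_basis_def R_simps)
 let ?g = "%(x, r). c k r**.N x"
 let ?L = "tensor_lift N ?g"
 have 4: "?g (a**.N x, r) = ?g (x, a*.Rinf r)" if "a : $(R n)" "x : $N" "r : $Rinf" for a x r
  using that csm c N.smult_assoc1[of "c k r" a x] by(simp add: N.R.m_comm)
 have L: "s : $(T n N) ==> t : $(T n N) ==> ?L (s+.(T n N) t) = ?L s+.N ?L t"
   "x : $N ==> r : $Rinf ==> ?L (pure (R n) (%a. a) Rinf N x r) = c k r**.N x"
   "s : $(T n N) ==> ?L s : $N" for s t x r
  using B.tensor_lift_additive[of N ?g, OF N.abelian_group_axioms _ _ _ 4] c cadd
  by(simp_all add: N.smult_l_distr N.smult_r_distr)
 have Lb: "?L (b j**.(T n N) tens n N y) = c k (b j)**.N y" if "y : $N" "j < (p ^ (m - n)) ^ d" for y j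
  using B.pur_smult[OF that(1) S.one_closed bR[OF that(2)]] L(2)[OF that(1) bR[OF that(2)]] bR[OF that(2)] by simp
 have L0: "?L 0_(T n N) = 0_N"
 proof -
  have e: "0_(T n N)+.(T n N) 0_(T n N) = 0_(T n N)" by simp
  have "?L 0_(T n N) = ?L 0_(T n N)+.N ?L 0_(T n N)"
   using L(1)[OF Tm.zero_closed Tm.zero_closed] unfolding e .
  thus ?thesis using L(3)[OF Tm.zero_closed] by(metis N.M.add.r_cancel_one')
 qed
 have tc: "tens n N y : $(T n N)" if "y : $N" for y using linear_mapsD(1)[OF tens_linear[OF N] that] .
 have "v : $(T n N) & ?L v = 0_N" if "v : scaled_sum (T n N) b (tens n N ` $N) k'" "k' \<le> k" for v k'
  using that
 proof(induction k' arbitrary: v)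
  case 0 thus ?case using L0 by simp
 next
  case (Suc k')
  obtain w y where wy: "v = w+.(T n N) b k'**.(T n N) tens n N y" "w : scaled_sum (T n N) b (tens n N ` $N) k'" "y : $N"
   using Suc.prems(1) by auto
  have w: "w : $(T n N)" "?L w = 0_N" using Suc.IH[OF wy(2)] Suc.prems(2) by auto
  have k': "k' < (p ^ (m - n)) ^ d" "k' ~= k" using Suc.prems(2) k by auto
  have bt: "b k'**.(T n N) tens n N y : $(T n N)" using bR[OF k'(1)] tc[OF wy(3)] by simp
  have "?L (b k'**.(T n N) tens n N y) = 0_N" using Lb[OF wy(3) k'(1)] cb[OF k'(1)] k'(2) wy(3) by simp
  thus ?case unfolding wy(1) L(1)[OF w(1) bt] using w bt by simp
 qed
 hence u': "u : $(T n N)" "?L u = 0_N" using u by auto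
 have bt: "b k**.(T n N) tens n N x : $(T n N)" using bR[OF k] tc[OF x] by simp
 have "0_N = ?L u+.N ?L (b k**.(T n N) tens n N x)" using L(1)[OF u'(1) bt] unfolding z L0 .
 also have "\<dots> = x" unfolding u'(2) Lb[OF x k] cb[OF k] using x by simp
 finally show ?thesis by simp
qed

lemma scaled_sum_mono: "K \<subseteq> K' ==> scaled_sum M b K k \<subseteq> scaled_sum M b K' k"
 by(induction k) auto

text \<open>Independence over a basis of \<open>R m\<close> over \<open>R n\<close> passes from \<open>Rinf \<otimes> N\<close> to any module into which it
 embeds on the relevant elements.\<close>

lemma image_independent:
 assumes N: "module (R n) N" and bc: "dual_basis n m b c" and k: "k < (p ^ (m - n)) ^ d"
  and M: "module Rinf M" and f: "f : linear_maps Rinf (T n N) M" and inj: "inj_on f ($(T n N))"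
  and K: "K \<subseteq> $N" and u: "u : scaled_sum M b ((%x. f (tens n N x)) ` K) k" and x: "x : $N"
  and z: "u+.M b k**.M f (tens n N x) = 0_M"
 shows "x = 0_N"
proof -
 interpret Tm: module Rinf "T n N" by(rule T_module[OF N])
 note bR = dual_basis_Rinf[OF bc]
 have tc: "tens n N y : $(T n N)" if "y : $N" for y using linear_mapsD(1)[OF tens_linear[OF N] that] .
 have im: "(%x. f (tens n N x)) ` K = f ` (tens n N ` K)" by blast
 have tK: "tens n N ` K \<subseteq> $(T n N)" using K tc by blast
 have si: "scaled_sum M b (f ` (tens n N ` K)) k = f ` scaled_sum (T n N) b (tens n N ` K) k \<and>
   scaled_sum (T n N) b (tens n N ` K) k \<subseteq> $(T n N)"
  using k bR by(intro scaled_sum_image[OF f Tm.module_axioms M tK]) simp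
 then obtain w where w: "w : scaled_sum (T n N) b (tens n N ` K) k" "u = f w" "w : $(T n N)"
  using u unfolding im by blast
 have bt: "b k**.(T n N) tens n N x : $(T n N)" using bR[OF k] tc[OF x] by simp
 have "f (w+.(T n N) b k**.(T n N) tens n N x) = f 0_(T n N)"
  using z unfolding w(2) linear_mapsD(2)[OF f w(3) bt] linear_mapsD(3)[OF f bR[OF k] tc[OF x]] linear_maps_zero[OF f Tm.module_axioms M] .
 hence z': "w+.(T n N) b k**.(T n N) tens n N x = 0_(T n N)"
  using inj_onD[OF inj] w(3) bt Tm.zero_closed by blast
 have "w : scaled_sum (T n N) b (tens n N ` $N) k"
  using w(1) scaled_sum_mono[of "tens n N ` K" "tens n N ` $N"] K by blast
 thus ?thesis using tens_independent[OF N bc k _ x z'] by blast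
qed

text \<open>The case m = n of independence, where the dual basis has a single member.\<close>

lemma tens_inj:
 assumes N: "module (R n) N" and M: "module Rinf M" and f: "f : linear_maps Rinf (T n N) M"
  and inj: "inj_on f ($(T n N))" and x: "x : $N" and z: "f (tens n N x) = 0_M"
 shows "x = 0_N"
proof -
 interpret M: module Rinf M by(rule M)
 obtain b c where bc: "dual_basis n n b c" using exists_dual_basis[of n n] by blast
 have "b 0 : $Rinf" using bc SC_Rinf by(auto simp: dual_basis_def)
 hence "0_M+.M b 0**.M f (tens n N x) = 0_M" unfolding z by simp
 thus ?thesis
  by(intro image_independent[OF N bc _ M f inj empty_subsetI _ x]) simp_all
qed

text \<open>A root at level \<open>n\<close> and the corresponding root at level \<open>e\<close>
  have a common power, a power of the parameter; and the l-th power of the root at level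
  \<open>e\<close> kills every element of the filtration.\<close>

lemma gen_power_zero:
 assumes M: "module Rinf M" and T: "triangular Rinf M (gens e) l Q" and a: "a : gens n"
 shows "\<exists>t. \<forall>x\<in>Q. (a^.Rinf (t::nat))**.M x = 0_M"
proof -
 interpret M: module Rinf M by(rule M)
 obtain i where i: "i : {1..d}" "a = gen n i" using a unfolding gens_def by blast
 have g: "gen e i : $Rinf" "a : $Rinf" using gen_SC i SC_Rinf by blast+
 have "a^.Rinf (p ^ n * l) = (gen 0 i)^.Rinf l"
  using gen_pow[OF i(1), of 0 n] i(2) g by(simp add: S.nat_pow_pow[symmetric])
 also have "\<dots> = (gen e i^.Rinf l)^.Rinf (p ^ e)"
  using gen_pow[OF i(1), of 0 e, symmetric] g by(simp add: S.nat_pow_pow mult.commute)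
 also have "\<dots> = (gen e i^.Rinf l)^.Rinf (p ^ e - 1)*.Rinf gen e i^.Rinf l"
  using p0 g by(metis One_nat_def S.nat_pow_Suc Suc_pred zero_less_power)
 finally have eq: "a^.Rinf (p ^ n * l) = (gen e i^.Rinf l)^.Rinf (p ^ e - 1)*.Rinf gen e i^.Rinf l" .
 have "(a^.Rinf (p ^ n * l))**.M x = 0_M" if x: "x : Q" for x
 proof -
  have xM: "x : $M" using x M.submoduleE(1)[OF M.triangular_submodule[OF T]] by blast
  have gk: "gen e i : gens e" "gens e \<subseteq> $Rinf" using i gens_SC[of e] SC_Rinf[of e] unfolding gens_def by auto
  have "(gen e i^.Rinf l)**.M x = 0_M" by(rule triangular_power_zero[OF M T gk x])
  thus ?thesis unfolding eq using g xM by(simp add: M.smult_assoc1)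
 qed
 thus ?thesis by blast
qed

text \<open>\<open>N\<close> embeds into \<open>M\<close> and inherits torsion from it, so it has a
  filtration at level \<open>n\<close> with at most \<open>s\<close> steps, whose image spans
  \<open>M\<close> over \<open>Rinf\<close>. This feeds one presentation of \<open>M\<close> into
  the length inequality for another.\<close>

lemma presented_triangular:
 assumes M: "module Rinf M" and T: "triangular Rinf M (gens e) l $M"
  and N: "module (R n) N" and len: "module_length (R n) N = enat s"
  and iso: "isomorphic_modules Rinf M (T n N)"
 shows "\<exists>l'\<le>s. triangular Rinf M (gens n) l' $M"
proof -
 interpret M: module Rinf M by(rule M)
 interpret N: module "R n" N by(rule N)
 interpret B: base_change_setup "R n" "%a. a" Rinf N by(rule base_change_setup[OF N])
 have Tm: "module Rinf (T n N)" by(rule T_module[OF N])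
 obtain f where f: "f : linear_maps Rinf M (T n N)" "bij_betw f $M ($(T n N))"
  using iso unfolding isomorphic_modules_def by blast
 define g where "g = inv_into $M f"
 have g: "g : linear_maps Rinf (T n N) M" unfolding g_def by(rule linear_maps_inv_into[OF f M])
 have gbij: "bij_betw g ($(T n N)) $M" unfolding g_def by(rule bij_betw_inv_into[OF f(2)])
 have ginj: "inj_on g ($(T n N))" using gbij by(rule bij_betw_imp_inj_on)
 let ?j = "%x. g (tens n N x)"
 have MR: "module (R n) M" by(rule module_R[OF M])
 have sub: "$(R n) \<subseteq> $Rinf" using SC_Rinf by(simp add: R_simps)
 have j: "?j : linear_maps (R n) N M" by(rule tens_comp_linear[OF N g])
 obtain h where h: "ranked (R n) N $N s h" using module_length_ranked[OF len N] by blast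
 have gR: "gens n \<subseteq> $(R n)" using gens_SC by(simp add: R_simps)
 have tors: "\<exists>t. (a^.(R n) (t::nat))**.N x = 0_N" if a: "a : gens n" and x: "x : $N" for a x
 proof -
  obtain t where t: "\<forall>x\<in>$M. (a^.Rinf (t::nat))**.M x = 0_M" using gen_power_zero[OF M T a] by blast
  have aR: "a^.(R n) t : $(R n)" using a gR by auto
  have "?j ((a^.(R n) t)**.N x) = (a^.Rinf t)**.M ?j x"
   using linear_mapsD(3)[OF j aR x] by(simp add: R_pow)
  also have "\<dots> = 0_M" using t linear_mapsD(1)[OF j x] by blast
  finally show ?thesis using tens_inj[OF N M g ginj N.smult_closed[OF aR x]] by blast
 qed
 obtain l' where l': "l' \<le> s" "triangular (R n) N (gens n) l' $N"
  using N.ranked_triangular[OF finite_gens gR N.carrier_is_submodule tors h] by blast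
 obtain Q' where Q': "triangular Rinf M (gens n) l' Q'" "?j ` $N \<subseteq> Q'"
  using triangular_extend_scalars[OF N M j sub MR gR l'(2)] by blast
 have Q's: "submodule Q' Rinf M" by(rule M.triangular_submodule[OF Q'(1)])
 have fQ: "submodule (f ` Q') Rinf (T n N)" by(rule linear_maps_image_submodule[OF f(1) M Tm Q's])
 have "tens n N x : f ` Q'" if x: "x : $N" for x
 proof -
  have t: "tens n N x : $(T n N)" using linear_mapsD(1)[OF tens_linear[OF N] x] .
  have "f (?j x) = tens n N x" unfolding g_def using f(2) t by(simp add: bij_betw_inv_into_right)
  moreover have "?j x : Q'" using Q'(2) x by blast
  ultimately show ?thesis by(metis imageI)
 qed
 hence "$(T n N) \<subseteq> f ` Q'" by(rule B.T_subset[OF fQ])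
 hence "f ` $M \<subseteq> f ` Q'" using f(2) by(simp add: bij_betw_def)
 hence "$M \<subseteq> Q'"
  using inj_on_image_mem_iff[OF bij_betw_imp_inj_on[OF f(2)] _ M.submoduleE(1)[OF Q's]] by blast
 hence "Q' = $M" using M.submoduleE(1)[OF Q's] by blast
 thus ?thesis using Q'(1) l'(1) by blast
qed

lemma inj_on_linear:
 assumes f: "f : linear_maps A M N" and M: "module A M" and N: "module A N"
  and k: "!!x. x : $M ==> f x = 0_N ==> x = 0_M"
 shows "inj_on f $M"
proof(rule inj_onI)
 interpret M: module A M by(rule M)
 interpret N: module A N by(rule N)
 fix x y assume xy: "x : $M" "y : $M" "f x = f y"
 have "f (x-.M y) = f x+.N-.N f y"
  unfolding a_minus_def using xy linear_mapsD(2)[OF f xy(1) M.a_inv_closed[OF xy(2)]] linear_maps_minus[OF f M N xy(2)] by simp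
 also have "\<dots> = 0_N" using xy linear_mapsD(1)[OF f] by(simp add: N.r_neg)
 finally have "x-.M y = 0_M" using k xy by simp
 moreover have "x = (x-.M y)+.M y" using xy by(simp add: a_minus_def M.M.a_assoc M.M.l_neg)
 ultimately show "x = y" using xy by simp
qed

lemma linear_maps_preimage_submodule:
 assumes f: "f : linear_maps A M N" and M: "module A M" and N: "module A N" and Q: "submodule Q A N"
 shows "submodule {x : $M. f x : Q} A M"
proof -
 interpret M: module A M by(rule M)
 interpret N: module A N by(rule N)
 note Q' = N.submoduleE[OF Q] N.submodule_zero_mem[OF Q]
 show ?thesis
 proof(rule M.submoduleI)
  show "0_M : {x : $M. f x : Q}" using linear_maps_zero[OF f M N] Q' by simp
  show "-.M a : {x : $M. f x : Q}" if "a : {x : $M. f x : Q}" for a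
   using that linear_maps_minus[OF f M N, of a] Q'(3)[of "f a"] by simp
  show "a+.M b : {x : $M. f x : Q}" if "a : {x : $M. f x : Q}" "b : {x : $M. f x : Q}" for a b
   using that linear_mapsD(2)[OF f, of a b] Q'(5)[of "f a" "f b"] by simp
  show "a**.M x : {x : $M. f x : Q}" if "a : $A" "x : {x : $M. f x : Q}" for a x
   using that linear_mapsD(3)[OF f, of a x] Q'(4)[of a "f x"] by simp
 qed auto
qed

lemma module_length_chain_top:
 assumes len: "module_length A N = enat s" and N: "module A N"
 obtains K where "!!i. i \<le> s ==> submodule (K i) A N" "!!i. i < s ==> K i \<subset> K (Suc i)" "s ~= 0 ==> K s = $N"
proof -
 interpret N: module A N by(rule N)
 obtain K0 where K0: "!!i. i \<le> s ==> submodule (K0 i) A N" "!!i. i < s ==> K0 i \<subset> K0 (Suc i)"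
  using module_length_chain[OF len N] by blast
 let ?K = "%i. if i = s then $N else K0 i"
 have "submodule (?K i) A N" if "i \<le> s" for i using K0(1)[OF that] N.carrier_is_submodule by simp
 moreover have "?K i \<subset> ?K (Suc i)" if "i < s" for i
  using K0(2)[OF that] N.submoduleE(1)[OF K0(1), of "Suc i"] that by auto
 ultimately show thesis by(rule that) simp_all
qed

text \<open>A longest chain in \<open>N\<close> maps to a chain in \<open>M\<close> whose multiples
  by a dual basis are independent, so the count at a common level applies.\<close>

lemma presented_length_le:
 assumes M: "module Rinf M" and T: "triangular Rinf M (gens e) l $M"
  and N: "module (R n) N" and fg: "finitely_generated (R n) N" and len: "module_length (R n) N = enat s"
  and iso: "isomorphic_modules Rinf M (T n N)"
 shows "s * p ^ (d * e) \<le> l * p ^ (d * n)"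
proof(cases "s = 0")
 case False
 interpret M: module Rinf M by(rule M)
 interpret N: module "R n" N by(rule N)
 have Tm: "module Rinf (T n N)" by(rule T_module[OF N])
 obtain f where f: "f : linear_maps Rinf M (T n N)" "bij_betw f $M ($(T n N))"
  using iso unfolding isomorphic_modules_def by blast
 define g where "g = inv_into $M f"
 have g: "g : linear_maps Rinf (T n N) M" unfolding g_def by(rule linear_maps_inv_into[OF f M])
 have gbij: "bij_betw g ($(T n N)) $M" unfolding g_def by(rule bij_betw_inv_into[OF f(2)])
 have ginj: "inj_on g ($(T n N))" using gbij by(rule bij_betw_imp_inj_on)
 let ?j = "%x. g (tens n N x)"
 have MR: "module (R n) M" by(rule module_R[OF M])
 interpret MR: module "R n" M by(rule MR)
 have sub: "$(R n) \<subseteq> $Rinf" using SC_Rinf by(simp add: R_simps)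
 have j: "?j : linear_maps (R n) N M" by(rule tens_comp_linear[OF N g])
 have jinj: "inj_on ?j $N" by(rule inj_on_linear[OF j N MR tens_inj[OF N M g ginj]])
 obtain K where K: "!!i. i \<le> s ==> submodule (K i) (R n) N" "!!i. i < s ==> K i \<subset> K (Suc i)" "s ~= 0 ==> K s = $N"
  using module_length_chain_top[OF len N] by blast
 have Ks: "K s = $N" by(rule K(3)[OF False])
 obtain Y where Y: "finite Y" "Y \<subseteq> $N" "module_span (R n) N Y = $N"
  using fg unfolding finitely_generated_def by blast
 show ?thesis
 proof(rule length_le_of_triangular[OF M T, where N = "%i. ?j ` K i" and Y = "?j ` Y"])
  show "submodule (?j ` K i) (R n) M" if "i \<le> s" for i by(rule linear_maps_image_submodule[OF j N MR K(1)[OF that]])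
  show "?j ` K i \<subset> ?j ` K (Suc i)" if i: "i < s" for i
  proof -
   have "K (Suc i) \<subseteq> $N" using N.submoduleE(1)[OF K(1)] i by simp
   from inj_on_subset[OF jinj this] K(2)[OF i] show ?thesis by(rule image_strict_mono)
  qed
  show "finite (?j ` Y)" "?j ` Y \<subseteq> ?j ` K s" using Y Ks by auto
  show "?j ` K s \<subseteq> Q" if Q: "submodule Q (R n) M" "?j ` Y \<subseteq> Q" for Q
  proof -
   have "submodule {x : $N. ?j x : Q} (R n) N"
   by(rule linear_maps_preimage_submodule[OF j N MR Q(1)])
   moreover have "Y \<subseteq> {x : $N. ?j x : Q}" using Y(2) Q(2) by blast
   ultimately have "module_span (R n) N Y \<subseteq> {x : $N. ?j x : Q}" by(rule module_span_subset)
   thus ?thesis unfolding Ks Y(3) by blast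
  qed
  show "x = 0_M" if nm: "n \<le> m" and bc: "dual_basis n m b c" and k: "k < (p ^ (m - n)) ^ d"
   and u: "u : scaled_sum M b (?j ` K s) k" and x: "x : ?j ` K s" and z: "u+.M b k**.M x = 0_M" for m b c k u x
  proof -
   obtain y where y: "y : $N" "x = ?j y" using x Ks by blast
   have "y = 0_N" using image_independent[OF N bc k M g ginj order_refl u[unfolded Ks] y(1)] z unfolding y(2) by blast
   thus ?thesis using y(2) linear_maps_zero[OF j N MR] by simp
  qed
 qed
qed simp

text \<open>A finitely presented module with a triangular filtration is defined over some \<open>R m\<close>: the span
 of its generators over \<open>R m\<close> satisfies no relation over \<open>Rinf\<close> beyond those with coefficients
 in \<open>R m\<close>.\<close>

lemma finitely_presented_level:
 fixes M :: "('w series, 'm) module"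
 assumes M: "module Rinf M" and T: "triangular Rinf M (gens e) l $M" and fp: "finitely_presented Rinf M"
 shows "\<exists>m s. \<exists>N :: ('w series, (nat => 'w series) set) module. module (R m) N & finitely_generated (R m) N \<and>
  module_length (R m) N = enat s & isomorphic_modules Rinf M (T m N)"
proof -
 interpret M: module Rinf M by(rule M)
 obtain r Y h where Y: "finite Y" "Y \<subseteq> $(free_module Rinf r)"
  and h: "h : linear_maps Rinf M (quotient_module (free_module Rinf r) (module_span Rinf (free_module Rinf r) Y))"
   "bij_betw h $M ($(quotient_module (free_module Rinf r) (module_span Rinf (free_module Rinf r) Y)))"
  using fp unfolding finitely_presented_def isomorphic_modules_def by blast
 let ?F = "free_module Rinf r" let ?S = "module_span Rinf ?F Y" let ?Q = "quotient_module ?F ?S"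
 have Fm: "module Rinf ?F" by(rule module_free_module[OF S.is_cring])
 interpret F: module Rinf ?F by(rule Fm)
 have Ss: "submodule ?S Rinf ?F" by(rule submodule_module_span[OF Fm Y(2)])
 have Qm: "module Rinf ?Q" by(rule module_quotient_module[OF Fm Ss])
 note cQ = carrier_quotient_module[OF Fm Ss]
 define hi where "hi = inv_into $M h"
 have hi: "hi : linear_maps Rinf ?Q M" unfolding hi_def by(rule linear_maps_inv_into[OF h M])
 have hib: "bij_betw hi $?Q $M" unfolding hi_def by(rule bij_betw_inv_into[OF h(2)])
 define lam where "lam = (%y. hi (?S +>\<^bsub>?F\<^esub> y))"
 have cos: "?S +>\<^bsub>?F\<^esub> y : $?Q" if "y : $?F" for y using that unfolding cQ by blast
 have lam: "lam : linear_maps Rinf ?F M"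
  unfolding linear_maps_def lam_def
 proof(intro CollectI conjI ballI funcsetI)
  fix y assume y: "y : $?F"
  show "hi (?S +>\<^bsub>?F\<^esub> y) : $M" by(rule linear_mapsD(1)[OF hi cos[OF y]])
  fix z assume z: "z : $?F"
  show "hi (?S +>\<^bsub>?F\<^esub> (y+.?F z)) = hi (?S +>\<^bsub>?F\<^esub> y)+.M hi (?S +>\<^bsub>?F\<^esub> z)"
   using linear_mapsD(2)[OF hi cos[OF y] cos[OF z]] unfolding add_quotient_module[OF Fm Ss y z] .
 next
  fix a y assume a: "a : $Rinf" and y: "y : $?F"
  show "hi (?S +>\<^bsub>?F\<^esub> (a**.?F y)) = a**.M hi (?S +>\<^bsub>?F\<^esub> y)"
   using linear_mapsD(3)[OF hi a cos[OF y]] unfolding smult_quotient_module[OF Fm Ss a y] .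
 qed
 have lam_surj: "\<exists>y\<in>$?F. x = lam y" if "x : $M" for x
  using that hib unfolding lam_def bij_betw_def cQ by blast
 have lam_ker: "y : ?S" if y: "y : $?F" "lam y = 0_M" for y
 proof -
  have "hi (?S +>\<^bsub>?F\<^esub> y) = hi (?S +>\<^bsub>?F\<^esub> 0_?F)"
   using y(2) linear_maps_zero[OF lam Fm M] unfolding lam_def by simp
  hence "?S +>\<^bsub>?F\<^esub> y = ?S +>\<^bsub>?F\<^esub> 0_?F"
   using inj_onD[OF bij_betw_imp_inj_on[OF hib]] cos y(1) F.zero_closed by blast
  hence "y-.?F 0_?F : ?S" using submodule_coset_eq[OF Fm Ss y(1) F.zero_closed] by blast
  thus ?thesis using F.submodule_diffD[OF Ss _ F.submodule_zero_mem[OF Ss] y(1)] by blast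
 qed
 have lamS: "lam y = 0_M" if y: "y : ?S" for y
 proof -
  have yF: "y : $?F" using y F.submoduleE(1)[OF Ss] by blast
  have "y-.?F 0_?F : ?S" using F.submodule_minus_closed[OF Ss y F.submodule_zero_mem[OF Ss]] .
  hence "lam y = lam 0_?F" using submodule_coset_eq[OF Fm Ss yF F.zero_closed] unfolding lam_def by simp
  thus ?thesis using linear_maps_zero[OF lam Fm M] by simp
 qed
 define v where "v = (%i. lam (basis_vector Rinf r i))"
 have vM: "v i : $M" for i
  unfolding v_def by(rule linear_mapsD(1)[OF lam basis_vector_closed[OF S.is_cring]])
 have lam_v: "lam y = free_lift M r v y" if "y : $?F" for y
  unfolding v_def by(rule linear_map_free_module[OF M lam that])
 have "\<exists>m0. \<forall>m\<ge>m0. \<exists>P'. triangular (R m) M (gens e) l P' & v ` {..<r} \<subseteq> P' & P' \<subseteq> $M"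
  by(rule triangular_descent[OF M module_R[OF M] _ _ finite_gens T])
   (use SC_mono vM in "auto simp: R_simps carrier_Rinf")
 then obtain m0 where m0: "!!m. m \<ge> m0 ==> \<exists>P'. triangular (R m) M (gens e) l P' & v ` {..<r} \<subseteq> P' & P' \<subseteq> $M" by blast
 have "\<exists>m1. \<forall>z\<in>Z. z : SC m1" if "finite Z" "Z \<subseteq> $Rinf" for Z
  using that
 proof(induction Z rule: finite_induct)
  case (insert z Z)
  then obtain m1 where m1: "\<forall>z\<in>Z. z : SC m1" by blast
  obtain m2 where m2: "m1 \<le> m2" "z : SC m2" using insert.prems Rinf_level[of z m1] by blast
  thus ?case using m1 SC_mono[OF m2(1)] by blast
 qed simp
 moreover have "finite ((%(y, i). y i) ` (Y \<times> {..<r}))" using Y(1) by simp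
 moreover have "(%(y, i). y i) ` (Y \<times> {..<r}) \<subseteq> $Rinf" using Y(2) by(auto simp: free_module_simps)
 ultimately obtain m1 where m1: "\<forall>z\<in>(%(y, i). y i) ` (Y \<times> {..<r}). z : SC m1" by blast
 \<comment> \<open>A level at which the filtration is available, the coefficients of all relations
   are defined, and the roots \<open>gens e\<close> exist.\<close>
 define m where "m = max m0 (max m1 e)"
 have m: "m0 \<le> m" "m1 \<le> m" "e \<le> m" unfolding m_def by auto
 have Ym: "y i : SC m" if "y : Y" "i < r" for y i
  using m1 SC_mono[OF m(2)] that by force
 obtain P' where P': "triangular (R m) M (gens e) l P'" "v ` {..<r} \<subseteq> P'" using m0[OF m(1)] by blast
 have MR: "module (R m) M" by(rule module_R[OF M])
 interpret MR: module "R m" M by(rule MR)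
 have P's: "submodule P' (R m) M" by(rule MR.triangular_submodule[OF P'(1)])
 let ?L = "(p ^ (m - e)) ^ d * l"
 obtain f where f: "ranked (R m) M P' ?L f"
  using triangular_gens_ranked[OF order_refl MR triangular_gens_refine[OF m(3) MR P'(1)]] by blast
 have Fmod: "module (R m) (free_module (R m) r)" by(rule module_free_module[OF R_cring])
 have flR: "free_lift M r v : linear_maps (R m) (free_module (R m) r) M"
  by(rule free_lift_linear[OF MR]) (rule vM)
 interpret FR: module "R m" "free_module (R m) r" by(rule Fmod)
 \<comment> \<open>The \<open>R m\<close>-span of the generators. Its length over \<open>R m\<close>
   is finite because it lies in \<open>P'\<close>, which has a triangular filtration over
   \<open>R m\<close>.\<close>
 define N0 where "N0 = free_lift M r v ` $(free_module (R m) r)"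
 have N0s: "submodule N0 (R m) M" unfolding N0_def
  by(rule linear_maps_image_submodule[OF flR Fmod MR FR.carrier_is_submodule])
 have N0P: "N0 \<subseteq> P'"
  unfolding N0_def using P'(2) by(auto simp: free_module_simps intro!: free_lift_mem[OF MR P's])
 have bvm: "basis_vector (R m) r i : $(free_module (R m) r)" for i by(rule basis_vector_closed[OF R_cring])
 have vN0: "v i : N0" if "i < r" for i
  unfolding N0_def using free_lift_basis_vector[OF MR _ that, of v] vM bvm by(metis imageI)
 let ?M0 = "M\<lparr>carrier := N0\<rparr>"
 have M0: "module (R m) ?M0" by(rule submodule.submodule_is_module[OF N0s MR])
 \<comment> \<open>An element is named by its fibre under \<open>lam\<close>, a set of coordinate
   functions; this places a copy of \<open>N0\<close> in the element type required of
   representatives.\<close>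
 define q where "q = (%x. {y : $?F. lam y = x})"
 have qinj: "inj_on q $?M0"
 proof(rule inj_onI)
  fix x x' assume x: "x : $?M0" "x' : $?M0" "q x = q x'"
  hence "x : $M" using MR.submoduleE(1)[OF N0s] by auto
  then obtain y where "y : q x" using lam_surj[of x] unfolding q_def by blast
  thus "x = x'" using x(3) unfolding q_def by blast
 qed
 obtain N where N: "module (R m) N" "q : linear_maps (R m) ?M0 N" "$N = q ` $?M0"
  using module_transport[OF M0 qinj] by blast
 interpret N: module "R m" N by(rule N(1))
 have qb: "bij_betw q $?M0 $N" using qinj N(3) by(simp add: bij_betw_def)
 define io where "io = inv_into $?M0 q"
 have io0: "io : linear_maps (R m) N ?M0" unfolding io_def by(rule linear_maps_inv_into[OF N(2) qb M0])
 have iob: "bij_betw io $N N0" using bij_betw_inv_into[OF qb] unfolding io_def by simp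
 have io: "io : linear_maps (R m) N M"
  using linear_mapsD[OF io0] MR.submoduleE(1)[OF N0s] unfolding linear_maps_def by auto
 have ioq: "io (q x) = x" if "x : N0" for x unfolding io_def using inv_into_f_f[OF qinj] that by simp
 let ?w = "%i. q (v i)"
 have wN: "?w i : $N" if "i < r" for i using vN0[OF that] N(3) by auto
 have ql: "q (free_lift M r v y) = free_lift N r ?w y" if y: "y : $(free_module (R m) r)" for y
 proof -
  let ?k = "%y. q (free_lift M r v y)"
  have fl0: "free_lift M r v : linear_maps (R m) (free_module (R m) r) ?M0"
   using linear_mapsD[OF flR] unfolding linear_maps_def N0_def by auto
  have "?k : linear_maps (R m) (free_module (R m) r) N"
   using linear_mapsD[OF fl0] linear_mapsD[OF N(2)] unfolding linear_maps_def by auto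
  hence "?k y = free_lift N r (%i. ?k (basis_vector (R m) r i)) y"
   by(rule linear_map_free_module[OF N(1) _ y])
  also have "\<dots> = free_lift N r ?w y"
  proof(rule N.free_lift_cong)
   show "?k (basis_vector (R m) r i) = ?w i" if "i < r" for i
   using free_lift_basis_vector[OF MR _ that, of v] vM by simp
   show "y i : $(R m)" if "i < r" for i using y that by(auto simp: free_module_simps)
  qed (use wN in simp_all)
  finally show ?thesis .
 qed
 have Nform: "\<exists>y\<in>$(free_module (R m) r). x = free_lift N r ?w y" if x: "x : $N" for x
 proof -
  obtain y where y: "y : $(free_module (R m) r)" "x = q (free_lift M r v y)" using x N(3) by(auto simp: N0_def)
  thus ?thesis using ql[OF y(1)] by blast
 qed
 have fgN: "finitely_generated (R m) N"
  unfolding finitely_generated_def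
 proof(intro exI[of _ "?w ` {..<r}"] conjI)
  show "?w ` {..<r} \<subseteq> $N" using wN by blast
  hence sp: "submodule (module_span (R m) N (?w ` {..<r})) (R m) N" by(rule submodule_module_span[OF N(1)])
  show "module_span (R m) N (?w ` {..<r}) = $N"
  proof
   show "module_span (R m) N (?w ` {..<r}) \<subseteq> $N" by(rule N.submoduleE(1)[OF sp])
   show "$N \<subseteq> module_span (R m) N (?w ` {..<r})"
   proof
   fix x assume "x : $N"
   then obtain y where y: "y : $(free_module (R m) r)" "x = free_lift N r ?w y" using Nform by blast
   show "x : module_span (R m) N (?w ` {..<r})" unfolding y(2)
   by(rule free_lift_mem[OF N(1) sp]) (use y(1) subset_module_span[of "?w ` {..<r}" "R m" N] in "auto simp: free_module_simps")
   qed
  qed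
 qed simp
 have "ranked (R m) N $N ?L (%K. f (io ` K))"
  unfolding ranked_def
 proof(intro conjI allI impI; elim conjE)
  have im: "submodule (io ` K) (R m) M" "io ` K \<subseteq> P'" if "submodule K (R m) N" for K
   using linear_maps_image_submodule[OF io N(1) MR that] N.submoduleE(1)[OF that] iob N0P by(auto simp: bij_betw_def)
  fix K assume K: "submodule K (R m) N"
  show "f (io ` K) \<le> ?L" by(rule ranked_le[OF f im[OF K]])
  fix K' assume K': "submodule K' (R m) N" "K \<subset> K'"
  have "io ` K \<subset> io ` K'"
   by(rule image_strict_mono[OF inj_on_subset[OF bij_betw_imp_inj_on[OF iob] N.submoduleE(1)[OF K'(1)]] K'(2)])
  thus "f (io ` K) < f (io ` K')" by(rule ranked_less[OF f im(1)[OF K] im(1)[OF K'(1)] _ im(2)[OF K'(1)]])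
 qed
 hence "module_length (R m) N \<le> enat ?L" by(rule module_length_leI[OF _ N(1)])
 then obtain s where s: "module_length (R m) N = enat s" using enat_ile by blast
 interpret B: base_change_setup "R m" "%a. a" Rinf N by(rule base_change_setup[OF N(1)])
 have Tm: "module Rinf (T m N)" by(rule T_module[OF N(1)])
 interpret Tm: module Rinf "T m N" by(rule Tm)
 \<comment> \<open>The candidate isomorphism from the base change to \<open>M\<close>. Its
   injectivity will come from \<open>ka\<close>, which maps the free module onto the base change and
   kills the relations \<open>Y\<close>, because these hold in \<open>N\<close> already.\<close>
 define L where "L = tensor_lift M (%(x, b). b**.M io x)"
 have L: "L : linear_maps Rinf (T m N) M"
   "!!x b. x : $N ==> b : $Rinf ==> L (pure (R m) (%a. a) Rinf N x b) = b**.M io x"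
  unfolding L_def using B.tensor_lift_linear[OF M, of io] linear_mapsD[OF io] by blast+
 define ka where "ka = free_lift (T m N) r (%i. tens m N (?w i))"
 have tw: "tens m N (?w i) : $(T m N)" if "i < r" for i using linear_mapsD(1)[OF tens_linear[OF N(1)] wN[OF that]] .
 have ka: "ka : linear_maps Rinf ?F (T m N)" unfolding ka_def by(rule free_lift_linear[OF Tm tw])
 have ka_tens: "ka y = tens m N (free_lift N r ?w y)" if y: "y : $?F" "!!i. i < r ==> y i : SC m" for y
 proof -
  let ?k = "%y. tens m N (free_lift N r ?w y)"
  have TR: "module (R m) (T m N)" by(rule module_R[OF Tm])
  interpret TR: module "R m" "T m N" by(rule TR)
  have flN: "free_lift N r ?w : linear_maps (R m) (free_module (R m) r) N" by(rule free_lift_linear[OF N(1) wN])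
  have "?k : linear_maps (R m) (free_module (R m) r) (T m N)"
   using linear_mapsD[OF flN] linear_mapsD[OF tens_linear[OF N(1)]] unfolding linear_maps_def by auto
  moreover have y': "y : $(free_module (R m) r)" using y by(auto simp: free_module_simps R_simps PiE_iff)
  ultimately have "?k y = free_lift (T m N) r (%i. ?k (basis_vector (R m) r i)) y"
   by(rule linear_map_free_module[OF TR])
  also have "\<dots> = ka y" unfolding ka_def
  proof(rule TR.free_lift_cong)
   show "?k (basis_vector (R m) r i) = tens m N (?w i)" if "i < r" for i
   using free_lift_basis_vector[OF N(1) wN that] by simp
  qed (use y tw in "simp_all add: R_simps")
  finally show ?thesis by simp
 qed
 have "submodule {y : $?F. ka y = 0_(T m N)} Rinf ?F"
  by(rule F.submoduleI)
   (auto simp: linear_maps_zero[OF ka Fm Tm] linear_maps_minus[OF ka Fm Tm] linear_mapsD(2,3)[OF ka])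
 moreover have "Y \<subseteq> {y : $?F. ka y = 0_(T m N)}"
 proof
  fix y assume y: "y : Y"
  have yF: "y : $?F" using y Y(2) by blast
  have y': "y : $(free_module (R m) r)" using yF Ym[OF y] by(auto simp: free_module_simps R_simps PiE_iff)
  have "free_lift M r v y = 0_M" using lamS[of y] subset_module_span[of Y Rinf ?F] y lam_v[OF yF] by auto
  hence "free_lift N r ?w y = q 0_M" using ql[OF y'] by simp
  also have "\<dots> = 0_N" using linear_maps_zero[OF N(2) M0 N(1)] by simp
  finally have "ka y = 0_(T m N)" using ka_tens[OF yF Ym[OF y]] linear_maps_zero[OF tens_linear[OF N(1)] N(1) module_R[OF Tm]] by simp
  thus "y : {y : $?F. ka y = 0_(T m N)}" using yF by blast
 qed
 ultimately have kaS: "ka y = 0_(T m N)" if "y : ?S" for y using module_span_subset that by blast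
 have ka_surj: "$(T m N) \<subseteq> ka ` $?F"
 proof(rule B.T_subset[OF linear_maps_image_submodule[OF ka Fm Tm F.carrier_is_submodule]])
  fix x assume "x : $N"
  then obtain y where y: "y : $(free_module (R m) r)" "x = free_lift N r ?w y" using Nform by blast
  have yF: "y : $?F" "!!i. i < r ==> y i : SC m" using y(1) SC_Rinf by(auto simp: free_module_simps R_simps PiE_iff)
  show "tens m N x : ka ` $?F" using imageI[OF yF(1), of ka] ka_tens[OF yF] y(2) by simp
 qed
 have Lka: "L (ka y) = lam y" if y: "y : $?F" for y
 proof -
  have "(%y. L (ka y)) : linear_maps Rinf ?F M"
   using linear_mapsD[OF L(1)] linear_mapsD[OF ka] unfolding linear_maps_def by auto
  hence "L (ka y) = free_lift M r (%i. L (ka (basis_vector Rinf r i))) y" by(rule linear_map_free_module[OF M _ y])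
  also have "\<dots> = free_lift M r v y"
  proof(rule M.free_lift_cong)
   show "L (ka (basis_vector Rinf r i)) = v i" if "i < r" for i
   unfolding ka_def using free_lift_basis_vector[OF Tm tw that] L(2)[OF wN[OF that] S.one_closed] ioq[OF vN0[OF that]] vM by simp
   show "y i : $Rinf" if "i < r" for i using y that by(auto simp: free_module_simps)
  qed (use vM in simp_all)
  finally show ?thesis unfolding lam_v[OF y] .
 qed
 have "inj_on L ($(T m N))"
 proof(rule inj_on_linear[OF L(1) Tm M])
  fix t assume t: "t : $(T m N)" "L t = 0_M"
  obtain y where y: "y : $?F" "t = ka y" using ka_surj t(1) by blast
  have "lam y = 0_M" using t(2) Lka[OF y(1)] y(2) by simp
  thus "t = 0_(T m N)" using kaS[OF lam_ker[OF y(1)]] y(2) by simp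
 qed
 moreover have "L ` $(T m N) = $M"
 proof
  show "L ` $(T m N) \<subseteq> $M" using linear_mapsD(1)[OF L(1)] by blast
  show "$M \<subseteq> L ` $(T m N)"
  proof
   fix x assume "x : $M"
   then obtain y where y: "y : $?F" "x = lam y" using lam_surj by blast
   show "x : L ` $(T m N)" unfolding y(2) Lka[OF y(1), symmetric] using linear_mapsD(1)[OF ka y(1)] by blast
  qed
 qed
 ultimately have Lb: "bij_betw L ($(T m N)) $M" by(simp add: bij_betw_def)
 have "isomorphic_modules Rinf M (T m N)"
  unfolding isomorphic_modules_def
  using linear_maps_inv_into[OF L(1) Lb Tm] bij_betw_inv_into[OF Lb] by blast
 thus ?thesis using N(1) fgN s by blast
qed

end

section \<open>Upper bounds for the normalized length\<close>

lemma of_nat_divide_le: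
 fixes a b q r :: nat
 assumes "a * q \<le> b * r" "0 < q" "0 < r"
 shows "of_nat a / of_nat r \<le> (of_nat b / of_nat q :: ennreal)"
proof -
 have "real a * real q \<le> real b * real r" using assms(1) by(metis of_nat_le_iff of_nat_mult)
 hence "real a / real r \<le> real b / real q" using assms(2,3) by(simp add: divide_simps)
 thus ?thesis using assms(2,3)
  by(simp add: ennreal_of_nat_eq_real_of_nat divide_ennreal ennreal_leI)
qed

context power_series_tower
begin

text \<open>Two presentations of \<open>M\<close> satisfy the length inequality in both directions,
  so the length divided by p^(d level) is the same for both and the definite description has a
  value.\<close>

lemma normalized_length_fp_le:
 fixes M :: "('w series, 'm) module"
 assumes M: "module Rinf M" and T: "triangular Rinf M (gens e) l $M" and fp: "finitely_presented Rinf M"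
 shows "normalized_length_fp p d (R_level p d W V \<pi>) Rinf M \<le> of_nat l / of_nat (p ^ (d * e))"
proof -
 obtain m s and N :: "('w series, (nat => 'w series) set) module" where N: "module (R m) N"
  "finitely_generated (R m) N" "module_length (R m) N = enat s" "isomorphic_modules Rinf M (T m N)"
  using finitely_presented_level[OF M T fp] by blast
 have pp: "0 < p ^ j" for j using p0 by simp
 have cmp: "s' * p ^ (d * m') \<le> t' * p ^ (d * n')"
  if h: "module (R m') N'" "module_length (R m') N' = enat t'" "isomorphic_modules Rinf M (T m' N')"
   "module (R n') N''" "finitely_generated (R n') N''" "module_length (R n') N'' = enat s'" "isomorphic_modules Rinf M (T n' N'')"
  for m' n' s' t' and N' N'' :: "('w series, (nat => 'w series) set) module"
 proof -
  obtain l' where l': "l' \<le> t'" "triangular Rinf M (gens m') l' $M"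
   using presented_triangular[OF M T h(1-3)] by blast
  have "s' * p ^ (d * m') \<le> l' * p ^ (d * n')" by(rule presented_length_le[OF M l'(2) h(4-7)])
  also have "\<dots> \<le> t' * p ^ (d * n')" using l'(1) by simp
  finally show ?thesis .
 qed
 have "normalized_length_fp p d (R_level p d W V \<pi>) Rinf M = of_nat s / of_nat (p ^ (d * m))"
  unfolding normalized_length_fp_def
 proof(rule the_equality)
  show "\<exists>n. \<exists>N :: ('w series, (nat => 'w series) set) module. module (R n) N & finitely_generated (R n) N \<and>
   module_length (R n) N < \<infinity> & isomorphic_modules Rinf M (T n N) \<and>
   of_nat s / of_nat (p ^ (d * m)) = ennreal_of_enat (module_length (R n) N) / of_nat (p ^ (d * n))"
   using N by(intro exI[of _ m] exI[of _ N]) simp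
  fix v :: ennreal
  assume "\<exists>n. \<exists>N :: ('w series, (nat => 'w series) set) module. module (R n) N & finitely_generated (R n) N \<and>
   module_length (R n) N < \<infinity> & isomorphic_modules Rinf M (T n N) \<and>
   v = ennreal_of_enat (module_length (R n) N) / of_nat (p ^ (d * n))"
  then obtain n and N' :: "('w series, (nat => 'w series) set) module" where N': "module (R n) N'"
   "finitely_generated (R n) N'" "module_length (R n) N' < \<infinity>" "isomorphic_modules Rinf M (T n N')"
   "v = ennreal_of_enat (module_length (R n) N') / of_nat (p ^ (d * n))" by blast
  obtain s' where s': "module_length (R n) N' = enat s'" using N'(3) by(cases "module_length (R n) N'") auto
  have "v = of_nat s' / of_nat (p ^ (d * n))" using N'(5) s' by simp
  moreover have "s' * p ^ (d * m) \<le> s * p ^ (d * n)" by(rule cmp[OF N(1,3,4) N'(1,2) s' N'(4)])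
  moreover have "s * p ^ (d * n) \<le> s' * p ^ (d * m)" by(rule cmp[OF N'(1) s' N'(4) N])
  ultimately show "v = of_nat s / of_nat (p ^ (d * m))"
   using of_nat_divide_le[OF _ pp pp] by(metis order_antisym)
 qed
 also have "\<dots> \<le> of_nat l / of_nat (p ^ (d * e))"
  by(rule of_nat_divide_le[OF presented_length_le[OF M T N] pp pp])
 finally show ?thesis .
qed

text \<open>Each parameter is a positive power of a root in \<open>gens e\<close>, so the maximal
  ideal sends every term of the filtration into the previous one.\<close>

lemma triangular_torsion:
 assumes M: "module Rinf M" and T: "triangular Rinf M (gens e) l Q"
 shows "a : ideal_power (R 0) (max_ideal p d W V \<pi>) l ==> x : Q ==> a**.M x = 0_M"
 using T
proof(induction arbitrary: a x)
 case zero
 interpret M: module Rinf M by(rule M)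
 from zero show ?case using subsetD[OF SC_Rinf, of a 0] by(auto simp: ideal_power_def ideals_set_def R_simps)
next
 case (step l Q v)
 interpret M: module Rinf M by(rule M)
 let ?I = "max_ideal p d W V \<pi>"
 interpret R0: cring "R 0" by(rule R_cring)
 have Qs: "submodule Q Rinf M" by(rule M.triangular_submodule[OF step.hyps(1)])
 note Q = M.submoduleE[OF Qs] M.submodule_zero_mem[OF Qs]
 have gR: "gens e \<subseteq> $Rinf" using gens_SC SC_Rinf by blast
 have gv: "gen 0 i**.M v : Q" if i: "i : {1..d}" for i
 proof -
  obtain q where q: "p ^ e = Suc q" using p0 by(metis gr0_conv_Suc zero_less_power)
  have g: "gen e i : gens e" using i unfolding gens_def by blast
  have "gen 0 i = gen e i^.Rinf q*.Rinf gen e i" using gen_pow[OF i, of 0 e] q by simp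
  hence "gen 0 i**.M v = gen e i^.Rinf q**.M (gen e i**.M v)"
   using g gR step.hyps(2) by(auto simp: M.smult_assoc1)
  thus ?thesis using Q(4)[OF _ step.hyps(3)[OF g], of "gen e i^.Rinf q"] g gR by auto
 qed
 \<comment> \<open>An ideal that contains the parameters contains the maximal ideal they
   generate.\<close>
 have "ideal {b : SC 0. b**.M v : Q} (R 0)"
 proof(rule idealI)
  show "subgroup {b : SC 0. b**.M v : Q} (add_monoid (R 0))"
  proof(rule R0.add.subgroupI)
   show "-.(R 0) b : {b : SC 0. b**.M v : Q}" if b: "b : {b : SC 0. b**.M v : Q}" for b
   proof -
   have b0: "b : $(R 0)" "b : $Rinf" using b SC_Rinf by(auto simp: R_simps)
   have c: "-.(R 0) b : SC 0" using R0.a_inv_closed[OF b0(1)] by(simp add: R_simps)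
   have "-.(R 0) b+.Rinf b = 0_Rinf" using R0.l_neg[OF b0(1)] by(simp add: R_simps)
   from S.minus_equality[OF this b0(2) subsetD[OF SC_Rinf c]] have "-.(R 0) b =-.Rinf b" by(rule sym)
   hence "-.(R 0) b**.M v =-.M (b**.M v)" using M.smult_l_minus[OF b0(2) step.hyps(2)] by simp
   thus ?thesis using b c Q(3) by simp
   qed
   show "b+.(R 0) b' : {b : SC 0. b**.M v : Q}"
   if b: "b : {b : SC 0. b**.M v : Q}" "b' : {b : SC 0. b**.M v : Q}" for b b'
   proof -
   have "b+.(R 0) b' : SC 0" using R0.a_closed b by(simp add: R_simps)
   moreover have "(b+.(R 0) b')**.M v = b**.M v+.M b'**.M v"
   using M.smult_l_distr[OF _ _ step.hyps(2), of b b'] b SC_Rinf by(auto simp: R_simps)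
   ultimately show ?thesis using b Q(5) by simp
   qed
   show "{b : SC 0. b**.M v : Q} ~= {}"
   using R0.zero_closed M.smult_l_null[OF step.hyps(2)] Q(7) by(auto simp: R_simps)
  qed (auto simp: R_simps)
  show "c*.(R 0) b : {b : SC 0. b**.M v : Q}"
   and "b*.(R 0) c : {b : SC 0. b**.M v : Q}" if b: "b : {b : SC 0. b**.M v : Q}" and c: "c : $(R 0)" for b c
  proof -
   have "c*.(R 0) b : SC 0" using R0.m_closed c b by(simp add: R_simps)
   moreover have "(c*.(R 0) b)**.M v = c**.M (b**.M v)"
   using M.smult_assoc1[OF _ _ step.hyps(2), of c b] b c SC_Rinf by(auto simp: R_simps)
   ultimately show *: "c*.(R 0) b : {b : SC 0. b**.M v : Q}"
   using b c Q(4)[of c "b**.M v"] SC_Rinf by(auto simp: R_simps)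
   have "b*.(R 0) c = c*.(R 0) b" using R0.m_comm[of b c] b c by(simp add: R_simps)
   thus "b*.(R 0) c : {b : SC 0. b**.M v : Q}" using * by(simp only:)
  qed
 qed (rule R0.ring_axioms)
 moreover have "parameters p W ` {1..d} \<subseteq> {b : SC 0. b**.M v : Q}"
  using gv gen_SC[of _ 0] gen_0 by auto
 ultimately have I: "?I \<subseteq> {b : SC 0. b**.M v : Q}"
  unfolding max_ideal_def by(rule R0.genideal_minimal)
 have pI: "parameters p W ` {1..d} \<subseteq> $(R 0)" using gen_SC[of _ 0] gen_0 by(auto simp: R_simps)
 have Iid: "ideal ?I (R 0)" unfolding max_ideal_def by(rule R0.genideal_ideal[OF pI])
 have powR: "ideal (ideal_power (R 0) ?I t) (R 0)" for t
  by(induction t) (auto simp: ideal_power_def ideals_set_def nat_pow_def R0.oneideal intro!: R0.ideal_prod_is_ideal Iid)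
 have mQ: "b**.M x : Q" if b: "b : ?I" and x: "x : adjoin Rinf M Q v" for b x
 proof -
  have bS: "b : $Rinf" "b**.M v : Q" using I b SC_Rinf by auto
  obtain q r where qr: "q : Q" "r : $Rinf" "x = q+.M r**.M v"
   using x unfolding adjoin_def by blast
  have "b**.M x = b**.M q+.M b**.M (r**.M v)"
   using qr Q(1) bS step.hyps(2) M.smult_r_distr[of b q "r**.M v"] by auto
  also have "b**.M (r**.M v) = r**.M (b**.M v)"
   using qr(2) bS(1) step.hyps(2) M.smult_assoc1[of b r v] M.smult_assoc1[of r b v] S.m_comm[of b r] by simp
  finally show ?thesis using Q(4)[OF bS(1) qr(1)] Q(4)[OF qr(2) bS(2)] Q(5) by simp
 qed
 have xM: "x : $M" using step.prems(2) M.adjoin_subset[OF M.carrier_is_submodule Q(1) step.hyps(2)] by blast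
 have "a : ideal_prod (R 0) (ideal_power (R 0) ?I l) ?I"
  using step.prems(1) by(simp add: ideal_power_def ideals_set_def nat_pow_def)
 thus ?case
 proof(induction rule: ideal_prod.induct)
  case (prod i j)
  have ij: "i : $Rinf" "j : $Rinf"
   using ideal.Icarr[OF powR prod(1)] I prod(2) SC_Rinf by(auto simp: R_simps)
  show ?case using step.IH[OF prod(1) mQ[OF prod(2) step.prems(2)]] M.smult_assoc1[OF ij xM] by(simp add: R_simps)
 next
  case (sum s t)
  have st: "s : $Rinf" "t : $Rinf"
   using subsetD[OF R0.ideal_prod_in_carrier[OF powR Iid] sum(1)] subsetD[OF R0.ideal_prod_in_carrier[OF powR Iid] sum(2)] SC_Rinf
   by(auto simp: R_simps)
  show ?case using M.smult_l_distr[OF st xM] sum(3,4) by(simp add: R_simps)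
 qed
qed

text \<open>A triangular filtration makes \<open>M\<close> finitely generated, so the supremum
  clause of the definition does not occur; if \<open>M\<close> is not finitely presented, the cover
  by triangular relations enters the infimum.\<close>

lemma normalized_length_le:
 fixes M :: "('w series, 'm) module"
 assumes M: "module Rinf M" and T: "triangular Rinf M (gens e) l $M"
 shows "normalized_length p d (R_level p d W V \<pi>) Rinf (max_ideal p d W V \<pi>) M \<le> of_nat l / of_nat (p ^ (d * e))"
proof(cases "finitely_presented Rinf M")
 case True
 thus ?thesis unfolding normalized_length_def using normalized_length_fp_le[OF M T True] by simp
next
 case False
 interpret M: module Rinf M by(rule M)
 obtain x c where x: "\<forall>i<l. x i : $M" and car: "$M = {free_lift M l x y | y. \<forall>i<l. y i : $Rinf}"
  using triangular_generators[OF M T] by blast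
 have xs: "x ` {..<l} \<subseteq> $M" using x by auto
 have sp: "submodule (module_span Rinf M (x ` {..<l})) Rinf M" by(rule submodule_module_span[OF M xs])
 have "$M \<subseteq> module_span Rinf M (x ` {..<l})"
 proof
  fix z assume "z : $M"
  then obtain y where y: "z = free_lift M l x y" "\<forall>i<l. y i : $Rinf" using car by blast
  show "z : module_span Rinf M (x ` {..<l})" unfolding y(1)
   by(rule free_lift_mem[OF M sp]) (use y(2) subset_module_span[of "x ` {..<l}" Rinf M] in auto)
 qed
 hence fg: "finitely_generated Rinf M"
  unfolding finitely_generated_def using M.submoduleE(1)[OF sp] xs by(intro exI[of _ "x ` {..<l}"]) auto
 have gR: "gens e \<subseteq> $Rinf" using gens_SC SC_Rinf by blast
 obtain Y where Y: "finite Y" "Y \<subseteq> $(free_module Rinf l)"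
  "triangular Rinf (quotient_module (free_module Rinf l) (module_span Rinf (free_module Rinf l) Y)) (gens e) l
   ($(quotient_module (free_module Rinf l) (module_span Rinf (free_module Rinf l) Y)))"
  "\<exists>f\<in>linear_maps Rinf (quotient_module (free_module Rinf l) (module_span Rinf (free_module Rinf l) Y)) M.
   f ` $(quotient_module (free_module Rinf l) (module_span Rinf (free_module Rinf l) Y)) = $M"
  by(rule triangular_cover[OF M T finite_gens gR])
 define N where "N = quotient_module (free_module Rinf l) (module_span Rinf (free_module Rinf l) Y)"
 have Fm: "module Rinf (free_module Rinf l)" by(rule module_free_module[OF S.is_cring])
 have N: "module Rinf N" unfolding N_def
  by(rule module_quotient_module[OF Fm submodule_module_span[OF Fm Y(2)]])
 have "(%y. y) : linear_maps Rinf N N" unfolding linear_maps_def by auto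
 hence "isomorphic_modules Rinf N N" unfolding isomorphic_modules_def using bij_betw_id[of "$N"] by(auto simp: id_def)
 hence fpN: "finitely_presented Rinf N" unfolding finitely_presented_def using Y(1,2) N_def by blast
 have TN: "triangular Rinf N (gens e) l $N" using Y(3) unfolding N_def .
 have tor: "torsion_module (R 0) (max_ideal p d W V \<pi>) N"
  unfolding torsion_module_def using triangular_torsion[OF N TN] by blast
 have "normalized_length p d (R_level p d W V \<pi>) Rinf (max_ideal p d W V \<pi>) M =
  normalized_length_fg p d (R_level p d W V \<pi>) Rinf (max_ideal p d W V \<pi>) M"
  unfolding normalized_length_def using False fg by simp
 also have "\<dots> \<le> normalized_length_fp p d (R_level p d W V \<pi>) Rinf N"
  unfolding normalized_length_fg_def using N tor fpN Y(4)[folded N_def] by(intro Inf_lower) blast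
 also have "\<dots> \<le> of_nat l / of_nat (p ^ (d * e))" by(rule normalized_length_fp_le[OF N TN fpN])
 finally show ?thesis .
qed

end

section \<open>Congruences modulo p and the Cech complex inside one ring\<close>

text \<open>\<open>ring_nat\<close> is declared for the unextended record type of rings, to which
  this locale fixes its parameter.\<close>

locale plain_cring = cring R for R :: "'a ring" (structure)
begin

lemma ring_nat_rules: "ring_nat R m : $R" "ring_nat R 0 = \<zero>" "ring_nat R (Suc 0) = \<one>"
 "ring_nat R (m + k) = ring_nat R m \<oplus> ring_nat R k" "ring_nat R (m * k) = ring_nat R m \<otimes> ring_nat R k"
proof -
 show "ring_nat R (m * k) = ring_nat R m \<otimes> ring_nat R k"
  using add.nat_pow_pow[of \<one> m k] add_pow_ldistr[of \<one> "add_pow R k \<one>" m] by(simp add: ring_nat_def mult.commute)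
qed (simp_all add: ring_nat_def add.nat_pow_mult[symmetric])

text \<open>All powers up to \<open>N\<close> are summed over the same range, the surplus binomial
  coefficients being zero; the induction on \<open>m\<close> can then keep one index set.\<close>

lemma binomial_expansion:
 assumes a: "a : $R" and b: "b : $R"
 shows "m \<le> N ==> (a \<oplus> b) [^] (m::nat) = (\<Oplus>k\<in>{..N}. ring_nat R (m choose k) \<otimes> (a [^] k \<otimes> b [^] (m - k)))"
proof(induction m)
 case 0
 have "(\<Oplus>k\<in>{..N}. ring_nat R (0 choose k) \<otimes> (a [^] k \<otimes> b [^] (0 - k))) = (\<Oplus>k\<in>{..N}. if 0 = k then \<one> else \<zero>)"
  by(rule finsum_cong') (use a b in "auto simp: binomial_eq_0 ring_nat_rules")
 also have "\<dots> = \<one>" using finsum_singleton[of 0 "{..N}" "%_. \<one>"] by simp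
 finally show ?case by simp
next
 case (Suc m)
 let ?g = "%m k. ring_nat R (m choose k) \<otimes> (a [^] k \<otimes> b [^] (m - k))"
 have gc: "?g m k : $R" for m k using a b by(simp add: ring_nat_rules)
 obtain N' where N': "N = Suc N'" using Suc.prems by(cases N) auto
 have g0: "?g (Suc m) 0 = b \<otimes> ?g m 0" using a b by(simp add: m_comm ring_nat_rules)
 have gS: "?g (Suc m) (Suc k) = a \<otimes> ?g m k \<oplus> b \<otimes> ?g m (Suc k)" for k
 proof(cases "k < m")
  case True
  then obtain q where q: "m = Suc (k + q)" using less_iff_Suc_add by auto
  have "b \<otimes> ?g m (Suc k) = ring_nat R (m choose Suc k) \<otimes> (a [^] Suc k \<otimes> b [^] (m - k))"
   using a b unfolding q by(simp add: m_ac ring_nat_rules(1))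
  moreover have "a \<otimes> ?g m k = ring_nat R (m choose k) \<otimes> (a [^] Suc k \<otimes> b [^] (m - k))"
   using a b by(simp add: m_ac ring_nat_rules(1))
  ultimately show ?thesis using a b by(simp add: ring_nat_rules l_distr)
 next
  case False
  have c: "ring_nat R q : $R" for q by(rule ring_nat_rules)
  show ?thesis using False a b c
   by(cases "k = m") (simp_all add: m_ac binomial_eq_0 ring_nat_rules(2,3))
 qed
 have top: "(\<Oplus>k\<in>{..N}. ?g m k) = (\<Oplus>k\<in>{..N'}. ?g m k)"
 proof -
  have "?g m (Suc N') = \<zero>" using Suc.prems N' a b by(simp add: binomial_eq_0 ring_nat_rules)
  thus ?thesis unfolding N' using gc by(subst finsum_Suc) (auto intro!: finsum_closed)
 qed
 have "(a \<oplus> b) [^] Suc m = (\<Oplus>k\<in>{..N}. ?g m k) \<otimes> (a \<oplus> b)" using Suc by simp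
 also have "\<dots> = a \<otimes> (\<Oplus>k\<in>{..N}. ?g m k) \<oplus> b \<otimes> (\<Oplus>k\<in>{..N}. ?g m k)"
  using r_distr[OF a b] m_comm[OF a] m_comm[OF b] gc finsum_closed[of "?g m" "{..N}"] by simp
 also have "a \<otimes> (\<Oplus>k\<in>{..N}. ?g m k) = (\<Oplus>k\<in>{..N'}. a \<otimes> ?g m k)" unfolding top by(rule finsum_rdistr; (intro Pi_I finite_atMost finsum_closed gc m_closed a_closed a b)?)
 also have "b \<otimes> (\<Oplus>k\<in>{..N}. ?g m k) = (\<Oplus>k\<in>{..N}. b \<otimes> ?g m k)" by(rule finsum_rdistr; (intro Pi_I finite_atMost finsum_closed gc m_closed a_closed a b)?)
 also have "\<dots> = (\<Oplus>k\<in>{..N'}. b \<otimes> ?g m (Suc k)) \<oplus> b \<otimes> ?g m 0"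
  unfolding N' by(rule finsum_Suc2; (intro Pi_I finite_atMost finsum_closed gc m_closed a_closed a b)?)
 also have "(\<Oplus>k\<in>{..N'}. a \<otimes> ?g m k) \<oplus> ((\<Oplus>k\<in>{..N'}. b \<otimes> ?g m (Suc k)) \<oplus> b \<otimes> ?g m 0) =
   ((\<Oplus>k\<in>{..N'}. a \<otimes> ?g m k) \<oplus> (\<Oplus>k\<in>{..N'}. b \<otimes> ?g m (Suc k))) \<oplus> b \<otimes> ?g m 0"
  by(rule a_assoc[symmetric]; (intro Pi_I finite_atMost finsum_closed gc m_closed a_closed a b)?)
 also have "(\<Oplus>k\<in>{..N'}. a \<otimes> ?g m k) \<oplus> (\<Oplus>k\<in>{..N'}. b \<otimes> ?g m (Suc k)) = (\<Oplus>k\<in>{..N'}. a \<otimes> ?g m k \<oplus> b \<otimes> ?g m (Suc k))"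
  by(rule finsum_addf[symmetric]; (intro Pi_I finite_atMost finsum_closed gc m_closed a_closed a b)?)
 also have "\<dots> \<oplus> b \<otimes> ?g m 0 = (\<Oplus>k\<in>{..N}. ?g (Suc m) k)"
  unfolding gS[symmetric] g0[symmetric] N' by(rule finsum_Suc2[symmetric]; (intro Pi_I finite_atMost finsum_closed gc m_closed a_closed a b)?)
 finally show ?case .
qed

end

text \<open>Congruence modulo \<open>p\<close> within a subring. In the ambient field
  \<open>p\<close> will be invertible, so the quotient has to be recorded as an element of
  \<open>B\<close>.\<close>

definition (in plain_cring) p_cong :: "nat => 'a set => 'a => 'a => bool"
 where "p_cong p B u v \<longleftrightarrow> u : B & v : B & (\<exists>e\<in>B. u = v \<oplus> ring_nat R p \<otimes> e)"

context plain_cring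
begin

context
 fixes p :: nat and B assumes p: "Factorial_Ring.prime p" and B: "subring B R"
begin

lemmas sub = subringE(2-3,5-7)[OF B] subsetD[OF subringE(1)[OF B]]

lemma sub_pow: "u : B ==> u [^] (k::nat) : B"
 by(induction k) (auto intro: sub)

lemma ring_nat_mem: "ring_nat R m : B"
 unfolding ring_nat_def by(induction m) (auto intro: sub)

lemma p_cong_refl: "u : B ==> p_cong p B u u"
 unfolding p_cong_def using sub by(intro conjI bexI[of _ \<zero>]) (auto simp: ring_nat_closed ring_axioms)

lemma p_cong_sym: "p_cong p B u v ==> p_cong p B v u"
 unfolding p_cong_def
proof(elim conjE bexE, intro conjI)
 fix e assume e: "u : B" "v : B" "e : B" "u = v \<oplus> ring_nat R p \<otimes> e"
 thus "\<exists>e\<in>B. v = u \<oplus> ring_nat R p \<otimes> e"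
  using sub ring_nat_mem by(intro bexI[of _ "\<ominus> e"]) (auto simp: a_assoc r_minus r_neg)
qed

lemma p_cong_trans: "p_cong p B u v ==> p_cong p B v w ==> p_cong p B u w"
 unfolding p_cong_def
proof(elim conjE bexE, intro conjI)
 fix e e' assume e: "e : B" "e' : B" "w : B" "u = v \<oplus> ring_nat R p \<otimes> e" "v = w \<oplus> ring_nat R p \<otimes> e'"
 have c: "e : $R" "e' : $R" "w : $R" "ring_nat R p : $R" using e sub ring_nat_mem by auto
 show "\<exists>e\<in>B. u = w \<oplus> ring_nat R p \<otimes> e"
  unfolding e(4,5) using e(1,2) sub c by(intro bexI[of _ "e' \<oplus> e"]) (auto simp: a_assoc r_distr)
qed

lemma p_cong_add: "p_cong p B u v ==> p_cong p B u' v' ==> p_cong p B (u \<oplus> u') (v \<oplus> v')"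
 unfolding p_cong_def
proof(elim conjE bexE, intro conjI)
 fix e e' assume e: "e : B" "e' : B" "v : B" "v' : B" "u = v \<oplus> ring_nat R p \<otimes> e" "u' = v' \<oplus> ring_nat R p \<otimes> e'"
 have c: "e : $R" "e' : $R" "v : $R" "v' : $R" "ring_nat R p : $R" using e sub ring_nat_mem by auto
 show "\<exists>e\<in>B. u \<oplus> u' = (v \<oplus> v') \<oplus> ring_nat R p \<otimes> e"
  unfolding e(5,6) using e(1,2) sub c by(intro bexI[of _ "e \<oplus> e'"]) (auto simp: a_ac r_distr)
qed (auto intro: sub)

lemma p_cong_mult: "c : B ==> p_cong p B u v ==> p_cong p B (c \<otimes> u) (c \<otimes> v)"
 unfolding p_cong_def
proof(elim conjE bexE, intro conjI)
 fix e assume e: "c : B" "e : B" "v : B" "u = v \<oplus> ring_nat R p \<otimes> e"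
 have c: "c : $R" "e : $R" "v : $R" "ring_nat R p : $R" using e sub ring_nat_mem by auto
 show "\<exists>e\<in>B. c \<otimes> u = c \<otimes> v \<oplus> ring_nat R p \<otimes> e"
  unfolding e(4) using e(1,2) sub c by(intro bexI[of _ "c \<otimes> e"]) (auto simp: m_ac r_distr)
qed (auto intro: sub)

lemma p_congD: "p_cong p B u v ==> u : $R" "p_cong p B u v ==> v : $R"
 "p_cong p B u v ==> u : B" "p_cong p B u v ==> v : B"
 unfolding p_cong_def using sub(6) by blast+

lemma p_cong_finsum:
 "finite A ==> (!!i. i : A ==> p_cong p B (f i) (g i)) ==> p_cong p B (finsum R f A) (finsum R g A)"
proof(induction A rule: finite_induct)
 case (insert a A)
 hence "f i : $R" "g i : $R" if "i : insert a A" for i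
  using p_congD[OF insert.prems[OF that]] by simp_all
 thus ?case using p_cong_add[OF insert.prems[of a] insert.IH[OF insert.prems]] insert.hyps by(simp add: finsum_insert Pi_def)
qed (simp add: p_cong_refl sub)

text \<open>The prime \<open>p\<close> divides the inner binomial coefficients, and the integral
  quotients supply the witness in \<open>B\<close>.\<close>

lemma p_cong_power_add:
 assumes a: "a : B" and b: "b : B"
 shows "p_cong p B ((a \<oplus> b) [^] p) (a [^] p \<oplus> b [^] p)"
proof -
 define g where "g = (%k. ring_nat R (p choose k) \<otimes> (a [^] k \<otimes> b [^] (p - k)))"
 define h where "h = (%k. ring_nat R ((p choose Suc k) div p) \<otimes> (a [^] Suc k \<otimes> b [^] (p - Suc k)))"
 have c: "a : $R" "b : $R" "ring_nat R m : $R" for m using a b sub ring_nat_mem by auto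
 have gc: "g k : $R" "h k : $R" for k unfolding g_def h_def using c by simp_all
 obtain q where q: "p = Suc q" using prime_gt_0_nat[OF p] by(cases p) auto
 have hB0: "h k : B" for k unfolding h_def using a b by(intro sub sub_pow ring_nat_mem)
 have gh: "g (Suc k) = ring_nat R p \<otimes> h k" if k: "k < q" for k
 proof -
  have "p dvd p choose Suc k" by(rule dvd_choose_prime[OF _ _ _ p]) (use k q in auto)
  hence "ring_nat R (p choose Suc k) = ring_nat R p \<otimes> ring_nat R ((p choose Suc k) div p)"
   using ring_nat_rules(5)[of p "(p choose Suc k) div p"] by simp
  thus ?thesis unfolding g_def h_def using c by(simp add: m_assoc)
 qed
 have "(a \<oplus> b) [^] p = finsum R g {..p}" unfolding g_def by(rule binomial_expansion[OF c(1,2) order_refl])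
 also have "\<dots> = (\<Oplus>k\<in>{..q}. g (Suc k)) \<oplus> g 0" by(subst q, rule finsum_Suc2) (use gc in auto)
 also have "g 0 = b [^] p" unfolding g_def using c by(simp add: ring_nat_rules)
 also have "(\<Oplus>k\<in>{..q}. g (Suc k)) = g (Suc q) \<oplus> (\<Oplus>k\<in>{..<q}. g (Suc k))"
  by(rule add.finprod_Suc3) (use gc in auto)
 also have "(\<Oplus>k\<in>{..<q}. g (Suc k)) = (\<Oplus>k\<in>{..<q}. ring_nat R p \<otimes> h k)"
  by(rule finsum_cong') (use gh gc c in auto)
 also have "\<dots> = ring_nat R p \<otimes> (\<Oplus>k\<in>{..<q}. h k)" by(rule finsum_rdistr[symmetric]) (use gc c in auto)
 also have "g (Suc q) = a [^] p" unfolding g_def using c q by(simp add: ring_nat_rules)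
 also have "a [^] p \<oplus> ring_nat R p \<otimes> (\<Oplus>k\<in>{..<q}. h k) \<oplus> b [^] p = a [^] p \<oplus> b [^] p \<oplus> ring_nat R p \<otimes> (\<Oplus>k\<in>{..<q}. h k)"
  using c gc finsum_closed[of h "{..<q}"] by(simp add: a_ac Pi_def)
 finally have *: "(a \<oplus> b) [^] p = a [^] p \<oplus> b [^] p \<oplus> ring_nat R p \<otimes> (\<Oplus>k\<in>{..<q}. h k)" .
 have hB: "(\<Oplus>k\<in>{..<q}. h k) : B" by(rule subring_finsum[OF B hB0])
 have "(a \<oplus> b) [^] p : B" "a [^] p \<oplus> b [^] p : B" by(intro sub_pow sub a b)+
 thus ?thesis unfolding p_cong_def using * hB by blast
qed

text \<open>Additivity applied to an element and its negative, which treats p = 2 and odd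
  \<open>p\<close> alike.\<close>

lemma p_cong_power_minus:
 assumes a: "a : B" shows "p_cong p B ((\<ominus> a) [^] p) (\<ominus> (a [^] p))"
proof -
 have c: "\<ominus> a : B" "(\<ominus> a) [^] p : B" "a [^] p : B" using a by(auto intro: sub sub_pow)
 have cc: "a : $R" "(\<ominus> a) [^] p : $R" "a [^] p : $R" using a c sub by auto
 have "p_cong p B \<zero> (a [^] p \<oplus> (\<ominus> a) [^] p)"
  using p_cong_power_add[OF a c(1)] cc prime_gt_0_nat[OF p] by(simp add: r_neg nat_pow_zero)
 from p_cong_add[OF this p_cong_refl[OF sub(3)[OF c(3)]]]
 have "p_cong p B (\<ominus> (a [^] p)) ((\<ominus> a) [^] p)"
  using cc by(simp add: a_comm[of "a [^] p" "(\<ominus> a) [^] p"] a_assoc r_neg)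
 thus ?thesis by(rule p_cong_sym)
qed

lemma p_cong_power_finsum:
 "finite A ==> (!!i. i : A ==> f i : B) ==> p_cong p B (finsum R f A [^] p) (\<Oplus>i\<in>A. f i [^] p)"
proof(induction A rule: finite_induct)
 case empty
 thus ?case using prime_gt_0_nat[OF p] by(simp add: p_cong_refl sub nat_pow_zero)
next
 case (insert a A)
 have f: "f i : $R" "f i [^] p : $R" if "i : insert a A" for i using insert.prems[OF that] sub by auto
 have fB: "finsum R f A : B" by(rule subring_finsum[OF B]) (use insert.prems in blast)
 have fa: "f a : B" using insert.prems by blast
 have "p_cong p B (finsum R f (insert a A) [^] p) (f a [^] p \<oplus> finsum R f A [^] p)"
  using p_cong_power_add[OF fa fB] insert.hyps f by(simp add: finsum_insert Pi_def)
 moreover have "p_cong p B (f a [^] p \<oplus> finsum R f A [^] p) (\<Oplus>i\<in>insert a A. f i [^] p)"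
  using p_cong_add[OF p_cong_refl[OF sub_pow[OF fa, of p]] insert.IH[OF insert.prems]] insert.hyps f
  by(simp add: finsum_insert Pi_def)
 ultimately show ?case by(rule p_cong_trans)
qed

end

lemma p_cong_mono: "p_cong p B u v ==> B \<subseteq> B' ==> p_cong p B' u v"
 unfolding p_cong_def by blast

definition sg :: "nat => 'a" where "sg n = (if even n then \<one> else \<ominus> \<one>)"

text \<open>The Cech differential for families of elements of one ambient ring. As all localizations
  will be subrings of it, the maps between them are inclusions and leave no trace in the
  formula.\<close>

definition cech_d :: "(nat set => 'a) => nat set => 'a"
 where "cech_d c J = (\<Oplus>i\<in>J. sg (card {l : J. l < i}) \<otimes> c (J - {i}))"

text \<open>The standard contracting homotopy by insertion of the index \<open>i\<close>. Its values
  lie in the localization at \<open>insert i K\<close>, hence in the ambient ring but in general not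
  in the localization at \<open>K\<close>.\<close>

definition contract :: "nat => (nat set => 'a) => nat set => 'a"
 where "contract i c K = (if i : K then \<zero> else sg (card {l : K. l < i}) \<otimes> c (insert i K))"

lemma sg_closed [simp]: "sg n : $R" unfolding sg_def by simp

lemma sg_mem: "subring B R ==> sg n : B" unfolding sg_def using subringE(3,5) by fastforce

lemma sg_sg: "x : $R ==> sg m \<otimes> (sg n \<otimes> x) = sg (m + n) \<otimes> x"
 unfolding sg_def by(simp add: l_minus)

lemma sg_even: "x : $R ==> even n ==> sg n \<otimes> x = x"
 unfolding sg_def by simp

lemma sg_cancel: "x : $R ==> odd (m + n) ==> sg m \<otimes> x \<oplus> sg n \<otimes> x = \<zero>"
 unfolding sg_def by(auto simp: l_minus r_neg l_neg)

lemma cech_d_closed: "(!!K. c K : $R) ==> cech_d c J : $R"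
 unfolding cech_d_def by(intro finsum_closed) auto

lemma cech_d_mem: "subring B R ==> (!!i. i : J ==> c (J - {i}) : B) ==> cech_d c J : B"
 unfolding cech_d_def by(intro subring_finsum) (auto intro: subringE(6) sg_mem)

lemma cech_d_cong:
 assumes "!!i. i : J ==> c (J - {i}) = c' (J - {i})" "!!K. c' K : $R"
 shows "cech_d c J = cech_d c' J"
 unfolding cech_d_def by(rule finsum_cong') (use assms in auto)

lemma cech_d_add:
 assumes "!!K. c K : $R" "!!K. c' K : $R"
 shows "cech_d (%K. c K \<oplus> c' K) J = cech_d c J \<oplus> cech_d c' J"
proof -
 have "cech_d (%K. c K \<oplus> c' K) J =
   (\<Oplus>i\<in>J. sg (card {l : J. l < i}) \<otimes> c (J - {i}) \<oplus> sg (card {l : J. l < i}) \<otimes> c' (J - {i}))"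
  unfolding cech_d_def by(rule finsum_cong') (use assms in "auto simp: r_distr")
 also have "\<dots> = cech_d c J \<oplus> cech_d c' J" unfolding cech_d_def by(rule finsum_addf) (use assms in auto)
 finally show ?thesis .
qed

lemma cech_d_smult:
 assumes "!!K. c K : $R" "a : $R"
 shows "cech_d (%K. a \<otimes> c K) J = a \<otimes> cech_d c J"
proof(cases "finite J")
 case True
 have "cech_d (%K. a \<otimes> c K) J = (\<Oplus>i\<in>J. a \<otimes> (sg (card {l : J. l < i}) \<otimes> c (J - {i})))"
  unfolding cech_d_def by(rule finsum_cong') (use assms in "auto simp: m_lcomm")
 also have "\<dots> = a \<otimes> cech_d c J" unfolding cech_d_def
  by(rule finsum_rdistr[symmetric]) (use assms True in auto)
 finally show ?thesis .
qed (use assms in "simp add: cech_d_def finsum_infinite")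

lemma cech_d_minus:
 assumes "!!K. c K : $R" shows "cech_d (%K. \<ominus> c K) J = \<ominus> cech_d c J"
 using cech_d_smult[where a = "\<ominus> \<one>" and J = J, OF assms] assms cech_d_closed[OF assms] by(simp add: l_minus)

lemma contract_closed: "(!!K. c K : $R) ==> contract i c K : $R"
 unfolding contract_def by simp

text \<open>If \<open>i\<close> lies in \<open>J\<close>, one term survives, the one removing
  \<open>i\<close>. Otherwise the terms other than \<open>c J\<close> cancel in pairs, because
  removing \<open>j\<close> and inserting \<open>i\<close> in the two orders gives opposite
  signs.\<close>

lemma cech_homotopy:
 assumes J: "finite J" and c: "!!K. c K : $R"
 shows "cech_d (contract i c) J \<oplus> contract i (cech_d c) J = c J"
proof(cases "i : J")
 case True
 have "cech_d (contract i c) J = (\<Oplus>j\<in>J. if i = j then c J else \<zero>)"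
  unfolding cech_d_def
 proof(rule finsum_cong')
  fix j assume "j : J"
  show "sg (card {l : J. l < j}) \<otimes> contract i c (J - {j}) = (if i = j then c J else \<zero>)"
  proof(cases "i = j")
   case e: True
   have "{l : J - {i}. l < i} = {l : J. l < i}" by auto
   thus ?thesis using e True c by(simp add: contract_def sg_sg sg_even insert_absorb)
  qed (use True in "simp add: contract_def")
 qed (use c in auto)
 also have "\<dots> = c J" by(rule finsum_singleton) (use True J c in auto)
 finally show ?thesis using True c by(simp add: contract_def)
next
 case False
 let ?m = "card {l : J. l < i}"
 let ?b = "%j. card {l : insert i J. l < j}"
 let ?x = "%j. sg (card {l : J. l < j}) \<otimes> contract i c (J - {j})"
 let ?y = "%j. sg ?m \<otimes> (sg (?b j) \<otimes> c (insert i J - {j}))"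
 have xy: "?x j \<oplus> ?y j = \<zero>" if j: "j : J" for j
 proof -
  have ij: "i ~= j" "i \<notin> J - {j}" using j False by auto
  have s: "insert i J - {j} = insert i (J - {j})" using ij by auto
  \<comment> \<open>Either removing \<open>j\<close> lowers the number of indices below
    \<open>i\<close>, or inserting \<open>i\<close> raises the number below \<open>j\<close>; one of
    the two happens, so the total parity is odd.\<close>
  have par: "odd (a + e + (m + b))" if "m = Suc e & b = a \<or> e = m & b = Suc a" for a b e m :: nat
   using that by presburger
  have "odd (card {l : J. l < j} + card {l : J - {j}. l < i} + (?m + ?b j))"
  proof(cases "j < i")
   case True
   have "{l : J. l < i} = insert j {l : J - {j}. l < i}" using True j by auto
   hence "?m = Suc (card {l : J - {j}. l < i})" using J by simp
   moreover have "{l : insert i J. l < j} = {l : J. l < j}" using True by auto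
   ultimately show ?thesis by(intro par) simp
  next
   case False
   have "{l : J - {j}. l < i} = {l : J. l < i}" using False by auto
   moreover have "{l : insert i J. l < j} = insert i {l : J. l < j}" using False ij by auto
   hence "?b j = Suc (card {l : J. l < j})" using J \<open>i \<notin> J\<close> by simp
   ultimately show ?thesis by(intro par) simp
  qed
  thus ?thesis using ij c by(simp add: contract_def sg_sg s sg_cancel)
 qed
 have ins: "{l : insert i J. l < i} = {l : J. l < i}" "insert i J - {i} = J" using False by auto
 let ?f = "%j. sg (?b j) \<otimes> c (insert i J - {j})"
 have "finsum R ?f (insert i J) = ?f i \<oplus> finsum R ?f J" by(rule finsum_insert) (use J False c in auto)
 hence "contract i (cech_d c) J = sg ?m \<otimes> (sg ?m \<otimes> c J \<oplus> finsum R ?f J)"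
  by(simp only: contract_def cech_d_def False if_False ins)
 also have "\<dots> = c J \<oplus> sg ?m \<otimes> (\<Oplus>j\<in>J. sg (?b j) \<otimes> c (insert i J - {j}))"
  using c by(simp add: r_distr sg_sg sg_even Pi_def)
 also have "sg ?m \<otimes> (\<Oplus>j\<in>J. sg (?b j) \<otimes> c (insert i J - {j})) = finsum R ?y J"
  by(rule finsum_rdistr) (use J c in auto)
 finally have 2: "contract i (cech_d c) J = c J \<oplus> finsum R ?y J" .
 have cl: "?x j : $R" "?y j : $R" for j using c contract_closed[OF c] by auto
 hence cf: "finsum R ?x J : $R" "finsum R ?y J : $R" by(intro finsum_closed; blast)+
 have "finsum R ?x J \<oplus> finsum R ?y J = (\<Oplus>j\<in>J. ?x j \<oplus> ?y j)" by(rule finsum_addf[symmetric]) (use cl in blast)+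
 also have "\<dots> = \<zero>" by(rule add.finprod_one_eqI) (rule xy)
 finally have z: "finsum R ?x J \<oplus> finsum R ?y J = \<zero>" .
 have "cech_d (contract i c) J \<oplus> contract i (cech_d c) J = finsum R ?x J \<oplus> (c J \<oplus> finsum R ?y J)"
  unfolding 2 by(simp add: cech_d_def)
 also have "\<dots> = c J \<oplus> (finsum R ?x J \<oplus> finsum R ?y J)" using cf c by(simp only: a_lcomm)
 finally show ?thesis using z c by simp
qed

text \<open>Induction on the size of \<open>J\<close> through the homotopy \<open>s\<close>. From s
  d = 1 - d s one gets d s d = d - d d s, and the last term vanishes on smaller sets; so the
  homotopy formula for d c makes s d d c vanish there, and up to sign this is the value of d d c at
  \<open>J\<close>.\<close>

lemma cech_d_d: "(!!K. c K : $R) ==> cech_d (cech_d c) J = \<zero>"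
proof(induction "card J" arbitrary: J c rule: less_induct)
 case less
 note c = less.prems
 show ?case
 proof(cases "finite J & J ~= {}")
  case True
  then obtain i where i: "i : J" by blast
  let ?K = "J - {i}"
  have K: "finite ?K" "card ?K < card J" using True card_Diff1_less[OF _ i] by auto
  have dc: "cech_d c L : $R" for L by(rule cech_d_closed[OF c])
  have dsc: "cech_d (contract i c) L : $R" for L by(rule cech_d_closed[OF contract_closed[OF c]])
  have ddc: "cech_d (cech_d c) L : $R" for L by(rule cech_d_closed[OF dc])
  have sdc: "contract i (cech_d c) L : $R" for L by(rule contract_closed[OF dc])
  have sddc: "contract i (cech_d (cech_d c)) L : $R" for L by(rule contract_closed[OF ddc])
  have cd: "contract i (cech_d c) L = c L \<oplus> \<ominus> cech_d (contract i c) L" if "finite L" for L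
   using r_neg1[OF dsc[of L] sdc[of L]] cech_homotopy[OF that c, of i] c[of L] dsc[of L]
   by(simp add: a_comm)
  have "cech_d (contract i (cech_d c)) ?K = cech_d (%L. c L \<oplus> \<ominus> cech_d (contract i c) L) ?K"
   by(rule cech_d_cong) (use cd K c dsc in auto)
  also have "\<dots> = cech_d c ?K \<oplus> \<ominus> cech_d (cech_d (contract i c)) ?K"
   using cech_d_add[of c "%L. \<ominus> cech_d (contract i c) L" ?K] cech_d_minus[OF dsc] c dsc by simp
  also have "cech_d (cech_d (contract i c)) ?K = \<zero>" by(rule less.hyps[OF K(2) contract_closed[OF c]])
  finally have "cech_d (contract i (cech_d c)) ?K = cech_d c ?K" using dc by simp
  hence "cech_d c ?K \<oplus> contract i (cech_d (cech_d c)) ?K = cech_d c ?K"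
   using cech_homotopy[where c = "cech_d c" and i = i, OF K(1) dc] by simp
  hence z: "contract i (cech_d (cech_d c)) ?K = \<zero>"
   using add.l_cancel[of "cech_d c ?K" "contract i (cech_d (cech_d c)) ?K" \<zero>] dc[of ?K] sddc[of ?K]
   by simp
  let ?n = "card {l : ?K. l < i}"
  have "sg ?n \<otimes> cech_d (cech_d c) J = \<zero>" using z i by(simp add: contract_def insert_absorb)
  hence "sg ?n \<otimes> (sg ?n \<otimes> cech_d (cech_d c) J) = \<zero>" by simp
  thus ?thesis using ddc by(simp add: sg_sg sg_even)
 next
  case False
  thus ?thesis by(auto simp: cech_d_def finsum_infinite)
 qed
qed

text \<open>Membership is demanded at every index set, so that families are total and can be
  combined without side conditions.\<close>

definition cocycle :: "nat => (nat set => 'a set) => nat => (nat set => 'a) => bool"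
 where "cocycle d A j z \<longleftrightarrow> (\<forall>J. z J : A J) & (\<forall>J\<in>cech_index d (Suc j). cech_d z J = \<zero>)"

definition coboundary :: "nat => (nat set => 'a set) => nat => (nat set => 'a) => bool"
 where "coboundary d A j z \<longleftrightarrow> (\<exists>c. (\<forall>J. c J : A J) & (\<forall>J\<in>cech_index d j. z J = cech_d c J))"

text \<open>The contraction by \<open>i\<close> bounds the cocycle, but with values in larger
  localizations. A common power of \<open>x\<close> clears the additional denominators on the
  finitely many index sets.\<close>

lemma cocycle_power_coboundary:
 assumes A: "!!J. subring (A J) R" and mono: "!!I J. I \<subseteq> J ==> A I \<subseteq> A J" and i: "i : {1..d}"
  and x: "!!J. x : A J" and loc: "!!K y. K : cech_index d k ==> y : A (insert i K) ==> \<exists>t::nat. x [^] t \<otimes> y : A K"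
  and z: "cocycle d A (Suc k) z"
 shows "\<exists>t::nat. coboundary d A (Suc k) (%J. x [^] t \<otimes> z J)"
proof -
 have zA: "z J : A J" for J using z unfolding cocycle_def by blast
 have zc: "z J : $R" for J using subringE(1)[OF A] zA by blast
 have xc: "x : $R" using subringE(1)[OF A] x by blast
 have sA: "contract i z K : A (insert i K)" for K
  unfolding contract_def using subringE(2)[OF A] subringE(6)[OF A sg_mem[OF A] zA] by simp
 have sc: "contract i z K : $R" for K by(rule contract_closed[OF zc])
 have "\<exists>t::nat. x [^] t \<otimes> contract i z K : A K" if "K : cech_index d k" for K using loc[OF that sA] .
 then obtain t :: "nat set => nat" where t: "!!K. K : cech_index d k ==> x [^] t K \<otimes> contract i z K : A K" by metis
 have fin: "finite (cech_index d k)" unfolding cech_index_def by simp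
 \<comment> \<open>The sum of the individual exponents is a common upper bound for them.\<close>
 define T where "T = sum t (cech_index d k)"
 define c where "c = (%K. if K : cech_index d k then x [^] T \<otimes> contract i z K else \<zero>)"
 have xT: "x [^] T : $R" using xc by simp
 have cA: "c K : A K" for K
 proof(cases "K : cech_index d k")
  case True
  have "t K \<le> T" unfolding T_def using member_le_sum[OF True _ fin, of t] by simp
  hence "x [^] T = x [^] (T - t K) \<otimes> x [^] t K" using xc by(simp add: nat_pow_mult)
  hence "x [^] T \<otimes> contract i z K = x [^] (T - t K) \<otimes> (x [^] t K \<otimes> contract i z K)"
   using xc sc by(simp add: m_assoc)
  moreover have "x [^] m : A K" for m :: nat by(induction m) (use subringE(3,6)[OF A] x in auto)
  ultimately show ?thesis unfolding c_def using True subringE(6)[OF A _ t[OF True]] by simp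
 qed (use subringE(2)[OF A] in "simp add: c_def")
 have "x [^] T \<otimes> z J = cech_d c J" if J: "J : cech_index d (Suc k)" for J
 proof -
  have fJ: "finite J" using J unfolding cech_index_def by(auto intro: finite_subset)
  have "cech_d c J = cech_d (%K. x [^] T \<otimes> contract i z K) J"
  proof(rule cech_d_cong)
   fix j assume "j : J"
   hence "J - {j} : cech_index d k" using J fJ unfolding cech_index_def by(auto simp: card_Diff_singleton)
   thus "c (J - {j}) = x [^] T \<otimes> contract i z (J - {j})" by(simp add: c_def)
  qed (use xT sc in simp)
  also have "\<dots> = x [^] T \<otimes> cech_d (contract i z) J" by(rule cech_d_smult[OF sc xT])
  also have "cech_d (contract i z) J = z J"
  proof -
   have "contract i (cech_d z) J = \<zero>"
   proof(cases "i : J")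
   case False
   hence "insert i J : cech_index d (Suc (Suc k))" using J i fJ unfolding cech_index_def by auto
   thus ?thesis using z unfolding cocycle_def contract_def by simp
   qed (simp add: contract_def)
   thus ?thesis using cech_homotopy[where i = i and c = z, OF fJ zc] cech_d_closed[where c = "contract i z", OF sc] by simp
  qed
  finally show ?thesis by simp
 qed
 thus ?thesis unfolding coboundary_def using cA by(intro exI[of _ T] exI[of _ c]) blast
qed

end

section \<open>The p-semilinear operation on Cech cochains\<close>

text \<open>\<open>A J\<close> and \<open>B J\<close> stand for the localizations of
  \<open>Sn\<close> and \<open>Sinf\<close> inside one field. \<open>root\<close> is the consequence
  of integral closedness that is used: an element whose p-th power is divisible by \<open>p\<close>
  is divisible by \<omega>. \<open>frob\<close> is surjectivity of Frobenius modulo \<open>p\<close>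
  on the localizations.\<close>

locale cech_pair = plain_cring R for R :: "'a ring" (structure) +
 fixes p d :: nat and A B :: "nat set => 'a set" and \<omega> :: 'a
 assumes p: "Factorial_Ring.prime p" and A: "!!J. subring (A J) R" and B: "!!J. subring (B J) R"
  and A_mono: "!!I J. I \<subseteq> J ==> A I \<subseteq> A J" and B_mono: "!!I J. I \<subseteq> J ==> B I \<subseteq> B J" and AB: "!!J. A J \<subseteq> B J"
  and \<omega>: "!!J. \<omega> : A J" "\<omega> [^] p = ring_nat R p" and \<omega>_cancel: "!!x. x : $R ==> \<omega> \<otimes> x = \<zero> ==> x = \<zero>"
  and root: "!!J u e. u : $R ==> e : B J ==> u [^] p = ring_nat R p \<otimes> e ==> \<exists>t\<in>B J. u = \<omega> \<otimes> t"
  and frob: "!!J y. y : B J ==> \<exists>w\<in>B J. p_cong p (B J) (w [^] p) y"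
begin

abbreviation "idx \<equiv> cech_index d"

lemma closed: "x : A J ==> x : $R" "x : B J ==> x : $R" "\<omega> : $R" "ring_nat R p : $R"
 using subringE(1)[OF A] subringE(1)[OF B] \<omega>(1) ring_nat_rules(1) by blast+

lemma idx_finite: "J : idx j ==> finite J"
 unfolding cech_index_def by(auto intro: finite_subset)

lemma idx_diff: "J : idx (Suc j) ==> i : J ==> J - {i} : idx j"
 using idx_finite[of J "Suc j"] unfolding cech_index_def by(auto simp: card_Diff_singleton)

lemma cancel: "x : $R ==> y : $R ==> \<omega> \<otimes> x = \<omega> \<otimes> y ==> x = y"
 using \<omega>_cancel[of "x \<ominus> y"] closed(3) by(simp add: a_minus_def r_distr r_minus r_neg r_right_minus_eq[unfolded a_minus_def])

lemma P_cancel: "x : $R ==> ring_nat R p \<otimes> x = \<zero> ==> x = \<zero>"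
proof -
 have "x : $R ==> \<omega> [^] m \<otimes> x = \<zero> ==> x = \<zero>" for m :: nat
  by(induction m) (use closed(3) in \<open>auto simp: m_assoc m_comm[of "\<omega> [^] _" \<omega>] intro: \<omega>_cancel\<close>)
 thus "x : $R ==> ring_nat R p \<otimes> x = \<zero> ==> x = \<zero>" unfolding \<omega>(2)[symmetric] .
qed

text \<open>Modulo \<open>p\<close>, Frobenius is additive and respects signs, hence commutes with
  the differential.\<close>

lemma cech_d_power:
 assumes S: "!!J. subring (S J) R" "!!I J. I \<subseteq> J ==> S I \<subseteq> S J" and c: "!!J. c J : S J" and J: "finite J"
 shows "p_cong p (S J) (cech_d c J [^] p) (cech_d (%K. c K [^] p) J)"
proof -
 have cJ: "c (J - {i}) : S J" for i using S(2)[of "J - {i}" J] c by blast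
 have "p_cong p (S J) (cech_d c J [^] p) (\<Oplus>i\<in>J. (sg (card {l : J. l < i}) \<otimes> c (J - {i})) [^] p)"
  unfolding cech_d_def by(rule p_cong_power_finsum[OF p S(1) J]) (intro subringE(6)[OF S(1)] sg_mem S(1) cJ)
 moreover have "p_cong p (S J) (\<Oplus>i\<in>J. (sg (card {l : J. l < i}) \<otimes> c (J - {i})) [^] p) (cech_d (%K. c K [^] p) J)"
  unfolding cech_d_def
 proof(rule p_cong_finsum[OF p S(1) J])
  fix i
  have cc: "c (J - {i}) : $R" using cJ subringE(1)[OF S(1)] by blast
  show "p_cong p (S J) ((sg (card {l : J. l < i}) \<otimes> c (J - {i})) [^] p) (sg (card {l : J. l < i}) \<otimes> c (J - {i}) [^] p)"
   using p_cong_refl[OF p S(1) sub_pow[OF p S(1) cJ[of i]]] p_cong_power_minus[OF p S(1) cJ[of i]] cc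
   by(simp add: sg_def l_minus)
 qed
 ultimately show ?thesis by(rule p_cong_trans[OF p S(1)])
qed

lemma cech_d_p_cong:
 assumes c: "!!K. p_cong p (B K) (c K) (c' K)" and J: "finite J"
 shows "p_cong p (B J) (cech_d c J) (cech_d c' J)"
 unfolding cech_d_def
proof(rule p_cong_finsum[OF p B J])
 fix i
 have "p_cong p (B J) (c (J - {i})) (c' (J - {i}))" by(rule p_cong_mono[OF c B_mono]) blast
 thus "p_cong p (B J) (sg (card {l : J. l < i}) \<otimes> c (J - {i})) (sg (card {l : J. l < i}) \<otimes> c' (J - {i}))"
  by(rule p_cong_mult[OF p B sg_mem[OF B]])
qed

lemma cech_d_frobenius:
 assumes w: "!!K. w K : B K" "!!K. p_cong p (B K) (w K [^] p) (y K)" and J: "finite J"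
 shows "p_cong p (B J) (cech_d w J [^] p) (cech_d y J)"
 using cech_d_power[where S = B, OF B B_mono w(1) J] cech_d_p_cong[OF w(2) J] by(rule p_cong_trans[OF p B])

text \<open>A relation on cochains because \<open>y\<close> and \<open>w\<close> are chosen. Keeping
  both as witnesses lets related pairs be added and scaled; uniqueness holds for cohomology
  classes.\<close>

definition frobenius_lift :: "nat => (nat set => 'a) => (nat set => 'a) => bool"
 where "frobenius_lift k z z' \<longleftrightarrow> (\<exists>y w. (\<forall>J. y J : A J) & (\<forall>J. w J : B J) & (\<forall>K. p_cong p (B K) (w K [^] p) (y K)) \<and>
  (\<forall>J\<in>idx (Suc k). ring_nat R p \<otimes> z J = cech_d y J & \<omega> \<otimes> z' J = cech_d w J))"

lemma frobenius_liftI: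
 assumes "!!J. y J : A J" "!!J. w J : B J" "!!K. p_cong p (B K) (w K [^] p) (y K)"
  "!!J. J : idx (Suc k) ==> ring_nat R p \<otimes> z J = cech_d y J" "!!J. J : idx (Suc k) ==> \<omega> \<otimes> z' J = cech_d w J"
 shows "frobenius_lift k z z'"
 unfolding frobenius_lift_def using assms by blast

lemma p_cong_multiple: "u : $R ==> e : B J ==> p_cong p (B J) u (ring_nat R p \<otimes> e) ==> \<exists>e'\<in>B J. u = ring_nat R p \<otimes> e'"
 unfolding p_cong_def using closed(2,4) subringE(7)[OF B, of e J] by(auto simp: r_distr[symmetric])

lemma exists_root_family:
 assumes w: "!!K. w K : B K" and y: "!!K. K : I ==> \<exists>e\<in>B K. w K [^] p = ring_nat R p \<otimes> e"
 shows "\<exists>u. (\<forall>K. u K : B K) & (\<forall>K\<in>I. w K = \<omega> \<otimes> u K)"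
proof -
 have "\<exists>t\<in>B K. w K = \<omega> \<otimes> t" if "K : I" for K using y[OF that] root[OF closed(2)[OF w]] by blast
 hence "\<exists>u. u : B K & (K : I \<longrightarrow> w K = \<omega> \<otimes> u)" for K using subringE(2)[OF B] by(cases "K : I") auto
 thus ?thesis by metis
qed

text \<open>The p-th power of d w is congruent to d y = p z, so \<open>p\<close> divides it and
  \<omega> divides d w. The quotient is a cocycle because \<omega> can be cancelled.\<close>

lemma frobenius_lift_exists:
 assumes c: "coboundary d A (Suc k) (%J. ring_nat R p \<otimes> z J)" and z: "!!J. z J : A J"
 shows "\<exists>z'. cocycle d B (Suc k) z' & frobenius_lift k z z'"
proof -
 obtain y where y: "!!J. y J : A J" "!!J. J : idx (Suc k) ==> ring_nat R p \<otimes> z J = cech_d y J"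
  using c unfolding coboundary_def by blast
 have "\<exists>w\<in>B K. p_cong p (B K) (w [^] p) (y K)" for K using frob[of "y K" K] y(1) AB by blast
 then obtain w where w: "!!K. w K : B K" "!!K. p_cong p (B K) (w K [^] p) (y K)" by metis
 have wc: "w K : $R" for K using closed(2)[OF w(1)] .
 have dwB: "cech_d w K : B K" for K by(rule cech_d_mem[OF B]) (use B_mono[of "K - {_}" K] w(1) in blast)
 have "\<exists>e\<in>B K. cech_d w K [^] p = ring_nat R p \<otimes> e" if K: "K : idx (Suc k)" for K
  by(rule p_cong_multiple[of _ "z K"])
   (use cech_d_frobenius[OF w idx_finite[OF K]] y(2)[OF K] z AB closed(2)[OF dwB] in auto)
 then obtain z' where z': "!!K. z' K : B K" "!!K. K : idx (Suc k) ==> cech_d w K = \<omega> \<otimes> z' K"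
  using exists_root_family[where w = "cech_d w" and I = "idx (Suc k)", OF dwB] by blast
 have zc: "z' K : $R" for K using closed(2)[OF z'(1)] .
 have "cech_d z' J = \<zero>" if J: "J : idx (Suc (Suc k))" for J
 proof(rule \<omega>_cancel)
  have "\<omega> \<otimes> cech_d z' J = cech_d (%K. \<omega> \<otimes> z' K) J" by(rule cech_d_smult[OF zc closed(3), symmetric])
  also have "\<dots> = cech_d (cech_d w) J"
   by(rule cech_d_cong) (use z'(2)[OF idx_diff[OF J]] cech_d_closed[OF wc] in simp_all)
  also have "\<dots> = \<zero>" by(rule cech_d_d[OF wc])
  finally show "\<omega> \<otimes> cech_d z' J = \<zero>" .
 qed (rule cech_d_closed[OF zc])
 hence "cocycle d B (Suc k) z'" unfolding cocycle_def using z'(1) by blast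
 moreover have "frobenius_lift k z z'"
  by(rule frobenius_liftI[where y = y and w = w]) (use y w z'(2) in simp_all)
 ultimately show ?thesis by blast
qed

text \<open>If z = d z1, then y - p z1 is a cocycle in degree \<open>k\<close>, hence of the form d
  y2. For a p-th root w2 of y2 modulo \<open>p\<close>, the p-th power of w - d w2 is divisible by
  \<open>p\<close>, so w - d w2 = \<omega> u; applying d and cancelling \<omega> gives z' = d
  u.\<close>

lemma frobenius_lift_zero:
 assumes H: "!!y. cocycle d A k y ==> coboundary d A k y"
  and G: "frobenius_lift k z z'" and z: "coboundary d A (Suc k) z" and z': "!!J. z' J : B J"
 shows "coboundary d B (Suc k) z'"
proof -
 let ?P = "ring_nat R p"
 obtain y w where yw: "!!J. y J : A J" "!!J. w J : B J" "!!K. p_cong p (B K) (w K [^] p) (y K)"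
  "!!J. J : idx (Suc k) ==> ?P \<otimes> z J = cech_d y J" "!!J. J : idx (Suc k) ==> \<omega> \<otimes> z' J = cech_d w J"
  using G unfolding frobenius_lift_def by blast
 obtain z1 where z1: "!!J. z1 J : A J" "!!J. J : idx (Suc k) ==> z J = cech_d z1 J"
  using z unfolding coboundary_def by blast
 note cl = closed(1)[OF yw(1)] closed(2)[OF yw(2)] closed(1)[OF z1(1)] closed(2)[OF z'] closed(3,4)
 have PA: "?P \<otimes> z1 J : A J" for J by(intro subringE(6)[OF A] ring_nat_mem[OF p A] z1)
 have Pc: "?P \<otimes> z1 J : $R" for J using cl by simp
 define y1 where "y1 = (%K. y K \<oplus> \<ominus> (?P \<otimes> z1 K))"
 have y1A: "y1 K : A K" for K unfolding y1_def by(intro subringE(5,7)[OF A] PA yw(1))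
 have "cech_d y1 J = \<zero>" if J: "J : idx (Suc k)" for J
 proof -
  have "cech_d y1 J = cech_d y J \<oplus> \<ominus> (?P \<otimes> cech_d z1 J)"
   unfolding y1_def using cech_d_add[where c = y and c' = "%K. \<ominus> (?P \<otimes> z1 K)" and J = J]
   cech_d_minus[where c = "%K. ?P \<otimes> z1 K" and J = J] cech_d_smult[where c = z1 and a = ?P and J = J] cl by simp
  thus ?thesis using yw(4)[OF J] z1(2)[OF J] cech_d_closed[where c = y and J = J] cl by(simp add: r_neg)
 qed
 hence "cocycle d A k y1" unfolding cocycle_def using y1A by blast
 then obtain y2 where y2: "!!K. y2 K : A K" "!!K. K : idx k ==> y1 K = cech_d y2 K"
  using H unfolding coboundary_def by blast
 have "\<exists>w\<in>B K. p_cong p (B K) (w [^] p) (y2 K)" for K using frob[of "y2 K" K] y2(1) AB by blast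
 then obtain w2 where w2: "!!K. w2 K : B K" "!!K. p_cong p (B K) (w2 K [^] p) (y2 K)" by metis
 have w2c: "w2 K : $R" for K using closed(2)[OF w2(1)] .
 have dw2: "cech_d w2 K : B K" for K by(rule cech_d_mem[OF B]) (use B_mono[of "K - {_}" K] w2(1) in blast)
 have dw2c: "cech_d w2 K : $R" for K using closed(2)[OF dw2] .
 have wB: "w K \<oplus> \<ominus> cech_d w2 K : B K" for K by(intro subringE(5,7)[OF B] dw2 yw(2))
 have "\<exists>e\<in>B K. (w K \<oplus> \<ominus> cech_d w2 K) [^] p = ?P \<otimes> e" if K: "K : idx k" for K
 proof -
  let ?D = "cech_d w2 K"
  note tr = p_cong_trans[OF p B] and ad = p_cong_add[OF p B] and rf = p_cong_refl[OF p B]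
  have mD: "\<ominus> ?D : B K" by(rule subringE(5)[OF B dw2])
  have DpB: "?D [^] p : B K" "\<ominus> (?D [^] p) : B K" using sub_pow[OF p B dw2] subringE(5)[OF B] by blast+
  have "p_cong p (B K) (?D [^] p) (y1 K)" using cech_d_frobenius[OF w2 idx_finite[OF K]] y2(2)[OF K] by simp
  moreover have "p_cong p (B K) (y1 K) (y K)"
   unfolding p_cong_def y1_def using y1A[of K, unfolded y1_def] yw(1)[of K] AB[of K] z1(1)[of K] subringE(5)[OF B, of "z1 K" K] cl
   by(intro conjI bexI[of _ "\<ominus> z1 K"]) (auto simp: r_minus)
  ultimately have "p_cong p (B K) (?D [^] p) (w K [^] p)" using tr p_cong_sym[OF p B yw(3)] by blast
  from ad[OF this rf[OF DpB(2)]] have "p_cong p (B K) \<zero> (w K [^] p \<oplus> \<ominus> (?D [^] p))" using dw2c by(simp add: r_neg)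
  from p_cong_sym[OF p B this] have 1: "p_cong p (B K) (w K [^] p \<oplus> \<ominus> (?D [^] p)) \<zero>" .
  have 2: "p_cong p (B K) (w K [^] p \<oplus> (\<ominus> ?D) [^] p) (w K [^] p \<oplus> \<ominus> (?D [^] p))"
   by(rule ad[OF rf[OF sub_pow[OF p B yw(2)]] p_cong_power_minus[OF p B dw2]])
  have 3: "p_cong p (B K) ((w K \<oplus> \<ominus> ?D) [^] p) (w K [^] p \<oplus> (\<ominus> ?D) [^] p)" by(rule p_cong_power_add[OF p B yw(2) mD])
  have "p_cong p (B K) ((w K \<oplus> \<ominus> ?D) [^] p) (?P \<otimes> \<zero>)" using tr[OF 3 tr[OF 2 1]] cl by simp
  from p_cong_multiple[OF _ subringE(2)[OF B] this]
  show ?thesis using cl dw2c by simp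
 qed
 then obtain u where u: "!!K. u K : B K" "!!K. K : idx k ==> w K \<oplus> \<ominus> cech_d w2 K = \<omega> \<otimes> u K"
  using exists_root_family[where w = "%K. w K \<oplus> \<ominus> cech_d w2 K" and I = "idx k", OF wB] by blast
 have uc: "u K : $R" for K using closed(2)[OF u(1)] .
 have wu: "w K = cech_d w2 K \<oplus> \<omega> \<otimes> u K" if "K : idx k" for K
 proof -
  have "w K = cech_d w2 K \<oplus> (w K \<oplus> \<ominus> cech_d w2 K)" using cl dw2c by(simp add: a_lcomm[of "cech_d w2 K"] r_neg)
  thus ?thesis using u(2)[OF that] by simp
 qed
 have "z' J = cech_d u J" if J: "J : idx (Suc k)" for J
 proof(rule cancel)
  have "\<omega> \<otimes> z' J = cech_d (%K. cech_d w2 K \<oplus> \<omega> \<otimes> u K) J"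
   unfolding yw(5)[OF J] by(rule cech_d_cong) (use wu[OF idx_diff[OF J]] dw2c uc cl in simp_all)
  also have "\<dots> = cech_d (cech_d w2) J \<oplus> \<omega> \<otimes> cech_d u J"
   using cech_d_add[where c = "cech_d w2" and c' = "%K. \<omega> \<otimes> u K" and J = J]
   cech_d_smult[where c = u and a = \<omega> and J = J] dw2c uc cl by simp
  also have "\<dots> = \<omega> \<otimes> cech_d u J" using cech_d_d[OF w2c] cech_d_closed[OF uc] cl by simp
  finally show "\<omega> \<otimes> z' J = \<omega> \<otimes> cech_d u J" .
 qed (use cl cech_d_closed[OF uc] in simp_all)
 thus ?thesis unfolding coboundary_def using u(1) by blast
qed

lemma frobenius_lift_add:
 assumes "frobenius_lift k z1 z1'" "frobenius_lift k z2 z2'"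
  and zc: "!!J. z1 J : $R" "!!J. z1' J : $R" "!!J. z2 J : $R" "!!J. z2' J : $R"
 shows "frobenius_lift k (%J. z1 J \<oplus> z2 J) (%J. z1' J \<oplus> z2' J)"
proof -
 obtain y1 w1 where 1: "!!J. y1 J : A J" "!!J. w1 J : B J" "!!K. p_cong p (B K) (w1 K [^] p) (y1 K)"
  "!!J. J : idx (Suc k) ==> ring_nat R p \<otimes> z1 J = cech_d y1 J & \<omega> \<otimes> z1' J = cech_d w1 J"
  using assms(1) unfolding frobenius_lift_def by blast
 obtain y2 w2 where 2: "!!J. y2 J : A J" "!!J. w2 J : B J" "!!K. p_cong p (B K) (w2 K [^] p) (y2 K)"
  "!!J. J : idx (Suc k) ==> ring_nat R p \<otimes> z2 J = cech_d y2 J & \<omega> \<otimes> z2' J = cech_d w2 J"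
  using assms(2) unfolding frobenius_lift_def by blast
 note cl = closed(1)[OF 1(1)] closed(2)[OF 1(2)] closed(1)[OF 2(1)] closed(2)[OF 2(2)] closed(3,4)
 show ?thesis
 proof(rule frobenius_liftI[where y = "%J. y1 J \<oplus> y2 J" and w = "%J. w1 J \<oplus> w2 J"])
  show "y1 J \<oplus> y2 J : A J" for J by(rule subringE(7)[OF A 1(1) 2(1)])
  show "w1 J \<oplus> w2 J : B J" for J by(rule subringE(7)[OF B 1(2) 2(2)])
  show "p_cong p (B K) ((w1 K \<oplus> w2 K) [^] p) (y1 K \<oplus> y2 K)" for K
   using p_cong_trans[OF p B p_cong_power_add[OF p B 1(2) 2(2)] p_cong_add[OF p B 1(3) 2(3)]] .
  fix J assume "J : idx (Suc k)"
  thus "ring_nat R p \<otimes> (z1 J \<oplus> z2 J) = cech_d (%J. y1 J \<oplus> y2 J) J" "\<omega> \<otimes> (z1' J \<oplus> z2' J) = cech_d (%J. w1 J \<oplus> w2 J) J"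
   using 1(4) 2(4) zc cl by(simp_all add: cech_d_add r_distr)
 qed
qed

lemma frobenius_lift_minus:
 assumes "frobenius_lift k z z'" and zc: "!!J. z J : $R" "!!J. z' J : $R"
 shows "frobenius_lift k (%J. \<ominus> z J) (%J. \<ominus> z' J)"
proof -
 obtain y w where 1: "!!J. y J : A J" "!!J. w J : B J" "!!K. p_cong p (B K) (w K [^] p) (y K)"
  "!!J. J : idx (Suc k) ==> ring_nat R p \<otimes> z J = cech_d y J & \<omega> \<otimes> z' J = cech_d w J"
  using assms(1) unfolding frobenius_lift_def by blast
 note cl = closed(1)[OF 1(1)] closed(2)[OF 1(2)] closed(3,4)
 have m1: "\<ominus> \<one> : B K" for K using subringE(3,5)[OF B] by blast
 show ?thesis
 proof(rule frobenius_liftI[where y = "%J. \<ominus> y J" and w = "%J. \<ominus> w J"])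
  show "\<ominus> y J : A J" for J by(rule subringE(5)[OF A 1(1)])
  show "\<ominus> w J : B J" for J by(rule subringE(5)[OF B 1(2)])
  show "p_cong p (B K) ((\<ominus> w K) [^] p) (\<ominus> y K)" for K
   using p_cong_trans[OF p B p_cong_power_minus[OF p B 1(2)[of K]]] p_cong_mult[OF p B m1 1(3)[of K]] cl by(simp add: l_minus)
  fix J assume "J : idx (Suc k)"
  thus "ring_nat R p \<otimes> (\<ominus> z J) = cech_d (%J. \<ominus> y J) J" "\<omega> \<otimes> (\<ominus> z' J) = cech_d (%J. \<ominus> w J) J"
   using 1(4) zc cl by(simp_all add: cech_d_minus r_minus)
 qed
qed

text \<open>Multiplying \<open>w\<close> by \<open>b\<close> multiplies its p-th power by
  \<open>a\<close>; this is the p-semilinearity of the operation.\<close>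

lemma frobenius_lift_smult:
 assumes "frobenius_lift k z z'" and zc: "!!J. z J : $R" "!!J. z' J : $R"
  and a: "!!J. a : A J" and b: "!!J. b : B J" and ab: "b [^] p = a"
 shows "frobenius_lift k (%J. a \<otimes> z J) (%J. b \<otimes> z' J)"
proof -
 obtain y w where 1: "!!J. y J : A J" "!!J. w J : B J" "!!K. p_cong p (B K) (w K [^] p) (y K)"
  "!!J. J : idx (Suc k) ==> ring_nat R p \<otimes> z J = cech_d y J & \<omega> \<otimes> z' J = cech_d w J"
  using assms(1) unfolding frobenius_lift_def by blast
 note cl = closed(1)[OF 1(1)] closed(2)[OF 1(2)] closed(3,4) closed(1)[OF a] closed(2)[OF b]
 show ?thesis
 proof(rule frobenius_liftI[where y = "%J. a \<otimes> y J" and w = "%J. b \<otimes> w J"])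
  show "a \<otimes> y J : A J" for J by(rule subringE(6)[OF A a 1(1)])
  show "b \<otimes> w J : B J" for J by(rule subringE(6)[OF B b 1(2)])
  show "p_cong p (B K) ((b \<otimes> w K) [^] p) (a \<otimes> y K)" for K
   using p_cong_mult[OF p B subsetD[OF AB a] 1(3)[of K]] cl ab by(simp add: nat_pow_distrib)
  fix J assume J: "J : idx (Suc k)"
  show "ring_nat R p \<otimes> (a \<otimes> z J) = cech_d (%J. a \<otimes> y J) J"
   using 1(4)[OF J] zc cl by(simp add: cech_d_smult m_lcomm[of "ring_nat R p"])
  show "\<omega> \<otimes> (b \<otimes> z' J) = cech_d (%J. b \<otimes> w J) J"
   using 1(4)[OF J] zc cl by(simp add: cech_d_smult m_lcomm[of \<omega>])
 qed
qed

text \<open>If \<omega> z = d y, let y^p consist of the p-th powers of the values of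
  \<open>y\<close>. Then d(y^p) is congruent to (d y)^p = p z^p, so d(y^p) = p z0 with z0 over
  \<open>A\<close>, and the choice w = y relates z0 to \<open>z\<close> itself.\<close>

lemma frobenius_lift_image:
 assumes z: "!!J. z J : A J" and c: "coboundary d A (Suc k) (%J. \<omega> \<otimes> z J)"
 shows "\<exists>z0. cocycle d A (Suc k) z0 & coboundary d A (Suc k) (%J. ring_nat R p \<otimes> z0 J) & frobenius_lift k z0 z"
proof -
 let ?P = "ring_nat R p"
 obtain y where y: "!!J. y J : A J" "!!J. J : idx (Suc k) ==> \<omega> \<otimes> z J = cech_d y J"
  using c unfolding coboundary_def by blast
 let ?q = "%K. y K [^] p"
 have qA: "?q K : A K" for K by(rule sub_pow[OF p A y(1)])
 note cl = closed(1)[OF y(1)] closed(1)[OF z] closed(1)[OF qA] closed(3,4)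
 have "\<exists>e\<in>A J. cech_d ?q J = ?P \<otimes> e" if J: "J : idx (Suc k)" for J
 proof -
  have "p_cong p (A J) (cech_d ?q J) (cech_d y J [^] p)"
   by(rule p_cong_sym[OF p A cech_d_power[where S = A, OF A A_mono y(1) idx_finite[OF J]]])
  moreover have "cech_d y J [^] p = ?P \<otimes> z J [^] p" using y(2)[OF J, symmetric] cl by(simp add: nat_pow_distrib \<omega>(2))
  ultimately obtain e where e: "e : A J" "cech_d ?q J = ?P \<otimes> z J [^] p \<oplus> ?P \<otimes> e" unfolding p_cong_def by auto
  have "z J [^] p \<oplus> e : A J" by(intro subringE(7)[OF A] sub_pow[OF p A z] e(1))
  thus ?thesis using e closed(1)[OF e(1)] cl by(intro bexI[of _ "z J [^] p \<oplus> e"]) (simp_all add: r_distr)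
 qed
 hence "\<exists>e. e : A J & (J : idx (Suc k) \<longrightarrow> cech_d ?q J = ?P \<otimes> e)" for J
  using subringE(2)[OF A] by(cases "J : idx (Suc k)") auto
 then obtain z0 where z0: "!!J. z0 J : A J" "!!J. J : idx (Suc k) ==> cech_d ?q J = ?P \<otimes> z0 J" by metis
 have z0c: "z0 K : $R" for K using closed(1)[OF z0(1)] .
 have "cech_d z0 J = \<zero>" if J: "J : idx (Suc (Suc k))" for J
 proof(rule P_cancel)
  have "?P \<otimes> cech_d z0 J = cech_d (%K. ?P \<otimes> z0 K) J" by(rule cech_d_smult[OF z0c closed(4), symmetric])
  also have "\<dots> = cech_d (cech_d ?q) J"
   by(rule cech_d_cong) (use z0(2)[OF idx_diff[OF J]] cech_d_closed[where c = ?q] cl in simp_all)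
  also have "\<dots> = \<zero>" by(rule cech_d_d) (use cl in simp)
  finally show "?P \<otimes> cech_d z0 J = \<zero>" .
 qed (rule cech_d_closed[OF z0c])
 hence "cocycle d A (Suc k) z0" unfolding cocycle_def using z0(1) by blast
 moreover have "coboundary d A (Suc k) (%J. ?P \<otimes> z0 J)" unfolding coboundary_def using z0(2) qA by(intro exI[of _ ?q]) auto
 moreover have "frobenius_lift k z0 z"
  by(rule frobenius_liftI[where y = ?q and w = y])
   (use z0(2) qA y p_cong_refl[OF p B subsetD[OF AB qA]] subsetD[OF AB y(1)] in simp_all)
 ultimately show ?thesis by blast
qed

end

section \<open>Localizations and the fraction field of a domain\<close>

locale fractions = domain A for A :: "'a ring" (structure) +
 fixes U :: "'a set"
 assumes U: "U \<subseteq> $A - {\<zero>}" "\<one> : U" "!!s t. s : U ==> t : U ==> s \<otimes> t : U"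
begin

abbreviation "fr \<equiv> fraction A U (self_module A)"
abbreviation "Loc \<equiv> localization A U (self_module A)"

lemma Uc: "s : U ==> s : $A" "s : U ==> s ~= \<zero>" using U(1) by auto

lemma mem_fr: "x : $A ==> s : U ==> (y, t) : fr x s \<longleftrightarrow> y : $A & t : U & t \<otimes> x = s \<otimes> y"
 unfolding fraction_def localization_rel_def using U(2) by(auto simp: Uc m_lcancel intro!: bexI[of _ \<one>])

lemma fr_eq:
 assumes "x : $A" "s : U" "y : $A" "t : U"
 shows "fr x s = fr y t \<longleftrightarrow> t \<otimes> x = s \<otimes> y"
proof
 assume "fr x s = fr y t"
 hence "(x, s) : fr y t" using mem_fr[OF assms(1,2)] assms Uc by(auto simp: m_comm)
 thus "t \<otimes> x = s \<otimes> y" using mem_fr[OF assms(3,4)] by simp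
next
 have sub: "fr x s \<subseteq> fr y t" if a: "x : $A" "s : U" "y : $A" "t : U" "t \<otimes> x = s \<otimes> y" for x y s t
 proof clarify
  fix z r assume "(z, r) : fr x s"
  hence z: "z : $A" "r : U" "r \<otimes> x = s \<otimes> z" using mem_fr[OF a(1,2)] by auto
  note c = a(1,3) z(1) Uc(1)[OF a(2)] Uc(1)[OF a(4)] Uc(1)[OF z(2)]
  have "s \<otimes> (r \<otimes> y) = r \<otimes> (t \<otimes> x)" unfolding a(5) using c by(simp add: m_lcomm)
  also have "\<dots> = t \<otimes> (s \<otimes> z)" unfolding z(3)[symmetric] using c by(simp add: m_lcomm)
  finally have "s \<otimes> (r \<otimes> y) = s \<otimes> (t \<otimes> z)" using c by(simp add: m_lcomm)
  hence "r \<otimes> y = t \<otimes> z" using m_lcancel[OF Uc(2)[OF a(2)]] c by simp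
  thus "(z, r) : fr y t" using mem_fr[OF a(3,4)] z by simp
 qed
 assume "t \<otimes> x = s \<otimes> y"
 thus "fr x s = fr y t" using sub[of x s y t] sub[of y t x s] assms by auto
qed

text \<open>Operations on fractions are defined as unions over representatives; as soon as all
  representatives give the same value, the union is that value.\<close>

lemma UN_fr:
 assumes "x : $A" "s : U" "!!y t. y : $A ==> t : U ==> fr y t = fr x s ==> f (y, t) = f (x, s)"
 shows "(\<Union>z\<in>fr x s. f z) = f (x, s)"
proof -
 have "f z = f (x, s)" if "z : fr x s" for z
 proof -
  obtain y t where z: "z = (y, t)" by(cases z)
  hence "y : $A" "t : U" "t \<otimes> x = s \<otimes> y" using that mem_fr[OF assms(1,2)] by auto
  thus ?thesis unfolding z using assms(3)[of y t] fr_eq[of x s y t] assms(1,2) by metis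
 qed
 moreover have "(x, s) : fr x s" using mem_fr assms(1,2) Uc by(simp add: m_comm)
 ultimately show ?thesis by blast
qed

lemma carrier_Loc: "$Loc = {fr x s | x s. x : $A & s : U}"
 unfolding localization_def fraction_def by(auto simp: quotient_def)

lemma zero_Loc: "0_Loc = fr \<zero> \<one>" by(simp add: localization_def)

context
 fixes x s y t assumes xs: "x : $A" "s : U" and yt: "y : $A" "t : U"
begin

lemma add_Loc: "fr x s+.Loc fr y t = fr (t \<otimes> x \<oplus> s \<otimes> y) (s \<otimes> t)"
proof -
 have e: "fr (t' \<otimes> x' \<oplus> s' \<otimes> y') (s' \<otimes> t') = fr (t \<otimes> x \<oplus> s \<otimes> y) (s \<otimes> t)"
  if a: "x' : $A" "s' : U" "fr x' s' = fr x s" "y' : $A" "t' : U" "fr y' t' = fr y t" for x' s' y' t'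
 proof -
  note c = a(1,4) xs(1) yt(1) Uc(1)[OF a(2)] Uc(1)[OF a(5)] Uc(1)[OF xs(2)] Uc(1)[OF yt(2)]
  have h: "s \<otimes> x' = s' \<otimes> x" "t \<otimes> y' = t' \<otimes> y" using a fr_eq xs yt by blast+
  have "s \<otimes> t \<otimes> (t' \<otimes> x' \<oplus> s' \<otimes> y') = t \<otimes> t' \<otimes> (s \<otimes> x') \<oplus> s \<otimes> s' \<otimes> (t \<otimes> y')"
   using c by(simp add: r_distr m_ac)
  also have "\<dots> = s' \<otimes> t' \<otimes> (t \<otimes> x \<oplus> s \<otimes> y)" unfolding h using c by(simp add: r_distr m_ac)
  finally show ?thesis using a xs yt c U(3) fr_eq by simp
 qed
 have "fr x s+.Loc fr y t = (\<Union>(x, s)\<in>fr x s. \<Union>(y, t)\<in>fr y t. fr (t \<otimes> x \<oplus> s \<otimes> y) (s \<otimes> t))"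
  by(simp add: localization_def)
 also have "\<dots> = (%(x, s). \<Union>(y, t)\<in>fr y t. fr (t \<otimes> x \<oplus> s \<otimes> y) (s \<otimes> t)) (x, s)"
 proof(rule UN_fr[OF xs])
  fix x' s' assume a: "x' : $A" "s' : U" "fr x' s' = fr x s"
  have "(\<Union>(y, t)\<in>fr y t. fr (t \<otimes> x'' \<oplus> s'' \<otimes> y) (s'' \<otimes> t)) = fr (t \<otimes> x \<oplus> s \<otimes> y) (s \<otimes> t)"
   if "x'' : $A" "s'' : U" "fr x'' s'' = fr x s" for x'' s''
   using UN_fr[OF yt, of "%(y, t). fr (t \<otimes> x'' \<oplus> s'' \<otimes> y) (s'' \<otimes> t)"] e[OF that] e[OF that yt refl] by simp
  from this[OF a] this[OF xs refl]
  show "(%(x, s). \<Union>(y, t)\<in>fr y t. fr (t \<otimes> x \<oplus> s \<otimes> y) (s \<otimes> t)) (x', s') =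
   (%(x, s). \<Union>(y, t)\<in>fr y t. fr (t \<otimes> x \<oplus> s \<otimes> y) (s \<otimes> t)) (x, s)" by simp
 qed
 also have "\<dots> = fr (t \<otimes> x \<oplus> s \<otimes> y) (s \<otimes> t)"
  using UN_fr[OF yt, of "%(y, t). fr (t \<otimes> x \<oplus> s \<otimes> y) (s \<otimes> t)"] e[OF xs refl] by simp
 finally show ?thesis .
qed

lemma UN_mult: "(\<Union>(x, s)\<in>fr x s. \<Union>(y, t)\<in>fr y t. fr (x \<otimes> y) (s \<otimes> t)) = fr (x \<otimes> y) (s \<otimes> t)"
proof -
 have e: "fr (x' \<otimes> y') (s' \<otimes> t') = fr (x \<otimes> y) (s \<otimes> t)"
  if a: "x' : $A" "s' : U" "fr x' s' = fr x s" "y' : $A" "t' : U" "fr y' t' = fr y t" for x' s' y' t'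
 proof -
  note c = a(1,4) xs(1) yt(1) Uc(1)[OF a(2)] Uc(1)[OF a(5)] Uc(1)[OF xs(2)] Uc(1)[OF yt(2)]
  have h: "s \<otimes> x' = s' \<otimes> x" "t \<otimes> y' = t' \<otimes> y" using a fr_eq xs yt by blast+
  have "s \<otimes> t \<otimes> (x' \<otimes> y') = (s \<otimes> x') \<otimes> (t \<otimes> y')" using c by(simp add: m_ac)
  also have "\<dots> = s' \<otimes> t' \<otimes> (x \<otimes> y)" unfolding h using c by(simp add: m_ac)
  finally show ?thesis using a xs yt c U(3) fr_eq by simp
 qed
 have i: "(\<Union>(y, t)\<in>fr y t. fr (x'' \<otimes> y) (s'' \<otimes> t)) = fr (x \<otimes> y) (s \<otimes> t)"
  if "x'' : $A" "s'' : U" "fr x'' s'' = fr x s" for x'' s''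
  using UN_fr[OF yt, of "%(y, t). fr (x'' \<otimes> y) (s'' \<otimes> t)"] e[OF that] e[OF that yt refl] by simp
 have "(\<Union>(x, s)\<in>fr x s. \<Union>(y, t)\<in>fr y t. fr (x \<otimes> y) (s \<otimes> t)) =
   (%(x, s). \<Union>(y, t)\<in>fr y t. fr (x \<otimes> y) (s \<otimes> t)) (x, s)"
  by(rule UN_fr[OF xs]) (use i xs in simp)
 thus ?thesis using i[OF xs refl] by simp
qed

lemma smult_Loc: "a : $A ==> a**.Loc fr x s = fr (a \<otimes> x) s"
proof -
 assume a: "a : $A"
 have "fr (a \<otimes> x') s' = fr (a \<otimes> x) s" if b: "x' : $A" "s' : U" "fr x' s' = fr x s" for x' s'
 proof -
  have "s \<otimes> x' = s' \<otimes> x" using fr_eq b xs by blast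
  hence "s \<otimes> (a \<otimes> x') = s' \<otimes> (a \<otimes> x)" using a b xs Uc m_lcomm[of _ a] by metis
  thus ?thesis using fr_eq a b xs by simp
 qed
 thus ?thesis using UN_fr[OF xs, of "%(x, s). fr (a \<otimes> x) s"] by(simp add: localization_def)
qed

end

end

lemma fractions_nonzero: "domain A ==> fractions A ($A - {0_A})"
proof -
 assume "domain A"
 then interpret domain A .
 show ?thesis by unfold_locales (auto simp: integral_iff)
qed

lemma fraction_field:
 assumes "domain A"
 shows "field (fraction_field A)" "to_fraction_field A : ring_hom A (fraction_field A)" "inj_on (to_fraction_field A) $A"
proof -
 interpret fractions A "$A - {0_A}" by(rule fractions_nonzero[OF assms])
 let ?U = "$A - {0_A}"
 let ?F = "fraction_field A"
 have Fs: "$?F = {fr x s | x s. x : $A & s : ?U}" "0_?F = fr 0_A 1_A" "1_?F = fr 1_A 1_A"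
  by(simp_all add: fraction_field_def Let_def carrier_Loc zero_Loc)
 have add: "fr x s+.?F fr y t = fr (t*.A x+.A s*.A y) (s*.A t)"
  and mult: "fr x s*.?F fr y t = fr (x*.A y) (s*.A t)"
  if "x : $A" "s : ?U" "y : $A" "t : ?U" for x s y t
  using add_Loc[OF that] UN_mult[OF that] by(simp_all add: fraction_field_def Let_def)
 have frF: "fr x s : $?F" if "x : $A" "s : ?U" for x s using that Fs(1) by blast
 have mU: "s*.A t : ?U" if "s : ?U" "t : ?U" for s t using U(3)[OF that] .
 have "cring ?F"
 proof(rule cringI)
  show "abelian_group ?F"
  proof(rule abelian_groupI)
   fix a1 a2 assume "a1 : $?F" "a2 : $?F"
   then obtain x s y t where a1: "a1 = fr x s" "x : $A" "s : ?U" and a2: "a2 = fr y t" "y : $A" "t : ?U"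
   unfolding Fs(1) by blast
   have c: "s : $A" "t : $A" using a1 a2 by auto
   show "a1+.?F a2 : $?F" unfolding a1(1) a2(1) add[OF a1(2,3) a2(2,3)]
   by(rule frF) (use a1 a2 mU c in auto)
   show "a1+.?F a2 = a2+.?F a1" unfolding a1(1) a2(1) add[OF a1(2,3) a2(2,3)] add[OF a2(2,3) a1(2,3)]
   using a1 a2 c by(simp add: a_comm m_comm)
   fix a3 assume "a3 : $?F"
   then obtain z u where a3: "a3 = fr z u" "z : $A" "u : ?U" unfolding Fs(1) by blast
   have cu: "u : $A" using a3 by auto
   show "a1+.?F a2+.?F a3 = a1+.?F (a2+.?F a3)" unfolding a1(1) a2(1) a3(1)
   using a1(2,3) a2(2,3) a3(2,3) c cu mU by(simp add: add r_distr m_ac a_assoc)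
  next
   fix a1 assume "a1 : $?F"
   then obtain x s where a1: "a1 = fr x s" "x : $A" "s : ?U" unfolding Fs(1) by blast
   have c: "s : $A" using a1 by auto
   show "0_?F+.?F a1 = a1" unfolding a1(1) Fs(2) using a1 c by(subst add) auto
   show "\<exists>a2\<in>$?F. a2+.?F a1 = 0_?F"
   proof(rule bexI[of _ "fr (-.A x) s"])
   show "fr (-.A x) s+.?F a1 = 0_?F" unfolding a1(1) Fs(2) using a1 c mU[of s s]
   by(simp add: add fr_eq r_minus l_neg)
   qed (use a1 in "auto intro: frF")
  qed (auto simp: Fs(2) intro: frF)
  show "comm_monoid ?F"
  proof(rule comm_monoidI)
   fix a1 a2 assume "a1 : $?F" "a2 : $?F"
   then obtain x s y t where a1: "a1 = fr x s" "x : $A" "s : ?U" and a2: "a2 = fr y t" "y : $A" "t : ?U"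
   unfolding Fs(1) by blast
   have c: "s : $A" "t : $A" using a1 a2 by auto
   show "a1*.?F a2 : $?F" unfolding a1(1) a2(1) mult[OF a1(2,3) a2(2,3)]
   by(rule frF) (use a1 a2 mU in auto)
   show "a1*.?F a2 = a2*.?F a1" unfolding a1(1) a2(1) mult[OF a1(2,3) a2(2,3)] mult[OF a2(2,3) a1(2,3)]
   using a1 a2 c by(simp add: m_comm)
   fix a3 assume "a3 : $?F"
   then obtain z u where a3: "a3 = fr z u" "z : $A" "u : ?U" unfolding Fs(1) by blast
   have cu: "u : $A" using a3 by auto
   show "a1*.?F a2*.?F a3 = a1*.?F (a2*.?F a3)" unfolding a1(1) a2(1) a3(1)
   using a1(2,3) a2(2,3) a3(2,3) c cu mU by(simp add: mult m_assoc)
  next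
   fix a1 assume "a1 : $?F"
   then obtain x s where a1: "a1 = fr x s" "x : $A" "s : ?U" unfolding Fs(1) by blast
   show "1_?F*.?F a1 = a1" unfolding a1(1) Fs(3) using a1 by(simp add: mult)
  qed (auto simp: Fs(3) intro: frF)
  fix a1 a2 a3 assume "a1 : $?F" "a2 : $?F" "a3 : $?F"
  then obtain x s y t z u where a1: "a1 = fr x s" "x : $A" "s : ?U" and a2: "a2 = fr y t" "y : $A" "t : ?U"
   and a3: "a3 = fr z u" "z : $A" "u : ?U" unfolding Fs(1) by blast
  have c: "s : $A" "t : $A" "u : $A" using a1 a2 a3 by auto
  note m = mU[OF a1(3) a2(3)] mU[OF mU[OF a1(3) a2(3)] a3(3)] mU[OF a1(3) a3(3)] mU[OF a2(3) a3(3)] mU[OF mU[OF a1(3) a3(3)] mU[OF a2(3) a3(3)]]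
  have "(a1+.?F a2)*.?F a3 = fr ((t*.A x+.A s*.A y)*.A z) (s*.A t*.A u)"
   unfolding a1(1) a2(1) a3(1) add[OF a1(2,3) a2(2,3)] by(rule mult) (use a1 a2 a3 c m in simp_all)
  also have "\<dots> = fr (t*.A u*.A (x*.A z)+.A s*.A u*.A (y*.A z)) (s*.A u*.A (t*.A u))"
   by(subst fr_eq) (use a1(2) a2(2) a3(2) c m in "simp_all add: m_ac r_distr l_distr")
  also have "\<dots> = a1*.?F a3+.?F a2*.?F a3"
   unfolding a1(1) a2(1) a3(1) mult[OF a1(2,3) a3(2,3)] mult[OF a2(2,3) a3(2,3)]
   by(rule add[symmetric]) (use a1 a2 a3 m in simp_all)
  finally show "(a1+.?F a2)*.?F a3 = a1*.?F a3+.?F a2*.?F a3" .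
 qed
 then interpret F: cring ?F .
 show "field ?F"
 proof(rule F.cring_fieldI2)
  show "0_?F ~= 1_?F" unfolding Fs(2,3) by(simp add: fr_eq)
  fix a1 assume a1: "a1 : $?F" "a1 ~= 0_?F"
  then obtain x s where x: "a1 = fr x s" "x : $A" "s : ?U" unfolding Fs(1) by blast
  have "x ~= 0_A" using a1(2) x unfolding Fs(2) by(auto simp: fr_eq)
  thus "\<exists>b\<in>$?F. a1*.?F b = 1_?F"
   unfolding Fs(3) x(1) using x mU[of s x] by(intro bexI[of _ "fr s x"]) (auto simp: mult fr_eq m_comm intro: frF)
 qed
 show "to_fraction_field A : ring_hom A ?F"
  by(rule ring_hom_memI) (use frF in "simp_all add: to_fraction_field_def Fs(3) mult add")
 show "inj_on (to_fraction_field A) $A"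
  by(rule inj_onI) (simp add: to_fraction_field_def fr_eq)
qed

context plain_cring
begin

lemma cocycle_comb:
 assumes A: "!!J. subring (A J) R" and z: "cocycle d A j z" "cocycle d A j z'" and a: "!!J. a : A J"
 shows "cocycle d A j (%J. z J \<oplus> z' J)" "cocycle d A j (%J. a \<otimes> z J)"
proof -
 have m: "z J : A J" "z' J : A J" for J using z unfolding cocycle_def by blast+
 have c: "z J : $R" "z' J : $R" "a : $R" for J using m a subringE(1)[OF A] by blast+
 show "cocycle d A j (%J. z J \<oplus> z' J)" "cocycle d A j (%J. a \<otimes> z J)"
  using z c m a subringE(6,7)[OF A] unfolding cocycle_def by(simp_all add: cech_d_add cech_d_smult)
qed

lemma coboundary_comb:
 assumes A: "!!J. subring (A J) R" and z: "coboundary d A j z" "coboundary d A j z'" and a: "!!J. a : A J"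
 shows "coboundary d A j (%J. z J \<oplus> z' J)" "coboundary d A j (%J. a \<otimes> z J)"
proof -
 obtain c c' where c: "!!J. c J : A J" "!!J. J : cech_index d j ==> z J = cech_d c J"
  and c': "!!J. c' J : A J" "!!J. J : cech_index d j ==> z' J = cech_d c' J"
  using z unfolding coboundary_def by blast
 have cl: "c J : $R" "c' J : $R" "a : $R" for J using c(1) c'(1) a subringE(1)[OF A] by blast+
 show "coboundary d A j (%J. z J \<oplus> z' J)" unfolding coboundary_def
  using c c' cl subringE(7)[OF A] by(intro exI[of _ "%J. c J \<oplus> c' J"]) (simp add: cech_d_add)
 show "coboundary d A j (%J. a \<otimes> z J)" unfolding coboundary_def
  using c a cl subringE(6)[OF A] by(intro exI[of _ "%J. a \<otimes> c J"]) (simp add: cech_d_smult)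
qed

lemma coboundary_cocycle:
 assumes A: "!!J. subring (A J) R" and z: "!!J. z J : A J" "coboundary d A j z"
 shows "cocycle d A j z"
proof -
 obtain c where c: "!!J. c J : A J" "!!J. J : cech_index d j ==> z J = cech_d c J"
  using z unfolding coboundary_def by blast
 have cl: "c J : $R" "z J : $R" for J using c(1) z(1) subringE(1)[OF A] by blast+
 have "cech_d z J = \<zero>" if J: "J : cech_index d (Suc j)" for J
 proof -
  have "J - {i} : cech_index d j" if "i : J" for i
   using J that finite_subset[of J "{1..d}"] unfolding cech_index_def by(auto simp: card_Diff_singleton)
  hence "cech_d z J = cech_d (cech_d c) J"
   by(intro cech_d_cong) (use c(2) cech_d_closed[OF cl(1)] in simp_all)
  thus ?thesis using cech_d_d[OF cl(1)] by simp
 qed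
 thus ?thesis unfolding cocycle_def using z(1) by blast
qed

end

lemma abelian_group_diff_zero:
 assumes M: "abelian_group M" and x: "x : $M" "y : $M"
 shows "x+.M-.M y = 0_M \<longleftrightarrow> x = y"
proof -
 interpret abelian_group M by(rule M)
 have "x = (x+.M-.M y)+.M y" using x by(simp add: a_assoc l_neg)
 thus ?thesis using x by(auto simp: r_neg)
qed

lemma submoduleI_smult:
 assumes M: "module A M" and "Q \<subseteq> $M" "0_M : Q" "!!x y. x : Q ==> y : Q ==> x+.M y : Q"
  and sm: "!!a x. a : $A ==> x : Q ==> a**.M x : Q"
 shows "submodule Q A M"
proof -
 interpret M: module A M by(rule M)
 have "-.M x : Q" if "x : Q" for x
  using sm[of "-.A 1_A" x] that assms(2) M.smult_l_minus[of "1_A" x] by auto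
 thus ?thesis using assms by(intro M.submoduleI) auto
qed

section \<open>Local cohomology computed inside a field\<close>

text \<open>Through the injection \<open>h\<close> every localization becomes a subring of
  \<open>F\<close>, and a Cech cochain a family of field elements. \<open>F\<close> may be larger
  than the fraction field of \<open>A\<close>, so that two rings can share it.\<close>

locale cech_embedding = A: domain A + F: plain_cring F
 for A :: "'a ring" and F :: "'f ring" +
 fixes h :: "'a => 'f" and x :: "nat => 'a" and d :: nat
 assumes F: "field F" and h: "h : ring_hom A F" "inj_on h $A"
  and x: "!!i. i : {1..d} ==> x i : $A" "!!i. i : {1..d} ==> x i ~= 0_A"
begin

interpretation F: field F by(rule F)
interpretation h: ring_hom_ring A F h
 by(rule ring_hom_ringI2[OF A.ring_axioms F.ring_axioms h(1)])

abbreviation "idx \<equiv> cech_index d"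
abbreviation "U J \<equiv> cech_denominators A x J"
abbreviation "L J \<equiv> cech_localization A x (self_module A) J"
abbreviation "fr J \<equiv> fraction A (U J) (self_module A)"
abbreviation "xx J \<equiv> finprod A x J"

lemma h_zero_iff: "a : $A ==> h a = 0_F \<longleftrightarrow> a = 0_A"
 using inj_onD[OF h(2), of a "0_A"] h.hom_zero by auto

lemma xx_closed: "J \<subseteq> {1..d} ==> xx J : $A"
 using x by(intro A.finprod_closed) auto

lemma xx_union: "I \<subseteq> {1..d} ==> J \<subseteq> {1..d} ==> I \<inter> J = {} ==> xx (I \<union> J) = xx I*.A xx J"
 using x by(intro A.finprod_Un_disjoint) (auto intro: finite_subset)

lemma xx_nonzero: "J \<subseteq> {1..d} ==> xx J ~= 0_A"
proof -
 have "finite J ==> J \<subseteq> {1..d} ==> xx J ~= 0_A"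
 proof(induction J rule: finite_induct)
  case (insert i J)
  have "xx (insert i J) = x i*.A xx J" using insert x by(intro A.finprod_insert) auto
  thus ?case using insert x xx_closed[of J] A.integral_iff[of "x i" "xx J"] by auto
 qed simp
 thus "J \<subseteq> {1..d} ==> xx J ~= 0_A" using finite_subset by blast
qed

lemma pow_nonzero: "a : $A ==> a ~= 0_A ==> a^.A (t::nat) ~= 0_A"
 by(induction t) (auto simp: A.integral_iff)

lemma fractions_U: assumes J: "J \<subseteq> {1..d}" shows "fractions A (U J)"
proof(intro fractions.intro fractions_axioms.intro A.domain_axioms)
 show "U J \<subseteq> $A - {0_A}" unfolding cech_denominators_def
  using xx_closed[OF J] xx_nonzero[OF J] pow_nonzero by auto
 show "1_A : U J" unfolding cech_denominators_def by(rule range_eqI[of _ _ 0]) simp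
 show "s*.A t : U J" if "s : U J" "t : U J" for s t
  using that xx_closed[OF J] unfolding cech_denominators_def by(auto simp: A.nat_pow_mult)
qed

lemma Uc: "J \<subseteq> {1..d} ==> s : U J ==> s : $A" "J \<subseteq> {1..d} ==> s : U J ==> h s : $F"
 "J \<subseteq> {1..d} ==> s : U J ==> h s ~= 0_F"
 using fractions.Uc[OF fractions_U] h_zero_iff h.hom_closed by auto

text \<open>The copy in \<open>F\<close> of the localization at the product of the \<open>x i\<close>, \<open>i \<in> J\<close>; the value for
 other sets is irrelevant.\<close>

definition loc :: "nat set => 'f set"
 where "loc J = (if J \<subseteq> {1..d} then {y : $F. \<exists>t::nat. \<exists>a\<in>$A. y*.F h (xx J)^.F t = h a} else $F)"

definition val :: "('a \<times> 'a) set => 'f"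
 where "val Y = (THE v. v : $F & (\<forall>(a, s)\<in>Y. v*.F h s = h a))"

lemma loc_iff: "J \<subseteq> {1..d} ==> y : loc J \<longleftrightarrow> y : $F & (\<exists>t::nat. \<exists>a\<in>$A. y*.F h (xx J)^.F t = h a)"
 by(simp add: loc_def)

lemma loc_subset: "loc J \<subseteq> $F" by(auto simp: loc_def)

lemma hxx: "J \<subseteq> {1..d} ==> h (xx J) : $F" using xx_closed by simp

lemma h_pow: "a : $A ==> h (a^.A (t::nat)) = h a^.F t" by(rule h.hom_nat_pow)

lemma loc_h: "a : $A ==> h a : loc J"
 unfolding loc_def using hxx by(auto intro!: exI[of _ "0::nat"] bexI[of _ a])

lemma loc_ring: "subring (loc J) F"
proof(cases "J \<subseteq> {1..d}")
 case J: True
 note hx = hxx[OF J] xx_closed[OF J]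
 show ?thesis
 proof(rule F.subringI)
  show "1_F : loc J" using loc_h[OF A.one_closed] by simp
  fix y z assume "y : loc J" "z : loc J"
  then obtain t u :: nat and a b where y: "y : $F" "a : $A" "y*.F h (xx J)^.F t = h a"
   and z: "z : $F" "b : $A" "z*.F h (xx J)^.F u = h b"
   unfolding loc_iff[OF J] by blast
  let ?q = "h (xx J)^.F t" and ?r = "h (xx J)^.F u"
  have qr: "h (xx J)^.F (t + u) = ?q*.F ?r" "?q : $F" "?r : $F" using hx by(simp_all add: F.nat_pow_mult)
  have "y*.F z*.F (?q*.F ?r) = (y*.F ?q)*.F (z*.F ?r)" using y(1) z(1) qr by(simp add: F.m_ac)
  hence "y*.F z*.F h (xx J)^.F (t + u) = h (a*.A b)" unfolding qr y(3) z(3) using y z by simp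
  thus "y*.F z : loc J" unfolding loc_iff[OF J] using y z A.m_closed F.m_closed by blast
  have "(y+.F z)*.F (?q*.F ?r) = (y*.F ?q)*.F ?r+.F (z*.F ?r)*.F ?q"
   using y(1) z(1) qr by(simp add: F.l_distr F.m_ac)
  hence "(y+.F z)*.F h (xx J)^.F (t + u) = h (a*.A xx J^.A u+.A b*.A xx J^.A t)"
   unfolding qr y(3) z(3) using y z hx by(simp add: h_pow)
  thus "y+.F z : loc J" unfolding loc_iff[OF J] using y z hx by(metis A.a_closed A.m_closed A.nat_pow_closed F.a_closed)
 next
  fix y assume "y : loc J"
  then obtain t :: nat and a where y: "y : $F" "a : $A" "y*.F h (xx J)^.F t = h a"
   unfolding loc_iff[OF J] by blast
  hence "(-.F y)*.F h (xx J)^.F t = h (-.A a)" using hx by(simp add: F.l_minus)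
  thus "-.F y : loc J" unfolding loc_iff[OF J] using y A.a_inv_closed F.a_inv_closed by blast
 qed (rule loc_subset)
qed (simp add: loc_def F.carrier_is_subring)

lemma loc_mono: assumes IJ: "I \<subseteq> J" shows "loc I \<subseteq> loc J"
proof(cases "J \<subseteq> {1..d}")
 case J: True
 have I: "I \<subseteq> {1..d}" using IJ J by blast
 have D: "J - I \<subseteq> {1..d}" using J by blast
 show ?thesis
 proof
  fix y assume "y : loc I"
  then obtain t :: nat and a where y: "y : $F" "a : $A" "y*.F h (xx I)^.F t = h a"
   unfolding loc_iff[OF I] by blast
  have "xx J = xx I*.A xx (J - I)" using xx_union[OF I D] IJ by(simp add: Un_absorb1)
  hence "y*.F h (xx J)^.F t = h (a*.A xx (J - I)^.A t)"
   using y xx_closed[OF I] xx_closed[OF D] by(simp add: h_pow F.nat_pow_distrib F.m_assoc[symmetric])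
  thus "y : loc J" unfolding loc_iff[OF J] using y xx_closed[OF D] by blast
 qed
qed (auto simp: loc_def)

text \<open>The product belonging to \<open>insert i K\<close> has one factor \<open>x i\<close>
  more than the one belonging to \<open>K\<close>, so a power of it removes the additional
  denominator.\<close>

lemma loc_insert:
 assumes K: "K : idx k" and i: "i : {1..d}" and y: "y : loc (insert i K)"
 shows "\<exists>t::nat. h (x i)^.F t*.F y : loc K"
proof(cases "i : K")
 case True
 thus ?thesis using y subsetD[OF loc_subset y] by(intro exI[of _ 0]) (simp add: insert_absorb)
next
 case False
 have Kd: "K \<subseteq> {1..d}" "insert i K \<subseteq> {1..d}" using K i unfolding cech_index_def by auto
 have e: "xx (insert i K) = x i*.A xx K" using False Kd x i by(intro A.finprod_insert) (auto intro: finite_subset)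
 obtain t :: nat and a where t: "y : $F" "a : $A" "y*.F h (xx (insert i K))^.F t = h a"
  using y unfolding loc_iff[OF Kd(2)] by blast
 have c: "h (x i) : $F" "h (xx K) : $F" using x(1)[OF i] hxx[OF Kd(1)] by auto
 have "h (x i)^.F t*.F y*.F h (xx K)^.F t = h a"
  using t(3)[unfolded e] c t(1) x(1)[OF i] xx_closed[OF Kd(1)] by(simp add: F.nat_pow_distrib F.m_ac)
 thus ?thesis unfolding loc_iff[OF Kd(1)] using t c F.m_closed F.nat_pow_closed by blast
qed

lemma val_unique:
 assumes J: "J \<subseteq> {1..d}" and a: "a : $A" "s : U J" and v: "v : $F" "v*.F h s = h a"
 shows "val (fr J a s) = v"
proof -
 interpret Q: fractions A "U J" by(rule fractions_U[OF J])
 note u = Uc[OF J]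
 show ?thesis unfolding val_def
 proof(rule the_equality)
  show "v : $F & (\<forall>(b, t)\<in>fr J a s. v*.F h t = h b)"
  proof(intro conjI v(1) ballI, clarify)
   fix b t assume "(b, t) : fr J a s"
   hence b: "b : $A" "t : U J" "t*.A a = s*.A b" using Q.mem_fr[OF a] by auto
   have "h s*.F (v*.F h t) = h t*.F (v*.F h s)" using v(1) u a b by(simp add: F.m_ac)
   also have "\<dots> = h (t*.A a)" using v(2) a b(1,2) u by simp
   also have "\<dots> = h s*.F h b" unfolding b(3) using a b(1,2) u by simp
   finally show "v*.F h t = h b" using F.m_lcancel[OF u(3)[OF a(2)] u(2)[OF a(2)], of "v*.F h t" "h b"] v a b u by simp
  qed
  fix w assume "w : $F & (\<forall>(b, t)\<in>fr J a s. w*.F h t = h b)"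
  moreover have "(a, s) : fr J a s" using Q.mem_fr[OF a] a u by(simp add: A.m_comm)
  ultimately have w: "w : $F" "w*.F h s = h a" by auto
  thus "w = v" using F.m_rcancel[OF u(3)[OF a(2)] u(2)[OF a(2)], of w v] v by simp
 qed
qed

lemma val_fr:
 assumes J: "J \<subseteq> {1..d}" and a: "a : $A" "s : U J"
 shows "val (fr J a s) : $F" "val (fr J a s)*.F h s = h a"
proof -
 note u = Uc[OF J a(2)]
 have i: "inv\<^bsub>F\<^esub> h s : $F" "inv\<^bsub>F\<^esub> h s*.F h s = 1_F" using u F.field_Units by auto
 have e: "h a*.F inv\<^bsub>F\<^esub> h s*.F h s = h a" using i u a by(simp add: F.m_assoc)
 show "val (fr J a s) : $F" "val (fr J a s)*.F h s = h a"
  using val_unique[OF J a _ e] e i a by simp_all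
qed

lemma L_simps: assumes J: "J \<subseteq> {1..d}"
 shows "$(L J) = {fr J a s | a s. a : $A & s : U J}" "0_(L J) = fr J 0_A 1_A"
 unfolding cech_localization_def using fractions.carrier_Loc[OF fractions_U[OF J]] fractions.zero_Loc[OF fractions_U[OF J]] by simp_all

lemma one_U: "J \<subseteq> {1..d} ==> 1_A : U J" using fractions.U(2)[OF fractions_U] .

lemma L_closed:
 assumes J: "J \<subseteq> {1..d}" and Y: "Y : $(L J)"
 shows "Z : $(L J) ==> Y+.(L J) Z : $(L J) & val (Y+.(L J) Z) = val Y+.F val Z"
  "c : $A ==> c**.(L J) Y : $(L J) & val (c**.(L J) Y) = h c*.F val Y"
proof -
 interpret Q: fractions A "U J" by(rule fractions_U[OF J])
 obtain a s where Y: "Y = fr J a s" "a : $A" "s : U J" using Y L_simps[OF J] by blast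
 note vY = val_fr[OF J Y(2,3)] Uc[OF J Y(3)]
 {
  assume "Z : $(L J)"
  then obtain b t where Z: "Z = fr J b t" "b : $A" "t : U J" using L_simps[OF J] by blast
  note vZ = val_fr[OF J Z(2,3)] Uc[OF J Z(3)]
  have st: "s*.A t : U J" using Q.U(3)[OF Y(3) Z(3)] .
  have c: "t*.A a+.A s*.A b : $A" using Y Z vY vZ by simp
  have e: "Y+.(L J) Z = fr J (t*.A a+.A s*.A b) (s*.A t)"
   unfolding Y(1) Z(1) cech_localization_def by(rule Q.add_Loc[OF Y(2,3) Z(2,3)])
  let ?u = "val (fr J a s)" and ?v = "val (fr J b t)"
  have "(?u+.F ?v)*.F h (s*.A t) = h t*.F (?u*.F h s)+.F h s*.F (?v*.F h t)"
   using vY(1,3,4) vZ(1,3,4) by(simp add: F.l_distr F.r_distr F.m_ac)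
  also have "\<dots> = h (t*.A a+.A s*.A b)" unfolding vY(2) vZ(2) using Y Z vY(3) vZ(3) by simp
  finally have "val (fr J (t*.A a+.A s*.A b) (s*.A t)) = ?u+.F ?v"
   by(intro val_unique[OF J c st]) (use vY vZ in simp_all)
  hence "val (Y+.(L J) Z) = val Y+.F val Z" unfolding e by(simp only: Y(1) Z(1))
  moreover have "Y+.(L J) Z : $(L J)" unfolding e L_simps[OF J] using c st by blast
  ultimately show "Y+.(L J) Z : $(L J) & val (Y+.(L J) Z) = val Y+.F val Z" by blast
 }
 assume c: "c : $A"
 have e: "c**.(L J) Y = fr J (c*.A a) s" unfolding Y(1) cech_localization_def by(rule Q.smult_Loc[OF Y(2,3) Y(2,3) c])
 have "val (fr J (c*.A a) s) = h c*.F val (fr J a s)"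
  by(rule val_unique[OF J _ Y(3)]) (use c Y(2,3) vY in "simp_all add: F.m_assoc")
 hence "val (c**.(L J) Y) = h c*.F val Y" unfolding e by(simp only: Y(1))
 moreover have "c**.(L J) Y : $(L J)" unfolding e L_simps[OF J] using c Y(2,3) A.m_closed by blast
 ultimately show "c**.(L J) Y : $(L J) & val (c**.(L J) Y) = h c*.F val Y" by blast
qed

lemma zero_L: "J \<subseteq> {1..d} ==> 0_(L J) : $(L J) & val 0_(L J) = 0_F"
 using val_unique[of J "0_A" "1_A" "0_F"] one_U[of J] L_simps[of J] by auto

lemma val_bij: assumes J: "J \<subseteq> {1..d}" shows "bij_betw val ($(L J)) (loc J)"
 unfolding bij_betw_def
proof(intro conjI inj_onI)
 interpret Q: fractions A "U J" by(rule fractions_U[OF J])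
 fix Y Z assume "Y : $(L J)" "Z : $(L J)" and e: "val Y = val Z"
 then obtain a s b t where Y: "Y = fr J a s" "a : $A" "s : U J" and Z: "Z = fr J b t" "b : $A" "t : U J"
  unfolding L_simps[OF J] by blast
 note vY = val_fr[OF J Y(2,3)] Uc[OF J Y(3)] and vZ = val_fr[OF J Z(2,3)] Uc[OF J Z(3)]
 have "h t*.F (val Y*.F h s) = h s*.F (val Z*.F h t)" unfolding e using vZ vY Z(1) by(simp add: F.m_ac)
 hence "h (t*.A a) = h (s*.A b)" using vY(2,3) vZ(2,3) Y Z by simp
 hence "t*.A a = s*.A b" using inj_onD[OF h(2)] Y Z vY(3) vZ(3) by simp
 thus "Y = Z" unfolding Y(1) Z(1) using Q.fr_eq Y Z by blast
next
 show "val ` $(L J) = loc J"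
 proof(intro equalityI subsetI)
 fix v assume "v : val ` $(L J)"
 then obtain a s where a: "v = val (fr J a s)" "a : $A" "s : U J" unfolding L_simps[OF J] by blast
 obtain t :: nat where "s = xx J^.A t" using a(3) unfolding cech_denominators_def by blast
 thus "v : loc J" unfolding loc_iff[OF J] using val_fr[OF J a(2,3)] a h_pow[OF xx_closed[OF J], of t] by metis
next
 fix v assume "v : loc J"
 then obtain t :: nat and a where v: "v : $F" "a : $A" "v*.F h (xx J)^.F t = h a" unfolding loc_iff[OF J] by blast
 have s: "xx J^.A t : U J" unfolding cech_denominators_def by blast
 have "v = val (fr J a (xx J^.A t))" using val_unique[OF J v(2) s v(1)] v(3) h_pow[OF xx_closed[OF J]] by simp
 thus "v : val ` $(L J)" unfolding L_simps[OF J] using v(2) s by blast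
qed
qed

definition dec :: "nat set => 'f => ('a \<times> 'a) set" where "dec J = inv_into ($(L J)) val"

lemma dec: "J \<subseteq> {1..d} ==> v : loc J ==> dec J v : $(L J)" "J \<subseteq> {1..d} ==> v : loc J ==> val (dec J v) = v"
 unfolding dec_def using val_bij[of J] by(simp_all add: bij_betw_def inv_into_into f_inv_into_f)

lemma dec_val: "J \<subseteq> {1..d} ==> Y : $(L J) ==> val Y = v ==> dec J v = Y"
 unfolding dec_def using val_bij[of J] by(auto simp: bij_betw_def)

lemma val_loc: "J \<subseteq> {1..d} ==> Y : $(L J) ==> val Y : loc J"
 using val_bij[of J] by(auto simp: bij_betw_def)

lemma module_L: assumes J: "J \<subseteq> {1..d}" shows "module A (L J)"
proof(rule module_pullback[where h = val and M = "restrict_scalars h (self_module F)"])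
 show "module A (restrict_scalars h (self_module F))"
  by(rule module_restrict_scalars[OF module_self_module h(1)]) (rule F.is_cring A.is_cring)+
 show "val : $(L J) \<rightarrow> $(restrict_scalars h (self_module F))" using val_loc[OF J] loc_subset by auto
 show "inj_on val ($(L J))" using val_bij[OF J] by(simp add: bij_betw_def)
qed (use L_closed[OF J] zero_L[OF J] in simp_all)

lemma dec_simps:
 assumes J: "J \<subseteq> {1..d}"
 shows "u : loc J ==> v : loc J ==> dec J u+.(L J) dec J v = dec J (u+.F v)"
  "c : $A ==> v : loc J ==> c**.(L J) dec J v = dec J (h c*.F v)"
  "0_(L J) = dec J 0_F"
 using dec_val[OF J, of "dec J u+.(L J) dec J v" "u+.F v"] L_closed(1)[OF J, of "dec J u" "dec J v"] dec[OF J, of u] dec[OF J, of v]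
  dec_val[OF J, of "c**.(L J) dec J v" "h c*.F v"] L_closed(2)[OF J, of "dec J v" c]
  dec_val[OF J, of "0_(L J)" "0_F"] zero_L[OF J]
 by simp_all

lemma dec_finsum:
 assumes J: "J \<subseteq> {1..d}" and S: "finite S"
 shows "(!!i. i : S ==> f i : loc J) ==> finsum (L J) (%i. dec J (f i)) S = dec J (finsum F f S)"
 using S
proof(induction S rule: finite_induct)
 interpret Lm: module A "L J" by(rule module_L[OF J])
 {
  case empty thus ?case using dec_simps(3)[OF J] by simp
 next
  case (insert i S)
  have f: "f j : $F" "dec J (f j) : $(L J)" if "j : insert i S" for j
   using insert.prems[OF that] loc_subset dec(1)[OF J] by auto
  have S: "finsum F f S : loc J" by(rule F.subring_finsum[OF loc_ring]) (use insert.prems in blast)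
  have "finsum (L J) (%i. dec J (f i)) (insert i S) = dec J (f i)+.(L J) finsum (L J) (%i. dec J (f i)) S"
   by(rule Lm.finsum_insert) (use insert f in auto)
  also have "\<dots> = dec J (f i+.F finsum F f S)" using insert dec_simps(1)[OF J _ S] by simp
  also have "f i+.F finsum F f S = finsum F f (insert i S)" by(rule F.finsum_insert[symmetric]) (use insert f in auto)
  finally show ?case .
 }
qed

lemma dec_sign:
 assumes J: "J \<subseteq> {1..d}" and v: "v : loc J"
 shows "add_pow (L J) ((- 1 :: int) ^ m) (dec J v) = dec J (F.sg m*.F v)"
proof -
 interpret Lm: module A "L J" by(rule module_L[OF J])
 have vF: "v : $F" using v loc_subset by blast
 note c = dec(1)[OF J v]
 have mv: "-.F v : loc J" using subringE(5)[OF loc_ring v] .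
 have "-.(L J) dec J v = dec J (-.F v)"
  by(rule abelian_group_minusI[OF c dec(1)[OF J mv] Lm.abelian_group_axioms])
   (use dec_simps[OF J] v mv vF in "simp add: F.r_neg")
 moreover have "add_pow (L J) (- 1 :: int) (dec J v) =-.(L J) dec J v"
  using Lm.add.int_pow_neg[OF c, of 1] Lm.add.int_pow_1[OF c] by(simp add: a_inv_def)
 ultimately show ?thesis using vF Lm.add.int_pow_1[OF c] by(cases "even m") (simp_all add: F.sg_def F.l_minus)
qed

text \<open>All numerators, denominators and multipliers in the double union represent the same
  field element \<open>v\<close>, so the union collapses to the fraction over \<open>J\<close> that
  represents \<open>v\<close>.\<close>

lemma dec_map:
 assumes IJ: "I \<subseteq> J" and J: "J \<subseteq> {1..d}" and v: "v : loc I"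
 shows "localization_map A (U I) (U J) (self_module A) (dec I v) = dec J v"
proof -
 have I: "I \<subseteq> {1..d}" and D: "J - I \<subseteq> {1..d}" using IJ J by auto
 interpret Q: fractions A "U I" by(rule fractions_U[OF I])
 have vJ: "v : $F" "v : loc J" using v loc_subset loc_mono[OF IJ] by auto
 obtain a s where a: "dec I v = fr I a s" "a : $A" "s : U I" using dec(1)[OF I v] L_simps[OF I] by blast
 have all: "fr J (r*.A y) (r*.A t) = dec J v"
  if yt: "(y, t) : dec I v" and r: "r : $A" "r*.A t : U J" for y t r
 proof -
  have y: "y : $A" "t : U I" "t*.A a = s*.A y" using yt Q.mem_fr[OF a(2,3)] a(1) by auto
  have "fr I y t = dec I v" unfolding a(1) using Q.fr_eq[OF y(1,2) a(2,3)] y(3) by simp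
  hence "v*.F h t = h y" using val_fr[OF I y(1,2)] dec(2)[OF I v] by simp
  hence "v*.F h (r*.A t) = h (r*.A y)" using Uc(1,2)[OF I y(2)] y(1,2) r(1) vJ(1) by(simp add: F.m_lcomm[of v "h r"])
  hence "val (fr J (r*.A y) (r*.A t)) = v" using val_unique[OF J _ r(2) vJ(1)] y(1) r(1) by simp
  moreover have "fr J (r*.A y) (r*.A t) : $(L J)" unfolding L_simps[OF J] using y(1) r by blast
  ultimately show ?thesis using dec_val[OF J] by metis
 qed
 obtain m :: nat where m: "s = xx I^.A m" using a(3) unfolding cech_denominators_def by blast
 \<comment> \<open>An explicit multiplier, so that the union is not over an empty set.\<close>
 let ?r = "xx (J - I)^.A m"
 have "xx J = xx I*.A xx (J - I)" using xx_union[OF I D] IJ by(simp add: Un_absorb1)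
 hence "?r*.A s = xx J^.A m" using m xx_closed[OF I] xx_closed[OF D] by(simp add: A.nat_pow_distrib A.m_comm)
 hence r: "?r : $A" "?r*.A s : U J" using xx_closed[OF D] unfolding cech_denominators_def by auto
 have as: "(a, s) : dec I v" unfolding a(1) using Q.mem_fr[OF a(2,3)] a Uc(1)[OF I a(3)] by(simp add: A.m_comm)
 let ?g = "%z r. fr J (r*.A fst z) (r*.A snd z)"
 have g: "?g z r = dec J v" if "z : dec I v" "r : {r : $A. r*.A snd z : U J}" for z r
  using all[of "fst z" "snd z" r] that by simp
 have "localization_map A (U I) (U J) (self_module A) (dec I v) =
   (\<Union>z\<in>dec I v. \<Union>r\<in>{r : $A. r*.A snd z : U J}. ?g z r)"
  unfolding localization_map_def by(simp add: case_prod_unfold)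
 also have "\<dots> = (\<Union>z\<in>dec I v. \<Union>r\<in>{r : $A. r*.A snd z : U J}. dec J v)"
  by(intro SUP_cong refl g)
 also have "\<dots> = dec J v" using as r by fastforce
 finally show ?thesis .
qed

abbreviation "CC j \<equiv> cech_cochains A x d (self_module A) j"
abbreviation "H j \<equiv> local_cohomology A x d (self_module A) j"
abbreviation "Bd j \<equiv> cech_coboundaries A x d (self_module A) j"
abbreviation "cocyc j \<equiv> F.cocycle d loc j"
abbreviation "cobd j \<equiv> F.coboundary d loc j"

definition rep :: "nat => (nat set => 'f) => nat set => ('a \<times> 'a) set"
 where "rep j z = (\<lambda>J\<in>idx j. dec J (z J))"

definition cls :: "nat => (nat set => 'f) => (nat set => ('a \<times> 'a) set) set"
 where "cls j z = Bd j +>\<^bsub>CC j\<^esub> rep j z"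

lemma idxD: "J : idx j ==> J \<subseteq> {1..d}" "J : idx j ==> finite J"
 unfolding cech_index_def by(auto intro: finite_subset)

lemma module_CC: "module A (CC j)"
 unfolding cech_cochains_def by(rule module_direct_product[OF A.is_cring module_L[OF idxD(1)]])

lemma rep_simps:
 assumes "!!J. z J : loc J"
 shows "rep j z : $(CC j)" "(!!J. z' J : loc J) ==> rep j z+.(CC j) rep j z' = rep j (%J. z J+.F z' J)"
  "a : $A ==> a**.(CC j) rep j z = rep j (%J. h a*.F z J)"
  "0_(CC j) = rep j (%J. 0_F)"
proof -
 note d = dec_simps[OF idxD(1)] dec(1)[OF idxD(1)]
 show "rep j z : $(CC j)" using d(4)[OF _ assms] by(simp add: cech_cochains_def direct_product_simps rep_def)
 show "rep j z+.(CC j) rep j z' = rep j (%J. z J+.F z' J)" if "!!J. z' J : loc J"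
  unfolding cech_cochains_def direct_product_simps rep_def by(rule restrict_ext) (simp add: d(1)[OF _ assms that])
 show "a**.(CC j) rep j z = rep j (%J. h a*.F z J)" if "a : $A"
  unfolding cech_cochains_def direct_product_simps rep_def by(rule restrict_ext) (simp add: d(2)[OF _ that assms])
 show "0_(CC j) = rep j (%J. 0_F)"
  unfolding cech_cochains_def direct_product_simps rep_def by(rule restrict_ext) (simp add: d(3))
qed

lemma rep_eq:
 assumes "!!J. z J : loc J" "!!J. z' J : loc J"
 shows "rep j z = rep j z' \<longleftrightarrow> (\<forall>J\<in>idx j. z J = z' J)"
proof
 assume e: "rep j z = rep j z'"
 show "\<forall>J\<in>idx j. z J = z' J"
 proof
  fix J assume J: "J : idx j"
  have "dec J (z J) = dec J (z' J)" using fun_cong[OF e, of J] J by(simp add: rep_def)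
  thus "z J = z' J" using dec(2)[OF idxD(1)[OF J] assms(1)] dec(2)[OF idxD(1)[OF J] assms(2)] by metis
 qed
qed (auto simp: rep_def intro!: restrict_ext)

lemma carrier_CC:
 assumes "c : $(CC j)" obtains z where "!!J. z J : loc J" "c = rep j z"
proof(rule that)
 have c: "c J : $(L J)" if "J : idx j" for J
  using assms that by(auto simp: cech_cochains_def direct_product_simps)
 show "(if J : idx j then val (c J) else 0_F) : loc J" for J
  using val_loc[OF idxD(1) c] subringE(2)[OF loc_ring] by simp
 have "c J = dec J (val (c J))" if "J : idx j" for J using dec_val[OF idxD(1)[OF that] c[OF that] refl] by simp
 thus "c = rep j (%J. if J : idx j then val (c J) else 0_F)"
  using assms by(auto simp: cech_cochains_def direct_product_simps rep_def fun_eq_iff PiE_iff extensional_def)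
qed

lemma cech_d_loc: "(!!J. z J : loc J) ==> F.cech_d z J : loc J"
 by(rule F.cech_d_mem[OF loc_ring]) (use loc_mono[of "J - {_}" J] in blast)

text \<open>In \<open>F\<close> the localization maps are inclusions, so the differential is the
  signed sum of field elements.\<close>

lemma differential_rep:
 assumes z: "!!J. z J : loc J"
 shows "cech_differential A x d (self_module A) j (rep j z) = rep (Suc j) (F.cech_d z)"
 unfolding cech_differential_def rep_def[of "Suc j"]
proof(rule restrict_ext)
 fix J assume J: "J : idx (Suc j)"
 note Jd = idxD[OF J]
 interpret Lm: module A "L J" by(rule module_L[OF Jd(1)])
 have zl: "F.sg m*.F z (J - {i}) : loc J" for m i
  using subringE(6)[OF loc_ring F.sg_mem[OF loc_ring]] loc_mono[of "J - {i}" J] z by blast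
 have zJ: "z (J - {i}) : loc J" for i using loc_mono[of "J - {i}" J] z by blast
 have "(\<Oplus>\<^bsub>L J\<^esub>i\<in>J. add_pow (L J) ((- 1 :: int) ^ card {l : J. l < i})
   (localization_map A (U (J - {i})) (U J) (self_module A) (rep j z (J - {i})))) =
   (\<Oplus>\<^bsub>L J\<^esub>i\<in>J. dec J (F.sg (card {l : J. l < i})*.F z (J - {i})))"
 proof(rule Lm.finsum_cong')
  fix i assume i: "i : J"
  hence "J - {i} : idx j" using J Jd unfolding cech_index_def by(auto simp: card_Diff_singleton)
  hence "rep j z (J - {i}) = dec (J - {i}) (z (J - {i}))" by(simp add: rep_def)
  thus "add_pow (L J) ((- 1 :: int) ^ card {l : J. l < i})
   (localization_map A (U (J - {i})) (U J) (self_module A) (rep j z (J - {i}))) =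
   dec J (F.sg (card {l : J. l < i})*.F z (J - {i}))"
   using dec_map[of "J - {i}" J, OF _ Jd(1) z] dec_sign[OF Jd(1) zJ] by auto
 qed (use dec(1)[OF Jd(1) zl] in auto)
 also have "\<dots> = dec J (F.cech_d z J)" unfolding F.cech_d_def by(rule dec_finsum[OF Jd zl])
 finally show "(\<Oplus>\<^bsub>L J\<^esub>i\<in>J. add_pow (L J) ((- 1 :: int) ^ card {l : J. l < i})
   (localization_map A (U (J - {i})) (U J) (self_module A) (rep j z (J - {i})))) = dec J (F.cech_d z J)" .
qed

lemma zero_loc: "0_F : loc J" using subringE(2)[OF loc_ring] .

lemma cocycles_rep: "cech_cocycles A x d (self_module A) j = rep j ` {z. cocyc j z}"
proof -
 have "rep j z : cech_cocycles A x d (self_module A) j \<longleftrightarrow> cocyc j z" if z: "!!J. z J : loc J" for z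
  unfolding cech_cocycles_def F.cocycle_def
  using rep_simps(1)[OF z] z differential_rep[OF z] rep_simps(4)[OF z] rep_eq[of "F.cech_d z" "%_. 0_F", OF cech_d_loc[OF z] zero_loc]
  by auto
 moreover have "!!c. c : cech_cocycles A x d (self_module A) j ==> \<exists>z. (\<forall>J. z J : loc J) & c = rep j z"
  unfolding cech_cocycles_def using carrier_CC by blast
 ultimately show ?thesis using F.cocycle_def by blast
qed

text \<open>In degree 0 the one index set is empty and \<open>cech_d\<close> is an empty sum there,
  which agrees with the zero submodule prescribed in that degree.\<close>

lemma coboundaries_rep: "Bd j = rep j ` {z. (\<forall>J. z J : loc J) & cobd j z}"
proof(cases j)
 case 0
 have e: "cobd 0 z \<longleftrightarrow> (\<forall>J\<in>idx 0. z J = 0_F)" for z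
 proof -
  have i: "J = {}" if "J : idx 0" for J using idxD(2)[OF that] that by(simp add: cech_index_def)
  have "F.cech_d c {} = 0_F" for c by(simp add: F.cech_d_def)
  hence "\<forall>J\<in>idx 0. F.cech_d c J = 0_F" for c using i by blast
  thus ?thesis unfolding F.coboundary_def using zero_loc by fastforce
 qed
 show ?thesis unfolding 0 cech_coboundaries_def
  using rep_simps(4)[of "%_. 0_F"] zero_loc rep_eq[of _ "%_. 0_F" 0, OF _ zero_loc] e by auto
next
 case (Suc i)
 show ?thesis unfolding Suc cech_coboundaries_def nat.case
 proof(intro equalityI subsetI)
  fix b assume "b : cech_differential A x d (self_module A) i ` $(CC i)"
  then obtain c where c: "c : $(CC i)" "b = cech_differential A x d (self_module A) i c" by blast
  obtain z where z: "!!J. z J : loc J" "c = rep i z" using carrier_CC[OF c(1)] by blast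
  have "b = rep (Suc i) (F.cech_d z)" using c(2) z(2) differential_rep[OF z(1)] by simp
  have "cobd (Suc i) (F.cech_d z)" unfolding F.coboundary_def by(rule exI[of _ z]) (simp add: z(1))
  thus "b : rep (Suc i) ` {z. (\<forall>J. z J : loc J) & cobd (Suc i) z}" unfolding \<open>b = rep (Suc i) (F.cech_d z)\<close> using cech_d_loc[OF z(1)] by simp
 next
  fix b assume "b : rep (Suc i) ` {z. (\<forall>J. z J : loc J) & cobd (Suc i) z}"
  then obtain z c where z: "b = rep (Suc i) z" "!!J. z J : loc J" "!!J. c J : loc J" "!!J. J : idx (Suc i) ==> z J = F.cech_d c J"
   unfolding F.coboundary_def by blast
  have "b = cech_differential A x d (self_module A) i (rep i c)" unfolding z(1) differential_rep[OF z(3)] using rep_eq[OF z(2) cech_d_loc[OF z(3)]] z(4) by blast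
  thus "b : cech_differential A x d (self_module A) i ` $(CC i)"
   using rep_simps(1)[OF z(3), of i] by(rule image_eqI)
 qed
qed

abbreviation "ZZ j \<equiv> (CC j)\<lparr>carrier := cech_cocycles A x d (self_module A) j\<rparr>"

lemma cocycD: "cocyc j z ==> z J : loc J" unfolding F.cocycle_def by blast

lemma cocyc_zero: "cocyc j (%_. 0_F)" "cobd j (%_. 0_F)"
proof -
 have "F.cech_d (%_. 0_F) J = 0_F" for J
  unfolding F.cech_d_def by(rule F.add.finprod_one_eqI) simp
 thus "cocyc j (%_. 0_F)" "cobd j (%_. 0_F)"
  unfolding F.cocycle_def F.coboundary_def using zero_loc by(auto intro!: exI[of _ "%_. 0_F"])
qed

lemma cocyc_comb: "cocyc j z ==> cocyc j z' ==> cocyc j (%J. z J+.F z' J)"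
 "cocyc j z ==> a : $A ==> cocyc j (%J. h a*.F z J)"
 using F.cocycle_comb[where A = loc, OF loc_ring] loc_h by blast+

lemma module_ZZ: "module A (ZZ j)"
proof -
 have "submodule (cech_cocycles A x d (self_module A) j) A (CC j)"
 proof(rule submoduleI_smult[OF module_CC]; unfold cocycles_rep)
  show "rep j ` {z. cocyc j z} \<subseteq> $(CC j)" using rep_simps(1) cocycD by blast
  show "0_(CC j) : rep j ` {z. cocyc j z}" using rep_simps(4)[OF zero_loc] cocyc_zero(1) by blast
  fix y assume "y : rep j ` {z. cocyc j z}"
  then obtain z where z: "y = rep j z" "cocyc j z" by blast
  have zl: "z J : loc J" for J by(rule cocycD[OF z(2)])
  show "a**.(CC j) y : rep j ` {z. cocyc j z}" if "a : $A" for a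
   unfolding z(1) rep_simps(3)[OF zl that] using cocyc_comb(2)[OF z(2) that] by blast
  fix y' assume "y' : rep j ` {z. cocyc j z}"
  then obtain z' where z': "y' = rep j z'" "cocyc j z'" by blast
  have zl': "z' J : loc J" for J by(rule cocycD[OF z'(2)])
  show "y+.(CC j) y' : rep j ` {z. cocyc j z}"
   unfolding z(1) z'(1) rep_simps(2)[OF zl zl'] using cocyc_comb(1)[OF z(2) z'(2)] by blast
 qed
 thus ?thesis using submodule.submodule_is_module module_CC by blast
qed

lemma submodule_Bd: "submodule (Bd j) A (ZZ j)"
proof(rule submoduleI_smult[OF module_ZZ])
 show "Bd j \<subseteq> $(ZZ j)" unfolding coboundaries_rep using cocycles_rep F.coboundary_cocycle[where A = loc, OF loc_ring] by auto
 show "0_(ZZ j) : Bd j" unfolding coboundaries_rep using rep_simps(4)[OF zero_loc] cocyc_zero(2) zero_loc by auto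
 fix y assume "y : Bd j"
 then obtain z where z: "y = rep j z" "!!J. z J : loc J" "cobd j z" unfolding coboundaries_rep by blast
 {
  fix y' assume "y' : Bd j"
  then obtain z' where z': "y' = rep j z'" "!!J. z' J : loc J" "cobd j z'" unfolding coboundaries_rep by blast
  show "y+.(ZZ j) y' : Bd j" unfolding coboundaries_rep z(1) z'(1)
   using rep_simps(2)[OF z(2) z'(2)] F.coboundary_comb(1)[where A = loc, OF loc_ring z(3) z'(3) zero_loc] subringE(7)[OF loc_ring z(2) z'(2)] by auto
 }
 fix a assume a: "a : $A"
 show "a**.(ZZ j) y : Bd j" unfolding coboundaries_rep z(1)
  using rep_simps(3)[OF z(2) a] F.coboundary_comb(2)[where A = loc, OF loc_ring z(3) z(3) loc_h[OF a]] subringE(6)[OF loc_ring loc_h[OF a] z(2)] by auto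
qed

lemma cls_ZZ: "cls j z = Bd j +>\<^bsub>ZZ j\<^esub> rep j z"
 by(simp add: cls_def a_r_coset_def r_coset_def)

lemma module_H: "module A (H j)"
 unfolding local_cohomology_def by(rule module_quotient_module[OF module_ZZ submodule_Bd])

lemma rep_ZZ: "cocyc j z ==> rep j z : $(ZZ j)" using cocycles_rep by auto

lemma carrier_H: "$(H j) = cls j ` {z. cocyc j z}"
 unfolding local_cohomology_def carrier_quotient_module[OF module_ZZ submodule_Bd] by(auto simp: cls_ZZ cocycles_rep)

lemma cls_add:
 assumes z: "cocyc j z" "cocyc j z'"
 shows "cls j z+.(H j) cls j z' = cls j (%J. z J+.F z' J)"
proof -
 have "rep j z+.(ZZ j) rep j z' = rep j (%J. z J+.F z' J)"
  using rep_simps(2)[where z = z and z' = z', OF cocycD[OF z(1)] cocycD[OF z(2)]] by simp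
 thus ?thesis unfolding local_cohomology_def cls_ZZ
  using add_quotient_module[OF module_ZZ submodule_Bd rep_ZZ[OF z(1)] rep_ZZ[OF z(2)]] by(simp only:)
qed

lemma cls_smult:
 assumes z: "cocyc j z" and a: "a : $A"
 shows "a**.(H j) cls j z = cls j (%J. h a*.F z J)"
proof -
 have "a**.(ZZ j) rep j z = rep j (%J. h a*.F z J)"
  using rep_simps(3)[where z = z, OF cocycD[OF z] a] by simp
 thus ?thesis unfolding local_cohomology_def cls_ZZ
  using smult_quotient_module[OF module_ZZ submodule_Bd a rep_ZZ[OF z]] by(simp only:)
qed

lemma cls_zero: "cocyc j z ==> cls j z = 0_(H j) \<longleftrightarrow> cobd j z"
proof -
 assume z: "cocyc j z"
 interpret Z: module A "ZZ j" by(rule module_ZZ)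
 have "-.(ZZ j) 0_(ZZ j) = 0_(ZZ j)"
  by(rule abelian_group_minusI[OF Z.zero_closed Z.zero_closed Z.abelian_group_axioms Z.l_zero[OF Z.zero_closed]])
 hence "rep j z-.(ZZ j) 0_(ZZ j) = rep j z" using Z.r_zero[OF rep_ZZ[OF z]] by(simp only: a_minus_def)
 hence "cls j z = 0_(H j) \<longleftrightarrow> rep j z : Bd j"
  unfolding local_cohomology_def cls_ZZ zero_quotient_module[OF module_ZZ submodule_Bd]
  using submodule_coset_eq[OF module_ZZ submodule_Bd rep_ZZ[OF z] Z.zero_closed] by(simp only:)
 also have "\<dots> \<longleftrightarrow> cobd j z"
 proof
  assume "rep j z : Bd j"
  then obtain z' where z': "rep j z = rep j z'" "!!J. z' J : loc J" "cobd j z'" unfolding coboundaries_rep by blast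
  thus "cobd j z" using rep_eq[OF cocycD[OF z] z'(2), of j] unfolding F.coboundary_def by auto
 qed (use cocycD[OF z] in "auto simp: coboundaries_rep")
 finally show ?thesis .
qed

lemma cls_mem: "cocyc j z ==> c : cls j z ==> \<exists>z'. cocyc j z' & c = rep j z' & cls j z' = cls j z"
proof -
 assume z: "cocyc j z" and c: "c : cls j z"
 have m: "c : $(ZZ j)" "c-.(ZZ j) rep j z : Bd j"
  using submodule_coset_mem[OF module_ZZ submodule_Bd rep_ZZ[OF z], of c] c unfolding cls_ZZ by auto
 then obtain z' where z': "cocyc j z'" "c = rep j z'" using cocycles_rep by auto
 thus ?thesis
  using submodule_coset_eq[OF module_ZZ submodule_Bd m(1) rep_ZZ[OF z]] m(2) unfolding cls_ZZ by blast
qed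

lemma rep_cls: "cocyc j z ==> rep j z : cls j z"
 unfolding cls_ZZ using submodule_coset_self[OF module_ZZ submodule_Bd rep_ZZ] by blast

lemma cls_eq: assumes z: "cocyc j z" "cocyc j z'"
 shows "cls j z = cls j z' \<longleftrightarrow> cobd j (%J. z J+.F-.F z' J)"
proof -
 interpret Hm: module A "H j" by(rule module_H)
 have zc: "z' J : $F" for J using cocycD[OF z(2)] loc_subset by blast
 have m: "(%J. h (-.A 1_A)*.F z' J) = (%J.-.F z' J)" using zc by(simp add: F.l_minus)
 have a: "-.A 1_A : $A" by simp
 have mz: "cocyc j (%J.-.F z' J)" using cocyc_comb(2)[OF z(2) a] unfolding m .
 have c: "cls j z : $(H j)" "cls j z' : $(H j)" using carrier_H z by auto
 have "cls j (%J. z J+.F-.F z' J) = cls j z+.(H j) (-.A 1_A)**.(H j) cls j z'"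
  using cls_add[OF z(1) mz] cls_smult[OF z(2) a] unfolding m by simp
 also have "\<dots> = cls j z+.(H j)-.(H j) cls j z'" using Hm.smult_l_minus[OF A.one_closed c(2)] c by simp
 finally have e: "cls j (%J. z J+.F-.F z' J) = cls j z+.(H j)-.(H j) cls j z'" .
 show ?thesis
  using cls_zero[OF cocyc_comb(1)[OF z(1) mz]] c abelian_group_diff_zero[OF Hm.abelian_group_axioms c] unfolding e by blast
qed

end

section \<open>Filtrations carried along a p-semilinear relation\<close>

lemma (in module) triangular_carrier_update:
 assumes "triangular R M E l Q" "Q \<subseteq> C"
 shows "triangular R (M\<lparr>carrier := C\<rparr>) E l Q"
 using assms
proof(induction)
 case zero
 thus ?case using triangular.zero[of R "M\<lparr>carrier := C\<rparr>" E] by simp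
next
 case (step l P x)
 have P: "submodule P R M" by(rule triangular_submodule[OF step.hyps(1)])
 have xC: "x : C" "P \<subseteq> C" using mem_adjoin[OF P step.hyps(2)] subset_adjoin[OF submoduleE(1)[OF P] step.hyps(2)] step.prems by blast+
 have "triangular R (M\<lparr>carrier := C\<rparr>) E (Suc l) (adjoin R (M\<lparr>carrier := C\<rparr>) P x)"
  by(rule triangular.step[OF step.IH[OF xC(2)]]) (use xC step.hyps(3) in simp_all)
 thus ?case by(simp add: adjoin_def)
qed

context power_series_tower
begin

text \<open>\<open>G\<close> abstracts the operation on classes. Its values on a filtration at level
  \<open>n\<close> generate one at level \<open>n + 1\<close>: if \<open>a\<close> is a root of
  level \<open>n + 1\<close>, then \<open>a\<close> times a value at \<open>x\<close> is a value at
  a^p x, and a^p is a root of level \<open>n\<close>, which moves \<open>x\<close> into the previous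
  term. The filtration used is that of \<open>K\<close>, the classes killed by \<open>P\<close> with
  a value in \<open>I\<close>; \<open>P\<close> acts as h^p, so its rank is at most
  \<open>p * s\<close>.\<close>

lemma frobenius_relation_triangular:
 fixes N :: "('w series, 'n) module" and M :: "('w series, 'm) module"
 assumes N: "module (R n) N" and M: "module Rinf M" and \<phi>: "\<phi> : linear_maps (R n) N M"
  and h: "h : linear_maps (R n) N N" and hp: "!!x. x : $N ==> (h ^^ p) x = const P**.N x"
  and f: "ranked (R n) N {x : $N. h x = 0_N} s f"
  and tors: "!!a x. a : gens n ==> x : $N ==> \<exists>t. (a^.(R n) (t::nat))**.N x = 0_N"
  and G_total: "!!\<xi>. \<xi> : $N ==> const P**.N \<xi> = 0_N ==> \<exists>\<eta>. G \<xi> \<eta>"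
  and G_dom: "!!\<xi> \<eta>. G \<xi> \<eta> ==> \<xi> : $N & \<eta> : $M"
  and G_zero: "!!\<eta>. G 0_N \<eta> ==> \<eta> = 0_M"
  and G_add: "!!\<xi> \<eta> \<xi>' \<eta>'. G \<xi> \<eta> ==> G \<xi>' \<eta>' ==> G (\<xi>+.N \<xi>') (\<eta>+.M \<eta>')"
  and G_minus: "!!\<xi> \<eta>. G \<xi> \<eta> ==> G (-.N \<xi>) (-.M \<eta>)"
  and G_smult: "!!\<xi> \<eta> r b. G \<xi> \<eta> ==> r : SC n ==> b : SC (Suc n) ==> b^.Rinf p = r ==> G (r**.N \<xi>) (b**.M \<eta>)"
  and G_image: "!!\<alpha>. \<alpha> : $N ==> h \<alpha> = 0_N ==> \<exists>\<xi>. const P**.N \<xi> = 0_N & G \<xi> (\<phi> \<alpha>)"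
  and I: "submodule I Rinf M" "\<phi> ` {x : $N. h x = 0_N} \<subseteq> I"
   "!!Q. submodule Q Rinf M ==> \<phi> ` {x : $N. h x = 0_N} \<subseteq> Q ==> I \<subseteq> Q"
 shows "\<exists>l\<le>p * s. triangular Rinf M (gens (Suc n)) l I"
proof -
 interpret N: module "R n" N by(rule N)
 interpret M: module Rinf M by(rule M)
 note Im = M.submoduleE[OF I(1)] M.submodule_zero_mem[OF I(1)]
 define Hp where "Hp = {x : $N. const P**.N x = 0_N}"
 have Pn: "const P : SC n" by(rule const_SC[OF P_V])
 have rS: "a*.Rinf b : SC n" "a+.Rinf b : SC n" if "a : SC n" "b : SC n" for a b
  using subringE(6,7)[OF SC_subring] that by blast+
 have sm: "r**.N x : $N" if "r : SC n" "x : $N" for r x using N.smult_closed that by(simp add: R_simps)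
 have assoc: "(a*.Rinf b)**.N x = a**.N (b**.N x)" if "a : SC n" "b : SC n" "x : $N" for a b x
  using N.smult_assoc1[of a b x] that by(simp add: R_simps)
 have ldist: "(a+.Rinf b)**.N x = a**.N x+.N b**.N x" if "a : SC n" "b : SC n" "x : $N" for a b x
  using N.smult_l_distr[of a b x] that by(simp add: R_simps)
 have comm: "a**.N (b**.N x) = b**.N (a**.N x)" if "a : SC n" "b : SC n" "x : $N" for a b x
  using assoc[OF that] assoc[OF that(2,1,3)] S.m_comm[of a b] subsetD[OF SC_Rinf that(1)] subsetD[OF SC_Rinf that(2)] by simp
 have Hps: "submodule Hp (R n) N"
  by(rule submoduleI_smult[OF N]) (use Pn sm comm[OF Pn] in "auto simp: Hp_def R_simps N.smult_r_distr")
 note Hpm = N.submoduleE[OF Hps]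
 have G_fun: "\<eta> = \<eta>'" if "G \<xi> \<eta>" "G \<xi> \<eta>'" for \<xi> \<eta> \<eta>'
 proof -
  have c: "\<xi> : $N" "\<eta> : $M" "\<eta>' : $M" using G_dom that by blast+
  have "G 0_N (\<eta>+.M-.M \<eta>')" using G_add[OF that(1) G_minus[OF that(2)]] c by(simp add: N.r_neg)
  thus ?thesis using G_zero abelian_group_diff_zero[OF M.abelian_group_axioms c(2,3)] by blast
 qed
 \<comment> \<open>By perfectness v = u^p + P w, and \<open>P\<close> kills \<open>x\<close>; on
   these classes every constant therefore acts as a p-th power.\<close>
 have const_root: "\<exists>u\<in>V. const v**.N x = (const u^.Rinf p)**.N x" if v: "v : V" and x: "x : Hp" for v x
 proof -
  obtain u w where u: "u : V" "w : V" "v = u^.W p+.W P*.W w" using V_perfect[OF v] by blast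
  have VW: "v : $W" if "v : V" for v using subringE(1)[OF V] that by blast
  have VVe: "v : Ve 0" if "v : V" for v using V_Ve that by blast
  have uS: "const u^.Rinf p : SC n" unfolding const_pow[OF VVe[OF u(1)]] by(rule const_SC[OF subring_pow[OF V u(1)]])
  have "const v = const u^.Rinf p+.Rinf const w*.Rinf const P"
   unfolding const_pow[OF VVe[OF u(1)]] u(3) using u(1,2) VW[OF P_V] VW by(simp add: const_add const_mult_const[OF _ VVe[OF P_V], symmetric] m_comm)
  hence "const v**.N x = (const u^.Rinf p)**.N x+.N const w**.N (const P**.N x)"
   using x uS Pn rS const_SC[OF u(2)] by(simp add: Hp_def ldist assoc)
  thus ?thesis using u(1) x uS const_SC[OF u(2), of n] sm by(intro bexI[of _ u]) (auto simp: Hp_def R_simps)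
 qed
 have constS: "const u^.Rinf p : SC n" "const u : SC (Suc n)" if "u : V" for u
  using const_SC[OF that] const_SC[OF subring_pow[OF V that]] const_pow[of u 0 p] V_Ve[of 0] that by auto
 have gen_root: "gen n i = gen (Suc n) i^.Rinf p" "gen n i : SC n" "gen (Suc n) i : SC (Suc n)" if "i : {1..d}" for i
  using gen_pow[OF that, of n 1] gen_SC[OF that] by simp_all
 define K where "K = {\<xi> : Hp. \<exists>\<eta>\<in>I. G \<xi> \<eta>}"
 have I_smult: "b**.M \<eta> : I" if "b : SC (Suc n)" "\<eta> : I" for b \<eta> using Im(4) that SC_Rinf by blast
 have Kadd: "x+.N y : K" if "x : K" "y : K" for x y
  using that Hpm(5) G_add Im(5) unfolding K_def by blast
 have Kroot: "r**.N x : K" if "x : K" "r : SC n" "b : SC (Suc n)" "b^.Rinf p = r" for x r b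
  using that Hpm(4)[of r x] G_smult I_smult unfolding K_def by(fastforce simp: R_simps)
 have Kconst: "const v**.N x : K" if v: "v : V" and x: "x : K" for v x
 proof -
  obtain u where u: "u : V" "const v**.N x = (const u^.Rinf p)**.N x" using const_root[OF v] x unfolding K_def by blast
  show ?thesis unfolding u(2) by(rule Kroot[OF x constS[OF u(1)] refl])
 qed
 have K0: "0_N : K"
 proof -
  obtain \<eta> where e: "G 0_N \<eta>" using G_total[OF N.zero_closed] Pn by(auto simp: R_simps)
  thus ?thesis using G_zero[OF e] Im(7) N.submodule_zero_mem[OF Hps] unfolding K_def by blast
 qed
 have KN: "K \<subseteq> $N" using Hpm(1) unfolding K_def by blast
 text \<open>Induction on the sum of the exponents \<open>t i\<close> for which \<open>gen n i ^ t i\<close> kills \<open>x\<close>.\<close>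
 have Ksm: "r**.N x : K"
  if "x : K" "r : SC n" "!!i. i : {1..d} ==> (gen n i^.(R n) t i)**.N x = 0_N" for x r and t :: "nat => nat"
  using that
 proof(induction "sum t {1..d}" arbitrary: x r t rule: less_induct)
  case less
  have xN: "x : $N" using less.prems(1) KN by blast
  \<comment> \<open>A root of level \<open>n\<close> is a p-th power, so it keeps \<open>x\<close>
    in \<open>K\<close>. It also lowers the sum of exponents, and the remaining factor
    \<open>f\<close> falls under the induction hypothesis.\<close>
  have step: "f**.N (gen n i**.N x) : K" if i: "i : {1..d}" and f: "f : SC n" for i f
  proof(cases "t i")
   case 0
   hence "x = 0_N" using less.prems(3)[OF i] xN by simp
   thus ?thesis using K0 f gen_root(2)[OF i] by(simp add: R_simps)
  next
   case (Suc q)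
   have g: "gen n i : $(R n)" using gen_root(2)[OF i] by(simp add: R_simps)
   let ?t = "t(i := q)"
   have "sum ?t {1..d} < sum t {1..d}" by(rule sum_strict_mono_ex1) (use Suc i in auto)
   moreover have "gen n i**.N x : K" using Kroot[OF less.prems(1) gen_root(2,3)[OF i]] gen_root(1)[OF i] by simp
   moreover have "(gen n j^.(R n) ?t j)**.N (gen n i**.N x) = 0_N" if j: "j : {1..d}" for j
   proof -
   have gj: "gen n j : $(R n)" using gen_root(2)[OF j] by(simp add: R_simps)
   show ?thesis
   proof(cases "j = i")
   case True
   thus ?thesis using less.prems(3)[OF i] Suc N.smult_assoc1[OF _ g xN, of "gen n i^.(R n) q"] g by simp
   next
   case False
   have "(gen n j^.(R n) t j)**.N (gen n i**.N x) = gen n i**.N ((gen n j^.(R n) t j)**.N x)"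
   by(rule comm[OF _ _ xN]) (use N.R.nat_pow_closed[OF gj] g in "simp_all add: R_simps")
   thus ?thesis using less.prems(3)[OF j] False g by simp
   qed
   qed
   ultimately show ?thesis using less.hyps[of ?t "gen n i**.N x" f] f by blast
  qed
  have "\<exists>v\<in>V. \<exists>g\<in>{g : SC n. g**.N x : K}. r = const v+.Rinf g"
  proof(rule V_add_gens[OF _ _ _ less.prems(2)])
   show "a+.Rinf b : {g : SC n. g**.N x : K}"
   if "a : {g : SC n. g**.N x : K}" "b : {g : SC n. g**.N x : K}" for a b
   using that rS Kadd ldist[OF _ _ xN] by simp
   show "0_Rinf : {g : SC n. g**.N x : K}"
   using K0 xN N.smult_l_null[OF xN] subringE(2)[OF SC_subring] by(simp add: R_simps)
   show "gen n i*.Rinf f : {g : SC n. g**.N x : K}" if i: "i : {1..d}" and f: "f : SC n" for i f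
   using step[OF i f] rS gen_root(2)[OF i] f assoc[OF gen_root(2)[OF i] f xN] comm[OF gen_root(2)[OF i] f xN] by simp
  qed
  then obtain v g where v: "v : V" "g : SC n" "g**.N x : K" "r = const v+.Rinf g" by blast
  show ?case unfolding v(4) ldist[OF const_SC[OF v(1)] v(2) xN] by(rule Kadd[OF Kconst[OF v(1) less.prems(1)] v(3)])
 qed
 have Ks: "submodule K (R n) N"
 proof(rule submoduleI_smult[OF N KN K0 Kadd])
  fix r x assume r: "r : $(R n)" and x: "x : K"
  have "\<exists>t. (gen n i^.(R n) (t::nat))**.N x = 0_N" if "i : {1..d}" for i
   using tors[of "gen n i" x] that x KN unfolding gens_def by blast
  then obtain t :: "nat => nat" where "!!i. i : {1..d} ==> (gen n i^.(R n) t i)**.N x = 0_N" by metis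
  thus "r**.N x : K" using Ksm[OF x, of r t] r by(simp add: R_simps)
 qed
 have "{x : $N. (h ^^ p) x = 0_N} = Hp" unfolding Hp_def using hp by auto
 then obtain g where "ranked (R n) N Hp (p * s) g"
  using N.ranked_kernel_power[of h s f p] linear_mapsD[OF h] f by auto
 hence rK: "ranked (R n) N K (p * s) g" by(rule ranked_subset) (auto simp: K_def)
 have gR: "gens n \<subseteq> $(R n)" using gens_SC by(simp add: R_simps)
 obtain l where l: "l \<le> p * s" "triangular (R n) N (gens n) l K"
  using N.ranked_triangular[OF finite_gens gR Ks _ rK] tors KN by blast
 \<comment> \<open>The induction also records that every value on \<open>Q\<close> lies in
   \<open>Q'\<close>; this is what makes the value at the next generator admissible modulo
   \<open>Q'\<close>.\<close>
 have "\<exists>Q'. triangular Rinf M (gens (Suc n)) j Q' & Q' \<subseteq> I & (\<forall>\<xi>\<in>Q. \<forall>\<eta>. G \<xi> \<eta> \<longrightarrow> \<eta> : Q')"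
  if "triangular (R n) N (gens n) j Q" "Q \<subseteq> K" for j Q
  using that
 proof(induction)
  case zero
  show ?case using triangular.zero[of Rinf M "gens (Suc n)"] G_zero Im(7) by(intro exI[of _ "{0_M}"]) auto
 next
  case (step j Q x)
  have Qs: "submodule Q (R n) N" by(rule N.triangular_submodule[OF step.hyps(1)])
  have sub: "Q \<subseteq> adjoin (R n) N Q x" "x : adjoin (R n) N Q x"
   by(rule N.subset_adjoin[OF N.submoduleE(1)[OF Qs] step.hyps(2)], rule N.mem_adjoin[OF Qs step.hyps(2)])
  obtain Q' where Q': "triangular Rinf M (gens (Suc n)) j Q'" "Q' \<subseteq> I" "!!\<xi> \<eta>. \<xi> : Q ==> G \<xi> \<eta> ==> \<eta> : Q'"
   using step.IH step.prems sub(1) by blast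
  have Q's: "submodule Q' Rinf M" by(rule M.triangular_submodule[OF Q'(1)])
  have xK: "x : K" "x : Hp" using sub(2) step.prems unfolding K_def by auto
  obtain \<eta> where e: "\<eta> : I" "G x \<eta>" using xK(1) unfolding K_def by blast
  have eM: "\<eta> : $M" using G_dom[OF e(2)] by blast
  have "triangular Rinf M (gens (Suc n)) (Suc j) (adjoin Rinf M Q' \<eta>)"
  proof(rule triangular.step[OF Q'(1) eM])
   fix a assume "a : gens (Suc n)"
   then obtain i where i: "a = gen (Suc n) i" "i : {1..d}" unfolding gens_def by blast
   have "gen n i**.N x : Q" using step.hyps(3) i(2) unfolding gens_def by blast
   thus "a**.M \<eta> : Q'" using Q'(3) G_smult[OF e(2) gen_root(2,3)[OF i(2)]] gen_root(1)[OF i(2)] i(1) by simp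
  qed
  moreover have "adjoin Rinf M Q' \<eta> \<subseteq> I" by(rule M.adjoin_subset[OF I(1) Q'(2) e(1)])
  moreover have "\<eta>' : adjoin Rinf M Q' \<eta>" if \<xi>: "\<xi> : adjoin (R n) N Q x" and G': "G \<xi> \<eta>'" for \<xi> \<eta>'
  proof -
   obtain q r where q: "q : Q" "r : $(R n)" "\<xi> = q+.N r**.N x" using \<xi> unfolding adjoin_def by blast
   \<comment> \<open>Modulo \<open>Q\<close> the scalar \<open>r\<close> acts on \<open>x\<close>
     through a constant, and the constant acts as a p-th power, to which semilinearity
     applies.\<close>
   obtain v y where v: "v : V" "y : Q" "r**.N x = const v**.N x+.N y"
   using smult_mod_gens[OF N Qs step.hyps(2,3), of r] q(2) by(auto simp: R_simps)
   obtain u where u: "u : V" "const v**.N x = (const u^.Rinf p)**.N x" using const_root[OF v(1) xK(2)] by blast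
   have c: "q : $N" "y : $N" "const v**.N x : $N"
   using N.submoduleE(1)[OF Qs] q(1) v(2) sm[OF const_SC[OF v(1)] step.hyps(2)] by auto
   have qy: "q+.N y : Q" by(rule N.submoduleE(5)[OF Qs q(1) v(2)])
   hence "q+.N y : Hp" using sub(1) step.prems unfolding K_def by blast
   then obtain \<eta>1 where e1: "G (q+.N y) \<eta>1" using G_total unfolding Hp_def by blast
   have "\<xi> = (q+.N y)+.N (const u^.Rinf p)**.N x"
   unfolding q(3) v(3) u(2)[symmetric] using c by(simp add: N.a_assoc N.a_comm[of y])
   hence "G \<xi> (\<eta>1+.M const u**.M \<eta>)" using G_add[OF e1 G_smult[OF e(2) constS[OF u(1)] refl]] by simp
   hence "\<eta>' = \<eta>1+.M const u**.M \<eta>" using G_fun[OF G'] by blast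
   thus ?thesis using M.mem_adjoinI[OF Q'(3)[OF qy e1], of "const u" \<eta>] constS(2)[OF u(1)] SC_Rinf by blast
  qed
  ultimately show ?case by blast
 qed
 then obtain Q' where Q': "triangular Rinf M (gens (Suc n)) l Q'" "Q' \<subseteq> I" "!!\<xi> \<eta>. \<xi> : K ==> G \<xi> \<eta> ==> \<eta> : Q'"
  using l(2) by blast
 have "I \<subseteq> Q'"
 proof(rule I(3)[OF M.triangular_submodule[OF Q'(1)]], clarify)
  fix \<alpha> assume a: "\<alpha> : $N" "h \<alpha> = 0_N"
  obtain \<xi> where x: "const P**.N \<xi> = 0_N" "G \<xi> (\<phi> \<alpha>)" using G_image[OF a] by blast
  have "\<xi> : K" unfolding K_def Hp_def using x G_dom[OF x(2)] I(2) a by blast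
  thus "\<phi> \<alpha> : Q'" using Q'(3) x(2) by blast
 qed
 thus ?thesis using Q'(1,2) l(1) by(intro exI[of _ l]) (simp add: subset_antisym)
qed

end

section \<open>Two domains inside one fraction field\<close>

lemma hom_ring_nat:
 assumes f: "f : ring_hom A B" and A: "ring A" and B: "ring B"
 shows "f (ring_nat A m) = ring_nat B m"
proof -
 interpret A: ring A by(rule A)
 interpret B: ring B by(rule B)
 interpret f: ring_hom_ring A B f by(rule ring_hom_ringI2[OF A B f])
 show ?thesis unfolding ring_nat_def by(induction m) simp_all
qed

context cech_embedding
begin

lemma cls_neg: assumes z: "cocyc j z"
 shows "cocyc j (%J.-.F z J)" "cls j z+.(H j) cls j (%J.-.F z J) = 0_(H j)"
proof -
 interpret h: ring_hom_ring A F h by(rule ring_hom_ringI2[OF A.ring_axioms F.ring_axioms h(1)])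
 have zc: "z J : $F" for J using cocycD[OF z] loc_subset by blast
 have "(%J. h (-.A 1_A)*.F z J) = (%J.-.F z J)" using zc by(simp add: F.l_minus)
 thus n: "cocyc j (%J.-.F z J)" using cocyc_comb(2)[OF z, of "-.A 1_A"] by simp
 show "cls j z+.(H j) cls j (%J.-.F z J) = 0_(H j)"
  using cls_add[OF z n] cls_zero[OF cocyc_zero(1)] cocyc_zero(2) zc by(simp add: F.r_neg)
qed

end

text \<open>The coefficient list of the monic polynomial X^p - a is an integral equation for
  \<open>v\<close>.\<close>

lemma integrally_closed_root:
 assumes A: "domain A" and ic: "integrally_closed_domain A" and p: "0 < (p::nat)"
  and v: "v : $(fraction_field A)" "v^.(fraction_field A) p = to_fraction_field A a" "a : $A"
 shows "v : to_fraction_field A ` $A"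
proof -
 let ?F = "fraction_field A" and ?g = "to_fraction_field A"
 interpret A: domain A by(rule A)
 interpret F: field ?F by(rule fraction_field(1)[OF A])
 interpret g: ring_hom_ring A ?F ?g by(rule ring_hom_ringI2[OF A.ring_axioms F.ring_axioms fraction_field(2)[OF A]])
 let ?q = "1_?F # (replicate (p - 1) 0_?F @ [-.?F ?g a])"
 have ga: "?g a : $?F" using v(3) by simp
 have one: "1_?F : ?g ` $A" and zero: "0_?F : ?g ` $A" and neg: "-.?F ?g a : ?g ` $A"
  using g.hom_one g.hom_zero g.hom_a_inv[OF v(3)] v(3) by(metis A.one_closed A.zero_closed A.a_inv_closed imageI)+
 have "F.eval ?q v = v^.?F p+.?F F.eval (replicate (p - 1) 0_?F @ [-.?F ?g a]) v"
  using v(1) p by simp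
 also have "F.eval (replicate (p - 1) 0_?F @ [-.?F ?g a]) v =-.?F ?g a"
  using F.eval_replicate[of "[-.?F ?g a]" v "p - 1"] v(1) ga by simp
 finally have "F.eval ?q v = 0_?F" unfolding v(2) using ga by(simp add: F.r_neg)
 moreover have "set ?q \<subseteq> ?g ` $A" using one zero neg by auto
 ultimately have "integral_element ?F (?g ` $A) v"
  unfolding integral_element_def by(intro exI[of _ ?q]) simp
 thus ?thesis using ic v(1) unfolding integrally_closed_domain_def by blast
qed

text \<open>The localizations of \<open>A\<close> are placed in the fraction field of
  \<open>B\<close> through the composite embedding, so that the map induced by \<sigma> on cochains
  becomes an inclusion.\<close>

locale cech_tower = A: domain A + B: domain B for A :: "'a ring" and B :: "'b ring" +
 fixes \<sigma> :: "'a => 'b" and x :: "nat => 'a" and d :: nat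
 assumes \<sigma>: "\<sigma> : ring_hom A B" "inj_on \<sigma> $A"
  and x: "!!i. i : {1..d} ==> x i : $A" "!!i. i : {1..d} ==> x i ~= 0_A"
begin

abbreviation "F \<equiv> fraction_field B"
abbreviation "g \<equiv> to_fraction_field B"

sublocale FF: field F by(rule fraction_field(1)[OF B.domain_axioms])

interpretation s: ring_hom_cring A B \<sigma>
 by unfold_locales (rule \<sigma>(1))

interpretation g: ring_hom_ring B F g
 by(rule ring_hom_ringI2[OF B.ring_axioms FF.ring_axioms fraction_field(2)[OF B.domain_axioms]])

sublocale E1: cech_embedding A F "g \<circ> \<sigma>" x d
proof(intro cech_embedding.intro cech_embedding_axioms.intro plain_cring.intro)
 show "g \<circ> \<sigma> : ring_hom A F" by(rule ring_hom_trans[OF \<sigma>(1) fraction_field(2)[OF B.domain_axioms]])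
 show "inj_on (g \<circ> \<sigma>) $A"
  by(rule comp_inj_on[OF \<sigma>(2) inj_on_subset[OF fraction_field(3)[OF B.domain_axioms]]]) auto
qed (use x in "auto intro: A.domain_axioms FF.is_cring FF.field_axioms")

sublocale E2: cech_embedding B F g "\<sigma> \<circ> x" d
proof(intro cech_embedding.intro cech_embedding_axioms.intro plain_cring.intro)
 show "(\<sigma> \<circ> x) i ~= 0_B" if "i : {1..d}" for i
  using x[OF that] inj_onD[OF \<sigma>(2), of "x i" "0_A"] s.hom_zero by auto
qed (use x fraction_field[OF B.domain_axioms] in "auto intro: B.domain_axioms FF.is_cring FF.field_axioms")

lemma xx_map: "J \<subseteq> {1..d} ==> E2.xx J = \<sigma> (E1.xx J)"
proof -
 assume "J \<subseteq> {1..d}"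
 hence "x : J \<rightarrow> $A" using x(1) by blast
 thus ?thesis using s.hom_finprod[of x J] by(simp add: comp_def)
qed

lemma loc_le: "E1.loc J \<subseteq> E2.loc J"
proof(cases "J \<subseteq> {1..d}")
 case True
 show ?thesis
 proof
  fix y assume "y : E1.loc J"
  then obtain t :: nat and a where "y : $F" "a : $A" "y*.F g (\<sigma> (E1.xx J))^.F t = g (\<sigma> a)"
   unfolding E1.loc_iff[OF True] by auto
  thus "y : E2.loc J" unfolding E2.loc_iff[OF True] xx_map[OF True] using s.hom_closed by blast
 qed
qed (simp add: E1.loc_def E2.loc_def)

lemma fr_map:
 assumes J: "J \<subseteq> {1..d}" and v: "v : E1.loc J" and as: "(a, s) : E1.dec J v"
 shows "fraction B (E2.U J) (self_module B) (\<sigma> a) (\<sigma> s) = E2.dec J v"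
proof -
 interpret Q: fractions A "E1.U J" by(rule E1.fractions_U[OF J])
 obtain a0 s0 where 0: "E1.dec J v = E1.fr J a0 s0" "a0 : $A" "s0 : E1.U J"
  using E1.dec(1)[OF J v] E1.L_simps[OF J] by blast
 have m: "a : $A" "s : E1.U J" "s*.A a0 = s0*.A a" using as Q.mem_fr[OF 0(2,3)] unfolding 0(1) by auto
 have "E1.fr J a s = E1.dec J v" unfolding 0(1) using Q.fr_eq[OF m(1,2) 0(2,3)] m(3) by simp
 hence e: "v*.F g (\<sigma> s) = g (\<sigma> a)" using E1.val_fr(2)[OF J m(1,2)] E1.dec(2)[OF J v] by simp
 have pw: "\<sigma> (E1.xx J^.A r) = \<sigma> (E1.xx J)^.B r" for r :: nat
  by(induction r) (use E1.xx_closed[OF J] in simp_all)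
 obtain t :: nat where "s = E1.xx J^.A t" using m(2) unfolding cech_denominators_def by blast
 hence "\<sigma> s = E2.xx J^.B t" unfolding xx_map[OF J] using pw by simp
 hence sU: "\<sigma> s : E2.U J" unfolding cech_denominators_def by blast
 have vF: "v : $F" using v E1.loc_subset by blast
 have "E2.fr J (\<sigma> a) (\<sigma> s) : $(E2.L J)" unfolding E2.L_simps[OF J] using sU m(1) by auto
 thus ?thesis using E2.dec_val[OF J _ E2.val_unique[OF J _ sU vF e]] m(1) by simp
qed

lemma cocyc_le: "E1.cocyc j z ==> E2.cocyc j z"
 unfolding E1.F.cocycle_def using loc_le by blast

lemma cobd_le: "E1.cobd j z ==> E2.cobd j z"
 unfolding E1.F.coboundary_def using loc_le by blast

text \<open>The induced map reads the same family of field elements in the larger localizations. The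
  union over representatives is constant because coboundaries over \<open>A\<close> are coboundaries
  over \<open>B\<close>.\<close>

lemma local_cohomology_map_cls:
 assumes z: "E1.cocyc j z"
 shows "local_cohomology_map A x d j \<sigma> B (E1.cls j z) = E2.cls j z"
proof -
 let ?f = "%c. \<lambda>J\<in>cech_index d j. \<Union>(a, s)\<in>c J. fraction B (cech_denominators B (\<sigma> \<circ> x) J) (self_module B) (\<sigma> a) (\<sigma> s)"
 have f: "?f (E1.rep j z') = E2.rep j z'" if z': "E1.cocyc j z'" for z'
  unfolding E2.rep_def
 proof(rule restrict_ext)
  fix J assume J: "J : cech_index d j"
  note Jd = E1.idxD(1)[OF J]
  have v: "z' J : E1.loc J" by(rule E1.cocycD[OF z'])
  interpret Q: fractions A "E1.U J" by(rule E1.fractions_U[OF Jd])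
  obtain a0 s0 where 0: "E1.dec J (z' J) = E1.fr J a0 s0" "a0 : $A" "s0 : E1.U J"
   using E1.dec(1)[OF Jd v] E1.L_simps[OF Jd] by blast
  have ne: "(a0, s0) : E1.dec J (z' J)" unfolding 0(1) using Q.mem_fr[OF 0(2,3)] 0(2,3) Q.Uc(1) by(simp add: A.m_comm)
  have "(\<Union>(a, s)\<in>E1.rep j z' J. fraction B (E2.U J) (self_module B) (\<sigma> a) (\<sigma> s)) =
   (\<Union>y\<in>E1.dec J (z' J). E2.dec J (z' J))"
   using J fr_map[OF Jd v] unfolding E1.rep_def by(intro SUP_cong) auto
  also have "\<dots> = E2.dec J (z' J)" using ne by blast
  finally show "(\<Union>(a, s)\<in>E1.rep j z' J. fraction B (E2.U J) (self_module B) (\<sigma> a) (\<sigma> s)) = E2.dec J (z' J)" .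
 qed
 have *: "E2.Bd j +>\<^bsub>E2.CC j\<^esub> ?f c = E2.cls j z" if c: "c : E1.cls j z" for c
 proof -
  obtain z' where z': "E1.cocyc j z'" "c = E1.rep j z'" "E1.cls j z' = E1.cls j z" using E1.cls_mem[OF z c] by blast
  have "E2.cls j z' = E2.cls j z"
   using E1.cls_eq[OF z'(1) z] z'(3) E2.cls_eq[OF cocyc_le[OF z'(1)] cocyc_le[OF z]] cobd_le by simp
  thus ?thesis unfolding z'(2) f[OF z'(1)] E2.cls_def .
 qed
 have "local_cohomology_map A x d j \<sigma> B (E1.cls j z) = (\<Union>c\<in>E1.cls j z. E2.Bd j +>\<^bsub>E2.CC j\<^esub> ?f c)"
  unfolding local_cohomology_map_def by(simp add: Let_def)
 also have "\<dots> = (\<Union>c\<in>E1.cls j z. E2.cls j z)" using * by(intro SUP_cong) auto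
 also have "\<dots> = E2.cls j z" using E1.rep_cls[OF z] by blast
 finally show ?thesis .
qed

text \<open>If the product of v^p with a power \<open>s\<close> of the denominator lies in
  \<open>B\<close>, then so does (v s)^p = (v^p s) s^(p-1), and integral closedness applies to v
  s.\<close>

lemma loc_root_closed:
 assumes ic: "integrally_closed_domain B" and p: "0 < (p::nat)" and v: "v : $F" "v^.F p : E2.loc J"
 shows "v : E2.loc J"
proof(cases "J \<subseteq> {1..d}")
 case J: True
 have xB: "E2.xx J : $B" by(rule E2.xx_closed[OF J])
 obtain t :: nat and a where a: "a : $B" "v^.F p*.F g (E2.xx J)^.F t = g a"
  using v(2) unfolding E2.loc_iff[OF J] by blast
 let ?y = "g (E2.xx J)^.F t"
 have y: "?y : $F" using xB by simp
 obtain q where q: "p = Suc q" using p by(cases p) auto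
 have "(v*.F ?y)^.F p = v^.F p*.F ?y^.F p" by(rule FF.nat_pow_distrib[OF v(1) y])
 also have "?y^.F p = ?y*.F ?y^.F q" unfolding q using y by(simp add: FF.m_comm)
 also have "v^.F p*.F (?y*.F ?y^.F q) = g a*.F ?y^.F q"
  unfolding a(2)[symmetric] using v(1) y by(simp add: FF.m_assoc)
 also have "\<dots> = g (a*.B (E2.xx J^.B t)^.B q)" using a(1) xB by(simp add: E2.h_pow)
 finally have e: "(v*.F ?y)^.F p = g (a*.B (E2.xx J^.B t)^.B q)" .
 have "v*.F ?y : g ` $B"
  by(rule integrally_closed_root[OF B.domain_axioms ic p _ e]) (use v(1) y a(1) xB in simp_all)
 thus ?thesis unfolding E2.loc_iff[OF J] using v(1) by blast
qed (use v in "simp add: E2.loc_def")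

text \<open>Writing a/s as a s^(p-1) / s^p makes the denominator a p-th power, and Frobenius
  surjectivity is applied to the numerator. Off the index range \<open>loc\<close> is the whole
  field, where \<open>p\<close> is invertible and 0 serves as a root modulo
  \<open>p\<close>.\<close>

lemma loc_frobenius:
 assumes fs: "frobenius_surjective p (mod_p p B)" and p: "0 < p" and pB: "ring_nat B p ~= 0_B" and y: "y : E2.loc J"
 shows "\<exists>w\<in>E2.loc J. E1.F.p_cong p (E2.loc J) (w^.F p) y"
proof -
 note LR = subringE[OF E2.loc_ring[of J]]
 have yF: "y : $F" using y E2.loc_subset by blast
 have P: "ring_nat F p = g (ring_nat B p)" by(rule hom_ring_nat[OF fraction_field(2)[OF B.domain_axioms] B.ring_axioms FF.ring_axioms, symmetric])
 have PB: "ring_nat B p : $B" by(rule ring_nat_closed[OF B.ring_axioms])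
 have PF: "ring_nat F p : $F" using P PB by simp
 have PU: "ring_nat F p ~= 0_F" unfolding P using E2.h_zero_iff[OF PB] pB by simp
 have inv: "inv\<^bsub>F\<^esub> u : $F" "u*.F inv\<^bsub>F\<^esub> u = 1_F" if "u : $F" "u ~= 0_F" for u
  using that FF.field_Units by auto
 show ?thesis
 proof(cases "J \<subseteq> {1..d}")
  case J: True
  have xB: "E2.xx J : $B" by(rule E2.xx_closed[OF J])
  obtain t :: nat and a where a: "a : $B" "y*.F g (E2.xx J)^.F t = g a"
   using y unfolding E2.loc_iff[OF J] by blast
  let ?s = "E2.xx J^.B t"
  have s: "?s : $B" "?s ~= 0_B" using xB E2.pow_nonzero[OF xB E2.xx_nonzero[OF J]] by auto
  have gs: "g ?s : $F" "g ?s ~= 0_F" using s E2.h_zero_iff by auto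
  have ys: "y*.F g ?s = g a" using a(2) xB by(simp add: E2.h_pow)
  obtain q where q: "p = Suc q" using p by(cases p) auto
  obtain c e where ce: "c : $B" "e : $B" "a*.B ?s^.B q = c^.B p+.B ring_nat B p*.B e"
   using frobenius_surjective_mod_p[OF B.is_cring fs, of "a*.B ?s^.B q"] a(1) s(1) by auto
  let ?i = "inv\<^bsub>F\<^esub> (g ?s)"
  note i = inv[OF gs]
  have iL: "?i : E2.loc J"
  proof -
   have "?i*.F g (E2.xx J)^.F t = g 1_B" using i gs xB by(simp add: E2.h_pow FF.m_comm)
   thus ?thesis unfolding E2.loc_iff[OF J] using i(1) by blast
  qed
  have powL: "u : E2.loc J ==> u^.F (m::nat) : E2.loc J" for u m
   by(induction m) (simp_all only: FF.nat_pow_0 FF.nat_pow_Suc LR(3,6))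
  have ipL: "?i^.F p : E2.loc J" by(rule powL[OF iL])
  have gp: "g ?s^.F p*.F ?i^.F p = 1_F"
   using FF.nat_pow_distrib[OF gs(1) i(1), of p] i by simp
  have "y*.F g ?s^.F p = (y*.F g ?s)*.F g ?s^.F q"
   unfolding q using yF gs(1) by(simp add: FF.m_assoc FF.m_comm[of "g ?s"])
  also have "\<dots> = g (a*.B ?s^.B q)" unfolding ys using a(1) s(1) by(simp only: g.hom_mult B.nat_pow_closed g.hom_nat_pow)
  also have "\<dots> = g c^.F p+.F ring_nat F p*.F g e" unfolding ce(3) P using ce(1,2) PB by(simp add: E2.h_pow)
  finally have 1: "y*.F g ?s^.F p = g c^.F p+.F ring_nat F p*.F g e" .
  have "y = (y*.F g ?s^.F p)*.F ?i^.F p" using yF gs(1) i(1) gp by(simp add: FF.m_assoc)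
  also have "\<dots> = (g c*.F ?i)^.F p+.F ring_nat F p*.F (g e*.F ?i^.F p)"
   unfolding 1 using ce(1,2) i(1) PF by(simp add: FF.l_distr FF.m_assoc FF.nat_pow_distrib)
  finally have yy: "y = (g c*.F ?i)^.F p+.F ring_nat F p*.F (g e*.F ?i^.F p)" .
  have wL: "g c*.F ?i : E2.loc J" by(rule LR(6)[OF E2.loc_h[OF ce(1)] iL])
  have wpL: "(g c*.F ?i)^.F p : E2.loc J" by(rule powL[OF wL])
  have eL: "-.F (g e*.F ?i^.F p) : E2.loc J" by(rule LR(5)[OF LR(6)[OF E2.loc_h[OF ce(2)] ipL]])
  have "(g c*.F ?i)^.F p = y+.F ring_nat F p*.F-.F (g e*.F ?i^.F p)"
   using ce(1,2) i(1) PF by(subst yy) (simp add: FF.r_minus FF.a_assoc FF.r_neg)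
  thus ?thesis unfolding E1.F.p_cong_def using wL wpL eL y by blast
 next
  case False
  have l: "E2.loc J = $F" using False by(simp add: E2.loc_def)
  have "-.F (inv\<^bsub>F\<^esub> (ring_nat F p)*.F y) : $F" using inv[OF PF PU] yF by simp
  moreover have "0_F^.F p = y+.F ring_nat F p*.F-.F (inv\<^bsub>F\<^esub> (ring_nat F p)*.F y)"
   using inv[OF PF PU] yF PF p by(simp add: FF.r_minus FF.m_assoc[symmetric] FF.r_neg FF.nat_pow_zero)
  moreover have "0_F^.F p : $F" by simp
  ultimately show ?thesis unfolding E1.F.p_cong_def l using yF FF.zero_closed by blast
 qed
qed

end

section \<open>The comparison map\<close>

lemma linear_maps_funpow: "f : linear_maps A M M ==> x : $M ==> (f ^^ j) x : $M"
 by(induction j) (auto dest: linear_mapsD(1))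

lemma linear_maps_funpow_zero:
 assumes f: "f : linear_maps A M M" and k: "!!x. x : $M ==> f x = 0_M ==> x = 0_M"
 shows "x : $M ==> (f ^^ j) x = 0_M ==> x = 0_M"
 by(induction j) (auto intro: k linear_maps_funpow[OF f])

text \<open>The cohomological degree of the theorem is \<open>Suc k\<close> here, so that the
  vanishing hypothesis concerns degree \<open>k\<close>.\<close>

locale comparison = power_series_tower p W V \<pi> d
 for p :: nat and W :: "'w ring" and V :: "'w set" and \<pi> :: "nat => 'w" and d :: nat +
 fixes n k :: nat and Sn :: "'s ring" and Sinf :: "'t ring"
  and \<rho> :: "'w series => 's" and \<sigma> :: "'s => 't" and \<tau> :: "'w series => 't" and \<omega> :: 's
 assumes Sn: "domain Sn" and Sinf: "domain Sinf"
  and \<rho>: "\<rho> : ring_hom (R n) Sn" "inj_on \<rho> ($(R n))"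
  and \<sigma>: "\<sigma> : ring_hom Sn Sinf" "inj_on \<sigma> $Sn"
  and \<tau>: "\<tau> : ring_hom Rinf Sinf" "inj_on \<tau> $Rinf"
  and comm: "!!a. a : $(R n) ==> \<sigma> (\<rho> a) = \<tau> a"
  and ic: "integrally_closed_domain Sinf" and fs: "frobenius_surjective p (mod_p p Sinf)"
  and \<omega>: "\<omega> : $Sn" "\<sigma> \<omega> = \<tau> (const (\<pi> 1))"
begin

abbreviation "xs \<equiv> \<rho> \<circ> parameters p W"

lemma parameter_SC: "i : {1..d} ==> parameters p W i : SC n"
 using gen_SC[of i 0] gen_0[of i] SC_mono[of 0 n] by auto

lemma const_P_nonzero: "const P ~= 0_Rinf"
proof
 assume "const P = 0_Rinf"
 from fun_cong[OF this, of "%_. 0"] show False using P_nonzero by(simp add: constant_series_def zero_Rinf)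
qed

lemma parameter_nonzero: "i : {1..d} ==> parameters p W i ~= 0_Rinf"
proof
 assume e: "parameters p W i = 0_Rinf"
 show False
 proof(cases "i = 1")
  case True
  thus False using e const_P_nonzero by(simp add: parameters_def)
 next
  case False
  hence "variable_series W i = 0_Rinf" using e by(simp add: parameters_def)
  from fun_cong[OF this, of "(%_. 0)(i := 1)"] show False by(simp add: variable_series_def zero_Rinf)
 qed
qed

lemma SC_R: "a : SC m ==> a : $(R m)" by(simp add: R_simps)

sublocale C: cech_tower Sn Sinf \<sigma> xs d
proof(intro cech_tower.intro cech_tower_axioms.intro Sn Sinf \<sigma>)
 fix i assume i: "i : {1..d}"
 interpret r: ring_hom_ring "R n" Sn \<rho>
  by(rule ring_hom_ringI2[OF cring.axioms(1)[OF R_cring] cring.axioms(1)[OF domain.axioms(1)[OF Sn]] \<rho>(1)])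
 have c: "parameters p W i : $(R n)" by(rule SC_R[OF parameter_SC[OF i]])
 show "xs i : $Sn" using c by simp
 show "xs i ~= 0_Sn"
 proof
  assume "xs i = 0_Sn"
  hence "\<rho> (parameters p W i) = \<rho> 0_(R n)" using r.hom_zero by simp
  hence "parameters p W i = 0_(R n)" using inj_onD[OF \<rho>(2)] c r.R.zero_closed by blast
  thus False using parameter_nonzero[OF i] by(simp add: R_simps)
 qed
qed

interpretation r: ring_hom_ring "R n" Sn \<rho>
 by(rule ring_hom_ringI2[OF cring.axioms(1)[OF R_cring] C.A.ring_axioms \<rho>(1)])
interpretation t: ring_hom_ring Rinf Sinf \<tau>
 by(rule ring_hom_ringI2[OF S.ring_axioms C.B.ring_axioms \<tau>(1)])
interpretation s: ring_hom_ring Sn Sinf \<sigma>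
 by(rule ring_hom_ringI2[OF C.A.ring_axioms C.B.ring_axioms \<sigma>(1)])
interpretation g: ring_hom_ring Sinf C.F C.g
 by(rule ring_hom_ringI2[OF C.B.ring_axioms C.FF.ring_axioms fraction_field(2)[OF Sinf]])

text \<open>As \<sigma> is injective, the equation can be checked in \<open>Sinf\<close>, where
  \<omega> becomes the image of the p-th root of \<open>p\<close>.\<close>

lemma \<omega>_power: "\<omega>^.Sn p = \<rho> (const P)"
proof -
 have PS: "const P : $(R n)" by(rule SC_R[OF const_SC[OF P_V]])
 have p1: "const (\<pi> 1) : $Rinf" using const_Ve_SC[OF \<pi>_Ve] SC_Rinf by blast
 have "\<sigma> (\<omega>^.Sn p) = \<tau> (const (\<pi> 1)^.Rinf p)"
  using ring_hom_ring.hom_nat_pow[OF s.ring_hom_ring_axioms \<omega>(1)] ring_hom_ring.hom_nat_pow[OF t.ring_hom_ring_axioms p1] \<omega>(2) by simp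
 also have "const (\<pi> 1)^.Rinf p = const P" using const_pow[OF \<pi>_Ve[of 1]] \<pi>_Suc[of 0] \<pi>_0 by simp
 finally have "\<sigma> (\<omega>^.Sn p) = \<sigma> (\<rho> (const P))" using comm[OF PS] by simp
 thus ?thesis using inj_onD[OF \<sigma>(2)] \<omega>(1) PS by simp
qed

lemma P_Sinf: "\<sigma> (\<rho> (const P)) = ring_nat Sinf p" "ring_nat Sinf p ~= 0_Sinf"
proof -
 have PS: "const P : $(R n)" "const P : $Rinf" using SC_R const_SC[OF P_V] SC_Rinf by blast+
 have t: "\<tau> (const P) = ring_nat Sinf p" unfolding const_P by(rule hom_ring_nat[OF \<tau>(1) S.ring_axioms C.B.ring_axioms])
 thus "\<sigma> (\<rho> (const P)) = ring_nat Sinf p" using comm[OF PS(1)] by simp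
 show "ring_nat Sinf p ~= 0_Sinf"
  using inj_onD[OF \<tau>(2) _ PS(2) S.zero_closed] const_P_nonzero t.hom_zero unfolding t[symmetric] by auto
qed

lemma P_F: "ring_nat C.F p = C.g (\<sigma> (\<rho> (const P)))"
 unfolding P_Sinf(1) by(rule hom_ring_nat[OF fraction_field(2)[OF Sinf] C.B.ring_axioms C.FF.ring_axioms, symmetric])

lemma \<omega>_F: "C.g (\<sigma> \<omega>) : $C.F" "C.g (\<sigma> \<omega>)^.C.F p = ring_nat C.F p" "C.g (\<sigma> \<omega>) ~= 0_C.F"
proof -
 show c: "C.g (\<sigma> \<omega>) : $C.F" using \<omega>(1) by simp
 show e: "C.g (\<sigma> \<omega>)^.C.F p = ring_nat C.F p"
  using C.E1.h_pow[OF \<omega>(1), of p] unfolding \<omega>_power P_F by simp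
 have "ring_nat C.F p ~= 0_C.F"
  unfolding P_F P_Sinf(1) using C.E2.h_zero_iff[OF ring_nat_closed[OF C.B.ring_axioms]] P_Sinf(2) by simp
 thus "C.g (\<sigma> \<omega>) ~= 0_C.F" using e p0 by(auto simp: C.FF.nat_pow_zero)
qed

interpretation CP: cech_pair C.F p d C.E1.loc C.E2.loc "C.g (\<sigma> \<omega>)"
proof(intro cech_pair.intro cech_pair_axioms.intro plain_cring.intro C.FF.is_cring p C.E1.loc_ring C.E2.loc_ring C.E1.loc_mono C.E2.loc_mono C.loc_le \<omega>_F(2))
 show "C.g (\<sigma> \<omega>) : C.E1.loc J" for J using C.E1.loc_h[OF \<omega>(1)] by simp
 show "y = 0_C.F" if "y : $C.F" "C.g (\<sigma> \<omega>)*.C.F y = 0_C.F" for y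
  using C.FF.integral[OF that(2) \<omega>_F(1) that(1)] \<omega>_F(3) by blast
 show "\<exists>w\<in>C.E2.loc J. plain_cring.p_cong C.F p (C.E2.loc J) (w^.C.F p) y" if "y : C.E2.loc J" for J y
  by(rule C.loc_frobenius[OF fs p0 P_Sinf(2) that])
 \<comment> \<open>The quotient u/\<omega> has p-th power \<open>e\<close>, because \<omega>^p = p;
   so it lies in the localization by closedness under p-th roots.\<close>
 fix J u e assume u: "u : $C.F" "e : C.E2.loc J" "u^.C.F p = ring_nat C.F p*.C.F e"
 let ?w = "C.g (\<sigma> \<omega>)" and ?i = "inv\<^bsub>C.F\<^esub> (C.g (\<sigma> \<omega>))"
 have i: "?i : $C.F" "?w*.C.F ?i = 1_C.F" using \<omega>_F(1,3) C.FF.field_Units by auto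
 have eF: "e : $C.F" using u(2) C.E2.loc_subset by blast
 have "(?i*.C.F u)^.C.F p = ?i^.C.F p*.C.F (?w^.C.F p*.C.F e)"
  using u i \<omega>_F(2) by(simp add: C.FF.nat_pow_distrib)
 also have "\<dots> = (?w*.C.F ?i)^.C.F p*.C.F e"
  using i(1) \<omega>_F(1) eF by(simp add: C.FF.nat_pow_distrib C.FF.m_ac)
 finally have "(?i*.C.F u)^.C.F p = e" using i(2) eF by simp
 hence "?i*.C.F u : C.E2.loc J" using C.loc_root_closed[OF ic p0, of "?i*.C.F u"] u i by simp
 moreover have "u = ?w*.C.F (?i*.C.F u)" using i \<omega>_F(1) u(1) by(simp add: C.FF.m_assoc[symmetric])
 ultimately show "\<exists>t\<in>C.E2.loc J. u = ?w*.C.F t" by blast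
qed

abbreviation "N \<equiv> restrict_scalars \<rho> (C.E1.H (Suc k))"
abbreviation "M \<equiv> restrict_scalars \<tau> (C.E2.H (Suc k))"
abbreviation "\<phi> \<equiv> local_cohomology_map Sn xs d (Suc k) \<sigma> Sinf"
abbreviation "cls1 \<equiv> C.E1.cls (Suc k)"
abbreviation "cls2 \<equiv> C.E2.cls (Suc k)"
abbreviation "cocyc1 \<equiv> C.E1.cocyc (Suc k)"
abbreviation "cocyc2 \<equiv> C.E2.cocyc (Suc k)"
abbreviation "m\<omega> \<equiv> %\<xi>. \<omega>**.(C.E1.H (Suc k)) \<xi>"

lemma N: "module (R n) N" by(rule module_restrict_scalars[OF C.E1.module_H \<rho>(1) R_cring])
lemma M: "module Rinf M" by(rule module_restrict_scalars[OF C.E2.module_H \<tau>(1) S.is_cring])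

lemma N_cases: assumes "\<xi> : $N" obtains z where "cocyc1 z" "\<xi> = cls1 z"
 using assms C.E1.carrier_H by auto

lemma N_smult: "r : $(R n) ==> cocyc1 z ==> r**.N cls1 z = cls1 (%J. C.g (\<tau> r)*.C.F z J)"
 using C.E1.cls_smult[of "Suc k" z "\<rho> r"] comm[of r] by simp

lemma M_smult: "r : $Rinf ==> cocyc2 z ==> r**.M cls2 z = cls2 (%J. C.g (\<tau> r)*.C.F z J)"
 using C.E2.cls_smult[of "Suc k" z "\<tau> r"] by simp

lemma N_smult_cocyc: "r : $(R n) ==> cocyc1 z ==> cocyc1 (%J. C.g (\<tau> r)*.C.F z J)"
 using C.E1.cocyc_comb(2)[of "Suc k" z "\<rho> r"] comm[of r] by simp

lemma \<phi>_cls: "cocyc1 z ==> \<phi> (cls1 z) = cls2 z" by(rule C.local_cohomology_map_cls)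

lemma \<phi>_linear: "\<phi> : linear_maps (R n) N M"
proof -
 have "\<phi> \<xi> : $M" if "\<xi> : $N" for \<xi>
  using that \<phi>_cls C.cocyc_le C.E2.carrier_H by(elim N_cases) auto
 moreover have "\<phi> (\<xi>+.N \<xi>') = \<phi> \<xi>+.M \<phi> \<xi>'" if "\<xi> : $N" "\<xi>' : $N" for \<xi> \<xi>'
  using that by(elim N_cases) (simp add: C.E1.cls_add C.E2.cls_add \<phi>_cls C.cocyc_le C.E1.cocyc_comb)
 moreover have "\<phi> (r**.N \<xi>) = r**.M \<phi> \<xi>" if r: "r : $(R n)" and x: "\<xi> : $N" for r \<xi>
 proof -
  obtain z where z: "cocyc1 z" "\<xi> = cls1 z" using x by(rule N_cases)
  have rR: "r : $Rinf" using r SC_Rinf by(auto simp: R_simps)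
  show ?thesis unfolding z(2) N_smult[OF r z(1)] \<phi>_cls[OF z(1)] \<phi>_cls[OF N_smult_cocyc[OF r z(1)]]
   M_smult[OF rR C.cocyc_le[OF z(1)]] ..
 qed
 ultimately show ?thesis unfolding linear_maps_def by blast
qed

lemma m\<omega>_linear: "m\<omega> : linear_maps (R n) N N"
proof -
 interpret Hm: module Sn "C.E1.H (Suc k)" by(rule C.E1.module_H)
 have "m\<omega> (r**.N \<xi>) = r**.N m\<omega> \<xi>" if "r : $(R n)" "\<xi> : $N" for r \<xi>
  using that \<omega>(1) Hm.smult_assoc1[of \<omega> "\<rho> r" \<xi>] Hm.smult_assoc1[of "\<rho> r" \<omega> \<xi>] C.A.m_comm[of \<omega> "\<rho> r"] by simp
 thus ?thesis unfolding linear_maps_def using \<omega>(1) by(auto simp: Hm.smult_r_distr)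
qed

lemma m\<omega>_power: "\<xi> : $N ==> (m\<omega> ^^ p) \<xi> = const P**.N \<xi>"
proof -
 interpret Hm: module Sn "C.E1.H (Suc k)" by(rule C.E1.module_H)
 have "\<xi> : $N ==> (m\<omega> ^^ j) \<xi> = (\<omega>^.Sn j)**.(C.E1.H (Suc k)) \<xi>" for j :: nat
  by(induction j) (use \<omega>(1) in "simp_all add: Hm.smult_assoc1[symmetric] C.A.m_comm")
 thus "\<xi> : $N ==> (m\<omega> ^^ p) \<xi> = const P**.N \<xi>" using \<omega>_power by simp
qed

lemma P_smult_zero: "cocyc1 z ==> const P**.N cls1 z = 0_N \<longleftrightarrow> C.E1.cobd (Suc k) (%J. ring_nat C.F p*.C.F z J)"
proof -
 assume z: "cocyc1 z"
 have PS: "const P : $(R n)" by(rule SC_R[OF const_SC[OF P_V]])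
 show ?thesis unfolding N_smult[OF PS z] P_F comm[OF PS] using C.E1.cls_zero[OF N_smult_cocyc[OF PS z]] by simp
qed

text \<open>The p^n-th power of a root is a parameter, and some power of a parameter turns any
  cocycle into a coboundary.\<close>

lemma N_torsion: assumes a: "a : gens n" and \<xi>: "\<xi> : $N"
 shows "\<exists>t. (a^.(R n) (t::nat))**.N \<xi> = 0_N"
proof -
 obtain z where z: "cocyc1 z" "\<xi> = cls1 z" using \<xi> by(rule N_cases)
 obtain i where i: "i : {1..d}" "a = gen n i" using a unfolding gens_def by blast
 have aS: "a : $(R n)" "a : $Rinf" using gen_SC[OF i(1), of n] SC_Rinf i(2) by(auto simp: R_simps)
 let ?x = "(C.g \<circ> \<sigma>) (xs i)"
 have "\<exists>t::nat. C.E1.cobd (Suc k) (%J. ?x^.C.F t*.C.F z J)"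
  by(rule C.E1.F.cocycle_power_coboundary[OF C.E1.loc_ring C.E1.loc_mono i(1) C.E1.loc_h C.E1.loc_insert z(1)])
   (use i(1) C.x(1) in auto)
 then obtain t :: nat where t: "C.E1.cobd (Suc k) (%J. ?x^.C.F t*.C.F z J)" by blast
 have pc: "parameters p W i : $(R n)" by(rule SC_R[OF parameter_SC[OF i(1)]])
 have "a^.(R n) (p ^ n) = parameters p W i" using gen_pow[OF i(1), of 0 n] gen_0[OF i(1)] i(2) by(simp add: R_pow)
 hence "a^.(R n) (p ^ n * t) = parameters p W i^.(R n) t" using aS(1) by(metis r.R.nat_pow_pow)
 moreover have "\<rho> (parameters p W i^.(R n) t) = xs i^.Sn t"
  using ring_hom_ring.hom_nat_pow[OF r.ring_hom_ring_axioms pc] by simp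
 ultimately have "(a^.(R n) (p ^ n * t))**.N \<xi> = cls1 (%J. (C.g \<circ> \<sigma>) (xs i^.Sn t)*.C.F z J)"
  unfolding z(2) using C.E1.cls_smult[OF z(1), of "xs i^.Sn t"] C.x(1)[OF i(1)] by simp
 also have "(C.g \<circ> \<sigma>) (xs i^.Sn t) = ?x^.C.F t" by(rule C.E1.h_pow[OF C.x(1)[OF i(1)]])
 also have "cls1 (%J. ?x^.C.F t*.C.F z J) = 0_N"
 proof -
  have "cocyc1 (%J. (C.g \<circ> \<sigma>) (xs i^.Sn t)*.C.F z J)" by(rule C.E1.cocyc_comb(2)[OF z(1)]) (use C.x(1)[OF i(1)] in simp)
  thus ?thesis using C.E1.cls_zero t unfolding C.E1.h_pow[OF C.x(1)[OF i(1)]] by simp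
 qed
 finally show ?thesis by blast
qed

definition G :: "(nat set => ('s \<times> 's) set) set => (nat set => ('t \<times> 't) set) set => bool"
 where "G \<xi> \<eta> \<longleftrightarrow> (\<exists>z z'. cocyc1 z & cocyc2 z' & CP.frobenius_lift k z z' & \<xi> = cls1 z & \<eta> = cls2 z')"

lemma restrict_annihilated:
 "restrict_scalars \<rho> (annihilated (C.E1.H (Suc k)) \<omega>) = N\<lparr>carrier := {\<xi> : $N. m\<omega> \<xi> = 0_N}\<rparr>"
 by(simp add: restrict_scalars_def annihilated_def mk_module_def)

lemma image_triangular:
 assumes H0: "$(C.E1.H k) = {0_(C.E1.H k)}"
  and f: "ranked (R n) N {\<xi> : $N. m\<omega> \<xi> = 0_N} s f"
  and I: "submodule I Rinf M" "\<phi> ` {\<xi> : $N. m\<omega> \<xi> = 0_N} \<subseteq> I"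
   "!!Q. submodule Q Rinf M ==> \<phi> ` {\<xi> : $N. m\<omega> \<xi> = 0_N} \<subseteq> Q ==> I \<subseteq> Q"
 shows "\<exists>l\<le>p * s. triangular Rinf M (gens (Suc n)) l I"
proof(rule frobenius_relation_triangular[OF N M \<phi>_linear m\<omega>_linear m\<omega>_power f N_torsion _ _ _ _ _ _ _ I, where G = G])
 have c1: "z J : $C.F" if "cocyc1 z" for z J using C.E1.cocycD[OF that] C.E1.loc_subset by blast
 have c2: "z J : $C.F" if "cocyc2 z" for z J using C.E2.cocycD[OF that] C.E2.loc_subset by blast
 show "\<exists>\<eta>. G \<xi> \<eta>" if x: "\<xi> : $N" and z0: "const P**.N \<xi> = 0_N" for \<xi>
 proof -
  obtain z where z: "cocyc1 z" "\<xi> = cls1 z" using x by(rule N_cases)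
  have "C.E1.cobd (Suc k) (%J. ring_nat C.F p*.C.F z J)" using z0 P_smult_zero[OF z(1)] unfolding z(2) by blast
  then obtain z' where "cocyc2 z'" "CP.frobenius_lift k z z'" using CP.frobenius_lift_exists C.E1.cocycD[OF z(1)] by blast
  thus ?thesis unfolding G_def using z by blast
 qed
 show "\<xi> : $N & \<eta> : $M" if "G \<xi> \<eta>" for \<xi> \<eta>
  using that C.E1.carrier_H C.E2.carrier_H unfolding G_def by auto
 show "\<eta> = 0_M" if G0: "G 0_N \<eta>" for \<eta>
 proof -
  obtain z z' where z: "cocyc1 z" "cocyc2 z'" "CP.frobenius_lift k z z'" "0_N = cls1 z" "\<eta> = cls2 z'"
   using G0 unfolding G_def by blast
  \<comment> \<open>The vanishing hypothesis in degree \<open>k\<close>; it forces the value at zero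
    to be zero, and with additivity this makes \<open>G\<close> single valued.\<close>
  have H: "C.E1.cobd k y" if "C.E1.cocyc k y" for y
   using C.E1.cls_zero[OF that] C.E1.carrier_H[of k] H0 that by blast
  have zb: "C.E1.cobd (Suc k) z" using C.E1.cls_zero[OF z(1)] z(4) by simp
  have "C.E2.cobd (Suc k) z'" by(rule CP.frobenius_lift_zero[OF H z(3) zb C.E2.cocycD[OF z(2)]])
  thus ?thesis using C.E2.cls_zero[OF z(2)] z(5) by simp
 qed
 fix \<xi> \<eta> assume "G \<xi> \<eta>"
 then obtain z z' where z: "cocyc1 z" "cocyc2 z'" "CP.frobenius_lift k z z'" "\<xi> = cls1 z" "\<eta> = cls2 z'"
  unfolding G_def by blast
 show "G (\<xi>+.N \<xi>') (\<eta>+.M \<eta>')" if G': "G \<xi>' \<eta>'" for \<xi>' \<eta>'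
 proof -
  obtain y y' where y: "cocyc1 y" "cocyc2 y'" "CP.frobenius_lift k y y'" "\<xi>' = cls1 y" "\<eta>' = cls2 y'"
   using G' unfolding G_def by blast
  have "CP.frobenius_lift k (%J. z J+.C.F y J) (%J. z' J+.C.F y' J)"
   by(rule CP.frobenius_lift_add[OF z(3) y(3) c1[OF z(1)] c2[OF z(2)] c1[OF y(1)] c2[OF y(2)]])
  moreover have "cls1 z+.N cls1 y = cls1 (%J. z J+.C.F y J)"
   unfolding restrict_scalars_simps by(rule C.E1.cls_add[OF z(1) y(1)])
  moreover have "cls2 z'+.M cls2 y' = cls2 (%J. z' J+.C.F y' J)"
   unfolding restrict_scalars_simps by(rule C.E2.cls_add[OF z(2) y(2)])
  ultimately show ?thesis unfolding G_def z(4,5) y(4,5)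
   using C.E1.cocyc_comb(1)[OF z(1) y(1)] C.E2.cocyc_comb(1)[OF z(2) y(2)] by blast
 qed
 show "G (-.N \<xi>) (-.M \<eta>)"
 proof -
  note n1 = C.E1.cls_neg[OF z(1)] and n2 = C.E2.cls_neg[OF z(2)]
  have "-.N cls1 z = cls1 (%J.-.C.F z J)"
   by(rule abelian_group_minusI) (use C.E1.carrier_H z(1) n1 module.axioms(2)[OF N] in auto)
  moreover have "-.M cls2 z' = cls2 (%J.-.C.F z' J)"
   by(rule abelian_group_minusI) (use C.E2.carrier_H z(2) n2 module.axioms(2)[OF M] in auto)
  moreover have "CP.frobenius_lift k (%J.-.C.F z J) (%J.-.C.F z' J)"
   by(rule CP.frobenius_lift_minus[OF z(3) c1[OF z(1)] c2[OF z(2)]])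
  ultimately show ?thesis unfolding G_def z(4,5) using n1(1) n2(1) by blast
 qed
 show "G (r**.N \<xi>) (b**.M \<eta>)" if r: "r : SC n" and b: "b : SC (Suc n)" and br: "b^.Rinf p = r" for r b
 proof -
  have rR: "r : $(R n)" and bR: "b : $Rinf" using r b SC_Rinf by(auto simp: R_simps)
  have gr: "C.g (\<tau> r) : C.E1.loc J" "C.g (\<tau> b) : C.E2.loc J" for J
   using C.E1.loc_h[of "\<rho> r" J] C.E2.loc_h[of "\<tau> b" J] comm[OF rR] rR bR by simp_all
  have pw: "C.g (\<tau> b)^.C.F p = C.g (\<tau> r)"
   using C.E2.h_pow[of "\<tau> b" p] ring_hom_ring.hom_nat_pow[OF t.ring_hom_ring_axioms bR, of p] br bR by simp
  have "CP.frobenius_lift k (%J. C.g (\<tau> r)*.C.F z J) (%J. C.g (\<tau> b)*.C.F z' J)"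
   by(rule CP.frobenius_lift_smult[OF z(3) c1[OF z(1)] c2[OF z(2)] gr pw])
  moreover have "cocyc2 (%J. C.g (\<tau> b)*.C.F z' J)" by(rule C.E2.cocyc_comb(2)[OF z(2)]) (use bR in simp)
  ultimately show ?thesis unfolding G_def z(4,5) N_smult[OF rR z(1)] M_smult[OF bR z(2)]
   using N_smult_cocyc[OF rR z(1)] by blast
 qed
next
 fix \<alpha> assume a: "\<alpha> : $N" "m\<omega> \<alpha> = 0_N"
 obtain z where z: "cocyc1 z" "\<alpha> = cls1 z" using a(1) by(rule N_cases)
 have cw: "cocyc1 (%J. C.g (\<sigma> \<omega>)*.C.F z J)" using C.E1.cocyc_comb(2)[OF z(1) \<omega>(1)] by simp
 have "C.E1.cobd (Suc k) (%J. C.g (\<sigma> \<omega>)*.C.F z J)"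
  using C.E1.cls_zero[OF cw] C.E1.cls_smult[OF z(1) \<omega>(1)] a(2) z(2) by simp
 from CP.frobenius_lift_image[OF C.E1.cocycD[OF z(1)] this]
 obtain z0 where z0: "cocyc1 z0" "C.E1.cobd (Suc k) (%J. ring_nat C.F p*.C.F z0 J)" "CP.frobenius_lift k z0 z" by blast
 have "G (cls1 z0) (\<phi> \<alpha>)" unfolding G_def z(2) \<phi>_cls[OF z(1)] using z0 C.cocyc_le[OF z(1)] by blast
 thus "\<exists>\<xi>. const P**.N \<xi> = 0_N & G \<xi> (\<phi> \<alpha>)" using P_smult_zero[OF z0(1)] z0(2) by blast
qed

abbreviation "N\<omega> \<equiv> restrict_scalars \<rho> (annihilated (C.E1.H (Suc k)) \<omega>)"
abbreviation "K\<omega> \<equiv> {\<xi> : $N. m\<omega> \<xi> = 0_N}"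
abbreviation "\<Phi> \<equiv> cohomology_comparison Sn xs d (Suc k) \<sigma> Sinf \<tau>"

lemma scaled_sum_carrier_update: "scaled_sum (M'\<lparr>carrier := C\<rparr>) b Q j = scaled_sum M' b Q j"
 by(induction j) simp_all

lemma K\<omega>: "submodule K\<omega> (R n) N" "module (R n) N\<omega>" "$N\<omega> = K\<omega>"
proof -
 interpret Nm: module "R n" N by(rule N)
 have "submodule {\<xi> : $N. m\<omega> \<xi> : {0_N}} (R n) N"
  by(rule linear_maps_preimage_submodule[OF m\<omega>_linear N N Nm.submodule_singleton_zero])
 thus K: "submodule K\<omega> (R n) N" by simp
 show "module (R n) N\<omega>" unfolding restrict_annihilated by(rule submodule.submodule_is_module[OF K N])
 show "$N\<omega> = K\<omega>" unfolding restrict_annihilated by simp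
qed

text \<open>\<open>cohomology_comparison\<close> is one formula for \<Phi> and for its restriction,
  so the statement allows any module \<open>N'\<close> on which \<phi> is linear.\<close>

lemma \<Phi>_linear:
 assumes N': "module (R n) N'" and \<phi>: "\<phi> : linear_maps (R n) N' M"
 shows "\<Phi> : linear_maps Rinf (T n N') M" "\<xi> : $N' ==> \<Phi> (tens n N' \<xi>) = \<phi> \<xi>"
proof -
 interpret Mm: module Rinf M by(rule M)
 interpret B: base_change_setup "R n" "%a. a" Rinf N' by(rule base_change_setup[OF N'])
 have e: "\<Phi> = tensor_lift M (%(\<xi>, b). b**.M \<phi> \<xi>)" unfolding cohomology_comparison_def Let_def ..
 show "\<Phi> : linear_maps Rinf (T n N') M" unfolding e
  by(rule B.tensor_lift_linear(1)[OF M]) (use linear_mapsD[OF \<phi>] in simp_all)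
 have "\<Phi> (tens n N' \<xi>) = 1_Rinf**.M \<phi> \<xi>" if "\<xi> : $N'" unfolding e
  by(rule B.tensor_lift_linear(2)[OF M _ _ _ that S.one_closed]) (use linear_mapsD[OF \<phi>] in simp_all)
 thus "\<xi> : $N' ==> \<Phi> (tens n N' \<xi>) = \<phi> \<xi>" using linear_mapsD(1)[OF \<phi>] Mm.smult_one by metis
qed

text \<open>If \<omega> acts injectively on \<open>N\<close>, then so does its p-th power
  \<open>P\<close>, and so does the first root of level \<open>n\<close>, which divides
  \<open>P\<close>. But every element is killed by a power of that root.\<close>

lemma \<omega>_torsion_zero:
 assumes K: "K\<omega> = {0_N}"
 shows "$N = {0_N}"
proof -
 interpret Nm: module "R n" N by(rule N)
 let ?a = "gen n 1"
 have a: "?a : gens n" "1 : {1..d}" using d unfolding gens_def by auto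
 have aR: "?a : $(R n)" using gen_SC[OF a(2)] by(simp add: R_simps)
 have mw: "\<xi> = 0_N" if "\<xi> : $N" "m\<omega> \<xi> = 0_N" for \<xi> using K that by blast
 have pw: "\<xi> : $N ==> (m\<omega> ^^ j) \<xi> = 0_N ==> \<xi> = 0_N" for \<xi> and j :: nat
  by(rule linear_maps_funpow_zero[OF m\<omega>_linear mw])
 have a1: "\<xi> = 0_N" if x: "\<xi> : $N" "?a**.N \<xi> = 0_N" for \<xi>
 proof -
  obtain q where q: "p ^ n = Suc q" using p0 by(metis gr0_conv_Suc zero_less_power)
  have "const P = ?a^.(R n) q*.(R n) ?a"
   using gen_pow[OF a(2), of 0 n] gen_0[OF a(2)] q by(simp add: parameters_def R_pow R_simps)
  hence "const P**.N \<xi> = ?a^.(R n) q**.N (?a**.N \<xi>)"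
   using Nm.smult_assoc1[OF _ aR x(1), of "?a^.(R n) q"] aR by simp
  hence "const P**.N \<xi> = 0_N" unfolding x(2) using Nm.smult_r_null[of "?a^.(R n) q"] aR by simp
  thus ?thesis using pw[OF x(1), of p] m\<omega>_power[OF x(1)] by simp
 qed
 have "\<xi> : $N ==> (?a^.(R n) t)**.N \<xi> = 0_N ==> \<xi> = 0_N" for \<xi> and t :: nat
 proof(induction t arbitrary: \<xi>)
  case 0
  have e: "?a^.(R n) (0::nat) = 1_(R n)" by simp
  show ?case using 0(2)[unfolded e Nm.smult_one[OF 0(1)]] .
 next
  case (Suc t)
  have ax: "?a**.N \<xi> : $N" by(rule Nm.smult_closed[OF aR Suc.prems(1)])
  have e: "?a^.(R n) Suc t = ?a^.(R n) t*.(R n) ?a" by simp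
  have pc: "?a^.(R n) t : $(R n)" by(rule r.R.nat_pow_closed[OF aR])
  have "(?a^.(R n) t)**.N (?a**.N \<xi>) = 0_N"
   using Suc.prems(2)[unfolded e Nm.smult_assoc1[OF pc aR Suc.prems(1)]] .
  thus ?case using a1[OF Suc.prems(1) Suc.IH[OF ax]] by blast
 qed
 thus ?thesis using N_torsion[OF a(1)] Nm.zero_closed by blast
qed

text \<open>For the second claim, injectivity of \<Phi> on the base change of all of
  \<open>N\<close> already makes the images of the classes killed by \<omega> independent, and they
  lie in the filtered image of the first claim. The comparison therefore takes place inside that
  image.\<close>

lemma comparison_bound:
 assumes H0: "$(C.E1.H k) = {0_(C.E1.H k)}" and len: "module_length (R n) N < \<infinity>"
 shows "normalized_length p d (R_level p d W V \<pi>) Rinf (max_ideal p d W V \<pi>) (M\<lparr>carrier := \<Phi> ` $(T n N\<omega>)\<rparr>)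
   \<le> ennreal_of_enat (module_length (R n) N\<omega>) / of_nat (p ^ (d * (n + 1) - 1))" (is ?bound)
  and "$N ~= {0_N} ==> \<not> inj_on \<Phi> ($(T n N))"
proof -
 let ?I = "\<Phi> ` $(T n N\<omega>)" and ?MI = "M\<lparr>carrier := \<Phi> ` $(T n N\<omega>)\<rparr>"
 interpret Nm: module "R n" N by(rule N)
 interpret Mm: module Rinf M by(rule M)
 note K = K\<omega>
 have Tm: "module Rinf (T n N\<omega>)" by(rule T_module[OF K(2)])
 have gR: "gens n \<subseteq> $(R n)" using gens_SC by(simp add: R_simps)
 have "module_length (R n) N\<omega> \<le> module_length (R n) N"
  unfolding module_length_def restrict_annihilated Nm.submodule_carrier_update[OF K(1)] by(rule Sup_subset_mono) blast
 then obtain s where s: "module_length (R n) N\<omega> = enat s" using len by(cases "module_length (R n) N\<omega>") auto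
 obtain f where "ranked (R n) N\<omega> $N\<omega> s f" using module_length_ranked[OF s K(2)] by blast
 hence f: "ranked (R n) N K\<omega> s f" unfolding K(3) unfolding restrict_annihilated Nm.ranked_carrier_update[OF K(1)] .
 have \<phi>\<omega>: "\<phi> : linear_maps (R n) N\<omega> M" using \<phi>_linear unfolding restrict_annihilated linear_maps_def by auto
 note L = \<Phi>_linear[OF K(2) \<phi>\<omega>]
 have Is: "submodule ?I Rinf M"
  by(rule linear_maps_image_submodule[OF L(1) Tm M module.carrier_is_submodule[OF Tm]])
 interpret B: base_change_setup "R n" "%a. a" Rinf N\<omega> by(rule base_change_setup[OF K(2)])
 have tI: "\<phi> ` K\<omega> \<subseteq> ?I"
 proof
  fix y assume "y : \<phi> ` K\<omega>"
  then obtain \<xi> where x: "\<xi> : $N\<omega>" "y = \<phi> \<xi>" using K(3) by blast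
  show "y : ?I" unfolding x(2) L(2)[OF x(1), symmetric] using linear_mapsD(1)[OF tens_linear[OF K(2)] x(1)] by(rule imageI)
 qed
 have Imin: "?I \<subseteq> Q" if Q: "submodule Q Rinf M" "\<phi> ` K\<omega> \<subseteq> Q" for Q
 proof -
  have "$(T n N\<omega>) \<subseteq> {u : $(T n N\<omega>). \<Phi> u : Q}"
  proof(rule B.T_subset[OF linear_maps_preimage_submodule[OF L(1) Tm M Q(1)]])
   fix \<xi> assume x: "\<xi> : $N\<omega>"
   hence "\<phi> \<xi> : Q" using Q(2) K(3) by blast
   thus "tens n N\<omega> \<xi> : {u : $(T n N\<omega>). \<Phi> u : Q}"
   using linear_mapsD(1)[OF tens_linear[OF K(2)] x] L(2)[OF x] by simp
  qed
  thus ?thesis by blast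
 qed
 obtain l where l: "l \<le> p * s" "triangular Rinf M (gens (Suc n)) l ?I" using image_triangular[OF H0 f Is tI Imin] by blast
 have MI: "module Rinf ?MI" by(rule submodule.submodule_is_module[OF Is M])
 have T: "triangular Rinf ?MI (gens (Suc n)) l $?MI" using Mm.triangular_carrier_update[OF l(2) order_refl] by simp
 \<comment> \<open>Since \<open>d\<close> is positive, the natural subtraction is exact and one
   factor \<open>p\<close> can be split off.\<close>
 have p1: "d * (n + 1) = Suc (d * (n + 1) - 1)" using d by(simp add: add.commute)
 show ?bound
 proof -
  have "l * p ^ (d * (n + 1) - 1) \<le> p * s * p ^ (d * (n + 1) - 1)" using l(1) by(rule mult_le_mono1)
  also have "\<dots> = s * p ^ (d * Suc n)" using p1 power_Suc[of p "d * (n + 1) - 1"] by simp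
  finally have "of_nat l / of_nat (p ^ (d * Suc n)) \<le> (of_nat s / of_nat (p ^ (d * (n + 1) - 1)) :: ennreal)"
   by(rule of_nat_divide_le) (use p0 in auto)
  thus ?thesis using normalized_length_le[OF MI T] s by simp
 qed
 assume ne: "$N ~= {0_N}"
 obtain l0 where l0: "l0 \<le> s" "triangular (R n) N (gens n) l0 K\<omega>"
  using Nm.ranked_triangular[OF finite_gens gR K(1) _ f] N_torsion by blast
 show "\<not> inj_on \<Phi> ($(T n N))"
 proof
  assume inj: "inj_on \<Phi> ($(T n N))"
  note LN = \<Phi>_linear[OF N \<phi>_linear]
  have MR: "module (R n) M" by(rule module_R[OF M])
  have MIR: "module (R n) ?MI" by(rule module_R[OF MI])
  have "inj_on \<phi> $N"
   by(rule inj_on_linear[OF \<phi>_linear N MR]) (use tens_inj[OF N M LN(1) inj] LN(2) in simp)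
  hence \<phi>inj: "inj_on \<phi> K\<omega>" by(rule inj_on_subset) blast
  \<comment> \<open>With \<open>s = 0\<close> no nonzero class would be killed by \<omega>, and
    torsion would leave no nonzero class at all.\<close>
  have s0: "s ~= 0"
  proof
   assume "s = 0"
   hence "triangular (R n) N (gens n) 0 K\<omega>" using l0 by simp
   hence "K\<omega> = {0_N}" by(cases rule: triangular.cases) auto
   thus False using \<omega>_torsion_zero ne by blast
  qed
  obtain c where c: "!!i. i \<le> s ==> submodule (c i) (R n) N\<omega>" "!!i. i < s ==> c i \<subset> c (Suc i)" "s ~= 0 ==> c s = $N\<omega>"
   using module_length_chain_top[OF s K(2)] by blast
  have cs: "c s = K\<omega>" using c(3)[OF s0] K(3) by simp
  have \<phi>I: "\<phi> : linear_maps (R n) N\<omega> ?MI" using \<phi>\<omega> tI K(3) unfolding linear_maps_def by auto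
  have "triangular (R n) N\<omega> (gens n) l0 $N\<omega>"
   unfolding K(3) unfolding restrict_annihilated by(rule Nm.triangular_carrier_update[OF l0(2) order_refl])
  from triangular_generators[OF K(2) this] obtain v c' where
   "\<forall>i<l0. v i : $N\<omega>" "\<forall>i<l0. \<forall>a\<in>gens n. (\<forall>k<i. c' a i k : $(R n)) & a**.N\<omega> v i = free_lift N\<omega> i v (c' a i)"
   "$N\<omega> = {free_lift N\<omega> l0 v y | y. \<forall>i<l0. y i : $(R n)}"
   by(elim exE conjE) (rule that; assumption)
  hence v: "!!i. i < l0 ==> v i : $N\<omega>"
   "!!\<xi>. \<xi> : $N\<omega> ==> \<exists>y. \<xi> = free_lift N\<omega> l0 v y & (\<forall>i<l0. y i : $(R n))" by blast+
  have "s * p ^ (d * Suc n) \<le> l * p ^ (d * n)"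
  proof(rule length_le_of_triangular[OF MI T, where N = "%i. \<phi> ` c i" and Y = "\<phi> ` v ` {..<l0}"])
   show "submodule (\<phi> ` c i) (R n) ?MI" if "i \<le> s" for i
   by(rule linear_maps_image_submodule[OF \<phi>I K(2) MIR c(1)[OF that]])
   show "\<phi> ` c i \<subset> \<phi> ` c (Suc i)" if i: "i < s" for i
   proof -
   have "c (Suc i) \<subseteq> K\<omega>" using module.submoduleE(1)[OF K(2) c(1)[of "Suc i"]] i K(3) by simp
   from inj_on_subset[OF \<phi>inj this] c(2)[OF i] show ?thesis by(rule image_strict_mono)
   qed
   show "finite (\<phi> ` v ` {..<l0})" by simp
   show "\<phi> ` v ` {..<l0} \<subseteq> \<phi> ` c s" using v(1) K(3) unfolding cs by blast
   show "\<phi> ` c s \<subseteq> Q" if Q: "submodule Q (R n) ?MI" "\<phi> ` v ` {..<l0} \<subseteq> Q" for Q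
   proof -
   have sub: "submodule {\<xi> : $N\<omega>. \<phi> \<xi> : Q} (R n) N\<omega>"
   by(rule linear_maps_preimage_submodule[OF \<phi>I K(2) MIR Q(1)])
   have vQ: "v i : {\<xi> : $N\<omega>. \<phi> \<xi> : Q}" if "i < l0" for i using v(1)[OF that] Q(2) that by blast
   have "$N\<omega> \<subseteq> {\<xi> : $N\<omega>. \<phi> \<xi> : Q}"
   proof
   fix \<xi> assume "\<xi> : $N\<omega>"
   from v(2)[OF this] obtain y where y: "\<xi> = free_lift N\<omega> l0 v y" "!!i. i < l0 ==> y i : $(R n)" by blast
   show "\<xi> : {\<xi> : $N\<omega>. \<phi> \<xi> : Q}" unfolding y(1) by(rule free_lift_mem[OF K(2) sub vQ y(2)])
   qed
   thus ?thesis unfolding cs K(3)[symmetric] by blast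
   qed
   show "y = 0_?MI" if nm: "n \<le> m" and bc: "dual_basis n m b b'" and j: "j < (p ^ (m - n)) ^ d"
   and u: "u : scaled_sum ?MI b (\<phi> ` c s) j" and y: "y : \<phi> ` c s" and z: "u+.?MI b j**.?MI y = 0_?MI" for m b b' j u y
   proof -
   obtain \<xi> where x: "\<xi> : K\<omega>" "y = \<phi> \<xi>" using y unfolding cs by blast
   have xN: "\<xi> : $N" and K\<omega>N: "K\<omega> \<subseteq> $N" using x(1) by blast+
   have "\<phi> ` K\<omega> = (%\<xi>. \<Phi> (tens n N \<xi>)) ` K\<omega>" by(rule image_cong[OF refl]) (simp add: LN(2))
   hence u': "u : scaled_sum M b ((%\<xi>. \<Phi> (tens n N \<xi>)) ` K\<omega>) j" using u unfolding cs scaled_sum_carrier_update by simp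
   have "u+.M b j**.M \<Phi> (tens n N \<xi>) = 0_M" using z LN(2)[OF xN] unfolding x(2) by simp
   hence "\<xi> = 0_N" by(rule image_independent[OF N bc j M LN(1) inj K\<omega>N u' xN])
   thus ?thesis using x(2) linear_maps_zero[OF \<phi>_linear N MR] by simp
   qed
  qed
  also have "\<dots> \<le> p * s * p ^ (d * n)" using l(1) by(rule mult_le_mono1)
  \<comment> \<open>The positive \<open>s\<close> is cancelled; comparing exponents leaves d \<le>
    1.\<close>
  finally have "p ^ (d * Suc n) \<le> p ^ Suc (d * n)" using s0 by(simp add: mult.assoc mult.left_commute)
  hence "d * Suc n \<le> Suc (d * n)" using power_le_imp_le_exp prime_gt_1_nat[OF p] by blast
  thus False using d by simp
 qed
qed

end

theorem theorem3p6:
  fixes p d n k :: nat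
    and W :: "'w ring" and V :: "'w set" and \<pi> :: "nat \<Rightarrow> 'w"
    and Sn :: "'s ring" and Sinf :: "'t ring"
    and \<rho> :: "'w series \<Rightarrow> 's" and \<sigma> :: "'s \<Rightarrow> 't" and \<tau> :: "'w series \<Rightarrow> 't"
    and \<omega> :: 's
  defines "R \<equiv> R_level p d W V \<pi>"
    and "Rinf \<equiv> R_infinity p d W V \<pi>"
    and "mm \<equiv> max_ideal p d W V \<pi>"
    and "H \<equiv> local_cohomology Sn (\<rho> \<circ> parameters p W) d (self_module Sn)"
    and "Hinf \<equiv> local_cohomology Sinf (\<sigma> \<circ> (\<rho> \<circ> parameters p W)) d (self_module Sinf)"
    and "\<Phi> \<equiv> cohomology_comparison Sn (\<rho> \<circ> parameters p W) d k \<sigma> Sinf \<tau>"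
  assumes "Factorial_Ring.prime p"
    and "domain W" and "subring V W" and "complete_mixed_dvr p (W\<lparr>carrier := V\<rparr>)"
    and "compatible_roots p W \<pi>"
    and "domain_extension (R n) Sn \<rho>" and "module_finite (R n) Sn \<rho>"
    and "semi_perfect p (R n) Rinf Sn Sinf \<rho> \<sigma> \<tau>"
    and "\<omega> \<in> carrier Sn" and "\<sigma> \<omega> = \<tau> (constant_series W (\<pi> 1))"
    and "0 < k" and "k < d"
    and "carrier (H (k - 1)) = {\<zero>\<^bsub>H (k - 1)\<^esub>}"
    and "module_length (R n) (restrict_scalars \<rho> (H k)) < \<infinity>"
  shows "normalized_length p d R Rinf mm
      ((restrict_scalars \<tau> (Hinf k))\<lparr>carrier :=
        \<Phi> ` carrier (base_change (R n) (\<lambda>a. a) Rinf (restrict_scalars \<rho> (annihilated (H k) \<omega>)))\<rparr>)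
    \<le> ennreal_of_enat (module_length (R n) (restrict_scalars \<rho> (annihilated (H k) \<omega>)))
        / of_nat (p ^ (d * (n + 1) - 1)) \<and>
    (carrier (H k) \<noteq> {\<zero>\<^bsub>H k\<^esub>} \<longrightarrow>
      \<not> inj_on \<Phi> (carrier (base_change (R n) (\<lambda>a. a) Rinf (restrict_scalars \<rho> (H k)))))"
proof -
  \<comment> \<open>The locale counts degrees from the predecessor of \<open>k\<close>.\<close>
  obtain k' where k: "k = Suc k'" using assms(17) by (cases k) auto
  have sp: "domain_extension (R n) Sn \<rho>" "domain_extension Sn Sinf \<sigma>" "domain_extension Rinf Sinf \<tau>"
    "\<And>a. a \<in> carrier (R n) \<Longrightarrow> \<sigma> (\<rho> a) = \<tau> a" "integrally_closed_domain Sinf" "frobenius_surjective p (mod_p p Sinf)"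
    using assms(14) unfolding semi_perfect_def by blast+
  interpret comparison p W V \<pi> d n k' Sn Sinf \<rho> \<sigma> \<tau> \<omega>
  proof (intro comparison.intro power_series_tower.intro ramified_tower.intro power_series_tower_axioms.intro comparison_axioms.intro)
    \<comment> \<open>This bound, from 0 < k < d, is what excludes the injective case.\<close>
    show "2 \<le> d" using assms(18) k by simp
  qed (use assms sp in \<open>auto simp: domain_extension_def\<close>)
  show ?thesis
    using comparison_bound assms(19,20) unfolding k R_def Rinf_def mm_def H_def Hinf_def \<Phi>_def by simp
qed


end
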